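(* Let $A$ be an ergodic linear automorphism of $\mathbb{T}^N$ (induced by an element of $SL(N,\mathbb{Z})$) with $\dim(E^c)=2$. There is a neighbourhood $\mathcal{U}$ of $A$ in $\mathcal{C}^1_{\mathrm{vol}}(\mathbb{T}^N)$ such that for every $f\in\mathcal{U}$ the following holds: every non-empty closed set $E\subset\mathbb{T}^N$ that is $f$-invariant and $su$-saturated (with respect to $f$) satisfies $E=\mathbb{T}^N$.
   Context: For $A\in SL(N,\mathbb{Z})$ acting on $\mathbb{T}^N=\mathbb{R}^N/\mathbb{Z}^N$, $\mathbb{R}^N=E^s\oplus E^c\oplus E^u$, where $E^s,E^c,E^u$ are the sums of the generalized eigenspaces of $A$ corresponding to eigenvalues of modulus less than $1$, exactly $1$, more than $1$. Ergodicity is with respect to Lebesgue measure. $\mathcal{C}^1_{\mathrm{vol}}(\mathbb{T}^N)$ is the space of volume-preserving $\mathcal{C}^1$ diffeomorphisms of $\mathbb{T}^N$ with the $\mathcal{C}^1$ topology. A diffeomorphism $f:M\to M$ of a closed Riemannian manifold is partially hyperbolic if there is a $Df$-invariant splitting $TM=E^s_f\oplus E^c_f\oplus E^u_f$ with $E^s_f,E^u_f$ non-trivial and continuous functions $\mu_*,\lambda_*:M\to\mathbb{R}_+$, $*=s,c,u$, with $\mu_*(x)<\|D_xf(v)\|/\|v\|<\lambda_*(x)$ for all $0\neq v\in E^*_f(x)$, and $\lambda_s(x)<\min\{1,\mu_c(x)\}$, $\max\{1,\lambda_c(x)\}<\mu_u(x)$. Under the hypotheses, every $f$ sufficiently $\mathcal{C}^1$-close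 to $A$ is partially hyperbolic (with $E^*_f$ close to $E^*$), and $E^s_f$, $E^u_f$ are uniquely integrable to invariant foliations $\mathcal{F}^s_f$, $\mathcal{F}^u_f$. An $su$-path is a curve which is piecewise contained in leaves of $\mathcal{F}^s_f$ and $\mathcal{F}^u_f$ (finitely many pieces). The accessibility class $AC(x)$ is the set of points that can be joined to $x$ by an $su$-path. A set $E$ is $su$-saturated if $AC(x)\subset E$ for every $x\in E$. *)

theory Defs
  imports "HOL-Analysis.Analysis"
begin

quotient_type (overloaded) 'n torus =
    "real ^ 'n::finite" / "\<lambda>x y. \<forall>i. x $ i - y $ i \<in> \<int>"
  morphisms rep_torus torus_of
proof (rule equivpI)
  show "reflp (\<lambda>x y :: real ^ 'n. \<forall>i. x $ i - y $ i \<in> \<int>)"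
    by (simp add: reflp_def)
  show "symp (\<lambda>x y :: real ^ 'n. \<forall>i. x $ i - y $ i \<in> \<int>)"
    by (rule sympI) (metis Ints_minus minus_diff_eq)
  show "transp (\<lambda>x y :: real ^ 'n. \<forall>i. x $ i - y $ i \<in> \<int>)"
  proof (rule transpI, rule allI)
    fix x y z :: "real ^ 'n" and i
    assume "\<forall>i. x $ i - y $ i \<in> \<int>" "\<forall>i. y $ i - z $ i \<in> \<int>"
    then have "(x $ i - y $ i) + (y $ i - z $ i) \<in> \<int>" by (intro Ints_add) auto
    then show "x $ i - z $ i \<in> \<int>" by simp
  qed
qed

lemma torus_of_eq_iff: "torus_of x = torus_of y \<longleftrightarrow> (\<forall>i. x $ i - y $ i \<in> \<int>)"
  by (rule torus.abs_eq_iff)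

lemma torus_of_surj: "\<exists>x. torus_of x = p"
  using Quotient3_abs_rep[OF Quotient3_torus] by blast

lemma closed_fibre: "closed {y. torus_of y = p}"
proof -
  obtain z where z: "p = torus_of z" using torus_of_surj by metis
  have "{y. torus_of y = p} = (\<Inter>i. (\<lambda>y. y $ i - z $ i) -` \<int>)"
    by (auto simp: z torus_of_eq_iff)
  moreover have "closed \<dots>"
    by (intro closed_INT ballI closed_vimage closed_Ints continuous_intros)
  ultimately show ?thesis by simp
qed

instantiation torus :: (finite) metric_space
begin

definition dist_torus :: "'a torus \<Rightarrow> 'a torus \<Rightarrow> real"
  where "dist p q = setdist {x. torus_of x = p} {y. torus_of y = q}"

definition open_torus :: "'a torus set \<Rightarrow> bool"
  where "open U \<longleftrightarrow> open (torus_of -` U)"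

definition uniformity_torus :: "('a torus \<times> 'a torus) filter"
  where "(uniformity :: ('a torus \<times> 'a torus) filter) = (INF e\<in>{0<..}. principal {(p, q). dist p q < e})"

lemma dist_torus_of_less:
  fixes x :: "real ^ 'a"
  assumes "dist (torus_of x) q < e"
  obtains y where "torus_of y = q" "dist x y < e"
proof -
  obtain z where z: "torus_of z = q" using torus_of_surj by metis
  have "\<exists>a b. torus_of a = torus_of x \<and> torus_of b = q \<and> dist a b < e"
  proof (rule ccontr)
    assume "\<not> ?thesis"
    then have "\<And>a b. \<lbrakk>a \<in> {a. torus_of a = torus_of x}; b \<in> {b. torus_of b = q}\<rbrakk> \<Longrightarrow> e \<le> dist a b"
      by force
    then have "e \<le> setdist {a. torus_of a = torus_of x} {b. torus_of b = q}"
      using z by (intro le_setdistI) auto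
    with assms show False by (simp add: dist_torus_def)
  qed
  then obtain a b where ab: "torus_of a = torus_of x" "torus_of b = q" "dist a b < e" by blast
  have "\<forall>i. x $ i - a $ i \<in> \<int>" using ab(1)[symmetric] by (simp add: torus_of_eq_iff)
  then have "torus_of (b + (x - a)) = q"
    unfolding ab(2)[symmetric] torus_of_eq_iff by simp
  moreover have "dist x (b + (x - a)) = dist a b"
    by (simp add: dist_norm norm_minus_commute)
  ultimately show ?thesis using that ab(3) by metis
qed

lemma dist_torus_of_le: "dist (torus_of x) (torus_of y) \<le> dist x y"
  unfolding dist_torus_def by (rule setdist_le_dist) auto

instance
proof
  show "uniformity = (INF e\<in>{0<..}. principal {(p :: 'a torus, q). dist p q < e})"
    by (rule uniformity_torus_def)
next
  fix p q r :: "'a torus"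
  show "dist p q = 0 \<longleftrightarrow> p = q"
  proof
    assume 0: "dist p q = 0"
    obtain x where x: "torus_of x = p" using torus_of_surj by metis
    have "\<exists>y\<in>{y. torus_of y = q}. dist y x < e" if "e > 0" for e
    proof -
      have "dist (torus_of x) q < e" using 0 x that by simp
      then show ?thesis by (elim dist_torus_of_less) (auto simp: dist_commute)
    qed
    then have "x \<in> closure {y. torus_of y = q}" by (simp add: closure_approachable)
    then have "x \<in> {y. torus_of y = q}" using closed_fibre closure_closed by metis
    then show "p = q" using x by simp
  next
    assume "p = q"
    moreover obtain x where "torus_of x = p" using torus_of_surj by metis
    ultimately have "dist p q \<le> 0" "dist p q \<ge> 0"
      using dist_torus_of_le[of x x] by (auto simp: dist_torus_def setdist_pos_le)
    then show "dist p q = 0" by (rule order.antisym)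
  qed
  show "dist p q \<le> dist p r + dist q r"
  proof (rule field_le_epsilon)
    fix e :: real assume "e > 0"
    obtain z where z: "torus_of z = r" using torus_of_surj by metis
    have c: "dist s t = dist t s" for s t :: "'a torus"
      by (simp add: dist_torus_def setdist_sym)
    obtain x where x: "torus_of x = p" "dist z x < dist r p + e / 2"
      using dist_torus_of_less[of z p "dist r p + e / 2"] z \<open>e > 0\<close> by auto
    obtain y where y: "torus_of y = q" "dist z y < dist r q + e / 2"
      using dist_torus_of_less[of z q "dist r q + e / 2"] z \<open>e > 0\<close> by auto
    have "dist p q \<le> dist x y" using dist_torus_of_le[of x y] x y by simp
    also have "\<dots> \<le> dist z x + dist z y" by (rule dist_triangle3)
    also have "\<dots> \<le> dist p r + dist q r + e" using x y c[of r p] c[of r q] by simp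
    finally show "dist p q \<le> dist p r + dist q r + e" .
  qed
next
  fix U :: "'a torus set"
  have ev: "eventually P uniformity \<longleftrightarrow> (\<exists>e>0. \<forall>p q. dist p q < e \<longrightarrow> P (p, q))"
    for P :: "'a torus \<times> 'a torus \<Rightarrow> bool"
  proof -
    have "eventually P uniformity \<longleftrightarrow>
        (\<exists>e\<in>{0<..}. eventually P (principal {(p, q). dist p q < e}))"
      unfolding uniformity_torus_def
    proof (rule eventually_INF_base)
      fix a b :: real assume "a \<in> {0<..}" "b \<in> {0<..}"
      then show "\<exists>x\<in>{0<..}. principal {(p :: 'a torus, q). dist p q < x}
          \<le> inf (principal {(p, q). dist p q < a}) (principal {(p, q). dist p q < b})"
        by (intro bexI[of _ "min a b"]) auto
    qed auto
    then show ?thesis by (auto simp: eventually_principal)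
  qed
  have "open U \<longleftrightarrow> (\<forall>p\<in>U. \<exists>e>0. \<forall>q. dist p q < e \<longrightarrow> q \<in> U)"
  proof
    assume o: "open U"
    show "\<forall>p\<in>U. \<exists>e>0. \<forall>q. dist p q < e \<longrightarrow> q \<in> U"
    proof
      fix p assume "p \<in> U"
      obtain x where x: "torus_of x = p" using torus_of_surj by metis
      then obtain e where e: "e > 0" "\<And>y. dist y x < e \<Longrightarrow> torus_of y \<in> U"
        using o \<open>p \<in> U\<close> unfolding open_torus_def open_dist by force
      have "q \<in> U" if "dist p q < e" for q
        using dist_torus_of_less[of x q e] that e x by (metis dist_commute)
      then show "\<exists>e>0. \<forall>q. dist p q < e \<longrightarrow> q \<in> U" using e by blast
    qed
  next
    assume *: "\<forall>p\<in>U. \<exists>e>0. \<forall>q. dist p q < e \<longrightarrow> q \<in> U"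
    show "open U" unfolding open_torus_def open_dist
    proof
      fix x :: "real ^ 'a" assume "x \<in> torus_of -` U"
      then obtain e where e: "e > 0" "\<forall>q. dist (torus_of x) q < e \<longrightarrow> q \<in> U" using * by auto
      then have "\<forall>y. dist y x < e \<longrightarrow> y \<in> torus_of -` U"
        by (metis dist_commute dist_torus_of_le order.strict_trans1 vimageI)
      then show "\<exists>e>0. \<forall>y. dist y x < e \<longrightarrow> y \<in> torus_of -` U" using e by blast
    qed
  qed
  also have "\<dots> \<longleftrightarrow> (\<forall>p\<in>U. \<forall>\<^sub>F (p', q) in uniformity. p' = p \<longrightarrow> q \<in> U)"
    unfolding ev by (intro ball_cong refl) auto
  finally show "open U \<longleftrightarrow> (\<forall>p\<in>U. \<forall>\<^sub>F (p', q) in uniformity. p' = p \<longrightarrow> q \<in> U)" .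
qed

end

text \<open>Lebesgue measure on the torus: the image of Lebesgue measure on a fundamental domain.\<close>

definition torus_measure :: "'n::finite torus measure"
  where "torus_measure =
    distr (restrict_space lborel {x. \<forall>i. 0 \<le> x $ i \<and> x $ i < 1}) borel torus_of"

definition measure_preserving :: "'a measure \<Rightarrow> ('a \<Rightarrow> 'a) \<Rightarrow> bool"
  where "measure_preserving M f \<longleftrightarrow> f \<in> measurable M M \<and> distr M M f = M"

definition ergodic :: "'a measure \<Rightarrow> ('a \<Rightarrow> 'a) \<Rightarrow> bool"
  where "ergodic M f \<longleftrightarrow> measure_preserving M f \<and>
    (\<forall>B\<in>sets M. f -` B \<inter> space M = B \<longrightarrow> emeasure M B = 0 \<or> emeasure M (space M - B) = 0)"

lift_definition toral_map :: "int ^ 'n ^ 'n \<Rightarrow> 'n::finite torus \<Rightarrow> 'n torus"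
  is "\<lambda>A x. map_matrix real_of_int A *v x"
proof -
  fix A :: "int ^ 'n ^ 'n" and x y :: "real ^ 'n" and i
  assume "\<And>i. x $ i - y $ i \<in> \<int>"
  then have "(\<Sum>j\<in>UNIV. real_of_int (A $ i $ j) * (x $ j - y $ j)) \<in> \<int>"
    by (intro Ints_sum Ints_mult) auto
  then show "(map_matrix real_of_int A *v x) $ i - (map_matrix real_of_int A *v y) $ i \<in> \<int>"
    by (simp add: matrix_vector_mult_def map_matrix_def sum_subtractf right_diff_distrib)
qed

definition generalized_eigenspace :: "complex ^ 'n ^ 'n \<Rightarrow> complex \<Rightarrow> (complex ^ 'n) set"
  where "generalized_eigenspace B \<mu> =
    {v. \<exists>k. ((\<lambda>w. B *v w - \<mu> *s w) ^^ k) v = 0}"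

text \<open>
  The real vectors lying in the (complex) sum of the generalized eigenspaces with eigenvalue
  in \<open>S\<close>; a \<open>\<mu>\<close> that is not an eigenvalue contributes the zero space. For \<open>S\<close> closed under
  conjugation, this is the real subspace whose complexification is that sum.
\<close>

definition spectral_subspace :: "int ^ 'n ^ 'n \<Rightarrow> complex set \<Rightarrow> (real ^ 'n::finite) set"
  where "spectral_subspace A S =
    {v. (\<chi> i. complex_of_real (v $ i)) \<in>
        vec.span (\<Union>\<mu>\<in>S. generalized_eigenspace (map_matrix of_int A) \<mu>)}"

definition stable_space :: "int ^ 'n ^ 'n \<Rightarrow> (real ^ 'n::finite) set"
  where "stable_space A = spectral_subspace A {\<mu>. cmod \<mu> < 1}"

definition center_space :: "int ^ 'n ^ 'n \<Rightarrow> (real ^ 'n::finite) set"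
  where "center_space A = spectral_subspace A {\<mu>. cmod \<mu> = 1}"

definition unstable_space :: "int ^ 'n ^ 'n \<Rightarrow> (real ^ 'n::finite) set"
  where "unstable_space A = spectral_subspace A {\<mu>. cmod \<mu> > 1}"

text \<open>
  All tangent spaces of the torus are identified with \<open>real ^ 'n\<close> through translations, so
  derivatives are computed on lifts to the universal cover. Any two lifts of a map differ by an
  integer vector, so the choice of lift does not matter.
\<close>

definition is_lift :: "('n::finite torus \<Rightarrow> 'n torus) \<Rightarrow> (real ^ 'n \<Rightarrow> real ^ 'n) \<Rightarrow> bool"
  where "is_lift f F \<longleftrightarrow> continuous_on UNIV F \<and> (\<forall>x. torus_of (F x) = f (torus_of x))"

definition has_torus_derivative ::
    "('n::finite torus \<Rightarrow> 'n torus) \<Rightarrow> ((real ^ 'n) \<Rightarrow>\<^sub>L (real ^ 'n)) \<Rightarrow> 'n torus \<Rightarrow> bool"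
  where "has_torus_derivative f D p \<longleftrightarrow>
    (\<exists>F x. is_lift f F \<and> torus_of x = p \<and> (F has_derivative blinfun_apply D) (at x))"

definition torus_deriv ::
    "('n::finite torus \<Rightarrow> 'n torus) \<Rightarrow> 'n torus \<Rightarrow> ((real ^ 'n) \<Rightarrow>\<^sub>L (real ^ 'n))"
  where "torus_deriv f p = (THE D. has_torus_derivative f D p)"

definition C1_map :: "('n::finite torus \<Rightarrow> 'n torus) \<Rightarrow> bool"
  where "C1_map f \<longleftrightarrow> (\<exists>D. continuous_on UNIV D \<and> (\<forall>p. has_torus_derivative f (D p) p))"

definition C1_vol :: "('n::finite torus \<Rightarrow> 'n torus) set"
  where "C1_vol = {f. bij f \<and> C1_map f \<and> C1_map (inv f) \<and> measure_preserving torus_measure f}"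

definition C1_near ::
    "real \<Rightarrow> ('n::finite torus \<Rightarrow> 'n torus) \<Rightarrow> ('n torus \<Rightarrow> 'n torus) \<Rightarrow> bool"
  where "C1_near e f g \<longleftrightarrow>
    (\<forall>p. dist (f p) (g p) < e \<and> norm (torus_deriv f p - torus_deriv g p) < e)"

definition C1_vol_topology :: "('n::finite torus \<Rightarrow> 'n torus) topology"
  where "C1_vol_topology = topology (\<lambda>U. U \<subseteq> C1_vol \<and>
    (\<forall>f\<in>U. \<exists>e>0. \<forall>g\<in>C1_vol. C1_near e f g \<longrightarrow> g \<in> U))"

lemma openin_C1_vol_topology:
  fixes U :: "('n::finite torus \<Rightarrow> 'n torus) set"
  shows "openin C1_vol_topology U \<longleftrightarrow>
    U \<subseteq> C1_vol \<and> (\<forall>f\<in>U. \<exists>e>0. \<forall>g\<in>C1_vol. C1_near e f g \<longrightarrow> g \<in> U)"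
proof -
  have "istopology (\<lambda>U :: ('n torus \<Rightarrow> 'n torus) set. U \<subseteq> C1_vol \<and>
    (\<forall>f\<in>U. \<exists>e>0. \<forall>g\<in>C1_vol. C1_near e f g \<longrightarrow> g \<in> U))" (is "istopology ?P")
    unfolding istopology_def
  proof (intro conjI allI impI)
    fix S T :: "('n torus \<Rightarrow> 'n torus) set"
    assume S: "?P S" and T: "?P T"
    then show "S \<inter> T \<subseteq> C1_vol" by blast
    show "\<forall>f\<in>S \<inter> T. \<exists>e>0. \<forall>g\<in>C1_vol. C1_near e f g \<longrightarrow> g \<in> S \<inter> T"
    proof
      fix f assume f: "f \<in> S \<inter> T"
      obtain a where a: "a > 0" "\<And>g. g \<in> C1_vol \<Longrightarrow> C1_near a f g \<Longrightarrow> g \<in> S" using S f by blast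
      obtain b where b: "b > 0" "\<And>g. g \<in> C1_vol \<Longrightarrow> C1_near b f g \<Longrightarrow> g \<in> T" using T f by blast
      have "C1_near a f g \<and> C1_near b f g" if "C1_near (min a b) f g" for g
        using that unfolding C1_near_def by simp
      then have "\<forall>g\<in>C1_vol. C1_near (min a b) f g \<longrightarrow> g \<in> S \<inter> T" using a b by blast
      then show "\<exists>e>0. \<forall>g\<in>C1_vol. C1_near e f g \<longrightarrow> g \<in> S \<inter> T"
        using a(1) b(1) by (intro exI[of _ "min a b"]) simp
    qed
  next
    fix K :: "('n torus \<Rightarrow> 'n torus) set set"
    assume K: "\<forall>S\<in>K. ?P S"
    then show "\<Union>K \<subseteq> C1_vol" by blast
    show "\<forall>f\<in>\<Union>K. \<exists>e>0. \<forall>g\<in>C1_vol. C1_near e f g \<longrightarrow> g \<in> \<Union>K"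
      using K by (meson UnionE UnionI)
  qed
  then show ?thesis by (simp add: C1_vol_topology_def topology_inverse')
qed

definition riemannian_metric :: "('n::finite torus \<Rightarrow> real ^ 'n ^ 'n) \<Rightarrow> bool"
  where "riemannian_metric G \<longleftrightarrow> continuous_on UNIV G \<and>
    (\<forall>p. transpose (G p) = G p \<and> (\<forall>v. v \<noteq> 0 \<longrightarrow> v \<bullet> (G p *v v) > 0))"

definition riemannian_norm :: "('n::finite torus \<Rightarrow> real ^ 'n ^ 'n) \<Rightarrow> 'n torus \<Rightarrow> real ^ 'n \<Rightarrow> real"
  where "riemannian_norm G p v = sqrt (v \<bullet> (G p *v v))"

definition rate_bounds ::
    "('n::finite torus \<Rightarrow> real ^ 'n ^ 'n) \<Rightarrow> ('n torus \<Rightarrow> 'n torus) \<Rightarrow> ('n torus \<Rightarrow> (real ^ 'n) set)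
      \<Rightarrow> ('n torus \<Rightarrow> real) \<Rightarrow> ('n torus \<Rightarrow> real) \<Rightarrow> bool"
  where "rate_bounds G f E \<mu> \<nu> \<longleftrightarrow>
    continuous_on UNIV \<mu> \<and> continuous_on UNIV \<nu> \<and>
    (\<forall>p. 0 < \<mu> p \<and> 0 < \<nu> p \<and> (\<forall>v\<in>E p. v \<noteq> 0 \<longrightarrow>
      \<mu> p < riemannian_norm G (f p) (torus_deriv f p v) / riemannian_norm G p v \<and>
      riemannian_norm G (f p) (torus_deriv f p v) / riemannian_norm G p v < \<nu> p))"

definition invariant_bundle ::
    "('n::finite torus \<Rightarrow> 'n torus) \<Rightarrow> ('n torus \<Rightarrow> (real ^ 'n) set) \<Rightarrow> bool"
  where "invariant_bundle f E \<longleftrightarrow>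
    (\<forall>p. subspace (E p) \<and> torus_deriv f p ` E p = E (f p))"

text \<open>
  The Riemannian metric is existentially quantified: a linear automorphism need not contract
  its stable space in one step for the flat metric, but it does for an adapted one.
\<close>

definition partially_hyperbolic_splitting ::
    "('n::finite torus \<Rightarrow> 'n torus) \<Rightarrow> ('n torus \<Rightarrow> (real ^ 'n) set) \<Rightarrow>
      ('n torus \<Rightarrow> (real ^ 'n) set) \<Rightarrow> ('n torus \<Rightarrow> (real ^ 'n) set) \<Rightarrow> bool"
  where "partially_hyperbolic_splitting f Es Ec Eu \<longleftrightarrow>
    invariant_bundle f Es \<and> invariant_bundle f Ec \<and> invariant_bundle f Eu \<and>
    (\<forall>p. {a + b + c | a b c. a \<in> Es p \<and> b \<in> Ec p \<and> c \<in> Eu p} = UNIV \<and>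
         (\<forall>a\<in>Es p. \<forall>b\<in>Ec p. \<forall>c\<in>Eu p. a + b + c = 0 \<longrightarrow> a = 0 \<and> b = 0 \<and> c = 0) \<and>
         Es p \<noteq> {0} \<and> Eu p \<noteq> {0}) \<and>
    (\<exists>G \<mu>s \<nu>s \<mu>c \<nu>c \<mu>u \<nu>u. riemannian_metric G \<and>
       rate_bounds G f Es \<mu>s \<nu>s \<and> rate_bounds G f Ec \<mu>c \<nu>c \<and> rate_bounds G f Eu \<mu>u \<nu>u \<and>
       (\<forall>p. \<nu>s p < min 1 (\<mu>c p) \<and> max 1 (\<nu>c p) < \<mu>u p))"

definition product_box :: "(real ^ 'n) set \<Rightarrow> (real ^ 'n::finite) set"
  where "product_box H = {v + w | v w. v \<in> H \<and> norm v < 1 \<and> w \<in> H\<^sup>\<bottom> \<and> norm w < 1}"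

definition plaque :: "(real ^ 'n) set \<Rightarrow> real ^ 'n \<Rightarrow> (real ^ 'n::finite) set"
  where "plaque H z = {z' \<in> product_box H. z' - z \<in> H}"

text \<open>
  A continuous foliation with $C^1$ leaves tangent to the bundle \<open>E\<close>, given by the map \<open>W\<close>
  sending a point to its leaf. Each point has a foliation chart, written as a map \<open>\<phi>\<close> into the
  universal cover: on plaques it is an immersion tangent to \<open>E\<close>, with derivative \<open>L\<close> along the
  plaques continuous on the whole chart, and the plaques are the path components of the
  intersections of the leaves with the image of the chart.
\<close>

definition tangent_foliation ::
    "('n::finite torus \<Rightarrow> (real ^ 'n) set) \<Rightarrow> ('n torus \<Rightarrow> 'n torus set) \<Rightarrow> bool"
  where "tangent_foliation E W \<longleftrightarrow>
    (\<forall>p. p \<in> W p \<and> path_connected (W p) \<and> (\<forall>q\<in>W p. W q = W p)) \<and>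
    (\<forall>p. \<exists>H (\<phi> :: real ^ 'n \<Rightarrow> real ^ 'n) \<psi> (L :: real ^ 'n \<Rightarrow> (real ^ 'n) \<Rightarrow>\<^sub>L (real ^ 'n)) U.
       subspace H \<and> open U \<and> p \<in> U \<and>
       homeomorphism (product_box H) U (torus_of \<circ> \<phi>) \<psi> \<and>
       continuous_on (product_box H) \<phi> \<and> continuous_on (product_box H) L \<and>
       (\<forall>z\<in>product_box H.
          (\<phi> has_derivative blinfun_apply (L z)) (at z within plaque H z) \<and>
          inj_on (blinfun_apply (L z)) H \<and> L z ` H = E (torus_of (\<phi> z)) \<and>
          path_component_set (W (torus_of (\<phi> z)) \<inter> U) (torus_of (\<phi> z)) =
            (torus_of \<circ> \<phi>) ` plaque H z))"

definition uniquely_integrable_to ::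
    "('n::finite torus \<Rightarrow> (real ^ 'n) set) \<Rightarrow> ('n torus \<Rightarrow> 'n torus set) \<Rightarrow> bool"
  where "uniquely_integrable_to E W \<longleftrightarrow>
    tangent_foliation E W \<and> (\<forall>W'. tangent_foliation E W' \<longrightarrow> W' = W)"

definition invariant_foliation ::
    "('n::finite torus \<Rightarrow> 'n torus) \<Rightarrow> ('n torus \<Rightarrow> 'n torus set) \<Rightarrow> bool"
  where "invariant_foliation f W \<longleftrightarrow> (\<forall>p. f ` W p = W (f p))"

text \<open>
  \<open>Ws\<close> and \<open>Wu\<close> are the stable and unstable foliations of \<open>f\<close>, for the partially hyperbolic
  splitting of \<open>f\<close> that corresponds to the one of \<open>A\<close>. A map has at most one partially hyperbolic
  splitting with prescribed dimensions, but may have others with other dimensions.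
\<close>

definition su_foliations ::
    "int ^ 'n ^ 'n \<Rightarrow> ('n::finite torus \<Rightarrow> 'n torus) \<Rightarrow>
      ('n torus \<Rightarrow> 'n torus set) \<Rightarrow> ('n torus \<Rightarrow> 'n torus set) \<Rightarrow> bool"
  where "su_foliations A f Ws Wu \<longleftrightarrow>
    (\<exists>Es Ec Eu. partially_hyperbolic_splitting f Es Ec Eu \<and>
       (\<forall>p. dim (Es p) = dim (stable_space A) \<and> dim (Ec p) = dim (center_space A) \<and>
            dim (Eu p) = dim (unstable_space A)) \<and>
       uniquely_integrable_to Es Ws \<and> invariant_foliation f Ws \<and>
       uniquely_integrable_to Eu Wu \<and> invariant_foliation f Wu)"

definition su_path ::
    "('n::finite torus \<Rightarrow> 'n torus set) \<Rightarrow> ('n torus \<Rightarrow> 'n torus set) \<Rightarrow> (real \<Rightarrow> 'n torus) \<Rightarrow> bool"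
  where "su_path Ws Wu \<gamma> \<longleftrightarrow> path \<gamma> \<and>
    (\<exists>(n::nat) t. t 0 = 0 \<and> t n = 1 \<and>
       (\<forall>i<n. t i < t (Suc i) \<and>
          (\<exists>p. \<gamma> ` {t i..t (Suc i)} \<subseteq> Ws p \<or> \<gamma> ` {t i..t (Suc i)} \<subseteq> Wu p)))"

definition accessibility_class ::
    "('n::finite torus \<Rightarrow> 'n torus set) \<Rightarrow> ('n torus \<Rightarrow> 'n torus set) \<Rightarrow> 'n torus \<Rightarrow> 'n torus set"
  where "accessibility_class Ws Wu x =
    {y. \<exists>\<gamma>. su_path Ws Wu \<gamma> \<and> pathstart \<gamma> = x \<and> pathfinish \<gamma> = y}"

definition su_saturated ::
    "('n::finite torus \<Rightarrow> 'n torus set) \<Rightarrow> ('n torus \<Rightarrow> 'n torus set) \<Rightarrow> 'n torus set \<Rightarrow> bool"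
  where "su_saturated Ws Wu E \<longleftrightarrow> (\<forall>x\<in>E. accessibility_class Ws Wu x \<subseteq> E)"

end

theory Submission
  imports Defs "HOL-Computational_Algebra.Fundamental_Theorem_Algebra"
begin

text \<open>
  The lift \<open>F\<close> of a nearby \<open>f\<close> is a bounded, Lipschitz small perturbation of \<open>A\<close>. Invariant cones
  give through every point unique stable and unstable leaves of \<open>F\<close>, graphs over \<open>E\<^sup>s\<close> and \<open>E\<^sup>u\<close>;
  as they are determined by growth rates, they are the leaves of every foliation tangent to the
  bundles of a partially hyperbolic splitting. Ergodicity and \<open>dim E\<^sup>c = 2\<close> make \<open>A\<close> act on the
  centre, identified with the complex plane, as multiplication by a non-real algebraic number
  \<open>zeta\<close>, and a Liouville estimate bounds the centre coordinate of \<open>k\<close> from below by a power of its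
  norm, uniformly over the lattice vectors \<open>k\<close> needed.

  Suppose that the lift \<open>E\<close> of the set is not everything, and let \<open>V\<close> be its complement. By
  pigeonhole, for a point \<open>x\<close> two translates \<open>x + k\<^sub>1\<close> and \<open>x + k\<^sub>2\<close> are joined by \<open>su\<close>-paths to points at
  distance \<open>1 / X\<close>, where the length of the paths is polynomial in \<open>X\<close>. Contracting a path of that
  length takes only \<open>O(log X)\<close> iterates, and \<open>F\<close> moves the centre so slowly that the error
  remains small: an \<open>su\<close>-path can be traced from a nearby point with a nearby end. Hence \<open>V\<close> contains a
  path from \<open>y\<close> to \<open>y + k\<close>, thus quasi-lines in the directions \<open>k\<close> and \<open>A k\<close>, and \<open>E\<close> nearly
  contains one. As \<open>zeta\<close> is not real, the latter is transverse to one of the former. By Brouwer's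
  theorem some stable leaf of the one meets an unstable leaf of the other, so that tracing
  leads from \<open>E\<close> into \<open>V\<close>.
\<close>

text \<open>No regularity of holonomies along leaves is used; \<open>displacement\<close> stands in
  for it. Two points are followed for \<open>n\<close> iterates, with \<open>n\<close> just large
  enough to contract the leaf segment in question, at the cost of a factor \<open>th ^ n\<close>,
  where \<open>th\<close> tends to 1 with the perturbation. Every quantity is measured by one scale
  \<open>X = rho ^ n\<close>: lengths are bounded by a fixed power of \<open>X\<close>, gaps are of
  order \<open>1 / X\<close>, and \<open>th ^ 2 < rho\<close> lets a gap survive two legs. The order
  of choices matters: the exponents \<open>N2\<close> and \<open>QL\<close> depend on
  \<open>A\<close> alone, then \<open>rho > 1\<close> is taken so close to 1 that \<open>n\<close>
  iterates contract the longest leaf below order \<open>1 / X\<close>, and only then the size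
  \<open>e\<close> of the perturbation. The pigeonhole runs over combinations of \<open>u0\<close>,
  \<open>A u0\<close> and \<open>A (A u0)\<close>: there are \<open>B ^ 3\<close> of them with
  coefficients below \<open>B\<close>, while after a stable and an unstable leg only the two centre
  coordinates spread over a range of order \<open>B\<close>. The Liouville bound keeps the centre
  part of the chosen difference from being so small that the quasi-lines would have to be followed
  too long before they cross.\<close>

section \<open>Seminorms, the sizes of single components along a splitting\<close>

definition seminorm :: "('a::real_vector \<Rightarrow> real) \<Rightarrow> bool" where
 "seminorm p \<longleftrightarrow> (\<forall>x y. p (x + y) \<le> p x + p y) \<and> (\<forall>c x. p (c *\<^sub>R x) = \<bar>c\<bar> * p x)"

lemma seminorm_add: "seminorm p \<Longrightarrow> p (x + y) \<le> p x + p y"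
 and seminorm_scale: "seminorm p \<Longrightarrow> p (c *\<^sub>R x) = \<bar>c\<bar> * p x"
 by (auto simp: seminorm_def)

lemma seminorm_zero: "seminorm p \<Longrightarrow> p 0 = 0"
 using seminorm_scale[of p 0 0] by simp

lemma seminorm_minus: "seminorm p \<Longrightarrow> p (- x) = p x"
 using seminorm_scale[of p "-1" x] by simp

lemma seminorm_commute: "seminorm p \<Longrightarrow> p (x - y) = p (y - x)"
 using seminorm_minus[of p "x - y"] by simp

lemma seminorm_diff: "seminorm p \<Longrightarrow> p (x - y) \<le> p x + p y"
 using seminorm_add[of p x "- y"] by (simp add: seminorm_minus)

lemma seminorm_nonneg: "seminorm p \<Longrightarrow> 0 \<le> p x"
 using seminorm_diff[of p x x] by (simp add: seminorm_zero)

lemma seminorm_triangle: "seminorm p \<Longrightarrow> p (x - z) \<le> p (x - y) + p (y - z)"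
 using seminorm_add[of p "x - y" "y - z"] by simp

lemma seminorm_abs_diff: "seminorm p \<Longrightarrow> \<bar>p x - p y\<bar> \<le> p (x - y)"
 using seminorm_add[of p "x - y" y] seminorm_add[of p "y - x" x] seminorm_commute[of p x y]
 by simp

lemma seminorm_eq: "seminorm p \<Longrightarrow> p (x - y) = 0 \<Longrightarrow> p x = p y"
 using seminorm_abs_diff[of p x y] by simp

lemma seminorm_max:
 assumes "seminorm p" "seminorm q"
 shows "seminorm (\<lambda>x. max (p x) (q x))"
proof -
 have "max (p (x + y)) (q (x + y)) \<le> max (p x) (q x) + max (p y) (q y)" for x y
  using seminorm_add[OF assms(1), of x y] seminorm_add[OF assms(2), of x y] by linarith
 then show ?thesis
  using assms by (simp add: seminorm_def max_mult_distrib_left)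
qed

lemma seminorm_continuous:
 fixes p :: "'a::real_normed_vector \<Rightarrow> real"
 assumes "seminorm p" and "\<And>v. p v \<le> K * norm v"
 shows "continuous_on S p"
proof (rule lipschitz_on_continuous_on)
 show "(max K 0)-lipschitz_on S p"
 proof (rule lipschitz_onI)
  fix x y
  have "\<bar>p x - p y\<bar> \<le> p (x - y)" by (rule seminorm_abs_diff[OF assms(1)])
  also have "\<dots> \<le> K * norm (x - y)" by (rule assms)
  also have "\<dots> \<le> max K 0 * norm (x - y)" by (intro mult_right_mono) auto
  finally show "dist (p x) (p y) \<le> max K 0 * dist x y" by (simp add: dist_norm)
 qed simp
qed

section \<open>Cones and invariant leaves for sequences of maps\<close>

primrec seq_comp :: "(nat \<Rightarrow> 'a \<Rightarrow> 'a) \<Rightarrow> nat \<Rightarrow> 'a \<Rightarrow> 'a" where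
 "seq_comp g 0 = (\<lambda>x. x)"
| "seq_comp g (Suc n) = (\<lambda>x. g n (seq_comp g n x))"

text \<open>\<open>p\<close> measures the component that is contracted relative to the one measured
  by \<open>q\<close>, and \<open>P\<close> projects onto the kernel of \<open>q\<close> along that
  of \<open>p\<close>. The rate \<open>lam\<close> may be 1, as the stable and the centre-stable
  cone are both instances. The condition \<open>gap\<close> compares the largest growth
  \<open>lam + e\<close> of \<open>p\<close> in the thin cone \<open>q v \<le> kap * p v\<close>
  with the least growth \<open>m - e / kap\<close> of \<open>q\<close> outside of it, where
  \<open>max (p v) (q v) \<le> q v / kap\<close>.\<close>

locale cone_split =
 fixes B P :: "'a::euclidean_space \<Rightarrow> 'a" and p q :: "'a \<Rightarrow> real" and lam m kap e K :: real
 assumes linB: "linear B" and linP: "linear P" and snp: "seminorm p" and snq: "seminorm q"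
  and pP: "\<And>v. p (v - P v) = 0" and qP: "\<And>v. q (P v) = 0"
  and pB: "\<And>v. p (B v) \<le> lam * p v" and qB: "\<And>v. m * q v \<le> q (B v)"
  and qB0: "\<And>v. q v = 0 \<Longrightarrow> q (B v) = 0" and surjB: "surj B"
  and normK: "\<And>v. norm v \<le> K * (p v + q v)"
  and pK: "\<And>v. p v \<le> K * norm v" and qK: "\<And>v. q v \<le> K * norm v"
  and kap: "0 < kap" "kap \<le> 1" and lam0: "0 < lam" and e0: "0 \<le> e" and K0: "0 < K"
  and gap: "lam + e < m - e / kap"

text \<open>A sequence instead of one map: a later starting time stays within the locale, and the
  derivatives along an orbit form an instance, so that leaves and tangent spaces need only one
  proof.\<close>

locale cone_seq = cone_split B P p q lam m kap e K
 for B P :: "'a::euclidean_space \<Rightarrow> 'a" and p q lam m kap e K +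
 fixes g :: "nat \<Rightarrow> 'a \<Rightarrow> 'a"
 assumes gp: "\<And>n y z. p (g n y - g n z - B (y - z)) \<le> e * max (p (y - z)) (q (y - z))"
  and gq: "\<And>n y z. q (g n y - g n z - B (y - z)) \<le> e * max (p (y - z)) (q (y - z))"

context cone_seq
begin

abbreviation G where "G \<equiv> seq_comp g"

text \<open>The leaf of \<open>x\<close>, defined by cones and not by growth: the conditions are
  closed, which lets leaf points be obtained as limits. \<open>W_contract\<close> and
  \<open>W_growth\<close> translate to growth rates.\<close>

definition W :: "'a \<Rightarrow> 'a set" where
 "W x = {y. \<forall>n. q (G n y - G n x) \<le> kap * p (G n y - G n x)}"

lemma p0: "0 \<le> p x" and q0: "0 \<le> q x"
 using snp snq by (auto intro: seminorm_nonneg)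

lemma m1: "0 < m - e / kap" "0 < m"
proof -
 show "0 < m - e / kap" using gap lam0 e0 by linarith
 moreover have "0 \<le> e / kap" using e0 kap by simp
 ultimately show "0 < m" by linarith
qed

lemma contp: "continuous_on S p" and contq: "continuous_on S q"
 by (auto intro: seminorm_continuous[OF snp pK] seminorm_continuous[OF snq qK])

lemma p_zero_q_zero: "p v = 0 \<Longrightarrow> q v = 0 \<Longrightarrow> v = 0"
 using normK[of v] by simp

lemma cone_fwd:
 assumes "kap * p (y - z) \<le> q (y - z)"
 shows "kap * p (g n y - g n z) \<le> (lam + e) * q (y - z)"
  and "(m - e / kap) * q (y - z) \<le> q (g n y - g n z)"
  and "kap * p (g n y - g n z) \<le> q (g n y - g n z)"
proof -
 let ?d = "y - z" and ?d' = "g n y - g n z"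
 have a: "p ?d \<le> q ?d / kap" using assms kap by (simp add: field_simps)
 have "q ?d * kap \<le> q ?d" using kap q0[of ?d] by (simp add: mult_left_le)
 then have "q ?d \<le> q ?d / kap" using kap by (simp add: field_simps)
 with a have mx: "max (p ?d) (q ?d) \<le> q ?d / kap" by simp
 have emx: "e * max (p ?d) (q ?d) \<le> e * (q ?d / kap)" by (rule mult_left_mono[OF mx e0])
 have "p ?d' \<le> p (?d' - B ?d) + p (B ?d)"
  using seminorm_add[OF snp, of "?d' - B ?d" "B ?d"] by simp
 also have "\<dots> \<le> e * (q ?d / kap) + lam * (q ?d / kap)"
  using gp[of n y z] pB[of ?d] mult_left_mono[OF a, of lam] lam0 emx by linarith
 finally show 1: "kap * p ?d' \<le> (lam + e) * q ?d"
  using kap by (simp add: field_simps)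
 have "q (B ?d) \<le> q ?d' + q (?d' - B ?d)"
  using seminorm_diff[OF snq, of ?d' "?d' - B ?d"] by simp
 then show 2: "(m - e / kap) * q ?d \<le> q ?d'"
  using qB[of ?d] gq[of n y z] emx by (simp add: algebra_simps)
 have "(lam + e) * q ?d \<le> (m - e / kap) * q ?d"
  using gap q0[of ?d] by (intro mult_right_mono) auto
 with 1 2 show "kap * p ?d' \<le> q ?d'" by linarith
qed

lemma cone_fwd_strict:
 assumes "kap * p (y - z) < q (y - z)"
 shows "kap * p (g n y - g n z) < q (g n y - g n z)"
proof -
 have "0 < q (y - z)" using assms kap p0[of "y - z"]
  by (smt (verit) mult_nonneg_nonneg)
 then have "(lam + e) * q (y - z) < (m - e / kap) * q (y - z)"
  using gap by (intro mult_strict_right_mono) auto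
 with cone_fwd[of y z n] assms show ?thesis by linarith
qed

text \<open>The open wide cone is forward invariant, so the closed thin cone is backward invariant.
  Hence a condition arranged at time \<open>n\<close> holds at all earlier times.\<close>

lemma cone_bwd:
 assumes "q (g n y - g n z) \<le> kap * p (g n y - g n z)"
 shows "q (y - z) \<le> kap * p (y - z)"
 using cone_fwd_strict[of y z n] assms by linarith

lemma cone_contract:
 assumes "q (y - z) \<le> kap * p (y - z)"
 shows "p (g n y - g n z) \<le> (lam + e) * p (y - z)"
proof -
 let ?d = "y - z" and ?d' = "g n y - g n z"
 have "kap * p ?d \<le> p ?d" using kap p0[of ?d] by (simp add: mult_left_le_one_le)
 then have "max (p ?d) (q ?d) = p ?d" using assms by simp
 moreover have "p ?d' \<le> p (?d' - B ?d) + p (B ?d)"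
  using seminorm_add[OF snp, of "?d' - B ?d" "B ?d"] by simp
 ultimately show ?thesis using gp[of n y z] pB[of ?d] by (simp add: algebra_simps)
qed

lemma cone_bwd_iter:
 assumes "q (G n y - G n z) \<le> kap * p (G n y - G n z)" "j \<le> n"
 shows "q (G j y - G j z) \<le> kap * p (G j y - G j z)"
 using assms(2,1) by (induction rule: inc_induct) (auto dest: cone_bwd)

lemma cone_contract_iter:
 assumes "q (G n y - G n z) \<le> kap * p (G n y - G n z)"
 shows "p (G n y - G n z) \<le> (lam + e) ^ n * p (y - z)"
 using assms
proof (induction n)
 case (Suc n)
 have c: "q (G n y - G n z) \<le> kap * p (G n y - G n z)"
  using cone_bwd_iter[OF Suc.prems, of n] by simp
 have "p (G (Suc n) y - G (Suc n) z) \<le> (lam + e) * p (G n y - G n z)"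
  using cone_contract[OF c] by simp
 also have "\<dots> \<le> (lam + e) * ((lam + e) ^ n * p (y - z))"
  using Suc.IH[OF c] lam0 e0 by (intro mult_left_mono) auto
 finally show ?case by (simp add: algebra_simps)
qed simp

lemma cone_expand_iter:
 assumes "kap * p (y - z) \<le> q (y - z)"
 shows "kap * p (G n y - G n z) \<le> q (G n y - G n z) \<and>
  (m - e / kap) ^ n * q (y - z) \<le> q (G n y - G n z)"
proof (induction n)
 case (Suc n)
 have "(m - e / kap) * ((m - e / kap) ^ n * q (y - z)) \<le> (m - e / kap) * q (G n y - G n z)"
  using Suc m1 by (intro mult_left_mono) auto
 with Suc cone_fwd[of "G n y" "G n z" n] show ?case by (auto simp: algebra_simps)
qed (use assms in simp)

lemma W_contract: "y \<in> W x \<Longrightarrow> p (G n y - G n x) \<le> (lam + e) ^ n * p (y - x)"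
 unfolding W_def using cone_contract_iter by blast

lemma W_cone: "y \<in> W x \<Longrightarrow> q (G n y - G n x) \<le> kap * p (G n y - G n x)"
 by (simp add: W_def)

lemma W_cone0: "y \<in> W x \<Longrightarrow> q (y - x) \<le> kap * p (y - x)"
 using W_cone[of y x 0] by simp

lemma W_contract_q:
 assumes "y \<in> W x"
 shows "q (G n y - G n x) \<le> (lam + e) ^ n * p (y - x)"
proof -
 have "q (G n y - G n x) \<le> kap * p (G n y - G n x)" by (rule W_cone[OF assms])
 also have "\<dots> \<le> p (G n y - G n x)" using kap p0 by (simp add: mult_left_le_one_le)
 finally show ?thesis using W_contract[OF assms, of n] by linarith
qed

text \<open>In the wide cone \<open>q\<close> grows at the rate \<open>m - e / kap\<close>, which
  beats the assumed rate \<open>lam + e\<close> unless \<open>q\<close> vanishes.\<close>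

lemma cone_growth_zero:
 assumes "kap * p (y - x) \<le> q (y - x)"
  and "\<And>n. q (G n y - G n x) \<le> C * (lam + e) ^ n"
 shows "q (y - x) = 0"
proof (rule ccontr)
 assume "q (y - x) \<noteq> 0"
 then have d: "0 < q (y - x)" using q0[of "y - x"] by linarith
 define r where "r = (m - e / kap) / (lam + e)"
 have l: "0 < lam + e" using lam0 e0 by simp
 have r: "1 < r" unfolding r_def using gap l by simp
 have "r ^ n * q (y - x) \<le> C" for n
 proof -
  have "(m - e / kap) ^ n * q (y - x) \<le> C * (lam + e) ^ n"
   using cone_expand_iter[OF assms(1), of n] assms(2)[of n] by linarith
  then show ?thesis unfolding r_def power_divide using l by (simp add: field_simps)
 qed
 moreover obtain n where "C / q (y - x) < r ^ n" using real_arch_pow[OF r] by blast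
 ultimately show False using d by (metis not_less pos_divide_less_eq)
qed

lemma seq_comp_shift: "seq_comp g (k + n) x = seq_comp (\<lambda>i. g (n + i)) k (seq_comp g n x)"
 by (induction k) (auto simp: add.commute)

lemma shift: "cone_seq B P p q lam m kap e K (\<lambda>i. g (n + i))"
 by unfold_locales (auto intro: gp gq)

text \<open>If the difference is outside the thin cone at some time \<open>n\<close>, then
  \<open>cone_growth_zero\<close> for the sequence started at \<open>n\<close> makes
  \<open>q\<close> vanish there, which contradicts being outside. Transitivity of leaves and their
  identification with leaves of other foliations rest on this criterion.\<close>

lemma W_growth:
 assumes "\<And>n. q (G n y - G n x) \<le> C * (lam + e) ^ n"
 shows "y \<in> W x"
proof (rule ccontr)
 assume "y \<notin> W x"
 then obtain n where n: "kap * p (G n y - G n x) < q (G n y - G n x)"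
  unfolding W_def by (auto simp: not_le)
 interpret s: cone_seq B P p q lam m kap e K "\<lambda>i. g (n + i)" by (rule shift)
 have "q (G n y - G n x) = 0"
 proof (rule s.cone_growth_zero)
  fix k
  show "q (s.G k (G n y) - s.G k (G n x)) \<le> (C * (lam + e) ^ n) * (lam + e) ^ k"
   using assms[of "k + n"] by (simp add: seq_comp_shift power_add algebra_simps)
 qed (use n in simp)
 moreover have "0 \<le> kap * p (G n y - G n x)" using kap p0 by simp
 ultimately show False using n by simp
qed

lemma W_refl: "x \<in> W x"
 using kap p0 by (auto simp: W_def seminorm_zero snq snp)

lemma W_sym: "y \<in> W x \<Longrightarrow> x \<in> W y"
 by (auto simp: W_def seminorm_commute[OF snp] seminorm_commute[OF snq])

text \<open>The cone condition is not additive, but the growth bound is.\<close>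

lemma W_trans:
 assumes "y \<in> W x" "z \<in> W y"
 shows "z \<in> W x"
proof (rule W_growth)
 fix n
 have "q (G n z - G n x) \<le> q (G n z - G n y) + q (G n y - G n x)"
  by (rule seminorm_triangle[OF snq])
 also have "\<dots> \<le> (p (z - y) + p (y - x)) * (lam + e) ^ n"
  using W_contract_q[OF assms(1), of n] W_contract_q[OF assms(2), of n]
  by (simp add: algebra_simps)
 finally show "q (G n z - G n x) \<le> (p (z - y) + p (y - x)) * (lam + e) ^ n" .
qed

lemma W_unique:
 assumes "y \<in> W x" "z \<in> W x" "p (y - z) = 0"
 shows "y = z"
proof -
 have "y \<in> W z" using W_trans[OF W_sym[OF assms(2)] assms(1)] .
 from W_cone0[OF this] assms(3) have "q (y - z) = 0" using q0[of "y - z"] by simp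
 then show ?thesis using p_zero_q_zero[OF assms(3)] by simp
qed

lemma contg: "continuous_on S (g n)"
proof -
 obtain b where b: "0 < b" "\<And>x. norm (B x) \<le> b * norm x"
  using linear_bounded_pos[OF linB] by blast
 have bd: "norm (g n y - g n z) \<le> (b + 4 * K * e * K) * norm (y - z)" for y z
 proof -
  have mx: "max (p (y - z)) (q (y - z)) \<le> K * norm (y - z)" using pK qK by simp
  have "norm (g n y - g n z - B (y - z)) \<le> K * (2 * (e * max (p (y - z)) (q (y - z))))"
   using normK[of "g n y - g n z - B (y - z)"] gp[of n y z] gq[of n y z] K0
   by (smt (verit) mult_left_mono)
  also have "\<dots> \<le> K * (2 * (e * (K * norm (y - z))))"
   using mx K0 e0 by (intro mult_left_mono) auto
  also have "\<dots> \<le> 4 * K * e * K * norm (y - z)" using K0 e0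
   by (simp add: mult_ac mult_right_mono)
  finally have "norm (g n y - g n z - B (y - z)) \<le> 4 * K * e * K * norm (y - z)" .
  moreover have "norm (g n y - g n z) \<le> norm (g n y - g n z - B (y - z)) + norm (B (y - z))"
   using norm_triangle_ineq[of "g n y - g n z - B (y - z)" "B (y - z)"] by simp
  ultimately show ?thesis using b(2)[of "y - z"] by (simp add: algebra_simps)
 qed
 have "(b + 4 * K * e * K)-lipschitz_on S (g n)"
  by (rule lipschitz_onI) (use bd b K0 e0 in \<open>auto simp: dist_norm\<close>)
 then show ?thesis by (rule lipschitz_on_continuous_on)
qed

lemma contG: "continuous_on S (G n)"
proof (induction n)
 case (Suc n)
 have "continuous_on S (g n \<circ> G n)"
  by (rule continuous_on_compose[OF Suc contg])
 then show ?case by (simp add: comp_def)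
qed simp

text \<open>\<open>q (y - c) = 0\<close> says that \<open>y\<close> and \<open>c\<close> have the
  same expanding coordinate. So these are the Lipschitz graphs, of slope \<open>1 / kap\<close>,
  over the whole expanding space.\<close>

definition cu_graph :: "'a set \<Rightarrow> bool" where
 "cu_graph \<Gamma> \<longleftrightarrow> (\<forall>y\<in>\<Gamma>. \<forall>z\<in>\<Gamma>. kap * p (y - z) \<le> q (y - z)) \<and> (\<forall>c. \<exists>y\<in>\<Gamma>. q (y - c) = 0)"

text \<open>
 The image of a graph meets every prescribed fibre: the point sought is a fixed point of a
 self-map of a ball in the expanding space, and Brouwer's theorem provides one.
\<close>

lemma cu_graph_image:
 assumes "cu_graph \<Gamma>"
 shows "cu_graph (g n ` \<Gamma>)"
 unfolding cu_graph_def
proof (intro conjI ballI allI)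
 fix y z assume "y \<in> g n ` \<Gamma>" "z \<in> g n ` \<Gamma>"
 then show "kap * p (y - z) \<le> q (y - z)" using assms cone_fwd(3) unfolding cu_graph_def by auto
next
 fix c
 obtain gamma where gamma: "\<And>w. gamma w \<in> \<Gamma>" "\<And>w. q (gamma w - w) = 0"
  using assms unfolding cu_graph_def by metis
 obtain Bi where Bi: "linear Bi" "\<And>x. B (Bi x) = x"
  using linear_surjective_right_inverse[OF linB surjB] by (auto simp: fun_eq_iff)
 define phi where "phi y = g n y - B y" for y
 \<comment> \<open>A fixed point \<open>w\<close> solves \<open>B w + phi (gamma w) = c\<close> in
   the expanding coordinate, and \<open>gamma w\<close> agrees with \<open>w\<close> there; as
   \<open>g n (gamma w) = B (gamma w) + phi (gamma w)\<close>, the image of \<open>gamma w\<close>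
   then lies over \<open>c\<close>.\<close>
 define Psi where "Psi w = Bi (c - phi (gamma w)) - P (Bi (c - phi (gamma w)))" for w
 have m0: "0 < m" by (rule m1)
 have q_diff_P: "q (z - P z) \<le> q z" for z
  using seminorm_diff[OF snq, of z "P z"] qP by simp
 have qBi: "q (Bi z) \<le> q z / m" for z
  using qB[of "Bi z"] Bi m0 by (simp add: field_simps)
 have qgamma: "q (gamma w - gamma w') \<le> q (w - w')" for w w'
 proof -
  have "gamma w - gamma w' = (gamma w - w) + (w - w') + (w' - gamma w')" by simp
  then have "q (gamma w - gamma w') \<le> q (gamma w - w) + q (w - w') + q (w' - gamma w')"
   using seminorm_add[OF snq] by (smt (verit))
  then show ?thesis using gamma(2)[of w] gamma(2)[of w'] seminorm_commute[OF snq] by simp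
 qed
 have qphi: "q (phi (gamma w) - phi (gamma w')) \<le> (e / kap) * q (w - w')" for w w'
 proof -
  have eq: "phi (gamma w) - phi (gamma w') = g n (gamma w) - g n (gamma w') - B (gamma w - gamma w')"
   by (simp add: phi_def linear_diff[OF linB])
  have c: "kap * p (gamma w - gamma w') \<le> q (gamma w - gamma w')"
   using assms gamma(1) unfolding cu_graph_def by blast
  have "q (gamma w - gamma w') * kap \<le> q (gamma w - gamma w')" using kap q0 by (simp add: mult_left_le)
  with c have "max (p (gamma w - gamma w')) (q (gamma w - gamma w')) \<le> q (gamma w - gamma w') / kap"
   using kap by (simp add: field_simps)
  also have "\<dots> \<le> q (w - w') / kap" using qgamma kap by (intro divide_right_mono) auto
  finally have "e * max (p (gamma w - gamma w')) (q (gamma w - gamma w')) \<le> e * (q (w - w') / kap)"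
   by (rule mult_left_mono[OF _ e0])
  then show ?thesis unfolding eq using gq[of n "gamma w" "gamma w'"] by (simp add: algebra_simps)
 qed
 have Psi_lip: "q (Psi w - Psi w') \<le> (e / kap) / m * q (w - w')" for w w'
 proof -
  have eq: "Psi w - Psi w' = Bi (phi (gamma w') - phi (gamma w)) - P (Bi (phi (gamma w') - phi (gamma w)))"
   by (simp add: Psi_def linear_diff[OF Bi(1)] linear_diff[OF linP])
  have "q (Psi w - Psi w') \<le> q (phi (gamma w') - phi (gamma w)) / m"
   unfolding eq using q_diff_P qBi order_trans by blast
  also have "\<dots> \<le> (e / kap) * q (w - w') / m"
   using qphi[of w' w] m0 by (intro divide_right_mono) (auto simp: seminorm_commute[OF snq])
  finally show ?thesis by simp
 qed
 have pPsi: "p (Psi w) = 0" for w by (simp add: Psi_def pP)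
 \<comment> \<open>The radius solves \<open>q (Psi 0) + (e / kap) / m * r = r\<close>, so that the
   ball is mapped into itself.\<close>
 define r where "r = q (Psi 0) * m / (m - e / kap)"
 have r0: "0 \<le> r" unfolding r_def using m0 m1 q0 by simp
 define S where "S = {w. p w \<le> 0 \<and> q w \<le> r}"
 have "bounded S"
 proof -
  have "norm w \<le> K * r" if "w \<in> S" for w
  proof -
   have "norm w \<le> K * (p w + q w)" by (rule normK)
   also have "\<dots> \<le> K * r" using that K0 by (intro mult_left_mono) (auto simp: S_def)
   finally show ?thesis .
  qed
  then show ?thesis by (auto simp: bounded_iff)
 qed
 moreover have "closed S" unfolding S_def
  by (intro closed_Collect_conj closed_Collect_le contp contq continuous_on_const)
 ultimately have "compact S" by (simp add: compact_eq_bounded_closed)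
 moreover have "convex S"
 proof (rule convexI)
  fix x y and u v :: real assume xy: "x \<in> S" "y \<in> S" and uv: "0 \<le> u" "0 \<le> v" "u + v = 1"
  have "s (u *\<^sub>R x + v *\<^sub>R y) \<le> u * s x + v * s y" if "seminorm s" for s
   using seminorm_add[OF that, of "u *\<^sub>R x" "v *\<^sub>R y"] uv by (simp add: seminorm_scale[OF that])
  from this[OF snp] this[OF snq] show "u *\<^sub>R x + v *\<^sub>R y \<in> S"
   using xy uv convex_bound_le[of "p x" 0 "p y" u v] convex_bound_le[of "q x" r "q y" u v]
   unfolding S_def by auto
 qed
 moreover have "S \<noteq> {}" using r0 by (auto simp: S_def seminorm_zero[OF snp] seminorm_zero[OF snq] intro!: exI[of _ 0])
 moreover have "continuous_on S Psi"
 proof (rule lipschitz_on_continuous_on, rule lipschitz_onI)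
  fix w w'
  have "norm (Psi w - Psi w') \<le> K * (p (Psi w - Psi w') + q (Psi w - Psi w'))" by (rule normK)
  also have "\<dots> \<le> K * ((e / kap) / m * q (w - w'))"
   using Psi_lip[of w w'] seminorm_diff[OF snp, of "Psi w" "Psi w'"] pPsi K0
   by (intro mult_left_mono) auto
  also have "\<dots> \<le> K * ((e / kap) / m * (K * norm (w - w')))"
   using qK K0 e0 kap m0 by (intro mult_left_mono) auto
  finally show "dist (Psi w) (Psi w') \<le> (K * ((e / kap) / m) * K) * dist w w'"
   by (simp add: dist_norm mult_ac)
 qed (use K0 e0 kap m0 in simp)
 moreover have "Psi \<in> S \<rightarrow> S"
 proof
  fix w assume w: "w \<in> S"
  have "q (Psi w) \<le> q (Psi 0) + q (Psi w - Psi 0)"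
   using seminorm_add[OF snq, of "Psi 0" "Psi w - Psi 0"] by simp
  also have "\<dots> \<le> q (Psi 0) + (e / kap) / m * q w" using Psi_lip[of w 0] by simp
  also have "\<dots> \<le> q (Psi 0) + (e / kap) / m * r"
   using w e0 kap m0 by (intro add_left_mono mult_left_mono) (auto simp: S_def)
  also have "\<dots> = r"
  proof -
   have "r * (m - e / kap) = q (Psi 0) * m" unfolding r_def using m1 by simp
   then have "q (Psi 0) = r * (m - e / kap) / m" using m0 by simp
   also have "\<dots> = r - (e / kap) / m * r" using m0 by (simp add: field_simps)
   finally show ?thesis by simp
  qed
  finally show "Psi w \<in> S" by (simp add: S_def pPsi)
 qed
 ultimately obtain w where w: "w \<in> S" "Psi w = w" using brouwer[of S Psi] by blast
 let ?z = "Bi (c - phi (gamma w))"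
 have "w - ?z = - P ?z" using w(2) unfolding Psi_def by (metis add_diff_cancel_left' diff_add_cancel minus_diff_eq)
 then have "q (w - ?z) = 0" using qP[of ?z] seminorm_minus[OF snq, of "P ?z"] by simp
 then have "q (B (w - ?z)) = 0" by (rule qB0)
 moreover have "q (B (gamma w - w)) = 0" by (rule qB0[OF gamma(2)])
 moreover have "g n (gamma w) - c = B (gamma w - w) + B (w - ?z)"
  by (simp add: linear_diff[OF linB] Bi phi_def)
 ultimately have "q (g n (gamma w) - c) = 0"
  using seminorm_add[OF snq, of "B (gamma w - w)" "B (w - ?z)"] q0[of "g n (gamma w) - c"] by simp
 then show "\<exists>y\<in>g n ` \<Gamma>. q (y - c) = 0" using gamma(1) by blast
qed

lemma cu_graph_fibre: "cu_graph {y. p (y - v) = 0}"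
 unfolding cu_graph_def
proof (intro conjI ballI allI)
 fix y z assume "y \<in> {y. p (y - v) = 0}" "z \<in> {y. p (y - v) = 0}"
 then have "p (y - z) \<le> 0"
  using seminorm_triangle[OF snp, of y z v] seminorm_commute[OF snp, of z v] by simp
 then show "kap * p (y - z) \<le> q (y - z)" using p0[of "y - z"] q0 by simp
next
 fix c
 define y where "y = v + ((c - v) - P (c - v))"
 have "y - v = (c - v) - P (c - v)" by (simp add: y_def)
 then have "p (y - v) = 0" using pP[of "c - v"] by metis
 moreover have "q (y - c) = 0"
  using qP[of "c - v"] seminorm_minus[OF snq, of "P (c - v)"] by (simp add: y_def)
 ultimately show "\<exists>y\<in>{y. p (y - v) = 0}. q (y - c) = 0" by blast
qed

lemma cu_graph_G: "cu_graph (G n ` {y. p (y - v) = 0})"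
proof (induction n)
 case (Suc n)
 have "G (Suc n) ` {y. p (y - v) = 0} = g n ` (G n ` {y. p (y - v) = 0})" by auto
 with cu_graph_image[OF Suc] show ?case by simp
qed (use cu_graph_fibre in simp)

lemma W_exists_finite:
 obtains y where "p (y - v) = 0" "q (G n y - c) = 0"
proof -
 have "\<exists>z\<in>G n ` {y. p (y - v) = 0}. q (z - c) = 0"
  using cu_graph_G[of n v] unfolding cu_graph_def by blast
 then show ?thesis using that by blast
qed

lemma compact_box: "compact {y. p (y - x) \<le> r \<and> q (y - x) \<le> r}"
proof -
 have "norm y \<le> norm x + K * (r + r)" if "p (y - x) \<le> r" "q (y - x) \<le> r" for y
 proof -
  have "norm (y - x) \<le> K * (p (y - x) + q (y - x))" by (rule normK)
  also have "\<dots> \<le> K * (r + r)" using that K0 by (intro mult_left_mono) auto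
  finally show ?thesis using norm_triangle_ineq2[of y x] by linarith
 qed
 then have "bounded {y. p (y - x) \<le> r \<and> q (y - x) \<le> r}" by (auto simp: bounded_iff)
 moreover have "closed {y. p (y - x) \<le> r \<and> q (y - x) \<le> r}"
 proof (intro closed_Collect_conj closed_Collect_le continuous_on_const)
  show "continuous_on UNIV (\<lambda>y. p (y - x))"
   by (rule continuous_on_compose2[OF contp[of UNIV]]) (auto intro!: continuous_intros)
  show "continuous_on UNIV (\<lambda>y. q (y - x))"
   by (rule continuous_on_compose2[OF contq[of UNIV]]) (auto intro!: continuous_intros)
 qed
 ultimately show ?thesis by (simp add: compact_eq_bounded_closed)
qed

text \<open>For each \<open>n\<close> a point of the fibre over \<open>v\<close> is taken whose
  \<open>n\<close>th image has the expanding coordinate of that of \<open>x\<close>. By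
  \<open>cone_bwd_iter\<close> its difference from \<open>x\<close> is in the cone at all times up
  to \<open>n\<close>, so these points stay in a compact box, and a limit point satisfies the cone
  conditions at all times.\<close>

lemma W_exists:
 obtains y where "y \<in> W x" "p (y - v) = 0"
proof -
 have "\<forall>n. \<exists>y. p (y - v) = 0 \<and> q (G n y - G n x) = 0"
  using W_exists_finite by metis
 then obtain Y where Y: "\<And>n. p (Y n - v) = 0" "\<And>n. q (G n (Y n) - G n x) = 0" by metis
 have cone: "q (G j (Y n) - G j x) \<le> kap * p (G j (Y n) - G j x)" if "j \<le> n" for j n
 proof (rule cone_bwd_iter[OF _ that])
  show "q (G n (Y n) - G n x) \<le> kap * p (G n (Y n) - G n x)" using Y(2) kap p0 by simp
 qed
 have "Y n \<in> {y. p (y - x) \<le> p (v - x) \<and> q (y - x) \<le> p (v - x)}" for n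
 proof -
  have 1: "p (Y n - x) \<le> p (v - x)" using seminorm_triangle[OF snp, of "Y n" x v] Y(1) by simp
  have "q (Y n - x) \<le> kap * p (Y n - x)" using cone[of 0 n] by simp
  also have "\<dots> \<le> p (Y n - x)" using kap p0 by (simp add: mult_left_le_one_le)
  finally show ?thesis using 1 by simp
 qed
 then obtain y r where y: "strict_mono r" "(Y \<circ> r) \<longlonglongrightarrow> y"
  using compact_box[of x "p (v - x)"] unfolding compact_def by metis
 have lim: "(\<lambda>n. f (Y (r n))) \<longlonglongrightarrow> f y" if "continuous_on UNIV f" for f :: "'a \<Rightarrow> real"
  using continuous_on_tendsto_compose[OF that y(2)] by (simp add: comp_def)
 have contp': "continuous_on UNIV (\<lambda>y. p (G j y - a))" for j a
  by (rule continuous_on_compose2[OF contp[of UNIV]]) (auto intro!: continuous_intros contG)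
 have contq': "continuous_on UNIV (\<lambda>y. q (G j y - a))" for j a
  by (rule continuous_on_compose2[OF contq[of UNIV]]) (auto intro!: continuous_intros contG)
 have "q (G j y - G j x) \<le> kap * p (G j y - G j x)" for j
 proof (rule LIMSEQ_le[OF lim[OF contq'] tendsto_mult[OF tendsto_const lim[OF contp']]])
  show "\<exists>N. \<forall>n\<ge>N. q (G j (Y (r n)) - G j x) \<le> kap * p (G j (Y (r n)) - G j x)"
  proof (intro exI[of _ j] allI impI)
   fix n assume "j \<le> n"
   then have "j \<le> r n" using seq_suble[OF y(1), of n] by simp
   then show "q (G j (Y (r n)) - G j x) \<le> kap * p (G j (Y (r n)) - G j x)" by (rule cone)
  qed
 qed
 then have "y \<in> W x" by (simp add: W_def)
 moreover have "p (y - v) = 0"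
  using lim[OF contp'[of 0 v]] Y(1) by (simp add: LIMSEQ_const_iff)
 ultimately show ?thesis by (rule that)
qed

end

section \<open>Differentiability of leaves and their tangent bundle\<close>

lemma unique_limit_point_imp_tendsto:
 fixes X :: "nat \<Rightarrow> 'a::heine_borel"
 assumes "bounded (range X)"
  and "\<And>r l. strict_mono (r :: nat \<Rightarrow> nat) \<Longrightarrow> (\<lambda>n. X (r n)) \<longlonglongrightarrow> l \<Longrightarrow> l = L"
 shows "X \<longlonglongrightarrow> L"
proof (rule ccontr)
 assume "\<not> X \<longlonglongrightarrow> L"
 then obtain e where e: "0 < e" "\<And>N. \<exists>n\<ge>N. e \<le> dist (X n) L"
  unfolding lim_sequentially by (metis not_less)
 then have "infinite {n. e \<le> dist (X n) L}" by (auto simp: infinite_nat_iff_unbounded_le)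
 then have "\<exists>r::nat \<Rightarrow> nat. strict_mono r \<and> (\<forall>n. r n \<in> {n. e \<le> dist (X n) L})"
  by (rule infinite_enumerate)
 then obtain r :: "nat \<Rightarrow> nat" where r: "strict_mono r" "\<And>n. e \<le> dist (X (r n)) L" by auto
 have "bounded (range (X \<circ> r))" by (rule bounded_subset[OF assms(1)]) auto
 then obtain l r' where l: "strict_mono r'" "((X \<circ> r) \<circ> r') \<longlonglongrightarrow> l"
  using bounded_imp_convergent_subsequence[of "X \<circ> r"] by blast
 then have l': "(\<lambda>n. X ((r \<circ> r') n)) \<longlonglongrightarrow> l" by (simp add: comp_def)
 have "l = L" using assms(2)[OF strict_mono_o[OF r(1) l(1)] l'] .
 moreover have "e \<le> dist l L"
  by (rule Lim_bounded2[OF tendsto_dist[OF l' tendsto_const]]) (use r(2) in auto)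
 ultimately show False using e(1) by simp
qed

text \<open>Leaf points and tangent vectors are characterised uniquely by closed conditions; for
  such objects continuity follows from local boundedness alone.\<close>

lemma closed_graph_imp_continuous:
 fixes f :: "'a::metric_space \<Rightarrow> 'b::heine_borel"
 assumes bd: "\<And>X x. X \<longlonglongrightarrow> x \<Longrightarrow> bounded (range (\<lambda>n. f (X n)))"
  and cl: "\<And>X x y. X \<longlonglongrightarrow> x \<Longrightarrow> (\<lambda>n. f (X n)) \<longlonglongrightarrow> y \<Longrightarrow> y = f x"
 shows "continuous_on S f"
proof -
 have "isCont f x" for x
  unfolding continuous_at_sequentially comp_def
 proof (intro allI impI)
  fix X assume X: "X \<longlonglongrightarrow> x"
  show "(\<lambda>n. f (X n)) \<longlonglongrightarrow> f x"
  proof (rule unique_limit_point_imp_tendsto[OF bd[OF X]])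
   fix r :: "nat \<Rightarrow> nat" and l assume "strict_mono r" "(\<lambda>n. f (X (r n))) \<longlonglongrightarrow> l"
   then show "l = f x" using cl[of "\<lambda>n. X (r n)" x l] LIMSEQ_subseq_LIMSEQ[OF X, of r]
    by (simp add: comp_def)
  qed
 qed
 then show ?thesis by (simp add: continuous_at_imp_continuous_on)
qed

text \<open>The increments of \<open>F - B\<close> and the derivatives \<open>DF x - B\<close> obey
  the same bound \<open>e\<close>, so that the derivatives along an orbit satisfy the cone
  conditions with the constants of \<open>F\<close>.\<close>

locale cone_diff = cone_split B P p q lam m kap e K
 for B P :: "'a::euclidean_space \<Rightarrow> 'a" and p q lam m kap e K +
 fixes F :: "'a \<Rightarrow> 'a" and DF :: "'a \<Rightarrow> 'a \<Rightarrow>\<^sub>L 'a"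
 assumes Fp: "\<And>y z. p (F y - F z - B (y - z)) \<le> e * max (p (y - z)) (q (y - z))"
  and Fq: "\<And>y z. q (F y - F z - B (y - z)) \<le> e * max (p (y - z)) (q (y - z))"
  and DFp: "\<And>x v. p (DF x v - B v) \<le> e * max (p v) (q v)"
  and DFq: "\<And>x v. q (DF x v - B v) \<le> e * max (p v) (q v)"
  and F_deriv: "\<And>x. (F has_derivative DF x) (at x)"
  and contDF: "continuous_on UNIV DF"

sublocale cone_diff \<subseteq> cone_seq B P p q lam m kap e K "\<lambda>_. F"
 by unfold_locales (auto intro: Fp Fq)

context cone_diff
begin

primrec dG :: "nat \<Rightarrow> 'a \<Rightarrow> 'a \<Rightarrow>\<^sub>L 'a" where
 "dG 0 x = id_blinfun"
| "dG (Suc n) x = DF (G n x) o\<^sub>L dG n x"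

lemma G_Suc: "G n (F x) = G (Suc n) x"
 by (induction n) auto

lemma dG_Suc: "dG (Suc n) x v = dG n (F x) (DF x v)"
 by (induction n) (auto simp: G_Suc[simplified])

lemma dG_seq: "blinfun_apply (dG n x) = seq_comp (\<lambda>n. blinfun_apply (DF (G n x))) n"
 by (induction n) auto

lemma cocycle: "cone_seq B P p q lam m kap e K (\<lambda>n. blinfun_apply (DF (G n x)))"
 by unfold_locales (simp_all add: blinfun.diff_right[symmetric] DFp DFq)

text \<open>The linear counterpart of \<open>W\<close>: by \<open>tangent_W\<close> it is the leaf
  of 0 for the derivatives along the orbit of \<open>x\<close>.\<close>

definition tangent :: "'a \<Rightarrow> 'a set" where
 "tangent x = {v. \<forall>n. q (dG n x v) \<le> kap * p (dG n x v)}"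

lemma tangent_W: "tangent x = cone_seq.W p q kap (\<lambda>n. blinfun_apply (DF (G n x))) 0"
proof -
 interpret d: cone_seq B P p q lam m kap e K "\<lambda>n. blinfun_apply (DF (G n x))" by (rule cocycle)
 show ?thesis unfolding tangent_def d.W_def by (simp add: dG_seq[symmetric])
qed

lemma tangent_growth:
 assumes "\<And>n. q (dG n x v) \<le> C * (lam + e) ^ n"
 shows "v \<in> tangent x"
proof -
 interpret d: cone_seq B P p q lam m kap e K "\<lambda>n. blinfun_apply (DF (G n x))" by (rule cocycle)
 show ?thesis unfolding tangent_W
  by (rule d.W_growth[of _ _ C]) (use assms in \<open>simp add: dG_seq[symmetric]\<close>)
qed

lemma tangent_contract: "v \<in> tangent x \<Longrightarrow> p (dG n x v) \<le> (lam + e) ^ n * p v"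
 and tangent_contract_q: "v \<in> tangent x \<Longrightarrow> q (dG n x v) \<le> (lam + e) ^ n * p v"
 and tangent_cone: "v \<in> tangent x \<Longrightarrow> q v \<le> kap * p v"
proof -
 interpret d: cone_seq B P p q lam m kap e K "\<lambda>n. blinfun_apply (DF (G n x))" by (rule cocycle)
 assume "v \<in> tangent x"
 then have v: "v \<in> d.W 0" by (simp add: tangent_W)
 show "p (dG n x v) \<le> (lam + e) ^ n * p v" using d.W_contract[OF v, of n]
  by (simp add: dG_seq[symmetric])
 show "q (dG n x v) \<le> (lam + e) ^ n * p v" using d.W_contract_q[OF v, of n]
  by (simp add: dG_seq[symmetric])
 show "q v \<le> kap * p v" using d.W_cone0[OF v] by simp
qed

text \<open>As in \<open>W_trans\<close>, sums are handled by growth rates, because the cone itself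
  is not convex.\<close>

lemma subspace_tangent: "subspace (tangent x)"
proof (rule subspaceI)
 show "0 \<in> tangent x" by (simp add: tangent_def seminorm_zero snp snq)
 show "v + w \<in> tangent x" if "v \<in> tangent x" "w \<in> tangent x" for v w
 proof (rule tangent_growth)
  fix n
  show "q (dG n x (v + w)) \<le> (p v + p w) * (lam + e) ^ n"
   using tangent_contract_q[OF that(1), of n] tangent_contract_q[OF that(2), of n]
    seminorm_add[OF snq, of "dG n x v" "dG n x w"]
   by (simp add: blinfun.add_right algebra_simps)
 qed
 show "c *\<^sub>R v \<in> tangent x" if "v \<in> tangent x" for c v
 proof -
  have "\<bar>c\<bar> * q (dG n x v) \<le> \<bar>c\<bar> * (kap * p (dG n x v))" for n
   using that by (intro mult_left_mono) (auto simp: tangent_def)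
  then show ?thesis unfolding tangent_def
   by (auto simp: blinfun.scaleR_right seminorm_scale[OF snp] seminorm_scale[OF snq] mult.left_commute)
 qed
qed

lemma ex1_tangent: "\<exists>!w. w \<in> tangent x \<and> p (w - v) = 0"
proof -
 interpret d: cone_seq B P p q lam m kap e K "\<lambda>n. blinfun_apply (DF (G n x))" by (rule cocycle)
 obtain w where "w \<in> d.W 0" "p (w - v) = 0" using d.W_exists by blast
 moreover have "w' = w" if "w' \<in> d.W 0" "p (w' - v) = 0" for w'
 proof (rule d.W_unique[OF that(1) \<open>w \<in> d.W 0\<close>])
  have "p (w' - w) \<le> 0" using seminorm_triangle[OF snp, of w' w v] that(2) \<open>p (w - v) = 0\<close>
    seminorm_commute[OF snp, of v w] by simp
  then show "p (w' - w) = 0" using p0[of "w' - w"] by linarith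
 qed
 ultimately show ?thesis unfolding tangent_W by metis
qed

text \<open>\<open>tangent x\<close> is a graph over the kernel of \<open>q\<close>; this is its
  parametrization by the contracted coordinate of \<open>v\<close>, linear by
  \<open>linear_tau\<close>.\<close>

definition tau :: "'a \<Rightarrow> 'a \<Rightarrow> 'a" where
 "tau x v = (THE w. w \<in> tangent x \<and> p (w - v) = 0)"

lemma tau: "tau x v \<in> tangent x" "p (tau x v - v) = 0"
 using theI'[OF ex1_tangent[of x v]] by (auto simp: tau_def)

lemma tau_eqI: "w \<in> tangent x \<Longrightarrow> p (w - v) = 0 \<Longrightarrow> tau x v = w"
 using ex1_tangent[of x v] tau[of x v] by blast

lemma p_tau: "p (tau x v) = p v"
 using seminorm_eq[OF snp tau(2)] .

lemma linear_tau: "linear (tau x)"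
proof (rule linearI)
 fix v w c
 show "tau x (v + w) = tau x v + tau x w"
 proof (rule tau_eqI)
  show "tau x v + tau x w \<in> tangent x" using subspace_add[OF subspace_tangent tau(1) tau(1)] .
  have "p ((tau x v - v) + (tau x w - w)) \<le> 0"
   using seminorm_add[OF snp, of "tau x v - v" "tau x w - w"] tau(2)[of x v] tau(2)[of x w] by simp
  then show "p (tau x v + tau x w - (v + w)) = 0"
   using p0[of "tau x v + tau x w - (v + w)"] by (simp add: algebra_simps)
 qed
 show "tau x (c *\<^sub>R v) = c *\<^sub>R tau x v"
 proof (rule tau_eqI)
  show "c *\<^sub>R tau x v \<in> tangent x" using subspace_scale[OF subspace_tangent tau(1)] .
  show "p (c *\<^sub>R tau x v - c *\<^sub>R v) = 0"
   using seminorm_scale[OF snp, of c "tau x v - v"] tau(2)[of x v]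
   by (simp add: scaleR_diff_right)
 qed
qed

lemma norm_tau: "norm (tau x v) \<le> 2 * K * K * norm v"
proof -
 have "q (tau x v) \<le> kap * p (tau x v)" by (rule tangent_cone[OF tau(1)])
 also have "\<dots> \<le> p (tau x v)" using kap p0 by (simp add: mult_left_le_one_le)
 finally have "norm (tau x v) \<le> K * (p v + p v)"
  using normK[of "tau x v"] p_tau[of x v] K0 by (smt (verit) mult_left_mono)
 also have "\<dots> \<le> K * (K * norm v + K * norm v)"
  using pK[of v] K0 by (intro mult_left_mono) auto
 finally show ?thesis by (simp add: algebra_simps)
qed

lemma cont_dG: "continuous_on S (dG n)"
proof (induction n)
 case (Suc n)
 have "continuous_on S (\<lambda>x. DF (G n x))"
  by (rule continuous_on_compose2[OF contDF contG]) auto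
 with Suc show ?case by (auto intro!: continuous_intros)
qed (simp add: continuous_on_const)

lemma G_deriv: "(G n has_derivative dG n x) (at x)"
proof (induction n)
 case 0
 then show ?case by (simp add: id_blinfun.rep_eq)
next
 case (Suc n)
 have "((\<lambda>x. F (G n x)) has_derivative (\<lambda>v. DF (G n x) (dG n x v))) (at x)"
  by (rule has_derivative_compose[OF Suc F_deriv])
 then show ?case by simp
qed

text \<open>Limits of tangent vectors are tangent because every \<open>dG n\<close> is continuous
  and the cone is closed; boundedness comes from \<open>norm_tau\<close>.\<close>

lemma cont_tau: "continuous_on S (\<lambda>(x, v). tau x v)"
proof (rule closed_graph_imp_continuous)
 fix X :: "nat \<Rightarrow> 'a \<times> 'a" and a assume X: "X \<longlonglongrightarrow> a"
 obtain C where C: "\<And>n. norm (snd (X n)) \<le> C"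
 proof -
  have "Bseq (\<lambda>n. snd (X n))" by (rule convergent_imp_Bseq[OF convergentI[OF tendsto_snd[OF X]]])
  then show ?thesis using that by (auto simp: Bseq_def)
 qed
 have "norm (case X n of (x, v) \<Rightarrow> tau x v) \<le> 2 * K * K * C" for n
 proof -
  have "norm (tau (fst (X n)) (snd (X n))) \<le> 2 * K * K * norm (snd (X n))" by (rule norm_tau)
  also have "\<dots> \<le> 2 * K * K * C" using C K0 by (intro mult_left_mono) auto
  finally show ?thesis by (simp add: case_prod_beta)
 qed
 then show "bounded (range (\<lambda>n. case X n of (x, v) \<Rightarrow> tau x v))"
  unfolding bounded_iff by blast
next
 fix X :: "nat \<Rightarrow> 'a \<times> 'a" and a y
 assume X: "X \<longlonglongrightarrow> a" and Y: "(\<lambda>n. case X n of (x, v) \<Rightarrow> tau x v) \<longlonglongrightarrow> y"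
 define Y' where "Y' = (\<lambda>n. tau (fst (X n)) (snd (X n)))"
 have Y': "Y' \<longlonglongrightarrow> y" using Y by (simp add: Y'_def case_prod_beta)
 have lx: "(\<lambda>n. fst (X n)) \<longlonglongrightarrow> fst a" and lv: "(\<lambda>n. snd (X n)) \<longlonglongrightarrow> snd a"
  using X by (auto intro: tendsto_intros)
 have lim_s: "(\<lambda>n. s (Z n)) \<longlonglongrightarrow> s z" if "continuous_on UNIV s" "Z \<longlonglongrightarrow> z"
  for s :: "'a \<Rightarrow> real" and Z z
  using continuous_on_tendsto_compose[OF that] by simp
 have "y \<in> tangent (fst a)" unfolding tangent_def
 proof (intro CollectI allI)
  fix k
  have "(\<lambda>n. dG k (fst (X n))) \<longlonglongrightarrow> dG k (fst a)"
   using continuous_on_tendsto_compose[OF cont_dG[of UNIV k] lx] by simp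
  then have l: "(\<lambda>n. dG k (fst (X n)) (Y' n)) \<longlonglongrightarrow> dG k (fst a) y"
   using Y' by (rule tendsto_intros)
  show "q (dG k (fst a) y) \<le> kap * p (dG k (fst a) y)"
   by (rule LIMSEQ_le[OF lim_s[OF contq l] tendsto_mult[OF tendsto_const lim_s[OF contp l]]])
    (use tau(1) in \<open>auto simp: Y'_def tangent_def\<close>)
 qed
 moreover have "p (y - snd a) = 0"
  using lim_s[OF contp tendsto_diff[OF Y' lv]] tau(2) by (simp add: Y'_def LIMSEQ_const_iff)
 ultimately have "tau (fst a) (snd a) = y" by (rule tau_eqI)
 then show "y = (case a of (x, v) \<Rightarrow> tau x v)" by (simp add: case_prod_beta)
qed

definition tauL :: "'a \<Rightarrow> 'a \<Rightarrow>\<^sub>L 'a" where "tauL x = Blinfun (tau x)"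

lemma tauL: "blinfun_apply (tauL x) = tau x"
 unfolding tauL_def using linear_conv_bounded_linear[THEN iffD1, OF linear_tau]
 by (rule bounded_linear_Blinfun_apply)

lemma cont_tauL: "continuous_on S tauL"
proof (rule continuous_on_blinfun_componentwise)
 fix i
 have "continuous_on S ((\<lambda>(x, v). tau x v) \<circ> (\<lambda>x. (x, i)))"
  by (rule continuous_on_compose[OF _ cont_tau]) (intro continuous_intros)
 then show "continuous_on S (\<lambda>x. tauL x i)" by (simp add: tauL comp_def)
qed

lemma ex1_leaf: "\<exists>!y. y \<in> W x \<and> p (y - v) = 0"
proof -
 obtain w where w: "w \<in> W x" "p (w - v) = 0" using W_exists by blast
 moreover have "w' = w" if "w' \<in> W x" "p (w' - v) = 0" for w'
 proof (rule W_unique[OF that(1) w(1)])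
  have "p (w' - w) \<le> 0" using seminorm_triangle[OF snp, of w' w v] that(2) w(2)
    seminorm_commute[OF snp, of v w] by simp
  then show "p (w' - w) = 0" using p0[of "w' - w"] by linarith
 qed
 ultimately show ?thesis by metis
qed

text \<open>Parametrizes the leaf of \<open>x\<close> by the contracted coordinate. Only the class
  of \<open>v\<close> modulo the kernel of \<open>p\<close> matters, so the ambient space can serve
  as parameter space.\<close>

definition leaf_pt :: "'a \<Rightarrow> 'a \<Rightarrow> 'a" where
 "leaf_pt x v = (THE y. y \<in> W x \<and> p (y - v) = 0)"

lemma leaf_pt: "leaf_pt x v \<in> W x" "p (leaf_pt x v - v) = 0"
 using theI'[OF ex1_leaf[of x v]] by (auto simp: leaf_pt_def)

lemma leaf_pt_eqI: "y \<in> W x \<Longrightarrow> p (y - v) = 0 \<Longrightarrow> leaf_pt x v = y"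
 using ex1_leaf[of x v] leaf_pt[of x v] by blast

lemma leaf_pt_self: "y \<in> W x \<Longrightarrow> leaf_pt x y = y"
 by (rule leaf_pt_eqI) (simp_all add: seminorm_zero snp)

lemma p_leaf_pt: "p (leaf_pt x v - x) = p (v - x)"
proof -
 have "leaf_pt x v - x - (v - x) = leaf_pt x v - v" by simp
 then show ?thesis using seminorm_eq[OF snp, of "leaf_pt x v - x" "v - x"] leaf_pt(2)[of x v] by simp
qed

lemma q_leaf_pt: "q (leaf_pt x v - x) \<le> kap * p (v - x)"
 using W_cone0[OF leaf_pt(1), of x v] p_leaf_pt[of x v] by simp

lemma p_leaf_pt_diff: "p ((leaf_pt x v - leaf_pt x w) - (v - w)) = 0"
proof -
 have "(leaf_pt x v - leaf_pt x w) - (v - w) = (leaf_pt x v - v) - (leaf_pt x w - w)" by simp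
 then have "p ((leaf_pt x v - leaf_pt x w) - (v - w)) \<le> p (leaf_pt x v - v) + p (leaf_pt x w - w)"
  using seminorm_diff[OF snp] by metis
 then show ?thesis using p0[of "(leaf_pt x v - leaf_pt x w) - (v - w)"] leaf_pt(2) by simp
qed

lemma norm_leaf_pt: "norm (leaf_pt x v - x) \<le> 2 * K * K * norm (v - x)"
proof -
 have "kap * p (v - x) \<le> p (v - x)" using kap p0 by (simp add: mult_left_le_one_le)
 with q_leaf_pt[of x v] have "norm (leaf_pt x v - x) \<le> K * (p (v - x) + p (v - x))"
  using normK[of "leaf_pt x v - x"] p_leaf_pt[of x v] K0 by (smt (verit) mult_left_mono)
 also have "\<dots> \<le> K * (K * norm (v - x) + K * norm (v - x))"
  using pK[of "v - x"] K0 by (intro mult_left_mono) auto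
 finally show ?thesis by (simp add: algebra_simps)
qed

lemma tendsto_s:
 assumes "Z \<longlonglongrightarrow> z"
 shows "(\<lambda>n. p (Z n)) \<longlonglongrightarrow> p z" "(\<lambda>n. q (Z n)) \<longlonglongrightarrow> q z"
 using continuous_on_tendsto_compose[OF contp[of UNIV] assms]
  continuous_on_tendsto_compose[OF contq[of UNIV] assms] by auto

lemma W_closed:
 assumes "X \<longlonglongrightarrow> x" "Y \<longlonglongrightarrow> y" "\<And>n. Y n \<in> W (X n)"
 shows "y \<in> W x"
 unfolding W_def
proof (intro CollectI allI)
 fix k
 have l: "(\<lambda>n. G k (Y n) - G k (X n)) \<longlonglongrightarrow> G k y - G k x"
  using continuous_on_tendsto_compose[OF contG[of UNIV k] assms(1)]
   continuous_on_tendsto_compose[OF contG[of UNIV k] assms(2)] by (auto intro!: tendsto_diff)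
 show "q (G k y - G k x) \<le> kap * p (G k y - G k x)"
  by (rule LIMSEQ_le[OF tendsto_s(2)[OF l] tendsto_mult[OF tendsto_const tendsto_s(1)[OF l]]])
   (use W_cone[OF assms(3)] in auto)
qed

lemma cont_leaf_pt: "continuous_on S (\<lambda>(x, v). leaf_pt x v)"
proof (rule closed_graph_imp_continuous)
 fix X :: "nat \<Rightarrow> 'a \<times> 'a" and a assume X: "X \<longlonglongrightarrow> a"
 obtain C where C: "\<And>n. norm (X n) \<le> C"
 proof -
  have "Bseq X" by (rule convergent_imp_Bseq[OF convergentI[OF X]])
  then show ?thesis using that by (auto simp: Bseq_def)
 qed
 have "norm (case X n of (x, v) \<Rightarrow> leaf_pt x v) \<le> C + 2 * K * K * (C + C)" for n
 proof -
  obtain x v where xv: "X n = (x, v)" by fastforce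
  have xC: "norm x \<le> C" and vC: "norm v \<le> C"
   using C[of n] norm_fst_le[of x v] norm_snd_le[of v x] xv by auto
  have "norm (leaf_pt x v) \<le> norm x + norm (leaf_pt x v - x)"
   using norm_triangle_ineq[of x "leaf_pt x v - x"] by simp
  also have "\<dots> \<le> C + 2 * K * K * norm (v - x)" using norm_leaf_pt[of x v] xC by linarith
  also have "\<dots> \<le> C + 2 * K * K * (C + C)"
   using norm_triangle_ineq4[of v x] xC vC K0 by (intro add_left_mono mult_left_mono) auto
  finally show ?thesis by (simp add: xv)
 qed
 then show "bounded (range (\<lambda>n. case X n of (x, v) \<Rightarrow> leaf_pt x v))"
  unfolding bounded_iff by blast
next
 fix X :: "nat \<Rightarrow> 'a \<times> 'a" and a y
 assume X: "X \<longlonglongrightarrow> a" and Y: "(\<lambda>n. case X n of (x, v) \<Rightarrow> leaf_pt x v) \<longlonglongrightarrow> y"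
 have Y': "(\<lambda>n. leaf_pt (fst (X n)) (snd (X n))) \<longlonglongrightarrow> y" using Y by (simp add: case_prod_beta)
 have lx: "(\<lambda>n. fst (X n)) \<longlonglongrightarrow> fst a" and lv: "(\<lambda>n. snd (X n)) \<longlonglongrightarrow> snd a"
  using X by (auto intro: tendsto_intros)
 have "y \<in> W (fst a)" by (rule W_closed[OF lx Y' leaf_pt(1)])
 moreover have "p (y - snd a) = 0"
  using tendsto_s(1)[OF tendsto_diff[OF Y' lv]] leaf_pt(2) by (simp add: LIMSEQ_const_iff)
 ultimately have "leaf_pt (fst a) (snd a) = y" by (rule leaf_pt_eqI)
 then show "y = (case a of (x, v) \<Rightarrow> leaf_pt x v)" by (simp add: case_prod_beta)
qed

lemma cont_leaf_pt1: "continuous_on S (leaf_pt x)"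
proof -
 have "continuous_on S ((\<lambda>(x, v). leaf_pt x v) \<circ> (\<lambda>v. (x, v)))"
  by (rule continuous_on_compose[OF _ cont_leaf_pt]) (intro continuous_intros)
 then show ?thesis by (simp add: comp_def)
qed

text \<open>Strict differentiability, from the continuity of the derivative: in
  \<open>blow_up\<close> both points move.\<close>

lemma G_strict_deriv:
 assumes "0 < eps"
 obtains d where "0 < d"
  "\<And>y z. y \<in> ball x d \<Longrightarrow> z \<in> ball x d \<Longrightarrow> norm (G n y - G n z - dG n x (y - z)) \<le> eps * norm (y - z)"
proof -
 obtain d where d: "0 < d" "\<And>y. dist y x < d \<Longrightarrow> dist (dG n y) (dG n x) < eps"
  using cont_dG[of UNIV n] assms unfolding continuous_on_iff by (metis UNIV_I)
 have "norm (G n y - G n z - dG n x (y - z)) \<le> eps * norm (y - z)"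
  if "y \<in> ball x d" "z \<in> ball x d" for y z
 proof -
  have der: "((\<lambda>u. G n u - dG n x u) has_derivative (\<lambda>v. (dG n u - dG n x) v)) (at u within ball x d)"
   for u
   by (rule has_derivative_at_withinI) (auto intro!: derivative_eq_intros G_deriv simp: blinfun.diff_left)
  have "norm ((G n y - dG n x y) - (G n z - dG n x z)) \<le> eps * norm (y - z)"
  proof (rule differentiable_bound[OF convex_ball der _ that])
   fix u assume "u \<in> ball x d"
   then have "norm (dG n u - dG n x) < eps" using d(2)[of u] by (simp add: dist_commute dist_norm)
   then show "onorm (blinfun_apply (dG n u - dG n x)) \<le> eps" by (simp add: norm_blinfun.rep_eq)
  qed
  then show ?thesis by (simp add: blinfun.diff_right algebra_simps)
 qed
 then show ?thesis using that d(1) by blast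
qed

text \<open>Differences of points on one leaf satisfy the cone conditions at every time. After
  rescaling they converge to the vectors \<open>dG n y w\<close>, which inherit these closed
  conditions.\<close>

lemma blow_up:
 assumes Y: "Y \<longlonglongrightarrow> y" and Z: "Z \<longlonglongrightarrow> y" and W: "\<And>i. Y i \<in> W (Z i)"
  and t: "\<And>i. 0 < t i" and w: "(\<lambda>i. (Y i - Z i) /\<^sub>R t i) \<longlonglongrightarrow> w"
 shows "w \<in> tangent y"
 unfolding tangent_def
proof (intro CollectI allI)
 fix n
 let ?D = "\<lambda>i. G n (Y i) - G n (Z i)"
 have "(\<lambda>i. (?D i - dG n y (Y i - Z i)) /\<^sub>R t i) \<longlonglongrightarrow> 0"
 proof (rule LIMSEQ_I)
  fix r :: real assume r: "0 < r"
  have "Bseq (\<lambda>i. (Y i - Z i) /\<^sub>R t i)"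
   by (rule convergent_imp_Bseq[OF convergentI[OF w]])
  then obtain C where C: "0 < C" "\<And>i. norm ((Y i - Z i) /\<^sub>R t i) \<le> C" by (auto simp: Bseq_def)
  have "0 < r / (2 * C)" using r C by simp
  from G_strict_deriv[OF this, of y n]
  obtain d where d: "0 < d" "\<And>u v. u \<in> ball y d \<Longrightarrow> v \<in> ball y d \<Longrightarrow>
    norm (G n u - G n v - dG n y (u - v)) \<le> r / (2 * C) * norm (u - v)" by blast
  obtain N where N: "\<And>i. N \<le> i \<Longrightarrow> Y i \<in> ball y d \<and> Z i \<in> ball y d"
  proof -
   have "eventually (\<lambda>i. Y i \<in> ball y d \<and> Z i \<in> ball y d) sequentially"
    using d(1) Y Z by (intro eventually_conj topological_tendstoD) auto
   then show ?thesis using that unfolding eventually_sequentially by blast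
  qed
  have "norm ((?D i - dG n y (Y i - Z i)) /\<^sub>R t i - 0) < r" if "N \<le> i" for i
  proof -
   have "inverse (t i) * norm (?D i - dG n y (Y i - Z i))
     \<le> inverse (t i) * (r / (2 * C) * norm (Y i - Z i))"
    by (rule mult_left_mono[OF d(2)]) (use N[OF that] less_imp_le[OF t[of i]] in auto)
   then have "norm ((?D i - dG n y (Y i - Z i)) /\<^sub>R t i) \<le> r / (2 * C) * norm ((Y i - Z i) /\<^sub>R t i)"
    unfolding norm_scaleR abs_inverse abs_of_pos[OF t[of i]] by (simp only: mult.left_commute)
   also have "\<dots> \<le> r / (2 * C) * C"
    by (rule mult_left_mono[OF C(2)]) (use C(1) r in simp)
   also have "\<dots> < r" using C(1) r by simp
   finally show ?thesis by simp
  qed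
  then show "\<exists>N. \<forall>i\<ge>N. norm ((?D i - dG n y (Y i - Z i)) /\<^sub>R t i - 0) < r" by blast
 qed
 moreover have "(\<lambda>i. dG n y ((Y i - Z i) /\<^sub>R t i)) \<longlonglongrightarrow> dG n y w"
  using w by (intro tendsto_intros)
 ultimately have "(\<lambda>i. (?D i - dG n y (Y i - Z i)) /\<^sub>R t i + dG n y ((Y i - Z i) /\<^sub>R t i)) \<longlonglongrightarrow> 0 + dG n y w"
  by (rule tendsto_add)
 moreover have "(?D i - dG n y (Y i - Z i)) /\<^sub>R t i + dG n y ((Y i - Z i) /\<^sub>R t i) = ?D i /\<^sub>R t i" for i
  unfolding blinfun.scaleR_right by (simp only: scaleR_diff_right diff_add_cancel)
 ultimately have l: "(\<lambda>i. ?D i /\<^sub>R t i) \<longlonglongrightarrow> dG n y w" by simp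
 show "q (dG n y w) \<le> kap * p (dG n y w)"
 proof (rule LIMSEQ_le[OF tendsto_s(2)[OF l] tendsto_mult[OF tendsto_const tendsto_s(1)[OF l]]])
  have "q (?D i /\<^sub>R t i) \<le> kap * p (?D i /\<^sub>R t i)" for i
  proof -
   have "inverse (t i) * q (?D i) \<le> inverse (t i) * (kap * p (?D i))"
    by (rule mult_left_mono[OF W_cone[OF W]]) (use less_imp_le[OF t[of i]] in simp)
   then show ?thesis
    unfolding seminorm_scale[OF snp] seminorm_scale[OF snq] abs_inverse abs_of_pos[OF t[of i]]
    by (simp only: mult.left_commute)
  qed
  then show "\<exists>N. \<forall>i\<ge>N. q (?D i /\<^sub>R t i) \<le> kap * p (?D i /\<^sub>R t i)" by blast
 qed
qed

text \<open>The rescaled remainder is bounded, so it suffices that its limit points vanish. On a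
  subsequence along which the unit directions of \<open>V i - v\<close> converge to some
  \<open>u\<close>, the difference quotients of the leaf converge to a tangent vector with the
  contracted coordinate of \<open>u\<close>, and the only such vector is
  \<open>tau ?y u\<close>.\<close>

lemma leaf_pt_deriv: "(leaf_pt x has_derivative tau (leaf_pt x v)) (at v)"
proof -
 let ?y = "leaf_pt x v"
 let ?R = "\<lambda>v'. (leaf_pt x v' - ?y - tau ?y (v' - v)) /\<^sub>R norm (v' - v)"
 have bl: "bounded_linear (tau ?y)" using linear_tau linear_conv_bounded_linear by blast
 have "((\<lambda>v'. norm (leaf_pt x v' - ?y - tau ?y (v' - v)) / norm (v' - v)) \<longlongrightarrow> 0) (at v)"
  unfolding tendsto_at_iff_sequentially comp_def
 proof (intro allI impI)
  fix V :: "nat \<Rightarrow> 'a" assume "\<forall>i. V i \<in> UNIV - {v}" and V: "V \<longlonglongrightarrow> v"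
  then have t: "0 < norm (V i - v)" for i by auto
  have ly: "leaf_pt x (V i) - ?y \<in> {d. norm d \<le> 2 * K * K * norm (V i - v)}" for i
  proof -
   have "leaf_pt x (V i) \<in> W ?y" using W_trans[OF W_sym[OF leaf_pt(1)] leaf_pt(1)] .
   then have eq: "leaf_pt ?y (V i - v + ?y) = leaf_pt x (V i)"
   proof (rule leaf_pt_eqI)
    have "leaf_pt x (V i) - (V i - v + ?y) = (leaf_pt x (V i) - ?y) - (V i - v)" by simp
    then show "p (leaf_pt x (V i) - (V i - v + ?y)) = 0" using p_leaf_pt_diff by metis
   qed
   show ?thesis using norm_leaf_pt[of ?y "V i - v + ?y"] unfolding eq by simp
  qed
  have "(\<lambda>i. ?R (V i)) \<longlonglongrightarrow> 0"
  proof (rule unique_limit_point_imp_tendsto)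
   have "norm (?R (V i)) \<le> 2 * K * K + 2 * K * K" for i
   proof -
    have "norm (leaf_pt x (V i) - ?y - tau ?y (V i - v)) \<le> (2 * K * K + 2 * K * K) * norm (V i - v)"
     using ly[of i] norm_tau[of ?y "V i - v"]
      norm_triangle_ineq4[of "leaf_pt x (V i) - ?y" "tau ?y (V i - v)"]
     by (simp add: algebra_simps)
    moreover have "norm (?R (V i)) = norm (leaf_pt x (V i) - ?y - tau ?y (V i - v)) / norm (V i - v)"
     unfolding norm_scaleR by (simp add: divide_inverse mult.commute)
    ultimately show ?thesis using t[of i] by (simp only: pos_divide_le_eq)
   qed
   then show "bounded (range (\<lambda>i. ?R (V i)))" unfolding bounded_iff by blast
  next
   fix r :: "nat \<Rightarrow> nat" and l assume r: "strict_mono r" and l: "(\<lambda>i. ?R (V (r i))) \<longlonglongrightarrow> l"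
   define U where "U = (\<lambda>i. (V (r i) - v) /\<^sub>R norm (V (r i) - v))"
   have "norm (U i) = 1" for i using t[of "r i"] by (simp add: U_def)
   then have "bounded (range U)" unfolding bounded_iff by (metis order_refl rangeE)
   then obtain u s where s: "strict_mono s" "(U \<circ> s) \<longlonglongrightarrow> u"
    using bounded_imp_convergent_subsequence by blast
   define V' where "V' = (\<lambda>i. V (r (s i)))"
   have V': "V' \<longlonglongrightarrow> v"
    using LIMSEQ_subseq_LIMSEQ[OF V strict_mono_o[OF r s(1)]] by (simp add: V'_def comp_def)
   have u: "(\<lambda>i. (V' i - v) /\<^sub>R norm (V' i - v)) \<longlonglongrightarrow> u"
    using s(2) by (simp add: V'_def U_def comp_def)
   have l': "(\<lambda>i. ?R (V' i)) \<longlonglongrightarrow> l"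
    using LIMSEQ_subseq_LIMSEQ[OF l s(1)] by (simp add: V'_def comp_def)
   have tu: "(\<lambda>i. tau ?y ((V' i - v) /\<^sub>R norm (V' i - v))) \<longlonglongrightarrow> tau ?y u"
    by (rule bounded_linear.tendsto[OF bl u])
   have "?R (V' i) + tau ?y ((V' i - v) /\<^sub>R norm (V' i - v)) = (leaf_pt x (V' i) - ?y) /\<^sub>R norm (V' i - v)" for i
    unfolding linear_scale[OF linear_tau] by (simp only: scaleR_diff_right diff_add_cancel)
   with tendsto_add[OF l' tu]
   have w: "(\<lambda>i. (leaf_pt x (V' i) - ?y) /\<^sub>R norm (V' i - v)) \<longlonglongrightarrow> l + tau ?y u"
    by (simp only:)
   have cl: "(\<lambda>i. leaf_pt x (V' i)) \<longlonglongrightarrow> ?y"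
    by (rule continuous_on_tendsto_compose[OF cont_leaf_pt1[of UNIV x] V']) auto
   have "leaf_pt x (V' i) \<in> W ?y" for i using W_trans[OF W_sym[OF leaf_pt(1)] leaf_pt(1)] .
   moreover have "0 < norm (V' i - v)" for i unfolding V'_def by (rule t)
   ultimately have "l + tau ?y u \<in> tangent ?y" by (rule blow_up[OF cl tendsto_const _ _ w])
   moreover have "p (l + tau ?y u - u) = 0"
   proof -
    have "p ((leaf_pt x (V' i) - ?y) /\<^sub>R norm (V' i - v) - (V' i - v) /\<^sub>R norm (V' i - v)) = 0" for i
     unfolding scaleR_diff_right[symmetric] seminorm_scale[OF snp] p_leaf_pt_diff by (rule mult_zero_right)
    then have "(\<lambda>i. 0) \<longlonglongrightarrow> p (l + tau ?y u - u)"
     using tendsto_s(1)[OF tendsto_diff[OF w u]] by (simp only:)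
    then show ?thesis using LIMSEQ_unique[OF tendsto_const] by metis
   qed
   ultimately have "tau ?y u = l + tau ?y u" by (rule tau_eqI)
   then show "l = 0" by simp
  qed
  moreover have "norm (?R (V i)) = norm (leaf_pt x (V i) - ?y - tau ?y (V i - v)) / norm (V i - v)" for i
   unfolding norm_scaleR by (simp add: divide_inverse mult.commute)
  ultimately show "(\<lambda>i. norm (leaf_pt x (V i) - ?y - tau ?y (V i - v)) / norm (V i - v)) \<longlonglongrightarrow> 0"
   using tendsto_norm_zero by fastforce
 qed
 then show ?thesis unfolding has_derivative_iff_norm using bl by blast
qed

lemma tangent_forward: "v \<in> tangent x \<Longrightarrow> DF x v \<in> tangent (F x)"
 unfolding tangent_def mem_Collect_eq dG_Suc[symmetric] by blast

lemma tangent_backward: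
 assumes "DF x v \<in> tangent (F x)"
 shows "v \<in> tangent x"
 unfolding tangent_def
proof (intro CollectI allI)
 interpret d: cone_seq B P p q lam m kap e K "\<lambda>n. blinfun_apply (DF (G n x))" by (rule cocycle)
 fix n
 have *: "q (dG (Suc n) x v) \<le> kap * p (dG (Suc n) x v)" for n
  using assms unfolding dG_Suc by (simp add: tangent_def)
 show "q (dG n x v) \<le> kap * p (dG n x v)"
  using d.cone_bwd_iter[of "Suc n" v 0 n] *[of n] by (simp add: dG_seq[symmetric] del: seq_comp.simps dG.simps)
qed

lemma W_forward: "y \<in> W x \<Longrightarrow> F y \<in> W (F x)"
 unfolding W_def mem_Collect_eq G_Suc by blast

lemma W_backward:
 assumes "F y \<in> W (F x)"
 shows "y \<in> W x"
 unfolding W_def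
proof (intro CollectI allI)
 fix n
 have "q (G (Suc n) y - G (Suc n) x) \<le> kap * p (G (Suc n) y - G (Suc n) x)"
  using W_cone[OF assms, of n] by (simp add: G_Suc del: seq_comp.simps)
 from cone_bwd_iter[OF this, of n] show "q (G n y - G n x) \<le> kap * p (G n y - G n x)" by simp
qed

text \<open>Under \<open>G n\<close> the velocity is of order \<open>(lam + e) ^ n\<close>,
  uniformly along the curve, hence so is the distance of the images of its end points, and
  \<open>W_growth\<close> applies. This is how leaves of an arbitrary tangent foliation are
  recognised.\<close>

lemma tangent_curve_in_W:
 fixes gamma gamma' :: "real \<Rightarrow> 'a"
 assumes der: "\<And>t. t \<in> {0..1} \<Longrightarrow> (gamma has_vector_derivative gamma' t) (at t within {0..1})"
  and tan: "\<And>t. t \<in> {0..1} \<Longrightarrow> gamma' t \<in> tangent (gamma t)"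
  and bd: "\<And>t. t \<in> {0..1} \<Longrightarrow> norm (gamma' t) \<le> C"
 shows "gamma 1 \<in> W (gamma 0)"
proof (rule W_growth)
 fix n
 let ?b = "K * (2 * ((lam + e) ^ n * (K * C)))"
 have "norm (G n (gamma 1) - G n (gamma 0)) \<le> ?b * norm (1 - 0 :: real)"
 proof (rule differentiable_bound[of "{0..1::real}" "\<lambda>t. G n (gamma t)" "\<lambda>t s. dG n (gamma t) (s *\<^sub>R gamma' t)"])
  show "((\<lambda>t. G n (gamma t)) has_derivative (\<lambda>s. dG n (gamma t) (s *\<^sub>R gamma' t))) (at t within {0..1})"
   if "t \<in> {0..1}" for t
   using has_derivative_compose[OF der[OF that, unfolded has_vector_derivative_def] G_deriv] .
  show "onorm (\<lambda>s. dG n (gamma t) (s *\<^sub>R gamma' t)) \<le> ?b" if "t \<in> {0..1}" for t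
  proof (rule onorm_le)
   fix s :: real
   have "p (dG n (gamma t) (gamma' t)) \<le> (lam + e) ^ n * p (gamma' t)"
    and "q (dG n (gamma t) (gamma' t)) \<le> (lam + e) ^ n * p (gamma' t)"
    using tangent_contract tangent_contract_q tan[OF that] by auto
   moreover have "(lam + e) ^ n * p (gamma' t) \<le> (lam + e) ^ n * (K * C)"
   proof (rule mult_left_mono)
    show "p (gamma' t) \<le> K * C"
     using pK[of "gamma' t"] mult_left_mono[OF bd[OF that], of K] K0 by linarith
   qed (use lam0 e0 in simp)
   ultimately have "K * (p (dG n (gamma t) (gamma' t)) + q (dG n (gamma t) (gamma' t))) \<le> ?b"
    using K0 by (intro mult_left_mono) auto
   then have "norm (dG n (gamma t) (gamma' t)) \<le> ?b" using normK[of "dG n (gamma t) (gamma' t)"] by linarith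
   then show "norm (dG n (gamma t) (s *\<^sub>R gamma' t)) \<le> ?b * norm s"
    by (simp add: blinfun.scaleR_right mult.commute mult_left_mono)
  qed
 qed auto
 then have "K * norm (G n (gamma 1) - G n (gamma 0)) \<le> K * ?b"
  using K0 by (intro mult_left_mono) auto
 then have "q (G n (gamma 1) - G n (gamma 0)) \<le> K * ?b"
  using qK[of "G n (gamma 1) - G n (gamma 0)"] by linarith
 then show "q (G n (gamma 1) - G n (gamma 0)) \<le> (2 * K * K * K * C) * (lam + e) ^ n"
  by (simp add: mult_ac)
qed

lemma tangent_eq_image: "tangent x = tau x ` {v. q v = 0}"
proof
 show "tau x ` {v. q v = 0} \<subseteq> tangent x" using tau by auto
 show "tangent x \<subseteq> tau x ` {v. q v = 0}"
 proof
  fix w assume w: "w \<in> tangent x"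
  have "tau x (P w) = w"
   by (rule tau_eqI[OF w pP])
  then show "w \<in> tau x ` {v. q v = 0}" by (intro image_eqI[of _ _ "P w"]) (simp_all add: qP)
 qed
qed

lemma tau_inj: "q v = 0 \<Longrightarrow> q w = 0 \<Longrightarrow> tau x v = tau x w \<Longrightarrow> v = w"
proof -
 assume qv: "q v = 0" "q w = 0" and eq: "tau x v = tau x w"
 have "p (v - w) = 0" using p_tau[of x "v - w"] eq
  by (simp add: linear_diff[OF linear_tau] seminorm_zero[OF snp])
 moreover have "q (v - w) = 0" using seminorm_diff[OF snq, of v w] qv q0[of "v - w"] by simp
 ultimately show "v = w" using p_zero_q_zero[of "v - w"] by simp
qed

lemma subspace_qzero: "subspace {v. q v = 0}"
proof (rule subspaceI)
 show "0 \<in> {v. q v = 0}" by (simp add: seminorm_zero snq)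
 fix v w c assume "v \<in> {v. q v = 0}"
 then show "c *\<^sub>R v \<in> {v. q v = 0}" by (simp add: seminorm_scale snq)
 assume "w \<in> {v. q v = 0}"
 with \<open>v \<in> _\<close> show "v + w \<in> {v. q v = 0}"
  using seminorm_add[OF snq, of v w] q0[of "v + w"] by simp
qed

lemma dim_tangent: "dim (tangent x) = dim {v. q v = 0}"
 unfolding tangent_eq_image
proof (rule dim_image_eq[OF linear_tau])
 show "inj_on (tau x) (span {v. q v = 0})"
  unfolding span_eq_iff[THEN iffD2, OF subspace_qzero] using tau_inj by (auto intro: inj_onI)
qed

end

section \<open>Perturbations of a linear map with three invariant spaces\<close>

text \<open>\<open>ns\<close>, \<open>nc\<close>, \<open>nu\<close> measure the stable, centre and
  unstable component in norms adapted to \<open>A\<close>: a single step contracts, and the centre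
  is moved isometrically, as is possible for a plane on which \<open>A\<close> is conjugate to a
  rotation.\<close>

locale adapted =
 fixes A Ai Ps Pc Pu :: "'a::euclidean_space \<Rightarrow> 'a" and ns nc nu :: "'a \<Rightarrow> real" and lam K :: real
 assumes linA: "linear A" and linAi: "linear Ai" and A_Ai: "\<And>v. A (Ai v) = v" and Ai_A: "\<And>v. Ai (A v) = v"
  and linPs: "linear Ps" and linPc: "linear Pc" and linPu: "linear Pu"
  and sns: "seminorm ns" and snc: "seminorm nc" and snu: "seminorm nu"
  and P_sum: "\<And>v. Ps v + Pc v + Pu v = v"
  and nsP: "\<And>v. ns (Pc v) = 0" "\<And>v. ns (Pu v) = 0"
  and ncP: "\<And>v. nc (Ps v) = 0" "\<And>v. nc (Pu v) = 0"
  and nuP: "\<And>v. nu (Ps v) = 0" "\<And>v. nu (Pc v) = 0"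
  and lam: "0 < lam" "lam < 1" and K0: "0 < K"
  and nsA: "\<And>v. ns (A v) \<le> lam * ns v" and ncA: "\<And>v. nc (A v) = nc v"
  and nuAi: "\<And>v. nu (Ai v) \<le> lam * nu v"
  and nuA0: "\<And>v. nu v = 0 \<Longrightarrow> nu (A v) = 0" and nsAi0: "\<And>v. ns v = 0 \<Longrightarrow> ns (Ai v) = 0"
  and normK: "\<And>v. norm v \<le> K * (ns v + nc v + nu v)"
  and nsK: "\<And>v. ns v \<le> K * norm v" and ncK: "\<And>v. nc v \<le> K * norm v" and nuK: "\<And>v. nu v \<le> K * norm v"
begin

definition nmax :: "'a \<Rightarrow> real" where "nmax v = max (ns v) (max (nc v) (nu v))"

lemma snmax: "seminorm nmax"
 unfolding nmax_def by (intro seminorm_max sns snc snu)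

lemma n_le_nmax: "ns v \<le> nmax v" "nc v \<le> nmax v" "nu v \<le> nmax v"
 by (auto simp: nmax_def)

lemma n_nonneg: "0 \<le> ns v" "0 \<le> nc v" "0 \<le> nu v" "0 \<le> nmax v"
 using sns snc snu snmax seminorm_nonneg by auto

lemma norm_le_nmax: "norm v \<le> 3 * K * nmax v"
proof -
 have "K * (ns v + nc v + nu v) \<le> K * (nmax v + nmax v + nmax v)"
  using n_le_nmax[of v] K0 by (intro mult_left_mono) auto
 then show ?thesis using normK[of v] by simp
qed

lemma nmax_le_norm: "nmax v \<le> K * norm v"
 using nsK[of v] ncK[of v] nuK[of v] by (simp add: nmax_def)

lemma nuA: "nu v \<le> lam * nu (A v)"
 using nuAi[of "A v"] Ai_A[of v] by simp

lemma Ps_zero: "ns v = 0 \<Longrightarrow> Ps v = 0" and Pu_zero: "nu v = 0 \<Longrightarrow> Pu v = 0"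
 and nsPs: "ns (Ps v) = ns v" and nuPu: "nu (Pu v) = nu v" and ncPc: "nc (Pc v) = nc v"
proof -
 have s: "ns (Ps v) = ns v" for v
 proof (rule seminorm_eq[OF sns])
  have "Ps v - v = - (Pc v + Pu v)" using P_sum[of v] by (simp add: algebra_simps)
  then have "ns (Ps v - v) \<le> ns (Pc v) + ns (Pu v)"
   using seminorm_minus[OF sns] seminorm_add[OF sns] by metis
  then show "ns (Ps v - v) = 0" using nsP n_nonneg(1)[of "Ps v - v"] by simp
 qed
 have u: "nu (Pu v) = nu v" for v
 proof (rule seminorm_eq[OF snu])
  have "Pu v - v = - (Ps v + Pc v)" using P_sum[of v] by (simp add: algebra_simps)
  then have "nu (Pu v - v) \<le> nu (Ps v) + nu (Pc v)"
   using seminorm_minus[OF snu] seminorm_add[OF snu] by metis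
  then show "nu (Pu v - v) = 0" using nuP n_nonneg(3)[of "Pu v - v"] by simp
 qed
 show "ns (Ps v) = ns v" "nu (Pu v) = nu v" using s u by auto
 show "nc (Pc v) = nc v"
 proof (rule seminorm_eq[OF snc])
  have "Pc v - v = - (Ps v + Pu v)" using P_sum[of v] by (simp add: algebra_simps)
  then have "nc (Pc v - v) \<le> nc (Ps v) + nc (Pu v)"
   using seminorm_minus[OF snc] seminorm_add[OF snc] by metis
  then show "nc (Pc v - v) = 0" using ncP n_nonneg(2)[of "Pc v - v"] by simp
 qed
 show "Ps v = 0" if "ns v = 0" using normK[of "Ps v"] s[of v] that ncP nuP by simp
 show "Pu v = 0" if "nu v = 0" using normK[of "Pu v"] u[of v] that ncP nsP by simp
qed

lemma max_eq_0: "max (nc v) (nu v) = 0 \<longleftrightarrow> nc v = 0 \<and> nu v = 0"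
 using n_nonneg(2,3)[of v] by linarith

lemma nzero_imp_zero: "ns v = 0 \<Longrightarrow> nc v = 0 \<Longrightarrow> nu v = 0 \<Longrightarrow> v = 0"
 using normK[of v] by simp

text \<open>Through this reversal of time, every statement on stable leaves has an unstable twin
  without a second proof.\<close>

lemma swap: "adapted Ai A Pu Pc Ps nu nc ns lam K"
proof unfold_locales
 fix v
 show "nc (Ai v) = nc v" using ncA[of "Ai v"] by (simp add: A_Ai)
 show "Pu v + Pc v + Ps v = v" using P_sum[of v] by (simp add: add_ac)
 show "norm v \<le> K * (nu v + nc v + ns v)" using normK[of v] by (simp add: add_ac)
qed (rule A_Ai Ai_A sns snc snu nsP ncP nuP lam K0 nsA nuAi nsK ncK nuK
  linear_add[OF linA] linear_add[OF linAi] linear_add[OF linPs] linear_add[OF linPc] linear_add[OF linPu]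
  linear_scale[OF linA] linear_scale[OF linAi] linear_scale[OF linPs] linear_scale[OF linPc]
  linear_scale[OF linPu] | erule nuA0 nsAi0)+

end

text \<open>\<open>kap \<le> 1/2\<close> keeps complementary thin cones apart, see
  \<open>kap_trap\<close>. \<open>gap1\<close> is the cone condition for stable against
  centre-unstable, \<open>gap2\<close> the one for centre-stable against unstable.\<close>

locale pert = adapted A Ai Ps Pc Pu ns nc nu lam K
 for A Ai Ps Pc Pu :: "'a::euclidean_space \<Rightarrow> 'a" and ns nc nu lam K +
 fixes F :: "'a \<Rightarrow> 'a" and DF :: "'a \<Rightarrow> 'a \<Rightarrow>\<^sub>L 'a" and e kap :: real
 assumes F_lip: "\<And>y z. nmax (F y - F z - A (y - z)) \<le> e * nmax (y - z)"
  and DF_close: "\<And>x v. nmax (DF x v - A v) \<le> e * nmax v"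
  and F_close: "\<And>x. nmax (F x - A x) \<le> e"
  and F_deriv: "\<And>x. (F has_derivative DF x) (at x)"
  and contDF: "continuous_on UNIV DF"
  and kap: "0 < kap" "kap \<le> 1/2" and e0: "0 \<le> e"
  and gap1: "lam + e < 1 - e / kap" and gap2: "1 + e < 1 / lam - e / kap"

sublocale pert \<subseteq> s: cone_diff A Ps ns "\<lambda>v. max (nc v) (nu v)" lam 1 kap e "2 * K" F DF
proof unfold_locales
 fix v :: 'a
 have Kn: "K * norm v \<le> 2 * K * norm v" using K0 by simp
 show "ns (v - Ps v) = 0"
 proof -
  have "v - Ps v = Pc v + Pu v" using P_sum[of v] by (simp add: algebra_simps)
  then have "ns (v - Ps v) \<le> ns (Pc v) + ns (Pu v)" using seminorm_add[OF sns] by metis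
  then show ?thesis using nsP n_nonneg(1)[of "v - Ps v"] by simp
 qed
 show "max (nc (Ps v)) (nu (Ps v)) = 0" using ncP nuP by simp
 have "nu v \<le> nu (A v)"
  using nuA[of v] mult_left_le_one_le[of "nu (A v)" lam] lam n_nonneg(3)[of "A v"] by linarith
 then show "1 * max (nc v) (nu v) \<le> max (nc (A v)) (nu (A v))" using ncA[of v] by simp
 show "max (nc (A v)) (nu (A v)) = 0" if "max (nc v) (nu v) = 0"
  using that ncA[of v] nuA0[of v] n_nonneg(2,3)[of v] by (simp add: max_def split: if_splits)
 have "K * (ns v + nc v + nu v) \<le> K * (2 * (ns v + max (nc v) (nu v)))"
  using K0 n_nonneg[of v] by (intro mult_left_mono) auto
 then show "norm v \<le> 2 * K * (ns v + max (nc v) (nu v))"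
  using normK[of v] by (simp only: mult.assoc mult.left_commute[of K 2])
 show "ns v \<le> 2 * K * norm v" using nsK[of v] Kn by linarith
 show "max (nc v) (nu v) \<le> 2 * K * norm v" using ncK[of v] nuK[of v] Kn by linarith
next
 show "surj A" using A_Ai by (metis surjI)
next
 fix y z
 show "ns (F y - F z - A (y - z)) \<le> e * max (ns (y - z)) (max (nc (y - z)) (nu (y - z)))"
  using F_lip[of y z] n_le_nmax(1)[of "F y - F z - A (y - z)"] by (simp add: nmax_def)
 show "max (nc (F y - F z - A (y - z))) (nu (F y - F z - A (y - z)))
   \<le> e * max (ns (y - z)) (max (nc (y - z)) (nu (y - z)))"
  using F_lip[of y z] by (simp add: nmax_def)
next
 fix x v
 show "ns (DF x v - A v) \<le> e * max (ns v) (max (nc v) (nu v))"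
  using DF_close[of x v] by (simp add: nmax_def)
 show "max (nc (DF x v - A v)) (nu (DF x v - A v)) \<le> e * max (ns v) (max (nc v) (nu v))"
  using DF_close[of x v] by (simp add: nmax_def)
qed (use linA linPs sns seminorm_max[OF snc snu] nsA kap lam e0 K0 gap1 F_deriv contDF in \<open>auto simp: linear_add linear_scale\<close>)

sublocale pert \<subseteq> cs: cone_diff A "\<lambda>v. Ps v + Pc v" "\<lambda>v. max (ns v) (nc v)" nu 1 "1 / lam" kap e "2 * K" F DF
proof unfold_locales
 fix v :: 'a
 have Kn: "K * norm v \<le> 2 * K * norm v" using K0 by simp
 show "max (ns (v - (Ps v + Pc v))) (nc (v - (Ps v + Pc v))) = 0"
 proof -
  have "v - (Ps v + Pc v) = Pu v" using P_sum[of v] by (simp add: algebra_simps)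
  then show ?thesis using nsP ncP by simp
 qed
 show "nu (Ps v + Pc v) = 0"
  using seminorm_add[OF snu, of "Ps v" "Pc v"] nuP n_nonneg(3)[of "Ps v + Pc v"] by simp
 have "ns (A v) \<le> ns v"
  using nsA[of v] mult_left_le_one_le[of "ns v" lam] lam n_nonneg(1)[of v] by linarith
 then show "max (ns (A v)) (nc (A v)) \<le> 1 * max (ns v) (nc v)" using ncA[of v] by auto
 show "1 / lam * nu v \<le> nu (A v)" using nuA[of v] lam by (simp add: field_simps)
 show "nu (A v) = 0" if "nu v = 0" by (rule nuA0[OF that])
 have "K * (ns v + nc v + nu v) \<le> K * (2 * (max (ns v) (nc v) + nu v))"
  using K0 n_nonneg[of v] by (intro mult_left_mono) auto
 then show "norm v \<le> 2 * K * (max (ns v) (nc v) + nu v)"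
  using normK[of v] by (simp only: mult.assoc mult.left_commute[of K 2])
 show "nu v \<le> 2 * K * norm v" using nuK[of v] Kn by linarith
 show "max (ns v) (nc v) \<le> 2 * K * norm v" using ncK[of v] nsK[of v] Kn by linarith
next
 fix y z
 show "nu (F y - F z - A (y - z)) \<le> e * max (max (ns (y - z)) (nc (y - z))) (nu (y - z))"
  using F_lip[of y z] by (simp add: nmax_def max.assoc)
 show "max (ns (F y - F z - A (y - z))) (nc (F y - F z - A (y - z)))
   \<le> e * max (max (ns (y - z)) (nc (y - z))) (nu (y - z))"
  using F_lip[of y z] by (simp add: nmax_def max.assoc)
next
 fix x v
 show "nu (DF x v - A v) \<le> e * max (max (ns v) (nc v)) (nu v)"
  using DF_close[of x v] by (simp add: nmax_def max.assoc)
 show "max (ns (DF x v - A v)) (nc (DF x v - A v)) \<le> e * max (max (ns v) (nc v)) (nu v)"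
  using DF_close[of x v] by (simp add: nmax_def max.assoc)
qed (use snu seminorm_max[OF sns snc] gap2 kap e0 K0 F_deriv contDF A_Ai in
  \<open>auto simp: linear_add[OF linA] linear_scale[OF linA] intro: range_eqI[where x = "Ai _"] simp: linear_add[OF linPs] linear_add[OF linPc] linear_scale[OF linPs] linear_scale[OF linPc] scaleR_add_right\<close>)

context pert
begin

text \<open>The displacement from \<open>A\<close> is bounded, so a long leaf stays close to the stable space.\<close>

lemma drift:
 assumes y: "y \<in> s.W x" and n: "(lam + e) ^ n * ns (y - x) \<le> 1"
 shows "nc (y - x) \<le> 1 + 2 * e * real n" and "nu (y - x) \<le> 1 + 2 * e / (1 - lam)"
proof -
 let ?d = "\<lambda>j. s.G j y - s.G j x"
 \<comment> \<open>Replacing \<open>F\<close> by \<open>A\<close> costs at most \<open>e\<close> at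
   each of the two points, however far apart they are. Hence the centre drift is linear in the
   number of steps and does not involve the length of the leaf segment.\<close>
 have step: "t (A (?d j)) \<le> t (?d (Suc j)) + 2 * e"
  if "seminorm t" "\<And>v. t v \<le> nmax v" for t j
 proof -
  let ?a = "F (s.G j y) - A (s.G j y)" and ?b = "F (s.G j x) - A (s.G j x)"
  have eq: "A (?d j) = ?d (Suc j) - (?a - ?b)" by (simp add: linear_diff[OF linA])
  have "t (A (?d j)) \<le> t (?d (Suc j)) + t (?a - ?b)"
   unfolding eq by (rule seminorm_diff[OF that(1)])
  moreover have "t (?a - ?b) \<le> t ?a + t ?b" by (rule seminorm_diff[OF that(1)])
  moreover have "t ?a \<le> e" "t ?b \<le> e" using that(2) F_close order_trans by blast+
  ultimately show ?thesis by linarith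
 qed
 have "nc (y - x) \<le> nc (?d j) + 2 * e * real j" for j
 proof (induction j)
  case (Suc j)
  have "nc (?d j) \<le> nc (?d (Suc j)) + 2 * e" using step[OF snc n_le_nmax(2), of j] unfolding ncA .
  with Suc show ?case by (simp add: algebra_simps)
 qed simp
 note c = this[of n]
 \<comment> \<open>The sum of the errors \<open>2 * e\<close>, damped by the factor
   \<open>lam\<close> with each step backwards: it solves
   \<open>c = 2 * e + c * lam\<close>.\<close>
 define c where "c = 2 * e / (1 - lam)"
 have c2: "2 * e = c - c * lam" and c0: "0 \<le> c"
 proof -
  have "c * (1 - lam) = 2 * e" unfolding c_def using lam by simp
  then show "2 * e = c - c * lam" by (simp add: algebra_simps)
  show "0 \<le> c" unfolding c_def using lam e0 by simp
 qed
 have "nu (y - x) \<le> lam ^ j * nu (?d j) + (c - c * lam ^ j)" for j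
 proof (induction j)
  case (Suc j)
  have "nu (?d j) \<le> lam * nu (A (?d j))" by (rule nuA)
  also have "\<dots> \<le> lam * (nu (?d (Suc j)) + 2 * e)"
   using step[OF snu n_le_nmax(3), of j] lam by (intro mult_left_mono) auto
  also have "\<dots> \<le> lam * nu (?d (Suc j)) + (c - c * lam)"
   using lam e0 mult_left_le[of lam "2 * e"] unfolding c2[symmetric] by (simp add: distrib_left mult.commute)
  finally have "lam ^ j * nu (?d j) \<le> lam ^ j * (lam * nu (?d (Suc j)) + (c - c * lam))"
   using lam by (intro mult_left_mono) auto
  also have "\<dots> = lam ^ Suc j * nu (?d (Suc j)) + (c * lam ^ j - c * lam ^ Suc j)"
   by (simp add: distrib_left right_diff_distrib mult_ac)
  finally show ?case using Suc by linarith
 qed simp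
 note u = this[of n]
 have small: "max (nc (?d n)) (nu (?d n)) \<le> 1" using s.W_contract_q[OF y, of n] n by simp
 then show "nc (y - x) \<le> 1 + 2 * e * real n" using c by simp
 have "lam ^ n * nu (?d n) \<le> 1" using small lam n_nonneg(3)[of "?d n"]
  by (intro mult_le_one) (auto simp: power_le_one)
 moreover have "0 \<le> c * lam ^ n" using c0 lam by simp
 ultimately show "nu (y - x) \<le> 1 + 2 * e / (1 - lam)" using u unfolding c_def[symmetric] by linarith
qed

end

section \<open>Forward and backward map: the invariant splitting and the displacement
  estimate\<close>

locale pert_pair = fw: pert A Ai Ps Pc Pu ns nc nu lam K F DF e kap +
  bw: pert Ai A Pu Pc Ps nu nc ns lam K Fi DFi e kap
 for A Ai Ps Pc Pu :: "'a::euclidean_space \<Rightarrow> 'a" and ns nc nu lam K F DF Fi DFi e kap +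
 assumes F_Fi: "\<And>x. F (Fi x) = x" and Fi_F: "\<And>x. Fi (F x) = x"
begin

abbreviation Ws where "Ws \<equiv> fw.s.W"
abbreviation Wu where "Wu \<equiv> bw.s.W"
abbreviation Es where "Es \<equiv> fw.s.tangent"
abbreviation Eu where "Eu \<equiv> bw.s.tangent"
text \<open>Centre vectors grow slowly both forwards and backwards. Only their bundle is needed; no
  foliation is attached to it.\<close>

definition Ec where "Ec x = fw.cs.tangent x \<inter> bw.cs.tangent x"

lemma swap: "pert_pair Ai A Pu Pc Ps nu nc ns lam K Fi DFi F DF e kap"
 by unfold_locales (rule F_Fi Fi_F)+

lemma nmax_swap: "bw.nmax v = fw.nmax v"
 by (simp add: fw.nmax_def bw.nmax_def max.commute max.left_commute)

lemma DF_DFi: "DF x (DFi (F x) v) = v" and DFi_DF: "DFi (F x) (DF x v) = v"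
proof -
 have "((\<lambda>y. Fi (F y)) has_derivative (\<lambda>v. DFi (F x) (DF x v))) (at x)"
  by (rule has_derivative_compose[OF fw.F_deriv bw.F_deriv])
 then have "((\<lambda>y. y) has_derivative (\<lambda>v. DFi (F x) (DF x v))) (at x)" by (simp add: Fi_F)
 from has_derivative_unique[OF this has_derivative_ident] show "DFi (F x) (DF x v) = v"
  by (simp add: fun_eq_iff)
 have "((\<lambda>y. F (Fi y)) has_derivative (\<lambda>v. DF (Fi (F x)) (DFi (F x) v))) (at (F x))"
  by (rule has_derivative_compose[OF bw.F_deriv fw.F_deriv])
 then have "((\<lambda>y. y) has_derivative (\<lambda>v. DF x (DFi (F x) v))) (at (F x))" by (simp add: Fi_F F_Fi)
 from has_derivative_unique[OF this has_derivative_ident] show "DF x (DFi (F x) v) = v"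
  by (simp add: fun_eq_iff)
qed

lemma Es_iff: "DF x v \<in> Es (F x) \<longleftrightarrow> v \<in> Es x"
 using fw.s.tangent_forward fw.s.tangent_backward by blast

lemma Ecs_iff: "DF x v \<in> fw.cs.tangent (F x) \<longleftrightarrow> v \<in> fw.cs.tangent x"
 using fw.cs.tangent_forward fw.cs.tangent_backward by blast

lemma Eu_iff: "DF x v \<in> Eu (F x) \<longleftrightarrow> v \<in> Eu x"
 using bw.s.tangent_forward[of "DF x v" "F x"] bw.s.tangent_backward[of "F x" "DF x v"]
 by (auto simp: DFi_DF Fi_F)

lemma Ecu_iff: "DF x v \<in> bw.cs.tangent (F x) \<longleftrightarrow> v \<in> bw.cs.tangent x"
 using bw.cs.tangent_forward[of "DF x v" "F x"] bw.cs.tangent_backward[of "F x" "DF x v"]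
 by (auto simp: DFi_DF Fi_F)

lemma Ec_iff: "DF x v \<in> Ec (F x) \<longleftrightarrow> v \<in> Ec x"
 by (simp add: Ec_def Ecs_iff Ecu_iff)

lemma DF_image:
 assumes "\<And>x v. DF x v \<in> E (F x) \<longleftrightarrow> v \<in> E x"
 shows "DF x ` E x = E (F x)"
proof
 show "DF x ` E x \<subseteq> E (F x)" using assms by auto
 show "E (F x) \<subseteq> DF x ` E x"
 proof
  fix w assume "w \<in> E (F x)"
  then have "DFi (F x) w \<in> E x" using assms[of x "DFi (F x) w"] by (simp add: DF_DFi)
  then show "w \<in> DF x ` E x" by (intro image_eqI[of _ _ "DFi (F x) w"]) (simp_all add: DF_DFi)
 qed
qed

lemma kap_trap:
 assumes "a \<le> kap * b" "b \<le> kap * a" "0 \<le> a" "0 \<le> (b::real)"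
 shows "a = 0" "b = 0"
proof -
 have *: "kap * a \<le> 1/2 * a" "kap * b \<le> 1/2 * b"
  by (rule mult_right_mono[OF fw.kap(2) assms(3)], rule mult_right_mono[OF fw.kap(2) assms(4)])
 then show "a = 0" "b = 0" using assms by linarith+
qed

text \<open>Membership in either bundle is a growth condition, and the one for the centre-stable
  bundle is weaker.\<close>

lemma Es_subset_Ecs: "Es x \<subseteq> fw.cs.tangent x"
proof
 fix v assume v: "v \<in> Es x"
 show "v \<in> fw.cs.tangent x"
 proof (rule fw.cs.tangent_growth)
  fix n
  have "nu (fw.cs.dG n x v) \<le> (lam + e) ^ n * ns v"
   using fw.s.tangent_contract_q[OF v, of n] by simp
  also have "\<dots> \<le> (1 + e) ^ n * ns v"
   using fw.lam fw.e0 fw.n_nonneg by (intro mult_right_mono power_mono) auto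
  finally show "nu (fw.cs.dG n x v) \<le> ns v * (1 + e) ^ n" by (simp add: mult.commute)
 qed
qed

lemma Es_Int_Ecu: "Es x \<inter> bw.cs.tangent x = {0}"
proof -
 have "v = 0" if "v \<in> Es x" "v \<in> bw.cs.tangent x" for v
 proof -
  have 1: "max (nc v) (nu v) \<le> kap * ns v" by (rule fw.s.tangent_cone[OF that(1)])
  have 2: "ns v \<le> kap * max (nc v) (nu v)"
   using bw.cs.tangent_cone[OF that(2)] by (simp add: max.commute)
  have "ns v = 0" "max (nc v) (nu v) = 0"
   using kap_trap[OF 2 1] fw.n_nonneg[of v] by auto
  then show ?thesis using fw.n_nonneg[of v] by (intro fw.nzero_imp_zero) auto
 qed
 moreover have "0 \<in> Es x" "0 \<in> bw.cs.tangent x"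
  using subspace_0 fw.s.subspace_tangent bw.cs.subspace_tangent by blast+
 ultimately show ?thesis by blast
qed

lemma complement_sum:
 fixes S T :: "'a set"
 assumes "subspace S" "subspace T" "S \<inter> T = {0}" "dim S + dim T = DIM('a)"
 shows "{x + y | x y. x \<in> S \<and> y \<in> T} = UNIV"
proof -
 have "dim {x + y | x y. x \<in> S \<and> y \<in> T} = DIM('a)"
  using dim_sums_Int[OF assms(1,2)] assms(3,4) by simp
 then have "span {x + y | x y. x \<in> S \<and> y \<in> T} = UNIV" by (simp add: dim_eq_full)
 then show ?thesis using span_eq_iff[THEN iffD2, OF subspace_sums[OF assms(1,2)]] by simp
qed

lemma dim_complement: "dim {v. max (nc v) (nu v) = 0} + dim {v. ns v = 0} = DIM('a)"
proof -
 have i: "{v. max (nc v) (nu v) = 0} \<inter> {v. ns v = 0} = {0}"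
  unfolding fw.max_eq_0
  by (auto intro: fw.nzero_imp_zero simp: seminorm_zero[OF fw.sns] seminorm_zero[OF fw.snc] seminorm_zero[OF fw.snu])
 have "\<exists>a b. v = a + b \<and> max (nc a) (nu a) = 0 \<and> ns b = 0" for v
 proof (intro exI conjI)
  show "v = Ps v + (Pc v + Pu v)" using fw.P_sum[of v] by (simp add: algebra_simps)
  show "max (nc (Ps v)) (nu (Ps v)) = 0" using fw.ncP fw.nuP by simp
  show "ns (Pc v + Pu v) = 0"
   using seminorm_add[OF fw.sns, of "Pc v" "Pu v"] fw.nsP fw.n_nonneg(1)[of "Pc v + Pu v"] by simp
 qed
 then have "{x + y | x y. x \<in> {v. max (nc v) (nu v) = 0} \<and> y \<in> {v. ns v = 0}} = UNIV" by blast
 then show ?thesis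
  using dim_sums_Int[OF fw.s.subspace_qzero bw.cs.subspace_qzero] i by simp
qed

lemma Es_Ecu_sum: "{a + b | a b. a \<in> Es x \<and> b \<in> bw.cs.tangent x} = UNIV"
 by (rule complement_sum[OF fw.s.subspace_tangent bw.cs.subspace_tangent Es_Int_Ecu])
  (simp only: fw.s.dim_tangent bw.cs.dim_tangent dim_complement)

lemma subspace_Ec: "subspace (Ec x)"
 unfolding Ec_def by (rule subspace_inter[OF fw.cs.subspace_tangent bw.cs.subspace_tangent])

lemma dim_Es: "dim (Es x) = dim {v. nc v = 0 \<and> nu v = 0}"
 using fw.s.dim_tangent[of x] unfolding fw.max_eq_0 .

text \<open>The larger of the stable and the unstable part, if it exceeded the centre part, would be
  the largest of the three and yet at most \<open>kap \<le> 1/2\<close> times another of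
  them.\<close>

lemma Ec_cone:
 assumes "v \<in> Ec x"
 shows "ns v \<le> kap * nc v" "nu v \<le> kap * nc v"
proof -
 have 1: "nu v \<le> kap * max (ns v) (nc v)" and 2: "ns v \<le> kap * max (nu v) (nc v)"
  using fw.cs.tangent_cone bw.cs.tangent_cone assms by (auto simp: Ec_def)
 have k: "kap * a \<le> a" if "0 \<le> a" for a using fw.kap that by (simp add: mult_left_le_one_le)
 have "ns v \<le> nc v \<and> nu v \<le> nc v"
 proof (rule ccontr)
  assume *: "\<not> ?thesis"
  then have "max (nu v) (nc v) = nu v \<or> max (ns v) (nc v) = ns v" by linarith
  have h: "kap * a \<le> a / 2" if "0 \<le> a" for a using fw.kap that mult_right_mono[of kap "1/2" a] by simp
  show False using 1 2 * h[of "max (ns v) (nc v)"] h[of "max (nu v) (nc v)"] kap_trap[of "ns v" "nu v"] fw.n_nonneg[of v]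
   by (auto simp: max_def split: if_splits)
 qed
 then show "ns v \<le> kap * nc v" "nu v \<le> kap * nc v" using 1 2 by (auto simp: max_def split: if_splits)
qed

end

context pert_pair
begin

interpretation sw: pert_pair Ai A Pu Pc Ps nu nc ns lam K Fi DFi F DF e kap by (rule swap)

lemma dim_Eu: "dim (Eu x) = dim {v. nc v = 0 \<and> ns v = 0}" by (rule sw.dim_Es)

lemma Eu_Ecs_sum: "{a + b | a b. a \<in> Eu x \<and> b \<in> fw.cs.tangent x} = UNIV" by (rule sw.Es_Ecu_sum)

lemma Eu_Int_Ecs: "Eu x \<inter> fw.cs.tangent x = {0}" by (rule sw.Es_Int_Ecu)

text \<open>As \<open>Es\<close> already complements the centre-unstable bundle, the two large
  bundles span everything, and the dimension of their intersection follows from their dimensions.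
  The same count for the linear spaces gives the same number.\<close>

lemma dim_Ec: "dim (Ec x) = dim {v. ns v = 0 \<and> nu v = 0}"
proof -
 have gen: "dim (S \<inter> T) = dim S + dim T - DIM('a)"
  if "subspace S" "subspace T" "R \<subseteq> S" "{a + b | a b. a \<in> R \<and> b \<in> T} = UNIV" for R S T :: "'a set"
 proof -
  have "{a + b | a b. a \<in> R \<and> b \<in> T} \<subseteq> {a + b | a b. a \<in> S \<and> b \<in> T}" using that(3) by blast
  then have "{a + b | a b. a \<in> S \<and> b \<in> T} = UNIV" using that(4) by blast
  then show ?thesis using dim_sums_Int[OF that(1,2)] by simp
 qed
 have "dim (Ec x) = dim (fw.cs.tangent x) + dim (bw.cs.tangent x) - DIM('a)"
  unfolding Ec_def
  by (rule gen[OF fw.cs.subspace_tangent bw.cs.subspace_tangent Es_subset_Ecs Es_Ecu_sum])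
 also have "\<dots> = dim {v. nu v = 0} + dim {v. ns v = 0} - DIM('a)"
  by (simp only: fw.cs.dim_tangent bw.cs.dim_tangent)
 also have "\<dots> = dim ({v. nu v = 0} \<inter> {v. ns v = 0})"
 proof (rule gen[symmetric, OF fw.cs.subspace_qzero bw.cs.subspace_qzero])
  show "{v. max (nc v) (nu v) = 0} \<subseteq> {v. nu v = 0}"
   unfolding fw.max_eq_0 by blast
  have "\<exists>a b. v = a + b \<and> max (nc a) (nu a) = 0 \<and> ns b = 0" for v
  proof (intro exI conjI)
   show "v = Ps v + (Pc v + Pu v)" using fw.P_sum[of v] by (simp add: algebra_simps)
   show "max (nc (Ps v)) (nu (Ps v)) = 0" using fw.ncP fw.nuP by simp
   show "ns (Pc v + Pu v) = 0"
    using seminorm_add[OF fw.sns, of "Pc v" "Pu v"] fw.nsP fw.n_nonneg(1)[of "Pc v + Pu v"] by simp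
  qed
  then show "{a + b |a b. a \<in> {v. max (nc v) (nu v) = 0} \<and> b \<in> {v. ns v = 0}} = UNIV" by blast
 qed
 also have "{v. nu v = 0} \<inter> {v. ns v = 0} = {v. ns v = 0 \<and> nu v = 0}" by blast
 finally show ?thesis .
qed

lemma splitting_sum: "{a + b + c | a b c. a \<in> Es x \<and> b \<in> Ec x \<and> c \<in> Eu x} = UNIV"
proof -
 have "\<exists>a b c. v = a + b + c \<and> a \<in> Es x \<and> b \<in> Ec x \<and> c \<in> Eu x" for v
 proof -
  have "v \<in> {a + b | a b. a \<in> Eu x \<and> b \<in> fw.cs.tangent x}" unfolding Eu_Ecs_sum by simp
  then obtain c w where c: "v = c + w" "c \<in> Eu x" "w \<in> fw.cs.tangent x" by blast
  have "w \<in> {a + b | a b. a \<in> Es x \<and> b \<in> bw.cs.tangent x}" unfolding Es_Ecu_sum by simp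
  then obtain a b where a: "w = a + b" "a \<in> Es x" "b \<in> bw.cs.tangent x" by blast
  have "b = w - a" using a by simp
  then have "b \<in> fw.cs.tangent x"
   using subspace_diff[OF fw.cs.subspace_tangent c(3)] a(2) Es_subset_Ecs by blast
  then have "b \<in> Ec x" using a(3) by (simp add: Ec_def)
  moreover have "v = a + b + c" using c a by simp
  ultimately show ?thesis using a(2) c(2) by blast
 qed
 then show ?thesis by blast
qed

lemma splitting_direct:
 assumes "a \<in> Es x" "b \<in> Ec x" "c \<in> Eu x" "a + b + c = 0"
 shows "a = 0 \<and> b = 0 \<and> c = 0"
proof -
 have "a + b \<in> fw.cs.tangent x"
  using assms Es_subset_Ecs[of x] by (auto simp: Ec_def intro: subspace_add[OF fw.cs.subspace_tangent])
 moreover have "c + (a + b) = 0" using assms(4) by (simp add: add.commute)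
 then have "c = - (a + b)" by (rule eq_neg_iff_add_eq_0[THEN iffD2])
 ultimately have "c \<in> fw.cs.tangent x" using subspace_neg[OF fw.cs.subspace_tangent] by blast
 then have c0: "c = 0" using assms(3) Eu_Int_Ecs by blast
 then have "a = - b" using assms(4) by (simp add: eq_neg_iff_add_eq_0)
 then have "a \<in> bw.cs.tangent x"
  using assms(2) subspace_neg[OF bw.cs.subspace_tangent] by (auto simp: Ec_def)
 then have "a = 0" using assms(1) Es_Int_Ecu by blast
 with c0 assms(4) show ?thesis by simp
qed

abbreviation "Gf \<equiv> seq_comp (\<lambda>_::nat. F)"
abbreviation "Gb \<equiv> seq_comp (\<lambda>_::nat. Fi)"

lemma Gb_Gf: "Gb n (Gf n x) = x"
proof (induction n arbitrary: x)
 case (Suc n)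
 have "Gb (Suc n) (Gf (Suc n) x) = Gb n (Fi (F (Gf n x)))"
  using bw.s.G_Suc[of n "F (Gf n x)"] by simp
 then show ?case using Suc by (simp add: Fi_F)
qed simp

lemma Gf_Gb: "Gf n (Gb n x) = x"
proof (induction n arbitrary: x)
 case (Suc n)
 have "Gf (Suc n) (Gb (Suc n) x) = Gf n (F (Fi (Gb n x)))"
  using fw.s.G_Suc[of n "Fi (Gb n x)"] by simp
 then show ?case using Suc by (simp add: F_Fi)
qed simp

lemma Wu_Gb: "y \<in> Wu x \<Longrightarrow> Gb n y \<in> Wu (Gb n x)"
 by (induction n) (auto intro: bw.s.W_forward)

text \<open>
 Moving \<open>w\<close> first along its unstable leaf keeps it from being expanded under \<open>F\<close> relative to \<open>z\<close>
 faster than the centre, so a short displacement survives a long stable move up to the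
 small factor \<open>((1 + e) / (1 - e / kap)) ^ n\<close>.
\<close>

lemma displacement:
 assumes z': "z' \<in> Ws z" and w: "fw.nmax (w - z) \<le> d" and l: "ns (z' - z) \<le> l"
 obtains w1 w' where "w1 \<in> Wu w" "w' \<in> Ws w1"
  "(1 - e / kap) ^ n * fw.nmax (w' - z') \<le> (lam + e) ^ n * (2 * l + 4 * d) + (1 + e) ^ n * (4 * d)"
proof -
 \<comment> \<open>The unstable leg is chosen at time \<open>n\<close>, so as to cancel there the
   unstable displacement from the image of \<open>z\<close>.\<close>
 define y where "y = bw.s.leaf_pt (Gf n w) (Gf n z)"
 have y: "y \<in> Wu (Gf n w)" "nu (y - Gf n z) = 0" unfolding y_def by (rule bw.s.leaf_pt)+
 define w1 where "w1 = Gb n y"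
 have w1: "w1 \<in> Wu w" unfolding w1_def using Wu_Gb[OF y(1), of n] by (simp add: Gb_Gf)
 have Gw1: "Gf n w1 = y" by (simp add: w1_def Gf_Gb)
 have cone: "nu (Gf n w1 - Gf n z) \<le> kap * max (ns (Gf n w1 - Gf n z)) (nc (Gf n w1 - Gf n z))"
  unfolding Gw1 using y(2) fw.kap fw.n_nonneg by (simp add: le_max_iff_disj)
 \<comment> \<open>A displacement in the centre-stable cone at time \<open>n\<close> was in it from
   the start. As \<open>w1 - w\<close> lies in the unstable cone, its size is thereby bounded by a
   multiple of \<open>d\<close>.\<close>
 have c0: "nu (w1 - z) \<le> kap * max (ns (w1 - z)) (nc (w1 - z))"
  using fw.cs.cone_bwd_iter[OF cone, of 0] by simp
 have cu: "max (nc (w1 - w)) (ns (w1 - w)) \<le> kap * nu (w1 - w)" by (rule bw.s.W_cone0[OF w1])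
 have tri: "t (w1 - z) \<le> t (w1 - w) + t (w - z)" if "seminorm t" for t
  using seminorm_triangle[OF that] .
 have wn: "ns (w - z) \<le> d" "nc (w - z) \<le> d" "nu (w - z) \<le> d"
  using fw.n_le_nmax[of "w - z"] w by auto
 have h: "kap * a \<le> a / 2" if "0 \<le> a" for a using fw.kap that mult_right_mono[of kap "1/2" a] by simp
 have sc: "max (ns (w1 - z)) (nc (w1 - z)) \<le> nu (w1 - w) / 2 + d"
  using tri[OF fw.sns] tri[OF fw.snc] cu wn h[OF fw.n_nonneg(3)[of "w1 - w"]] by linarith
 have n1: "nu (w1 - w) \<le> nu (w1 - z) + d"
  using seminorm_triangle[OF fw.snu, of w1 w z] wn(3) seminorm_commute[OF fw.snu, of w z] by simp
 have n2: "nu (w1 - z) \<le> (nu (w1 - w) / 2 + d) / 2"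
 proof -
  have "0 \<le> max (ns (w1 - z)) (nc (w1 - z))" using fw.n_nonneg(1)[of "w1 - z"] by simp
  note h[OF this]
  also have "max (ns (w1 - z)) (nc (w1 - z)) / 2 \<le> (nu (w1 - w) / 2 + d) / 2"
   by (rule divide_right_mono[OF sc]) simp
  finally show ?thesis using c0 by linarith
 qed
 have nuw: "nu (w1 - w) \<le> 2 * d" using n1 n2 by argo
 have m2: "max (ns (w1 - z)) (nc (w1 - z)) \<le> 2 * d" using sc nuw by argo
 have d0: "0 \<le> d" using wn fw.n_nonneg(1)[of "w - z"] by simp
 \<comment> \<open>The stable leg is chosen at time 0, without stable displacement from
   \<open>z'\<close>. The difference is then in the centre-unstable cone, where the size at time
   \<open>n\<close> controls the size at time 0.\<close>
 define w' where "w' = fw.s.leaf_pt w1 z'"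
 have w': "w' \<in> Ws w1" "ns (w' - z') = 0" unfolding w'_def by (rule fw.s.leaf_pt)+
 let ?q = "\<lambda>v. max (nc v) (nu v)"
 have snq: "seminorm ?q" by (rule fw.s.snq)
 have "(1 - e / kap) ^ n * ?q (w' - z') \<le> ?q (Gf n w' - Gf n z')"
  using fw.s.cone_expand_iter[of w' z' n] w'(2) fw.n_nonneg(2)[of "w' - z'"] by (simp add: le_max_iff_disj)
 also have "\<dots> \<le> ?q (Gf n w' - Gf n w1) + (?q (Gf n w1 - Gf n z) + ?q (Gf n z - Gf n z'))"
  using seminorm_triangle[OF snq, of "Gf n w'" "Gf n z'" "Gf n w1"]
   seminorm_triangle[OF snq, of "Gf n w1" "Gf n z'" "Gf n z"] by linarith
 finally have 1: "(1 - e / kap) ^ n * ?q (w' - z')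
  \<le> ?q (Gf n w' - Gf n w1) + (?q (Gf n w1 - Gf n z) + ?q (Gf n z - Gf n z'))" .
 have nn: "0 \<le> (lam + e) ^ n" using fw.lam fw.e0 by simp
 have nsz: "ns (w' - w1) \<le> l + 2 * d"
 proof -
  have "ns (w' - w1) \<le> ns (w' - z') + ns (z' - w1)" by (rule seminorm_triangle[OF fw.sns])
  moreover have "ns (z' - w1) \<le> ns (z' - z) + ns (z - w1)" by (rule seminorm_triangle[OF fw.sns])
  moreover have "ns (z - w1) \<le> 2 * d" using m2 seminorm_commute[OF fw.sns, of z w1] by simp
  ultimately show ?thesis using w'(2) l by linarith
 qed
 have 2: "?q (Gf n w' - Gf n w1) \<le> (lam + e) ^ n * (l + 2 * d)"
  using fw.s.W_contract_q[OF w'(1), of n] mult_left_mono[OF nsz nn] by linarith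
 have 3: "?q (Gf n z - Gf n z') \<le> (lam + e) ^ n * l"
  using fw.s.W_contract_q[OF z', of n] mult_left_mono[OF l nn]
   seminorm_commute[OF snq, of "Gf n z" "Gf n z'"] by linarith
 have "max (ns (Gf n w1 - Gf n z)) (nc (Gf n w1 - Gf n z)) \<le> (1 + e) ^ n * max (ns (w1 - z)) (nc (w1 - z))"
  by (rule fw.cs.cone_contract_iter[OF cone])
 also have "\<dots> \<le> (1 + e) ^ n * (2 * d)" using m2 fw.e0 by (intro mult_left_mono) auto
 finally have 4: "nc (Gf n w1 - Gf n z) \<le> (1 + e) ^ n * (2 * d)" by simp
 have 5: "?q (Gf n w1 - Gf n z) \<le> (1 + e) ^ n * (2 * d)"
  using 4 y(2) Gw1 fw.e0 d0 by simp
 have nm: "fw.nmax (w' - z') = ?q (w' - z')"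
  using w'(2) fw.n_nonneg(2)[of "w' - z'"] by (simp add: fw.nmax_def)
 have e5: "(1 + e) ^ n * (2 * d) \<le> (1 + e) ^ n * (4 * d)"
  using d0 fw.e0 by (intro mult_left_mono) auto
 have e6: "(lam + e) ^ n * (l + 2 * d) + (lam + e) ^ n * l \<le> (lam + e) ^ n * (2 * l + 4 * d)"
  using mult_left_mono[of "l + 2 * d + l" "2 * l + 4 * d" "(lam + e) ^ n"] d0 nn
  by (simp add: distrib_left)
 have "(1 - e / kap) ^ n * fw.nmax (w' - z') \<le> (lam + e) ^ n * (2 * l + 4 * d) + (1 + e) ^ n * (4 * d)"
  unfolding nm using 1 2 3 5 e5 e6 by linarith
 then show ?thesis using that w1 w'(1) by blast
qed

end

section \<open>Pigeonhole, quasi-lines and paths along leaves\<close>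

text \<open>Rounding \<open>h * c j i\<close> down to an integer leaves at most
  \<open>2 * h * b j + 1\<close> values for the coordinate \<open>j\<close>.\<close>

lemma pigeonhole_grid:
 fixes c :: "'j \<Rightarrow> 'i \<Rightarrow> real" and b :: "'j \<Rightarrow> nat"
 assumes "finite I" "finite J" "0 < (h::nat)"
  and bd: "\<And>i j. i \<in> I \<Longrightarrow> j \<in> J \<Longrightarrow> \<bar>c j i\<bar> \<le> real (b j)"
  and card: "(\<Prod>j\<in>J. 2 * h * b j + 1) < card I"
 obtains i i' where "i \<in> I" "i' \<in> I" "i \<noteq> i'" "\<And>j. j \<in> J \<Longrightarrow> \<bar>c j i - c j i'\<bar> \<le> 1 / real h"
proof -
 define \<Phi> where "\<Phi> i = (\<lambda>j\<in>J. \<lfloor>real h * c j i\<rfloor>)" for i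
 define R where "R = PiE J (\<lambda>j. {- int (h * b j)..int (h * b j)})"
 have "\<Phi> ` I \<subseteq> R"
 proof
  fix f assume "f \<in> \<Phi> ` I"
  then obtain i where i: "i \<in> I" "f = \<Phi> i" by blast
  have "\<lfloor>real h * c j i\<rfloor> \<in> {- int (h * b j)..int (h * b j)}" if "j \<in> J" for j
  proof -
   have "\<bar>real h * c j i\<bar> \<le> real (h * b j)"
    using mult_left_mono[OF bd[OF i(1) that], of "real h"] by (simp add: abs_mult)
   then have "- real_of_int (int (h * b j)) \<le> real h * c j i" "real h * c j i \<le> real_of_int (int (h * b j))"
    by linarith+
   moreover from this(2) have "real_of_int \<lfloor>real h * c j i\<rfloor> \<le> real_of_int (int (h * b j))"
    by (rule order_trans[OF of_int_floor_le])
   ultimately show ?thesis by (simp add: le_floor_iff del: of_nat_mult)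
  qed
  then show "f \<in> R" by (auto simp: i \<Phi>_def R_def)
 qed
 moreover have "finite R" unfolding R_def by (intro finite_PiE assms(2)) simp
 moreover have "card R = (\<Prod>j\<in>J. 2 * h * b j + 1)"
  unfolding R_def card_PiE[OF assms(2)]
 proof (intro prod.cong refl)
  fix j
  have "int (h * b j) + 1 - - int (h * b j) = int (2 * h * b j + 1)" by simp
  then show "card {- int (h * b j)..int (h * b j)} = 2 * h * b j + 1"
   by (simp only: card_atLeastAtMost_int nat_int)
 qed
 ultimately have "card (\<Phi> ` I) \<le> (\<Prod>j\<in>J. 2 * h * b j + 1)" using card_mono by metis
 then have "card (\<Phi> ` I) < card I" using card by (rule le_less_trans)
 then have "\<not> inj_on \<Phi> I" by (rule pigeonhole)
 then obtain i i' where i: "i \<in> I" "i' \<in> I" "i \<noteq> i'" "\<Phi> i = \<Phi> i'" unfolding inj_on_def by blast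
 have "\<bar>c j i - c j i'\<bar> \<le> 1 / real h" if "j \<in> J" for j
 proof -
  have "\<lfloor>real h * c j i\<rfloor> = \<lfloor>real h * c j i'\<rfloor>"
   using fun_cong[OF i(4), of j] that by (simp add: \<Phi>_def)
  then have "\<bar>real h * c j i - real h * c j i'\<bar> \<le> 1" by linarith
  then have "real h * \<bar>c j i - c j i'\<bar> \<le> 1"
   by (simp only: right_diff_distrib[symmetric] abs_mult abs_of_nat)
  then show ?thesis using assms(3) by (simp add: field_simps)
 qed
 then show ?thesis using that i by blast
qed

lemma convex_seminorm_le:
 assumes "seminorm p"
 shows "convex {v. p v \<le> r}"
proof (rule convexI)
 fix x y and u v :: real assume xy: "x \<in> {v. p v \<le> r}" "y \<in> {v. p v \<le> r}" and uv: "0 \<le> u" "0 \<le> v" "u + v = 1"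
 have "p (u *\<^sub>R x + v *\<^sub>R y) \<le> u * p x + v * p y"
  using seminorm_add[OF assms, of "u *\<^sub>R x" "v *\<^sub>R y"] uv by (simp add: seminorm_scale[OF assms])
 also have "\<dots> \<le> r" using xy uv by (intro convex_bound_le) auto
 finally show "u *\<^sub>R x + v *\<^sub>R y \<in> {v. p v \<le> r}" by simp
qed

text \<open>The translates of \<open>g\<close> by multiples of \<open>k\<close> fit together at the
  integers; near an integer, continuity comes from the two adjacent closed unit intervals.\<close>

lemma continuous_quasi_periodic:
 fixes g :: "real \<Rightarrow> 'a::real_normed_vector"
 assumes g: "path g" "pathfinish g = pathstart g + k"
 defines "c \<equiv> \<lambda>s. g (frac s) + of_int \<lfloor>s\<rfloor> *\<^sub>R k"
 shows "continuous_on UNIV c"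
proof -
 have seg: "continuous_on {real_of_int i..real_of_int i + 1} c" for i
 proof (rule continuous_on_eq)
  show "continuous_on {real_of_int i..real_of_int i + 1} (\<lambda>s. g (s - real_of_int i) + of_int i *\<^sub>R k)"
  proof -
   have "continuous_on {real_of_int i..real_of_int i + 1} (\<lambda>s. g (s - real_of_int i))"
    by (rule continuous_on_compose2[OF g(1)[unfolded path_def]]) (auto intro!: continuous_intros)
   then show ?thesis by (intro continuous_intros)
  qed
  fix s assume s: "s \<in> {real_of_int i..real_of_int i + 1}"
  show "g (s - real_of_int i) + of_int i *\<^sub>R k = c s"
  proof (cases "s = real_of_int i + 1")
   case True
   then have "\<lfloor>s\<rfloor> = i + 1" "frac s = 0" by (simp_all add: frac_def)
   then show ?thesis using True g(2) by (simp add: c_def pathfinish_def pathstart_def algebra_simps)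
  next
   case False
   then have "\<lfloor>s\<rfloor> = i" using s by (intro floor_unique) auto
   then show ?thesis by (simp add: c_def frac_def)
  qed
 qed
 have "isCont c s" for s
 proof -
  let ?i = "\<lfloor>s\<rfloor>"
  have "continuous_on ({real_of_int (?i - 1)..real_of_int (?i - 1) + 1} \<union> {real_of_int ?i..real_of_int ?i + 1}) c"
   by (rule continuous_on_closed_Un[OF _ _ seg seg]) auto
  moreover have "{real_of_int (?i - 1)<..<real_of_int ?i + 1} \<subseteq>
    {real_of_int (?i - 1)..real_of_int (?i - 1) + 1} \<union> {real_of_int ?i..real_of_int ?i + 1}" by auto
  ultimately have "continuous_on {real_of_int (?i - 1)<..<real_of_int ?i + 1} c"
   using continuous_on_subset by blast
  moreover have "s \<in> {real_of_int (?i - 1)<..<real_of_int ?i + 1}" by simp linarith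
  ultimately show ?thesis using continuous_on_eq_continuous_at[OF open_greaterThanLessThan] by blast
 qed
 then show ?thesis by (simp add: continuous_at_imp_continuous_on)
qed

context pert_pair
begin

abbreviation "nm \<equiv> fw.nmax"

definition sat :: "'a set \<Rightarrow> bool" where
 "sat S \<longleftrightarrow> (\<forall>x\<in>S. Ws x \<subseteq> S \<and> Wu x \<subseteq> S)"

lemma sat_Compl: "sat S \<Longrightarrow> sat (- S)"
 unfolding sat_def using fw.s.W_sym bw.s.W_sym by blast

text \<open>The path lies over the straight segment of contracted coordinates. Its size bound is
  what keeps the curves built from such paths close to straight lines in
  \<open>chain\<close>.\<close>

lemma leaf_path:
 assumes "b \<in> Ws a"
 shows "path_component (Ws a \<inter> {v. nm (v - a) \<le> nm (b - a)}) a b"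
proof -
 define g where "g t = fw.s.leaf_pt a (a + t *\<^sub>R (b - a))" for t :: real
 have "continuous_on {0..1} g"
  unfolding g_def
  by (rule continuous_on_compose2[OF fw.s.cont_leaf_pt1[of UNIV]]) (auto intro!: continuous_intros)
 then have "path g" by (simp add: path_def)
 moreover have "path_image g \<subseteq> Ws a \<inter> {v. nm (v - a) \<le> nm (b - a)}"
 proof
  fix v assume "v \<in> path_image g"
  then obtain t where t: "0 \<le> t" "t \<le> 1" "v = g t" by (auto simp: path_image_def)
  have v: "v \<in> Ws a" by (simp add: t g_def fw.s.leaf_pt)
  have "ns (v - a) = t * ns (b - a)"
   using t fw.s.p_leaf_pt[of a "a + t *\<^sub>R (b - a)"] by (simp add: g_def seminorm_scale[OF fw.sns])
  also have "\<dots> \<le> ns (b - a)" using t fw.n_nonneg by (simp add: mult_left_le_one_le)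
  finally have 1: "ns (v - a) \<le> ns (b - a)" .
  have "max (nc (v - a)) (nu (v - a)) \<le> ns (v - a)"
   using fw.s.W_contract_q[OF v, of 0] by simp
  then have "nm (v - a) \<le> nm (b - a)" using 1 by (simp add: fw.nmax_def)
  with v show "v \<in> Ws a \<inter> {v. nm (v - a) \<le> nm (b - a)}" by simp
 qed
 moreover have "pathstart g = a" "pathfinish g = b"
  using fw.s.leaf_pt_self[OF fw.s.W_refl] fw.s.leaf_pt_self[OF assms]
  by (auto simp: pathstart_def pathfinish_def g_def)
 ultimately show ?thesis unfolding path_component_def by blast
qed

end

context pert_pair
begin

interpretation sw: pert_pair Ai A Pu Pc Ps nu nc ns lam K Fi DFi F DF e kap by (rule swap)

lemma leaf_path_u:
 assumes "b \<in> Wu a"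
 shows "path_component (Wu a \<inter> {v. nm (v - a) \<le> nm (b - a)}) a b"
 using sw.leaf_path[OF assms] unfolding nmax_swap .

lemma sat_path_component:
 assumes "sat V" "y \<in> V"
 shows "sat (path_component_set V y)"
 unfolding sat_def
proof (intro ballI conjI subsetI)
 fix x v assume x: "x \<in> path_component_set V y"
 then have xV: "x \<in> V" and xy: "path_component V y x" using path_component_mem by auto
 show "v \<in> path_component_set V y" if "v \<in> Ws x"
 proof -
  have "path_component V x v"
   by (rule path_component_of_subset[OF _ leaf_path[OF that]]) (use assms(1) xV in \<open>auto simp: sat_def\<close>)
  then show ?thesis using path_component_trans[OF xy] by simp
 qed
 show "v \<in> path_component_set V y" if "v \<in> Wu x"
 proof -
  have "path_component V x v"
   by (rule path_component_of_subset[OF _ leaf_path_u[OF that]]) (use assms(1) xV in \<open>auto simp: sat_def\<close>)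
  then show ?thesis using path_component_trans[OF xy] by simp
 qed
qed

text \<open>The ratio between the fastest growth of a centre-stable displacement and the slowest
  growth of a centre-unstable one. It is close to 1 because \<open>A\<close> is isometric on the
  centre.\<close>

abbreviation "th \<equiv> (1 + e) / (1 - e / kap)"

lemma th: "0 < 1 - e / kap" "1 \<le> th"
proof -
 show 1: "0 < 1 - e / kap" using fw.gap1 fw.lam fw.e0 by linarith
 have "0 \<le> e / kap" using fw.e0 fw.kap by simp
 then show "1 \<le> th" using 1 fw.e0 by simp
qed

text \<open>The bound of \<open>displacement\<close> once \<open>n\<close> iterates contract the
  leaf segment to length \<open>D\<close>.\<close>

lemma displacement_ratio:
 assumes "(1 - e / kap) ^ n * a \<le> (lam + e) ^ n * (2 * l + 4 * d) + (1 + e) ^ n * (4 * d)"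
  and "(lam + e) ^ n * l \<le> D" "0 \<le> d" "0 \<le> D"
 shows "a \<le> th ^ n * (2 * D + 8 * d)"
proof -
 have e1: "1 \<le> (1 + e) ^ n" using fw.e0 by simp
 have "(lam + e) ^ n * d \<le> d"
  using assms(3) fw.lam fw.e0 fw.gap1 th(1) fw.s.lam0
  by (intro mult_left_le_one_le power_le_one) (auto intro: order_trans[of _ "1 - e / kap"] simp: fw.kap(1) less_imp_le)
 then have "(1 - e / kap) ^ n * a \<le> 2 * D + 4 * d + (1 + e) ^ n * (4 * d)"
  using assms(1,2) by (simp add: distrib_left)
 also have "\<dots> \<le> (1 + e) ^ n * (2 * D + 4 * d) + (1 + e) ^ n * (4 * d)"
  using mult_right_mono[OF e1, of "2 * D + 4 * d"] assms(3,4) by simp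
 also have "\<dots> = (1 + e) ^ n * (2 * D + 8 * d)" by (simp add: distrib_left)
 finally have "a \<le> (1 + e) ^ n * (2 * D + 8 * d) / (1 - e / kap) ^ n"
  using th(1) by (simp add: pos_le_divide_eq mult.commute)
 also have "\<dots> = th ^ n * (2 * D + 8 * d)" by (simp add: power_divide)
 finally show ?thesis .
qed

text \<open>\<open>displacement\<close> twice, the second time with time reversed: the first leg
  turns \<open>D\<close> into at most \<open>10 * D * th ^ n\<close>, and the second turns this into
  \<open>82 * D * (th ^ 2) ^ n\<close>, where 82 is 2 + 8 * 10.\<close>

lemma double_displacement:
 assumes q: "q \<in> Ws z" and z'': "z'' \<in> Wu q" and w: "nm (w - z) \<le> D" "w \<in> S" and S: "sat S"
  and l: "(lam + e) ^ n * ns (q - z) \<le> D" "(lam + e) ^ n * nu (z'' - q) \<le> D"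
 obtains w'' where "w'' \<in> S" "nm (w'' - z'') \<le> 82 * D * (th ^ 2) ^ n"
proof -
 have D0: "0 \<le> D" using w fw.n_nonneg(4)[of "w - z"] by linarith
 obtain w1 w2 where w2: "w1 \<in> Wu w" "w2 \<in> Ws w1" and b2: "(1 - e / kap) ^ n * nm (w2 - q)
   \<le> (lam + e) ^ n * (2 * ns (q - z) + 4 * D) + (1 + e) ^ n * (4 * D)"
  using displacement[OF q w(1) order_refl] by blast
 have d2: "nm (w2 - q) \<le> th ^ n * (10 * D)"
  using displacement_ratio[OF b2 l(1) D0 D0] by simp
 let ?d2 = "th ^ n * (10 * D)"
 have alg: "t * (t * (2 * D) + 8 * (t * (10 * D))) = 82 * D * (t * t)" for t
  by (simp add: algebra_simps)
 have d20: "0 \<le> ?d2" using th(2) D0 by simp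
 obtain w3 w4 where w4: "w3 \<in> Ws w2" "w4 \<in> Wu w3" and b4: "(1 - e / kap) ^ n * bw.nmax (w4 - z'')
   \<le> (lam + e) ^ n * (2 * nu (z'' - q) + 4 * ?d2) + (1 + e) ^ n * (4 * ?d2)"
  using sw.displacement[OF z'' d2[folded nmax_swap] order_refl] by blast
 have "nm (w4 - z'') \<le> th ^ n * (2 * D + 8 * ?d2)"
  using displacement_ratio[OF b4 l(2) d20 D0] by (simp add: nmax_swap)
 also have "\<dots> \<le> th ^ n * (th ^ n * (2 * D) + 8 * ?d2)"
 proof (rule mult_left_mono)
  have "1 * (2 * D) \<le> th ^ n * (2 * D)"
   by (rule mult_right_mono[OF one_le_power[OF th(2)]]) (use D0 in simp)
  then show "2 * D + 8 * ?d2 \<le> th ^ n * (2 * D) + 8 * ?d2" by linarith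
  show "0 \<le> th ^ n" by (rule order_trans[OF zero_le_one one_le_power[OF th(2)]])
 qed
 also have "\<dots> = 82 * D * (th ^ n * th ^ n)" by (rule alg)
 also have "th ^ n * th ^ n = (th ^ 2) ^ n" by (simp only: power2_eq_square power_mult_distrib)
 finally have "nm (w4 - z'') \<le> 82 * D * (th ^ 2) ^ n" .
 moreover have "w4 \<in> S" using S w(2) w2 w4 unfolding sat_def by blast
 ultimately show ?thesis using that by blast
qed

end

section \<open>The complex centre coordinate and crossing quasi-lines\<close>

text \<open>\<open>ell\<close> is the coordinate that identifies the centre with the complex plane.
  Transversality of two vectors in the centre then reads
  \<open>Im (ell k * cnj (ell k')) \<noteq> 0\<close>.\<close>

locale pert_center = pert_pair +
 fixes ell :: "'a \<Rightarrow> complex" and zeta :: complex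
 assumes lin_ell: "linear ell" and nc_ell: "\<And>v. nc v = cmod (ell v)"
  and ell_A: "\<And>v. ell (A v) = zeta * ell v" and zeta: "Im zeta \<noteq> 0"
begin

lemma cmod_zeta: assumes "ell v \<noteq> 0" shows "cmod zeta = 1"
 using fw.ncA[of v] assms by (simp add: nc_ell ell_A norm_mult)

lemma ell_bound: "cmod (ell v) \<le> nm v"
 using fw.n_le_nmax(2)[of v] by (simp add: nc_ell)

text \<open>
 Stable leaves through one quasi-line meet unstable leaves through another one whose
 centre direction is transverse: Brouwer's theorem for the unknown
 \<open>(s, t, a, b)\<close>, where \<open>a\<close> and \<open>b\<close> are the stable and unstable displacements.
\<close>

lemma crossing:
 fixes c d :: "real \<Rightarrow> 'a"
 assumes cc: "continuous_on UNIV c" and cd: "continuous_on UNIV d"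
  and c: "\<And>s. nm (c s - s *\<^sub>R k) \<le> M1" and d: "\<And>t. nm (d t - t *\<^sub>R k') \<le> M2"
  and ang: "c0 * (cmod (ell k) * cmod (ell k')) \<le> \<bar>Im (ell k * cnj (ell k'))\<bar>"
  and c0: "0 < c0" and k: "ell k \<noteq> 0" "ell k' \<noteq> 0"
  and T: "(M1 + M2 + 2 * (1 + 2 * e * real n)) / (c0 * cmod (ell k)) \<le> T"
   "(M1 + M2 + 2 * (1 + 2 * e * real n)) / (c0 * cmod (ell k')) \<le> T"
  and L: "1 + 2 * e / (1 - lam) + T * (nm k + nm k') + M1 + M2 \<le> L"
  and n: "(lam + e) ^ n * L \<le> 1"
 obtains s t q where "q \<in> Ws (c s)" "q \<in> Wu (d t)" "ns (q - c s) \<le> L" "nu (q - d t) \<le> L"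
proof -
 let ?al = "ell k" and ?be = "ell k'"
 let ?E = "M1 + M2 + 2 * (1 + 2 * e * real n)"
 define Sa where "Sa = {a. ns a \<le> L \<and> nc a \<le> 0 \<and> nu a \<le> 0}"
 define Sb where "Sb = {b. nu b \<le> L \<and> nc b \<le> 0 \<and> ns b \<le> 0}"
 define S where "S = {-T..T} \<times> {-T..T} \<times> Sa \<times> Sb"
 have M0: "0 \<le> M1" "0 \<le> M2" using c[of 0] d[of 0] fw.n_nonneg(4) order_trans by blast+
 have E0: "0 \<le> ?E" using M0 fw.e0 by simp
 have T0: "0 \<le> T"
 proof (rule order_trans[OF _ T(1)])
  show "0 \<le> ?E / (c0 * cmod ?al)" using E0 c0 by simp
 qed
 have L0: "0 \<le> L"
 proof (rule order_trans[OF _ L])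
  show "0 \<le> 1 + 2 * e / (1 - lam) + T * (nm k + nm k') + M1 + M2"
   using T0 M0 fw.e0 fw.lam fw.n_nonneg(4) by (intro add_nonneg_nonneg mult_nonneg_nonneg) auto
 qed
 have contn: "continuous_on UNIV ns" "continuous_on UNIV nc" "continuous_on UNIV nu"
  using seminorm_continuous[OF fw.sns fw.nsK] seminorm_continuous[OF fw.snc fw.ncK]
   seminorm_continuous[OF fw.snu fw.nuK] by auto
 have cpt: "compact Sa" "compact Sb"
 proof -
  have "bounded X" if bX: "\<And>v. v \<in> X \<Longrightarrow> nm v \<le> L" for X
  proof -
   have "norm v \<le> 3 * K * L" if "v \<in> X" for v
   proof -
    have "3 * K * nm v \<le> 3 * K * L" using bX[OF that] fw.K0 by (intro mult_left_mono) auto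
    then show ?thesis using fw.norm_le_nmax[of v] by linarith
   qed
   then show ?thesis unfolding bounded_iff by blast
  qed
  moreover have "nm v \<le> L" if "v \<in> Sa" for v using that L0 by (simp add: Sa_def fw.nmax_def)
  moreover have "nm v \<le> L" if "v \<in> Sb" for v using that L0 by (simp add: Sb_def fw.nmax_def)
  moreover have "closed Sa" "closed Sb" unfolding Sa_def Sb_def
   by (intro closed_Collect_conj closed_Collect_le contn continuous_on_const)+
  ultimately show "compact Sa" "compact Sb" unfolding compact_eq_bounded_closed by blast+
 qed
 have cvx: "convex Sa" "convex Sb"
  unfolding Sa_def Sb_def Collect_conj_eq
  by (intro convex_Int convex_seminorm_le fw.sns fw.snc fw.snu)+
 have "compact S" unfolding S_def by (intro compact_Times cpt) auto
 moreover have "convex S" unfolding S_def by (intro convex_Times cvx) auto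
 moreover have "S \<noteq> {}"
 proof -
  have "0 \<in> Sa" "0 \<in> Sb" using L0
   by (simp_all add: Sa_def Sb_def seminorm_zero fw.sns fw.snc fw.snu)
  then have "(0, 0, 0, 0) \<in> S" using T0 by (simp add: S_def)
  then show ?thesis by blast
 qed
 moreover
 define q1 where "q1 s a = fw.s.leaf_pt (c s) (c s + a)" for s a
 define q2 where "q2 t b = bw.s.leaf_pt (d t) (d t + b)" for t b
 \<comment> \<open>The deviation of the centre coordinates of the two leaf points from those of
   \<open>s *\<^sub>R k\<close> and \<open>t *\<^sub>R k'\<close>. The centre coordinates of the
   leaf points agree exactly when \<open>E z\<close> equals
   \<open>s * ell k - t * ell k'\<close>.\<close>
 define E where "E z = (ell (q2 (fst (snd z)) (snd (snd (snd z)))) - of_real (fst (snd z)) * ?be)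
   - (ell (q1 (fst z) (fst (snd (snd z)))) - of_real (fst z) * ?al)" for z :: "real \<times> real \<times> 'a \<times> 'a"
 \<comment> \<open>Cramer's rule solves that equation for \<open>s\<close> and \<open>t\<close>; the
   other two entries replace each displacement by the one that would reach the other leaf point. At
   a fixed point the two leaf points coincide.\<close>
 define f where "f z = (Im (E z * cnj ?be) / Im (?al * cnj ?be), Im (E z * cnj ?al) / Im (?al * cnj ?be),
   Ps (q2 (fst (snd z)) (snd (snd (snd z))) - c (fst z)),
   Pu (q1 (fst z) (fst (snd (snd z))) - d (fst (snd z))))" for z :: "real \<times> real \<times> 'a \<times> 'a"
 have D0: "0 < \<bar>Im (?al * cnj ?be)\<bar>" using ang c0 k by (smt (verit) mult_pos_pos zero_less_norm_iff)
 have contc: "continuous_on X (\<lambda>z. c (h z))" if "continuous_on X h" for X and h :: "real \<times> real \<times> 'a \<times> 'a \<Rightarrow> real"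
  by (rule continuous_on_compose2[OF cc that]) auto
 have contd: "continuous_on X (\<lambda>z. d (h z))" if "continuous_on X h" for X and h :: "real \<times> real \<times> 'a \<times> 'a \<Rightarrow> real"
  by (rule continuous_on_compose2[OF cd that]) auto
 have cq1: "continuous_on S (\<lambda>z. q1 (fst z) (fst (snd (snd z))))"
 proof -
  have "continuous_on S (\<lambda>z. (c (fst z), c (fst z) + fst (snd (snd z))))"
   by (intro continuous_intros contc)
  from continuous_on_compose[OF this fw.s.cont_leaf_pt] show ?thesis by (simp add: comp_def q1_def)
 qed
 have cq2: "continuous_on S (\<lambda>z. q2 (fst (snd z)) (snd (snd (snd z))))"
 proof -
  have "continuous_on S (\<lambda>z. (d (fst (snd z)), d (fst (snd z)) + snd (snd (snd z))))"
   by (intro continuous_intros contd)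
  from continuous_on_compose[OF this bw.s.cont_leaf_pt] show ?thesis by (simp add: comp_def q2_def)
 qed
 have contlin: "continuous_on X (\<lambda>z. l (h z))" if "linear l" "continuous_on X h"
  for l :: "'a \<Rightarrow> 'b::real_normed_vector" and X and h :: "real \<times> real \<times> 'a \<times> 'a \<Rightarrow> 'a"
  by (rule continuous_on_compose2[OF linear_continuous_on[OF linear_conv_bounded_linear[THEN iffD1, OF that(1)]] that(2)]) auto
 have "continuous_on S f"
 proof -
  have cE: "continuous_on S E" unfolding E_def
   by (intro continuous_intros contlin[OF lin_ell cq1] contlin[OF lin_ell cq2])
  show ?thesis unfolding f_def
   by (intro continuous_intros contlin[OF fw.linPs] contlin[OF fw.linPu] cq1 cq2 contc contd cE)
    (use D0 in auto)
 qed
 moreover have "f \<in> S \<rightarrow> S"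
 proof
  fix z assume "z \<in> S"
  then obtain s t a b where z: "z = (s, t, a, b)" "\<bar>s\<bar> \<le> T" "\<bar>t\<bar> \<le> T" "a \<in> Sa" "b \<in> Sb"
   unfolding S_def by (auto simp: abs_le_iff)
  have w1: "q1 s a \<in> Ws (c s)" unfolding q1_def by (rule fw.s.leaf_pt)
  have w2: "q2 t b \<in> Wu (d t)" unfolding q2_def by (rule bw.s.leaf_pt)
  have l1: "ns (q1 s a - c s) \<le> L" using fw.s.p_leaf_pt[of "c s" "c s + a"] z(4) by (simp add: q1_def Sa_def)
  have l2: "nu (q2 t b - d t) \<le> L" using bw.s.p_leaf_pt[of "d t" "d t + b"] z(5) by (simp add: q2_def Sb_def)
  \<comment> \<open>Leaf segments of length at most \<open>L\<close> have length at most 1 after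
    \<open>n\<close> iterates, so \<open>drift\<close> bounds their other coordinates.\<close>
  have small: "(lam + e) ^ n * r \<le> 1" if "r \<le> L" for r
  proof -
   have "(lam + e) ^ n * r \<le> (lam + e) ^ n * L" using that fw.lam fw.e0 by (intro mult_left_mono) auto
   then show ?thesis using n by linarith
  qed
  note dr1 = fw.drift[OF w1 small[OF l1]]
  note dr2 = bw.drift[OF w2 small[OF l2]]
  have cE: "cmod (E z) \<le> ?E"
  proof -
   have "ell (q1 s a) - of_real s * ?al = ell (q1 s a - c s) + ell (c s - s *\<^sub>R k)"
    by (simp add: linear_diff[OF lin_ell] linear_scale[OF lin_ell] scaleR_conv_of_real)
   then have "cmod (ell (q1 s a) - of_real s * ?al) \<le> nc (q1 s a - c s) + nm (c s - s *\<^sub>R k)"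
    using norm_triangle_ineq[of "ell (q1 s a - c s)" "ell (c s - s *\<^sub>R k)"] ell_bound[of "c s - s *\<^sub>R k"]
    by (simp add: nc_ell)
   moreover have "ell (q2 t b) - of_real t * ?be = ell (q2 t b - d t) + ell (d t - t *\<^sub>R k')"
    by (simp add: linear_diff[OF lin_ell] linear_scale[OF lin_ell] scaleR_conv_of_real)
   then have "cmod (ell (q2 t b) - of_real t * ?be) \<le> nc (q2 t b - d t) + nm (d t - t *\<^sub>R k')"
    using norm_triangle_ineq[of "ell (q2 t b - d t)" "ell (d t - t *\<^sub>R k')"] ell_bound[of "d t - t *\<^sub>R k'"]
    by (simp add: nc_ell)
   moreover have "cmod (E z) \<le> cmod (ell (q2 t b) - of_real t * ?be) + cmod (ell (q1 s a) - of_real s * ?al)"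
    unfolding E_def z(1) fst_conv snd_conv by (rule norm_triangle_ineq4)
   ultimately have "cmod (E z) \<le> (nc (q2 t b - d t) + M2) + (nc (q1 s a - c s) + M1)"
    using c[of s] d[of t] by linarith
   also have "\<dots> \<le> (1 + 2 * e * real n + M2) + (1 + 2 * e * real n + M1)"
    by (intro add_mono order_refl dr1(1) dr2(1))
   finally show ?thesis by simp
  qed
  \<comment> \<open>By the angle condition the denominator is at least \<open>c0\<close> times the
    product of the two lengths, one of which cancels against the numerator.\<close>
  have quot: "\<bar>Im (E z * cnj x) / Im (?al * cnj ?be)\<bar> \<le> T"
   if "y \<noteq> 0" "?E / (c0 * cmod y) \<le> T" "c0 * (cmod y * cmod x) \<le> \<bar>Im (?al * cnj ?be)\<bar>" for x y
  proof -
   have "\<bar>Im (E z * cnj x)\<bar> \<le> cmod (E z * cnj x)" by (rule abs_Im_le_cmod)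
   also have "\<dots> \<le> ?E * cmod x" using cE by (simp add: norm_mult mult_right_mono)
   also have "\<dots> \<le> (T * (c0 * cmod y)) * cmod x"
    using that(1,2) c0 by (intro mult_right_mono) (simp_all add: pos_divide_le_eq)
   also have "\<dots> = T * (c0 * (cmod y * cmod x))" by simp
   also have "\<dots> \<le> T * \<bar>Im (?al * cnj ?be)\<bar>" by (rule mult_left_mono[OF that(3) T0])
   finally show ?thesis using D0 by (simp add: pos_divide_le_eq)
  qed
  have s': "\<bar>Im (E z * cnj ?be) / Im (?al * cnj ?be)\<bar> \<le> T" by (rule quot[OF k(1) T(1) ang])
  have t': "\<bar>Im (E z * cnj ?al) / Im (?al * cnj ?be)\<bar> \<le> T"
   by (rule quot[OF k(2) T(2)]) (use ang in \<open>simp add: mult.commute\<close>)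
  have lin: "p (c s - d t) \<le> M1 + M2 + T * (nm k + nm k')" if "\<And>v. p v \<le> nm v" for p :: "'a \<Rightarrow> real"
  proof -
   have "nm (c s - d t) \<le> nm (c s - s *\<^sub>R k) + nm (s *\<^sub>R k - d t)" by (rule seminorm_triangle[OF fw.snmax])
   moreover have "nm (s *\<^sub>R k - d t) \<le> nm (s *\<^sub>R k - t *\<^sub>R k') + nm (t *\<^sub>R k' - d t)"
    by (rule seminorm_triangle[OF fw.snmax])
   moreover have "nm (s *\<^sub>R k - t *\<^sub>R k') \<le> nm (s *\<^sub>R k) + nm (t *\<^sub>R k')" by (rule seminorm_diff[OF fw.snmax])
   moreover have "nm (s *\<^sub>R k) \<le> T * nm k" "nm (t *\<^sub>R k') \<le> T * nm k'"
    using z(2,3) fw.n_nonneg(4) by (simp_all add: seminorm_scale[OF fw.snmax] mult_right_mono)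
   moreover have "nm (t *\<^sub>R k' - d t) = nm (d t - t *\<^sub>R k')" by (rule seminorm_commute[OF fw.snmax])
   ultimately show ?thesis using c[of s] d[of t] that[of "c s - d t"] by (simp add: distrib_left)
  qed
  have a': "Ps (q2 t b - c s) \<in> Sa"
  proof -
   have "ns (q2 t b - c s) \<le> ns (q2 t b - d t) + ns (d t - c s)" by (rule seminorm_triangle[OF fw.sns])
   also have "ns (d t - c s) = ns (c s - d t)" by (rule seminorm_commute[OF fw.sns])
   finally have "ns (q2 t b - c s) \<le> L"
    using dr2(2) lin[of ns] fw.n_le_nmax(1) L by simp
   then show ?thesis by (simp add: Sa_def fw.nsPs fw.ncP fw.nuP)
  qed
  have b': "Pu (q1 s a - d t) \<in> Sb"
  proof -
   have "nu (q1 s a - d t) \<le> nu (q1 s a - c s) + nu (c s - d t)" by (rule seminorm_triangle[OF fw.snu])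
   then have "nu (q1 s a - d t) \<le> L"
    using dr1(2) lin[of nu] fw.n_le_nmax(3) L by simp
   then show ?thesis by (simp add: Sb_def fw.nuPu fw.ncP fw.nsP)
  qed
  have itv: "r \<in> {-T..T}" if "\<bar>r\<bar> \<le> T" for r using that by (simp add: abs_le_iff)
  from itv[OF s'] itv[OF t'] a' b' show "f z \<in> S"
   unfolding f_def S_def z(1) fst_conv snd_conv by (intro SigmaI)
 qed
 ultimately obtain z where z: "z \<in> S" "f z = z" using brouwer[of S f] by blast
 obtain s t a b where zd: "z = (s, t, a, b)" using prod_cases4 by blast
 have ab: "a \<in> Sa" "b \<in> Sb" using z(1) by (auto simp: zd S_def)
 let ?q1 = "q1 s a" and ?q2 = "q2 t b"
 have fx: "Im (E z * cnj ?be) / Im (?al * cnj ?be) = s" "Im (E z * cnj ?al) / Im (?al * cnj ?be) = t"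
  "Ps (?q2 - c s) = a" "Pu (?q1 - d t) = b"
  using z(2) unfolding f_def zd by simp_all
 have Ps1: "Ps ?q1 = Ps (c s) + a"
 proof -
  have "Ps (?q1 - (c s + a)) = 0" unfolding q1_def by (rule fw.Ps_zero[OF fw.s.leaf_pt(2)])
  moreover have "Ps a = a"
  proof -
   have "Pc a = 0" using fw.normK[of "Pc a"] fw.nsP fw.nuP fw.ncPc[of a] ab(1) fw.n_nonneg(2)[of a]
    by (simp add: Sa_def)
   moreover have "Pu a = 0" using fw.Pu_zero[of a] ab(1) fw.n_nonneg(3)[of a] by (simp add: Sa_def)
   ultimately show ?thesis using fw.P_sum[of a] by simp
  qed
  ultimately show ?thesis by (simp add: linear_diff[OF fw.linPs] linear_add[OF fw.linPs])
 qed
 have Pu2: "Pu ?q2 = Pu (d t) + b"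
 proof -
  have "Pu (?q2 - (d t + b)) = 0" unfolding q2_def by (rule fw.Pu_zero[OF bw.s.leaf_pt(2)])
  moreover have "Pu b = b"
  proof -
   have "Pc b = 0" using fw.normK[of "Pc b"] fw.nsP fw.nuP fw.ncPc[of b] ab(2) fw.n_nonneg(2)[of b]
    by (simp add: Sb_def)
   moreover have "Ps b = 0" using fw.Ps_zero[of b] ab(2) fw.n_nonneg(1)[of b] by (simp add: Sb_def)
   ultimately show ?thesis using fw.P_sum[of b] by simp
  qed
  ultimately show ?thesis by (simp add: linear_diff[OF fw.linPu] linear_add[OF fw.linPu])
 qed
 have "Ps (?q1 - ?q2) = 0"
  using fx(3) Ps1 unfolding linear_diff[OF fw.linPs] by (simp add: diff_eq_eq add.commute)
 then have n1: "ns (?q1 - ?q2) = 0" using fw.nsPs[of "?q1 - ?q2"] by (simp add: seminorm_zero[OF fw.sns])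
 have "Pu (?q1 - ?q2) = 0"
  using fx(4) Pu2 unfolding linear_diff[OF fw.linPu] by (simp add: diff_eq_eq add.commute)
 then have n2: "nu (?q1 - ?q2) = 0" using fw.nuPu[of "?q1 - ?q2"] by (simp add: seminorm_zero[OF fw.snu])
 \<comment> \<open>Cramer's rule for the coordinates of \<open>x\<close> with respect to the real
   basis \<open>al\<close>, \<open>be\<close> of the complex plane.\<close>
 have id: "of_real (Im (x * cnj be)) * al - of_real (Im (x * cnj al)) * be = of_real (Im (al * cnj be)) * x" for x al be
  by (simp add: complex_eq_iff algebra_simps)
 have "of_real s * ?al - of_real t * ?be = E z"
 proof -
  let ?D = "Im (?al * cnj ?be)"
  have D: "?D \<noteq> 0" using D0 by simp
  have st: "Im (E z * cnj ?be) = s * ?D" "Im (E z * cnj ?al) = t * ?D"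
   using fx(1,2) D unfolding divide_eq_eq by (simp_all only: if_True not_False_eq_True simp_thms if_P)
  have lin: "of_real r * (of_real s * al - of_real t * be) = of_real (s * r) * al - of_real (t * r) * be"
   for r and al be :: complex
   by (simp add: algebra_simps)
  have "of_real ?D * (of_real s * ?al - of_real t * ?be) = of_real ?D * E z"
   by (rule trans[OF lin id[of "E z" ?be ?al, unfolded st]])
  moreover have "complex_of_real ?D \<noteq> 0" using D unfolding of_real_eq_0_iff .
  ultimately show ?thesis by (simp only: mult_cancel_left) simp
 qed
 then have "ell (?q1 - ?q2) = 0" by (simp add: E_def zd linear_diff[OF lin_ell] algebra_simps)
 then have "nc (?q1 - ?q2) = 0" by (simp add: nc_ell)
 with n1 n2 have eq: "?q1 = ?q2" using fw.nzero_imp_zero[of "?q1 - ?q2"] by simp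
 show ?thesis
 proof (rule that)
  show "?q1 \<in> Ws (c s)" unfolding q1_def by (rule fw.s.leaf_pt)
  show "?q1 \<in> Wu (d t)" unfolding eq q2_def by (rule bw.s.leaf_pt)
  show "ns (?q1 - c s) \<le> L" using fw.s.p_leaf_pt[of "c s" "c s + a"] ab(1) by (simp add: q1_def Sa_def)
  show "nu (?q1 - d t) \<le> L" unfolding eq
   using bw.s.p_leaf_pt[of "d t" "d t + b"] ab(2) by (simp add: q2_def Sb_def)
 qed
qed

end

section \<open>The lattice: close pairs, quasi-lines and minimality\<close>

text \<open>The longest leaf, in \<open>clash\<close>, has length of order
  \<open>(rho ^ n) ^ (2 * N2 + N2 * QL)\<close>; one more power of \<open>rho\<close> in
  \<open>rate\<close> makes it contract to order \<open>1 / rho ^ n\<close>. The exponent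
  \<open>N2\<close> is that of the mesh in the cell count of \<open>close_pair\<close>: one for each
  Euclidean coordinate and two for the centre.\<close>

locale pert_lattice = pert_center A Ai Ps Pc Pu ns nc nu lam K F DF Fi DFi e kap ell zeta
 for A Ai Ps Pc Pu :: "'a::euclidean_space \<Rightarrow> 'a" and ns nc nu lam K F DF Fi DFi e kap ell zeta +
 fixes L :: "'a set" and u0 :: 'a and cL rho :: real and QL N2 :: nat
 assumes L_zero: "0 \<in> L" and L_add: "\<And>x y. x \<in> L \<Longrightarrow> y \<in> L \<Longrightarrow> x + y \<in> L"
  and L_minus: "\<And>x. x \<in> L \<Longrightarrow> - x \<in> L"
  and L_A: "\<And>k. k \<in> L \<Longrightarrow> A k \<in> L" and L_Ai: "\<And>k. k \<in> L \<Longrightarrow> Ai k \<in> L"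
  and F_per: "\<And>x k. k \<in> L \<Longrightarrow> F (x + k) = F x + A k"
  and u0: "u0 \<in> L" "ell u0 \<noteq> 0"
  and cL: "0 < cL"
  and liouville: "\<And>w0 w1 w2 :: int. (w0, w1, w2) \<noteq> (0, 0, 0) \<Longrightarrow>
   cL \<le> cmod (of_int w0 + of_int w1 * zeta + of_int w2 * zeta ^ 2) *
    (1 + \<bar>of_int w0\<bar> + \<bar>of_int w1\<bar> + \<bar>of_int w2\<bar>) ^ QL"
  and rho: "1 < rho"
  and N2: "N2 = DIM('a) + 2"
  and rate: "(lam + e) * rho ^ (2 * N2 + N2 * QL + 1) \<le> 1"
  and th_rho: "th ^ 2 < rho"
begin

lemma Fi_per: "k \<in> L \<Longrightarrow> Fi (x + k) = Fi x + Ai k"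
 using F_per[OF L_Ai, of k "Fi x"] by (metis F_Fi Fi_F fw.A_Ai)

lemma L_of_int: "k \<in> L \<Longrightarrow> of_int j *\<^sub>R k \<in> L"
proof (induction j rule: int_induct[where k = 0])
 case (step1 i)
 then show ?case using L_add[of "of_int i *\<^sub>R k" k] by (simp add: scaleR_add_left)
next
 case (step2 i)
 then show ?case using L_add[of "of_int i *\<^sub>R k" "- k"] L_minus[of k] by (simp add: scaleR_diff_left)
qed (simp add: L_zero)

lemma L_of_nat: "k \<in> L \<Longrightarrow> real j *\<^sub>R k \<in> L"
 using L_of_int[of k "int j"] by simp

lemma L_diff: "x \<in> L \<Longrightarrow> y \<in> L \<Longrightarrow> x - y \<in> L"
 using L_add[of x "- y"] L_minus[of y] by simp

lemma rho_ge_1: "1 \<le> rho ^ n" using rho by simp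

lemma lam_e: "0 < lam + e" "lam + e \<le> 1"
 using fw.lam fw.e0 fw.gap1 fw.kap th by (auto intro: order_trans[of _ "1 - e / kap"])

lemma lam_pow:
 assumes "j \<le> 2 * N2 + N2 * QL"
 shows "(lam + e) ^ n * (rho ^ n) ^ j \<le> 1 / rho ^ n"
proof -
 have "rho ^ (j + 1) \<le> rho ^ (2 * N2 + N2 * QL + 1)"
  using rho assms by (intro power_increasing) auto
 then have "(lam + e) * rho ^ (j + 1) \<le> (lam + e) * rho ^ (2 * N2 + N2 * QL + 1)"
  using lam_e by (intro mult_left_mono) auto
 also have "\<dots> \<le> 1" by (rule rate)
 finally have "((lam + e) * rho ^ (j + 1)) ^ n \<le> 1"
  using lam_e rho by (intro power_le_one) auto
 moreover have "(rho ^ j) ^ n = (rho ^ n) ^ j" by (simp only: power_mult[symmetric] mult.commute)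
 ultimately have "(lam + e) ^ n * (rho ^ n) ^ j * rho ^ n \<le> 1"
  by (simp only: power_mult_distrib power_add power_one_right mult.assoc)
 then show ?thesis using rho by (simp add: pos_le_divide_eq)
qed

lemma lam_pow_C:
 assumes "j \<le> 2 * N2 + N2 * QL" "0 \<le> C" "x \<le> C * (rho ^ n) ^ j"
 shows "(lam + e) ^ n * x \<le> C / rho ^ n"
proof -
 have "(lam + e) ^ n * x \<le> (lam + e) ^ n * (C * (rho ^ n) ^ j)"
  using assms lam_e by (intro mult_left_mono) auto
 also have "\<dots> = C * ((lam + e) ^ n * (rho ^ n) ^ j)" by simp
 also have "\<dots> \<le> C * (1 / rho ^ n)" by (rule mult_left_mono[OF lam_pow[OF assms(1)] assms(2)])
 finally show ?thesis by simp
qed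

text \<open>Turns the centre drift, which is linear in \<open>n\<close> and thus logarithmic in the
  scale, into a term of the order of the scale; this crude bound suffices.\<close>

lemma n_le_rho: "real n \<le> rho ^ n / (rho - 1)"
proof -
 have "1 + real n * (rho - 1) \<le> (1 + (rho - 1)) ^ n" using rho by (intro Bernoulli_inequality) simp
 then have "real n * (rho - 1) \<le> rho ^ n" by simp
 then show ?thesis using rho by (simp add: pos_le_divide_eq)
qed

text \<open>All sizes are polynomial in the scale \<open>rho ^ n\<close>, with a constant that is to
  be independent of \<open>n\<close>. The last conjunct is the Liouville bound with the integer
  coefficients replaced by a bound of order \<open>(rho ^ n) ^ N2\<close>.\<close>

definition close_at :: "'a \<Rightarrow> real \<Rightarrow> nat \<Rightarrow> bool" where
 "close_at x C n \<longleftrightarrow> (\<exists>k1\<in>L. \<exists>k2\<in>L. \<exists>z1 z2 p1 p2. z1 \<in> Ws (x + k1) \<and> p1 \<in> Wu z1 \<and>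
   z2 \<in> Ws (x + k2) \<and> p2 \<in> Wu z2 \<and> nm (p1 - p2) \<le> C / rho ^ n \<and>
   nm k1 \<le> C * (rho ^ n) ^ N2 \<and> nm k2 \<le> C * (rho ^ n) ^ N2 \<and>
   nm z1 \<le> C * (rho ^ n) ^ N2 \<and> nm z2 \<le> C * (rho ^ n) ^ N2 \<and>
   nm p1 \<le> C * (rho ^ n) ^ N2 \<and> nm p2 \<le> C * (rho ^ n) ^ N2 \<and>
   cL * cmod (ell u0) \<le> cmod (ell (k1 - k2)) * (4 * C * (rho ^ n) ^ N2) ^ QL)"

text \<open>The two legs make the unstable coordinate vanish and leave the stable one bounded, so
  only the two centre coordinates are spread out, over a range of order \<open>B\<close>. There are
  \<open>B ^ 3\<close> candidates and at most \<open>B ^ 2 * (b0 * h ^ N2)\<close> grid cells, hence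
  \<open>B > b0 * h ^ N2\<close> forces a coincidence.\<close>

lemma close_pair: "\<exists>C\<ge>1. \<forall>n. C \<le> rho ^ n \<longrightarrow> close_at x C n"
proof -
 define mu where "mu = nm u0 + nm (A u0) + nm (A (A u0))"
 define ee where "ee = e / (rho - 1)"
 define C1 where "C1 = 1 + 2 * e / (1 - lam)"
 \<comment> \<open>\<open>c1 * B\<close> will bound the centre coordinates and \<open>b2\<close> the
   remaining ones; \<open>b0\<close> collects the constants of the cell count.\<close>
 define c1 where "c1 = nat \<lceil>nm x + mu + 2 + 8 * ee\<rceil>"
 define b2 where "b2 = nat \<lceil>3 * K * C1\<rceil>"
 define b0 where "b0 = 9 * c1 ^ 2 * (3 * b2) ^ DIM('a)"
 define beta where "beta = real b0 + 1"
 define muB where "muB = beta * mu"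
 define KN where "KN = K * DIM('a)"
 define C where "C = nm x + muB + beta + 2 + 4 * ee + C1 + 2 * KN + 4"
 have nn: "0 \<le> nm v" for v by (rule fw.n_nonneg)
 have mu0: "0 \<le> mu" unfolding mu_def using nn by simp
 have er: "0 \<le> ee" unfolding ee_def using fw.e0 rho by simp
 have C1: "1 \<le> C1" unfolding C1_def using fw.e0 fw.lam by simp
 have c1: "nm x + mu + 2 + 8 * ee \<le> real c1" unfolding c1_def by linarith
 then have c11: "1 \<le> c1" using nn[of x] mu0 er by linarith
 have b2: "3 * K * C1 \<le> real b2" unfolding b2_def by linarith
 have "0 < 3 * K * C1" using fw.K0 C1 by simp
 then have b21: "1 \<le> b2" using b2 by linarith
 note C_parts = C_def[symmetric]
 have KN: "0 \<le> KN" unfolding KN_def using fw.K0 by simp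
 have b00: "1 \<le> beta" by (simp add: beta_def)
 have bmu: "0 \<le> muB" unfolding muB_def beta_def using mu0 by simp
 have Cge: "1 \<le> C" using C_parts nn[of x] bmu b00 er C1 KN by linarith
 have "close_at x C n" if CX: "C \<le> rho ^ n" for n
 proof -
  define X where "X = rho ^ n"
  have X1: "1 \<le> X" unfolding X_def by (rule rho_ge_1)
  define h where "h = nat \<lfloor>X\<rfloor>"
  have fl: "1 \<le> \<lfloor>X\<rfloor>" using X1 by simp
  then have hX: "real h = of_int \<lfloor>X\<rfloor>" unfolding h_def by simp
  have h: "1 \<le> h" using fl unfolding h_def by linarith
  have h2: "real h \<le> X" "X \<le> 2 * real h"
   using fl hX floor_correct[of X] by linarith+
  \<comment> \<open>Just above the threshold of the pigeonhole argument.\<close>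
  define B where "B = b0 * h ^ N2 + 1"
  have B_X: "real B \<le> beta * X ^ N2"
  proof -
   have "real h ^ N2 \<le> X ^ N2" using h2 by (intro power_mono) auto
   then have "real b0 * real h ^ N2 \<le> real b0 * X ^ N2" by (intro mult_left_mono) auto
   moreover have "1 \<le> X ^ N2" using X1 by (rule one_le_power)
   ultimately show ?thesis unfolding B_def beta_def by (simp add: distrib_right)
  qed
  have hB: "h \<le> B"
  proof -
   have "1 \<le> b0" unfolding b0_def using c11 b21 by simp
   moreover have "h ^ 1 \<le> h ^ N2" using h N2 by (intro power_increasing) auto
   ultimately have "1 * h \<le> b0 * h ^ N2" by (intro mult_mono) auto
   then show ?thesis unfolding B_def by simp
  qed
  have B1: "1 \<le> B" unfolding B_def by simp
  define kk where "kk w = real (fst w) *\<^sub>R u0 + real (fst (snd w)) *\<^sub>R A u0 + real (snd (snd w)) *\<^sub>R A (A u0)"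
   for w :: "nat \<times> nat \<times> nat"
  \<comment> \<open>The stable leg ends where the stable coordinate is 0 and the unstable leg where
    the unstable coordinate is 0; the second leg moves the stable coordinate only by the bounded
    drift.\<close>
  define zz where "zz w = fw.s.leaf_pt (x + kk w) 0" for w
  define pp where "pp w = bw.s.leaf_pt (zz w) 0" for w
  define I where "I = {..<B} \<times> {..<B} \<times> {..<B}"
  have kkL: "kk w \<in> L" for w unfolding kk_def by (intro L_add L_of_nat u0(1) L_A)
  have nmk: "nm (kk w) \<le> real B * mu" if "w \<in> I" for w
  proof -
   have w: "real (fst w) \<le> real B" "real (fst (snd w)) \<le> real B" "real (snd (snd w)) \<le> real B"
    using that unfolding I_def by auto
   have "nm (kk w) \<le> nm (real (fst w) *\<^sub>R u0 + real (fst (snd w)) *\<^sub>R A u0) + nm (real (snd (snd w)) *\<^sub>R A (A u0))"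
    unfolding kk_def by (rule seminorm_add[OF fw.snmax])
   also have "nm (real (fst w) *\<^sub>R u0 + real (fst (snd w)) *\<^sub>R A u0) \<le> nm (real (fst w) *\<^sub>R u0) + nm (real (fst (snd w)) *\<^sub>R A u0)"
    by (rule seminorm_add[OF fw.snmax])
   finally have "nm (kk w) \<le> real (fst w) * nm u0 + real (fst (snd w)) * nm (A u0) + real (snd (snd w)) * nm (A (A u0))"
    by (simp add: seminorm_scale[OF fw.snmax])
   also have "\<dots> \<le> real B * nm u0 + real B * nm (A u0) + real B * nm (A (A u0))"
    by (intro add_mono mult_right_mono w nn)
   finally show ?thesis by (simp add: mu_def distrib_left)
  qed
  have Xpow: "1 \<le> X ^ N2" using X1 by (rule one_le_power)
  have scale: "r \<le> r * X ^ N2" if "0 \<le> r" for r using mult_left_mono[OF Xpow that] by simp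
  note scale_x = scale[OF nn[of x]]
  have scale_C1: "C1 \<le> C1 * X ^ N2" by (rule scale) (use C1 in simp)
  have Bmu: "real B * mu \<le> muB * X ^ N2"
   using mult_right_mono[OF B_X mu0] by (simp add: muB_def mult_ac)
  have drift_ok: "(lam + e) ^ n * r \<le> 1" if "r \<le> nm x + real B * mu + C1" for r
  proof -
   have "r \<le> (nm x + muB + C1) * X ^ N2"
    unfolding distrib_right using that Bmu scale_x scale_C1 by linarith
   then have "(lam + e) ^ n * r \<le> (nm x + muB + C1) / rho ^ n"
    unfolding X_def by (rule lam_pow_C[rotated 2]) (use nn[of x] bmu C1 in \<open>simp_all\<close>)
   also have "\<dots> \<le> C / rho ^ n"
    using C_parts b00 er KN rho_ge_1[of n] by (intro divide_right_mono) linarith+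
   also have "\<dots> \<le> 1" using CX rho_ge_1[of n] by simp
   finally show ?thesis .
  qed
  define r0 where "r0 = 2 * e * real n"
  have r0X: "r0 \<le> 2 * ee * X"
  proof -
   have "2 * e * real n \<le> 2 * e * (rho ^ n / (rho - 1))"
    using n_le_rho fw.e0 by (intro mult_left_mono) auto
   then show ?thesis by (simp add: r0_def X_def ee_def)
  qed
  have r00: "0 \<le> r0" unfolding r0_def using fw.e0 by simp
  have nmxk: "nm (x + kk w) \<le> nm x + real B * mu" if "w \<in> I" for w
   using seminorm_add[OF fw.snmax, of x "kk w"] nmk[OF that] by linarith
  have zW: "zz w \<in> Ws (x + kk w)" and ns_z: "ns (zz w) = 0" for w
   using fw.s.leaf_pt[of "x + kk w" 0] by (simp_all add: zz_def)
  have pW: "pp w \<in> Wu (zz w)" and nu_p: "nu (pp w) = 0" for w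
   using bw.s.leaf_pt[of "zz w" 0] by (simp_all add: pp_def)
  have z_bd: "nc (zz w) \<le> nm x + real B * mu + 1 + r0" "nu (zz w) \<le> nm x + real B * mu + C1"
   if w: "w \<in> I" for w
  proof -
   have "ns (zz w - (x + kk w)) = ns (x + kk w)"
    using fw.s.p_leaf_pt[of "x + kk w" 0] seminorm_minus[OF fw.sns, of "x + kk w"] by (simp add: zz_def)
   also have "\<dots> \<le> nm x + real B * mu + C1"
    using fw.n_le_nmax(1)[of "x + kk w"] nmxk[OF w] C1 by linarith
   finally have ok: "(lam + e) ^ n * ns (zz w - (x + kk w)) \<le> 1" by (rule drift_ok)
   note dr = fw.drift[OF zW ok]
   have "nc (zz w) \<le> nc (zz w - (x + kk w)) + nc (x + kk w)"
    using seminorm_add[OF fw.snc, of "zz w - (x + kk w)" "x + kk w"] by simp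
   then show "nc (zz w) \<le> nm x + real B * mu + 1 + r0"
    using dr(1) fw.n_le_nmax(2)[of "x + kk w"] nmxk[OF w] unfolding r0_def by linarith
   have "nu (zz w) \<le> nu (zz w - (x + kk w)) + nu (x + kk w)"
    using seminorm_add[OF fw.snu, of "zz w - (x + kk w)" "x + kk w"] by simp
   then show "nu (zz w) \<le> nm x + real B * mu + C1"
    using dr(2) fw.n_le_nmax(3)[of "x + kk w"] nmxk[OF w] unfolding C1_def by linarith
  qed
  have p_bd: "nc (pp w) \<le> nm x + real B * mu + 2 + 2 * r0" "ns (pp w) \<le> C1" if w: "w \<in> I" for w
  proof -
   have "nu (pp w - zz w) = nu (zz w)"
    using bw.s.p_leaf_pt[of "zz w" 0] seminorm_minus[OF fw.snu, of "zz w"] by (simp add: pp_def)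
   also have "\<dots> \<le> nm x + real B * mu + C1" by (rule z_bd(2)[OF w])
   finally have ok: "(lam + e) ^ n * nu (pp w - zz w) \<le> 1" by (rule drift_ok)
   note dr = bw.drift[OF pW ok]
   have "nc (pp w) \<le> nc (pp w - zz w) + nc (zz w)"
    using seminorm_add[OF fw.snc, of "pp w - zz w" "zz w"] by simp
   then show "nc (pp w) \<le> nm x + real B * mu + 2 + 2 * r0"
    using dr(1) z_bd(1)[OF w] unfolding r0_def by linarith
   have "ns (pp w) \<le> ns (pp w - zz w) + ns (zz w)"
    using seminorm_add[OF fw.sns, of "pp w - zz w" "zz w"] by simp
   then show "ns (pp w) \<le> C1" using dr(2) ns_z[of w] unfolding C1_def by linarith
  qed
  have r0B: "r0 \<le> 4 * ee * real B"
  proof -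
   have "r0 \<le> 2 * ee * X" by (rule r0X)
   also have "\<dots> \<le> 2 * ee * (2 * real B)"
    using h2(2) hB er by (intro mult_left_mono) auto
   also have "\<dots> = 4 * ee * real B" by simp
   finally show ?thesis .
  qed
  have ell_p: "cmod (ell (pp w)) \<le> real (c1 * B)" if w: "w \<in> I" for w
  proof -
   have B1': "1 \<le> real B" using B1 by simp
   have "cmod (ell (pp w)) \<le> nm x + real B * mu + 2 + 2 * r0" using p_bd(1)[OF w] by (simp add: nc_ell)
   also have "\<dots> \<le> nm x * real B + real B * mu + 2 * real B + 8 * ee * real B"
    using mult_left_mono[OF B1' nn[of x]] B1' r0B by linarith
   also have "\<dots> = (nm x + mu + 2 + 8 * ee) * real B" by (simp add: algebra_simps)
   also have "\<dots> \<le> real c1 * real B" by (rule mult_right_mono[OF c1]) simp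
   finally show ?thesis by simp
  qed
  define P' where "P' w = Ps (pp w) + Pu (pp w)" for w
  have P'_diff: "P' w - P' w' = Ps (pp w - pp w') + Pu (pp w - pp w')" for w w'
   by (simp add: P'_def linear_diff[OF fw.linPs] linear_diff[OF fw.linPu])
  have P'_norm: "norm (P' w) \<le> real b2" if w: "w \<in> I" for w
  proof -
   have "Pu (pp w) = 0" by (rule fw.Pu_zero[OF nu_p])
   then have "norm (P' w) \<le> K * (ns (Ps (pp w)) + nc (Ps (pp w)) + nu (Ps (pp w)))"
    using fw.normK by (simp add: P'_def)
   also have "\<dots> = K * ns (pp w)" by (simp add: fw.nsPs fw.ncP fw.nuP)
   also have "\<dots> \<le> K * C1" using p_bd(2)[OF w] fw.K0 by (intro mult_left_mono) auto
   also have "\<dots> \<le> 3 * K * C1" using fw.K0 C1 by simp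
   finally show ?thesis using b2 by linarith
  qed
  \<comment> \<open>The grid coordinates: real and imaginary part of the centre coordinate, and the
    Euclidean coordinates of the stable and unstable part together.\<close>
  define c where "c j w = (case j of Inl True \<Rightarrow> Re (ell (pp w)) | Inl False \<Rightarrow> Im (ell (pp w)) | Inr v \<Rightarrow> P' w \<bullet> v)"
   for j :: "bool + 'a" and w
  define b where "b j = (case j of Inl _ \<Rightarrow> c1 * B | Inr _ \<Rightarrow> b2)" for j :: "bool + 'a"
  define J where "J = (UNIV :: bool set) <+> (Basis :: 'a set)"
  obtain w w' where ww: "w \<in> I" "w' \<in> I" "w \<noteq> w'" and cl: "\<And>j. j \<in> J \<Longrightarrow> \<bar>c j w - c j w'\<bar> \<le> 1 / real h"
  proof (rule pigeonhole_grid[of I J h c b])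
   show "finite I" "finite J" by (simp_all add: I_def J_def)
   show "0 < h" using h by simp
   show "\<bar>c j i\<bar> \<le> real (b j)" if "i \<in> I" "j \<in> J" for i j
   proof (cases j)
    case (Inl y)
    then show ?thesis
     using ell_p[OF that(1)] abs_Re_le_cmod[of "ell (pp i)"] abs_Im_le_cmod[of "ell (pp i)"]
     by (cases y) (simp_all add: c_def b_def)
   next
    case (Inr v)
    then have "v \<in> Basis" using that(2) by (auto simp: J_def)
    then show ?thesis using P'_norm[OF that(1)] Basis_le_norm[of v "P' i"] Inr
     by (simp add: c_def b_def)
   qed
   have "(\<Prod>j\<in>J. 2 * h * b j + 1) = (2 * h * (c1 * B) + 1) ^ 2 * (2 * h * b2 + 1) ^ DIM('a)"
    unfolding J_def by (subst prod.Plus) (simp_all add: b_def UNIV_bool power2_eq_square)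
   also have "\<dots> \<le> (3 * h * (c1 * B)) ^ 2 * (3 * h * b2) ^ DIM('a)"
   proof (intro mult_mono power_mono)
    have "1 * 1 \<le> h * (c1 * B)" using h c11 B1 by (intro mult_mono) auto
    then show "2 * h * (c1 * B) + 1 \<le> 3 * h * (c1 * B)" by simp
    have "1 * 1 \<le> h * b2" using h b21 by (intro mult_mono) auto
    then show "2 * h * b2 + 1 \<le> 3 * h * b2" by simp
   qed auto
   also have "\<dots> = B ^ 2 * (b0 * h ^ N2)"
    unfolding b0_def N2 by (simp add: power_mult_distrib power_add algebra_simps power2_eq_square)
   also have "\<dots> < B ^ 2 * B" using B1 unfolding B_def by simp
   also have "\<dots> = card I" by (simp add: I_def power2_eq_square)
   finally show "(\<Prod>j\<in>J. 2 * h * b j + 1) < card I" .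
  qed blast
  have inv_h: "1 / real h \<le> 2 / X"
   using h h2 X1 by (simp add: field_simps)
  have close: "nm (pp w - pp w') \<le> C / rho ^ n"
  proof -
   let ?d = "pp w - pp w'"
   have "norm (P' w - P' w') \<le> (\<Sum>v\<in>Basis. \<bar>(P' w - P' w') \<bullet> v\<bar>)" by (rule norm_le_l1)
   also have "\<dots> \<le> (\<Sum>v\<in>(Basis::'a set). 1 / real h)"
   proof (rule sum_mono)
    fix v :: 'a assume "v \<in> Basis"
    then show "\<bar>(P' w - P' w') \<bullet> v\<bar> \<le> 1 / real h"
     using cl[of "Inr v"] by (simp add: J_def c_def inner_diff_left InrI)
   qed
   finally have nP: "norm (P' w - P' w') \<le> DIM('a) * (1 / real h)" by simp
   have "ns ?d \<le> K * norm (P' w - P' w')"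
   proof -
    have "ns (P' w - P' w') = ns (Ps ?d)"
     unfolding P'_diff by (rule seminorm_eq[OF fw.sns]) (simp add: fw.nsP)
    then show ?thesis using fw.nsK[of "P' w - P' w'"] by (simp add: fw.nsPs)
   qed
   moreover have "nu ?d = 0" using seminorm_diff[OF fw.snu, of "pp w" "pp w'"] nu_p fw.n_nonneg(3)[of ?d] by simp
   moreover have "nc ?d \<le> 2 * (1 / real h)"
   proof -
    have "nc ?d \<le> \<bar>Re (ell ?d)\<bar> + \<bar>Im (ell ?d)\<bar>" unfolding nc_ell by (rule cmod_le)
    also have "\<dots> \<le> 1 / real h + 1 / real h"
     using cl[of "Inl True"] cl[of "Inl False"]
     by (intro add_mono) (simp_all add: J_def c_def linear_diff[OF lin_ell] InlI)
    finally show ?thesis by simp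
   qed
   moreover have "K * norm (P' w - P' w') \<le> K * (DIM('a) * (1 / real h))"
    using nP fw.K0 by (intro mult_left_mono) auto
   moreover have "0 \<le> K * (DIM('a) * (1 / real h))" "0 \<le> 2 * (1 / real h)" using fw.K0 by simp_all
   ultimately have "nm ?d \<le> K * (DIM('a) * (1 / real h)) + 2 * (1 / real h)"
    unfolding fw.nmax_def by linarith
   also have "\<dots> = (KN + 2) * (1 / real h)" by (simp add: KN_def algebra_simps)
   also have "\<dots> \<le> (KN + 2) * (2 / X)" using KN by (intro mult_left_mono inv_h) auto
   also have "\<dots> = (2 * KN + 4) / X" by simp
   also have "\<dots> \<le> C / X" using C_parts nn[of x] bmu b00 er C1 X1 by (intro divide_right_mono) linarith+
   finally show ?thesis by (simp add: X_def)
  qed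
  have bnd: "r \<le> C * (rho ^ n) ^ N2" if "r \<le> nm x + real B * mu + 2 + 2 * r0 + C1" for r
  proof -
   have "X \<le> X ^ N2" using X1 N2 power_increasing[of 1 N2 X] by simp
   then have "2 * r0 \<le> 4 * ee * X ^ N2"
    using r0X mult_left_mono[of X "X ^ N2" "2 * ee"] er by linarith
   then have "r \<le> nm x * X ^ N2 + muB * X ^ N2 + 2 * X ^ N2 + 4 * ee * X ^ N2 + C1 * X ^ N2"
    using that Bmu scale_x scale_C1 Xpow by linarith
   also have "\<dots> = (nm x + muB + 2 + 4 * ee + C1) * X ^ N2"
    by (simp add: distrib_right)
   also have "\<dots> \<le> C * X ^ N2"
    using C_parts b00 KN Xpow by (intro mult_right_mono) linarith+
   finally show ?thesis by (simp add: X_def)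
  qed
  have z_nm: "nm (zz w) \<le> C * (rho ^ n) ^ N2" if "w \<in> I" for w
  proof (rule bnd)
   have "0 \<le> real B * mu" using mu0 by simp
   then show "nm (zz w) \<le> nm x + real B * mu + 2 + 2 * r0 + C1"
    using z_bd[OF that] ns_z[of w] nn[of x] r00 C1 unfolding fw.nmax_def by linarith
  qed
  have p_nm: "nm (pp w) \<le> C * (rho ^ n) ^ N2" if "w \<in> I" for w
  proof (rule bnd)
   have "0 \<le> real B * mu" using mu0 by simp
   then show "nm (pp w) \<le> nm x + real B * mu + 2 + 2 * r0 + C1"
    using p_bd[OF that] nu_p[of w] nn[of x] r00 C1 unfolding fw.nmax_def by linarith
  qed
  have k_nm: "nm (kk w) \<le> C * (rho ^ n) ^ N2" if "w \<in> I" for w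
   by (rule bnd) (use nmk[OF that] nn[of x] r00 C1 in linarith)
  define v0 v1 v2 where "v0 = int (fst w) - int (fst w')" and "v1 = int (fst (snd w)) - int (fst (snd w'))"
   and "v2 = int (snd (snd w)) - int (snd (snd w'))"
  have vne: "(v0, v1, v2) \<noteq> (0, 0, 0)" using ww(3) by (auto simp: v0_def v1_def v2_def prod_eq_iff)
  \<comment> \<open>Each application of \<open>A\<close> multiplies the centre coordinate by
    \<open>zeta\<close>, so the difference has an integer polynomial in \<open>zeta\<close> of
    degree at most 2 as factor, which is the situation of \<open>liouville\<close>.\<close>
  have ell_k: "ell (kk w - kk w') = (of_int v0 + of_int v1 * zeta + of_int v2 * zeta ^ 2) * ell u0"
   by (simp add: kk_def v0_def v1_def v2_def linear_diff[OF lin_ell] linear_add[OF lin_ell]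
     linear_scale[OF lin_ell] ell_A scaleR_conv_of_real algebra_simps power2_eq_square)
  have vB: "\<bar>of_int v0\<bar> \<le> real B" "\<bar>of_int v1\<bar> \<le> real B" "\<bar>of_int v2\<bar> \<le> real B"
   using ww(1,2) unfolding v0_def v1_def v2_def I_def by (auto simp: abs_le_iff)
  have "cL * cmod (ell u0) \<le> cmod (of_int v0 + of_int v1 * zeta + of_int v2 * zeta ^ 2) *
    (1 + \<bar>of_int v0\<bar> + \<bar>of_int v1\<bar> + \<bar>of_int v2\<bar>) ^ QL * cmod (ell u0)"
   by (rule mult_right_mono[OF liouville[OF vne]]) simp
  also have "\<dots> = cmod (ell (kk w - kk w')) * (1 + \<bar>of_int v0\<bar> + \<bar>of_int v1\<bar> + \<bar>of_int v2\<bar>) ^ QL"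
   unfolding ell_k norm_mult by simp
  also have "\<dots> \<le> cmod (ell (kk w - kk w')) * (4 * C * (rho ^ n) ^ N2) ^ QL"
  proof (intro mult_left_mono power_mono)
   have "1 + \<bar>of_int v0\<bar> + \<bar>of_int v1\<bar> + \<bar>of_int v2\<bar> \<le> 1 * X ^ N2 + 3 * (beta * X ^ N2)"
    using vB B_X Xpow by linarith
   also have "\<dots> = (1 + 3 * beta) * X ^ N2" by (simp add: distrib_right)
   also have "\<dots> \<le> (4 * C) * X ^ N2"
    using C_parts nn[of x] bmu b00 er C1 KN Xpow by (intro mult_right_mono) linarith+
   finally show "1 + \<bar>of_int v0\<bar> + \<bar>of_int v1\<bar> + \<bar>of_int v2\<bar> \<le> 4 * C * (rho ^ n) ^ N2"
    by (simp add: X_def)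
  qed auto
  finally have low: "cL * cmod (ell u0) \<le> cmod (ell (kk w - kk w')) * (4 * C * (rho ^ n) ^ N2) ^ QL" .
  show ?thesis unfolding close_at_def
   using kkL zW pW close low ww(1,2) z_nm p_nm k_nm by blast
 qed
 then show ?thesis using Cge by blast
qed

end

lemma eventually_power_gt:
 assumes "1 < (r::real)"
 shows "\<forall>\<^sub>F n in sequentially. C \<le> r ^ n"
proof -
 obtain N where N: "C < r ^ N" using real_arch_pow[OF assms] by blast
 have "C \<le> r ^ n" if "N \<le> n" for n
  using N power_increasing[OF that, of r] assms by linarith
 then show ?thesis unfolding eventually_sequentially by blast
qed

context pert_lattice
begin

interpretation sw: pert_pair Ai A Pu Pc Ps nu nc ns lam K Fi DFi F DF e kap by (rule swap)

lemma sw_sat: "sw.sat S = sat S"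
 by (auto simp: sat_def sw.sat_def)

lemma eventually_rho: "\<forall>\<^sub>F n in sequentially. C \<le> rho ^ n"
 by (rule eventually_power_gt[OF rho])

text \<open>A gap of order \<open>1 / rho ^ n\<close> outlasts the loss \<open>(th ^ 2) ^ n\<close>
  of two legs.\<close>

lemma eventually_th:
 assumes "0 < d"
 shows "\<forall>\<^sub>F n in sequentially. C * (th ^ 2) ^ n / rho ^ n < d"
proof -
 have "(\<lambda>n. C * (th ^ 2 / rho) ^ n) \<longlonglongrightarrow> C * 0"
  using th(2) rho th_rho by (intro tendsto_intros LIMSEQ_power_zero) simp
 moreover have "C * (T / rho) ^ n = C * T ^ n / rho ^ n" for T n by (simp add: power_divide)
 ultimately have "(\<lambda>n. C * (th ^ 2) ^ n / rho ^ n) \<longlonglongrightarrow> C * 0" by (simp only:)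
 then have "(\<lambda>n. C * (th ^ 2) ^ n / rho ^ n) \<longlonglongrightarrow> 0" by (simp only: mult_zero_right)
 then show ?thesis using assms by (rule order_tendstoD)
qed

definition inv_L :: "'a set \<Rightarrow> bool" where
 "inv_L S \<longleftrightarrow> (\<forall>x\<in>S. \<forall>k\<in>L. x + k \<in> S)"

lemma path_component_shift:
 assumes "inv_L V" "k \<in> L" "path_component V a b"
 shows "path_component V (a + k) (b + k)"
proof -
 obtain g where g: "path g" "path_image g \<subseteq> V" "pathstart g = a" "pathfinish g = b"
  using assms(3) unfolding path_component_def by blast
 have "path (\<lambda>t. g t + k)" using g(1) unfolding path_def by (intro continuous_intros)
 moreover have "path_image (\<lambda>t. g t + k) \<subseteq> V"
  using g(2) assms(1,2) unfolding path_image_def inv_L_def by auto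
 ultimately show ?thesis using g(3,4) unfolding path_component_def pathstart_def pathfinish_def by blast
qed

text \<open>
 Among the translates of a ball of \<open>V\<close> two become linked inside \<open>V\<close>: by \<open>close_pair\<close> two
 translates can be moved close to each other, and by the displacement lemma one of the
 moves can be undone starting from the other point.
\<close>

lemma V_line:
 assumes V: "open V" "sat V" "inv_L V" and y: "y \<in> V"
 obtains k where "k \<in> L" "ell k \<noteq> 0" "path_component V y (y + k)"
proof -
 obtain r where r: "0 < r" "ball y r \<subseteq> V" using V(1) y open_contains_ball by blast
 obtain C where C: "1 \<le> C" "\<And>n. C \<le> rho ^ n \<Longrightarrow> close_at y C n" using close_pair by blast
 define C2 where "C2 = nm y + 2 * C"
 have "\<forall>\<^sub>F n in sequentially. C \<le> rho ^ n \<and> (3 * K * 82 * C2) * (th ^ 2) ^ n / rho ^ n < r"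
  by (intro eventually_conj eventually_rho eventually_th r(1))
 then obtain n where n: "C \<le> rho ^ n" "(3 * K * 82 * C2) * (th ^ 2) ^ n / rho ^ n < r"
  using eventually_happens'[OF sequentially_bot] by blast
 let ?X = "rho ^ n"
 have X1: "1 \<le> ?X" by (rule rho_ge_1)
 have Xp: "1 \<le> ?X ^ N2" using X1 by (rule one_le_power)
 obtain k1 k2 z1 z2 p1 p2 where k: "k1 \<in> L" "k2 \<in> L"
  and W: "z1 \<in> Ws (y + k1)" "p1 \<in> Wu z1" "z2 \<in> Ws (y + k2)" "p2 \<in> Wu z2"
  and cl: "nm (p1 - p2) \<le> C / ?X"
  and bd: "nm k1 \<le> C * ?X ^ N2" "nm z1 \<le> C * ?X ^ N2" "nm p1 \<le> C * ?X ^ N2"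
  and low: "cL * cmod (ell u0) \<le> cmod (ell (k1 - k2)) * (4 * C * ?X ^ N2) ^ QL"
  using C(2)[OF n(1)] unfolding close_at_def by blast
 \<comment> \<open>A path component of a saturated set is saturated, so tracing from
   \<open>p2\<close> does not leave it.\<close>
 define S where "S = path_component_set V (y + k2)"
 have yk: "y + k \<in> V" if "k \<in> L" for k using y V(3) that by (simp add: inv_L_def)
 have S: "sat S" unfolding S_def by (rule sat_path_component[OF V(2) yk[OF k(2)]])
 have "y + k2 \<in> S" unfolding S_def using yk[OF k(2)] by (simp add: path_component_refl)
 then have p2S: "p2 \<in> S" using S W(3,4) unfolding sat_def by blast
 define D where "D = C2 / ?X"
 have C2: "0 \<le> C2" "C \<le> C2" "2 * C \<le> C2" using C(1) fw.n_nonneg(4)[of y] unfolding C2_def by linarith+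
 have j: "N2 \<le> 2 * N2 + N2 * QL" by simp
 have small: "(lam + e) ^ n * x \<le> D" if "x \<le> C2 * ?X ^ N2" for x
  unfolding D_def by (rule lam_pow_C[OF j C2(1) that])
 have nzp: "nu (z1 - p1) \<le> C2 * ?X ^ N2"
 proof -
  have "nu (z1 - p1) \<le> nm z1 + nm p1"
   using fw.n_le_nmax(3)[of "z1 - p1"] seminorm_diff[OF fw.snmax, of z1 p1] by linarith
  also have "\<dots> \<le> 2 * C * ?X ^ N2" using bd by linarith
  also have "\<dots> \<le> C2 * ?X ^ N2" using C2 Xp by (intro mult_right_mono) auto
  finally show ?thesis .
 qed
 have nyk: "ns (y + k1 - z1) \<le> C2 * ?X ^ N2"
 proof -
  have "ns (y + k1 - z1) \<le> nm (y + k1) + nm z1"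
   using fw.n_le_nmax(1)[of "y + k1 - z1"] seminorm_diff[OF fw.snmax, of "y + k1" z1] by linarith
  also have "\<dots> \<le> nm y + nm k1 + nm z1" using seminorm_add[OF fw.snmax, of y k1] by linarith
  also have "\<dots> \<le> nm y * ?X ^ N2 + 2 * C * ?X ^ N2"
   using bd mult_left_mono[OF Xp fw.n_nonneg(4)[of y]] by linarith
  finally show ?thesis by (simp add: C2_def distrib_right)
 qed
 have pD: "bw.nmax (p2 - p1) \<le> D"
 proof -
  have "C / ?X \<le> D" unfolding D_def using C2 X1 by (intro divide_right_mono) auto
  then show ?thesis using cl seminorm_commute[OF fw.snmax, of p1 p2] by (simp add: nmax_swap)
 qed
 \<comment> \<open>The path from \<open>y + k1\<close> to \<open>p1\<close> is traced backwards,
   with its unstable leg first; hence the version with time reversed.\<close>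
 obtain w where w: "w \<in> S" "bw.nmax (w - (y + k1)) \<le> 82 * D * (th ^ 2) ^ n"
  using sw.double_displacement[OF bw.s.W_sym[OF W(2)] fw.s.W_sym[OF W(1)] pD p2S _ small[OF nzp] small[OF nyk]] S
  by (auto simp: sw_sat)
 have "dist (y + k1) w < r"
 proof -
  have "norm (w - (y + k1)) \<le> 3 * K * nm (w - (y + k1))" by (rule fw.norm_le_nmax)
  also have "\<dots> \<le> 3 * K * (82 * D * (th ^ 2) ^ n)"
   using w(2) fw.K0 by (intro mult_left_mono) (auto simp: nmax_swap)
  also have "\<dots> = (3 * K * 82 * C2) * (th ^ 2) ^ n / ?X" by (simp add: D_def)
  also have "\<dots> < r" by (rule n(2))
  finally show ?thesis by (simp add: dist_norm norm_minus_commute)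
 qed
 then have wb: "w \<in> ball (y + k1) r" by simp
 have ballV: "ball (y + k1) r \<subseteq> V"
 proof
  fix v assume "v \<in> ball (y + k1) r"
  then have "v - k1 \<in> ball y r" by (simp add: dist_norm algebra_simps)
  then have "v - k1 + k1 \<in> V" using r(2) V(3) k(1) unfolding inv_L_def by blast
  then show "v \<in> V" by simp
 qed
 have "y + k1 \<in> ball (y + k1) r" using r(1) by simp
 then have "path_component (ball (y + k1) r) w (y + k1)"
  using convex_imp_path_connected[OF convex_ball] wb unfolding path_connected_component by blast
 then have "path_component V w (y + k1)" by (rule path_component_of_subset[OF ballV])
 moreover have "path_component V (y + k2) w" using w(1) by (simp add: S_def)
 ultimately have "path_component V (y + k2) (y + k1)" using path_component_trans by blast
 from path_component_shift[OF V(3) L_minus[OF k(2)] this]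
 have "path_component V y (y + (k1 - k2))" by (simp add: algebra_simps)
 moreover have "ell (k1 - k2) \<noteq> 0" using low cL u0(2) by (auto simp: mult_le_0_iff)
 ultimately show ?thesis using that L_diff[OF k] by blast
qed

text \<open>The path from \<open>y\<close> to \<open>y + k\<close> is compact in an open set, so it
  has a tube of positive width, which the lattice carries along to all translates.\<close>

lemma V_quasi_line:
 assumes V: "open V" "inv_L V" and k: "k \<in> L" "path_component V y (y + k)"
 obtains d M \<delta> where "continuous_on UNIV d" "\<And>t. nm (d t - t *\<^sub>R k) \<le> M" "0 < \<delta>"
  "\<And>t v. nm (v - d t) < \<delta> \<Longrightarrow> v \<in> V"
proof -
 obtain g where g: "path g" "path_image g \<subseteq> V" "pathstart g = y" "pathfinish g = y + k"
  using k(2) unfolding path_component_def by blast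
 define d where "d = (\<lambda>s. g (frac s) + of_int \<lfloor>s\<rfloor> *\<^sub>R k)"
 have cd: "continuous_on UNIV d" unfolding d_def
  by (rule continuous_quasi_periodic) (use g in auto)
 have gi: "g (frac t) \<in> path_image g" for t
  unfolding path_image_def using frac_ge_0[of t] frac_lt_1[of t] by (intro imageI) simp
 have cpt: "compact (path_image g)" by (rule compact_path_image[OF g(1)])
 obtain b where b: "\<And>x. x \<in> path_image g \<Longrightarrow> norm x \<le> b"
  using compact_imp_bounded[OF cpt] unfolding bounded_iff by blast
 have "nm (d t - t *\<^sub>R k) \<le> K * b + nm k" for t
 proof -
  have eq: "d t - t *\<^sub>R k = g (frac t) - frac t *\<^sub>R k"
   by (simp add: d_def frac_def scaleR_diff_left)
  have "nm (g (frac t) - frac t *\<^sub>R k) \<le> nm (g (frac t)) + nm (frac t *\<^sub>R k)"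
   by (rule seminorm_diff[OF fw.snmax])
  moreover have "nm (frac t *\<^sub>R k) \<le> nm k"
   using frac_ge_0[of t] frac_lt_1[of t] fw.n_nonneg(4)[of k]
   by (simp add: seminorm_scale[OF fw.snmax] mult_left_le_one_le less_imp_le)
  moreover have "nm (g (frac t)) \<le> K * b"
  proof -
   have "nm (g (frac t)) \<le> K * norm (g (frac t))" by (rule fw.nmax_le_norm)
   also have "\<dots> \<le> K * b" using b[OF gi] fw.K0 by (intro mult_left_mono) auto
   finally show ?thesis .
  qed
  ultimately show ?thesis unfolding eq by linarith
 qed
 note dM = this
 obtain eps where eps: "0 < eps" "\<And>x z. x \<in> path_image g \<Longrightarrow> z \<in> - V \<Longrightarrow> eps \<le> dist x z"
 proof -
  have "path_image g \<inter> - V = {}" using g(2) by blast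
  from separate_compact_closed[OF cpt closed_Compl[OF V(1)] this]
  show ?thesis using that by blast
 qed
 define \<delta> where "\<delta> = eps / (3 * K)"
 have d0: "0 < \<delta>" unfolding \<delta>_def using eps(1) fw.K0 by simp
 have "v \<in> V" if v: "nm (v - d t) < \<delta>" for t v
 proof -
  let ?k = "of_int \<lfloor>t\<rfloor> *\<^sub>R k"
  have "norm (v - d t) \<le> 3 * K * nm (v - d t)" by (rule fw.norm_le_nmax)
  also have "\<dots> < 3 * K * \<delta>" using v fw.K0 by (intro mult_strict_left_mono) auto
  also have "\<dots> = eps" unfolding \<delta>_def using fw.K0 by simp
  finally have "dist (g (frac t)) (v - ?k) < eps"
   by (simp add: d_def dist_norm norm_minus_commute algebra_simps)
  have "v - ?k \<in> V"
  proof (rule ccontr)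
   assume "v - ?k \<notin> V"
   then have "eps \<le> dist (g (frac t)) (v - ?k)" by (intro eps(2)[OF gi]) simp
   with \<open>dist (g (frac t)) (v - ?k) < eps\<close> show False by simp
  qed
  then have "v - ?k + ?k \<in> V" using V(2) L_of_int[OF k(1)] unfolding inv_L_def by blast
  then show ?thesis by simp
 qed
 then show ?thesis by (rule that[OF cd dM d0])
qed

text \<open>The counterpart of \<open>V_line\<close> for a closed set, with one small jump in each period.\<close>

lemma chain:
 assumes E: "sat E" "inv_L E" and x: "x \<in> E"
 obtains C where "1 \<le> C" "\<And>n. C \<le> rho ^ n \<Longrightarrow> \<exists>c k. k \<in> L \<and> continuous_on UNIV c \<and>
   (\<forall>s. nm (c s - s *\<^sub>R k) \<le> C * (rho ^ n) ^ N2) \<and> (\<forall>s. \<exists>w\<in>E. nm (w - c s) \<le> C / rho ^ n) \<and>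
   nm k \<le> C * (rho ^ n) ^ N2 \<and> cL * cmod (ell u0) \<le> cmod (ell k) * (C * (rho ^ n) ^ N2) ^ QL"
proof -
 obtain C where C: "1 \<le> C" "\<And>n. C \<le> rho ^ n \<Longrightarrow> close_at x C n" using close_pair by blast
 \<comment> \<open>Absorbs the legs, bounded by \<open>2 * nm x + 3 * C\<close>, the period, bounded
   by \<open>2 * C\<close>, and the factor 4 of the Liouville bound.\<close>
 define C' where "C' = 2 * nm x + 5 * C"
 have nx: "0 \<le> nm x" by (rule fw.n_nonneg)
 have C': "1 \<le> C'" "C \<le> C'" "4 * C \<le> C'" using C(1) nx unfolding C'_def by linarith+
 have "\<exists>c k. k \<in> L \<and> continuous_on UNIV c \<and>
   (\<forall>s. nm (c s - s *\<^sub>R k) \<le> C' * (rho ^ n) ^ N2) \<and> (\<forall>s. \<exists>w\<in>E. nm (w - c s) \<le> C' / rho ^ n) \<and>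
   nm k \<le> C' * (rho ^ n) ^ N2 \<and> cL * cmod (ell u0) \<le> cmod (ell k) * (C' * (rho ^ n) ^ N2) ^ QL"
  if n: "C' \<le> rho ^ n" for n
 proof -
  let ?X = "rho ^ n"
  have X1: "1 \<le> ?X" by (rule rho_ge_1)
  define Y where "Y = ?X ^ N2"
  have Y1: "1 \<le> Y" unfolding Y_def using X1 by (rule one_le_power)
  obtain k1 k2 z1 z2 p1 p2 where k: "k1 \<in> L" "k2 \<in> L"
   and W: "z1 \<in> Ws (x + k1)" "p1 \<in> Wu z1" "z2 \<in> Ws (x + k2)" "p2 \<in> Wu z2"
   and cl: "nm (p1 - p2) \<le> C / ?X"
   and bd: "nm k1 \<le> C * Y" "nm k2 \<le> C * Y" "nm z1 \<le> C * Y" "nm z2 \<le> C * Y"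
    "nm p1 \<le> C * Y" "nm p2 \<le> C * Y"
   and low: "cL * cmod (ell u0) \<le> cmod (ell (k1 - k2)) * (4 * C * Y) ^ QL"
  proof -
   have "C \<le> ?X" using C'(2) n by linarith
   from C(2)[OF this] show ?thesis using that unfolding close_at_def Y_def[symmetric] by blast
  qed
  define k where "k = k1 - k2"
  \<comment> \<open>The legs run inside \<open>E\<close>; only the short segment between
    \<open>p2\<close> and \<open>p1\<close> may leave it, which explains the tolerance
    \<open>C / ?X\<close>.\<close>
  define S where "S = {v. nm v \<le> (2 * nm x + 3 * C) * Y \<and> (\<exists>w\<in>E. nm (w - v) \<le> C / ?X)}"
  have CX: "0 \<le> C / ?X" using C(1) X1 by simp
  have SE: "v \<in> S" if "v \<in> E" "nm v \<le> (2 * nm x + 3 * C) * Y" for v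
   unfolding S_def using that CX by (auto intro!: bexI[of _ v] simp: seminorm_zero[OF fw.snmax])
  have tri: "nm v \<le> 2 * nm a + nm b" if "nm (v - a) \<le> nm (b - a)" for v a b
  proof -
   have "nm v \<le> nm (v - a) + nm a" using seminorm_add[OF fw.snmax, of "v - a" a] by simp
   then show ?thesis using that seminorm_diff[OF fw.snmax, of b a] by linarith
  qed
  have xk: "x + j \<in> E" if "j \<in> L" for j using x E(2) that by (simp add: inv_L_def)
  have nxY: "nm x \<le> nm x * Y" using mult_left_mono[OF Y1 nx] by simp
  have legs: "path_component S (x + j) z \<and> path_component S z p"
   if j: "j \<in> L" "nm j \<le> C * Y" and z: "z \<in> Ws (x + j)" "nm z \<le> C * Y"
    and p: "p \<in> Wu z" "nm p \<le> C * Y" for j z p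
  proof
   have zE: "z \<in> E" using z(1) xk[OF j(1)] E(1) unfolding sat_def by blast
   show "path_component S (x + j) z"
   proof (rule path_component_of_subset[OF _ leaf_path[OF z(1)]], rule subsetI)
    fix v assume v: "v \<in> Ws (x + j) \<inter> {v. nm (v - (x + j)) \<le> nm (z - (x + j))}"
    show "v \<in> S"
    proof (rule SE)
     show "v \<in> E" using v xk[OF j(1)] E(1) unfolding sat_def by blast
     have "nm v \<le> 2 * nm (x + j) + nm z" using v by (intro tri) auto
     also have "\<dots> \<le> 2 * nm x + 2 * nm j + nm z" using seminorm_add[OF fw.snmax, of x j] by linarith
     also have "\<dots> \<le> 2 * (nm x * Y) + 3 * (C * Y)" using nxY j(2) z(2) by linarith
     finally show "nm v \<le> (2 * nm x + 3 * C) * Y" by (simp add: algebra_simps)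
    qed
   qed
   show "path_component S z p"
   proof (rule path_component_of_subset[OF _ leaf_path_u[OF p(1)]], rule subsetI)
    fix v assume v: "v \<in> Wu z \<inter> {v. nm (v - z) \<le> nm (p - z)}"
    show "v \<in> S"
    proof (rule SE)
     show "v \<in> E" using v zE E(1) unfolding sat_def by blast
     have "nm v \<le> 2 * nm z + nm p" using v by (intro tri) auto
     also have "\<dots> \<le> 2 * (nm x * Y) + 3 * (C * Y)" using nxY nx z(2) p(2) by linarith
     finally show "nm v \<le> (2 * nm x + 3 * C) * Y" by (simp add: algebra_simps)
    qed
   qed
  qed
  have pcS: "path_component S (x + k2) (x + k1)"
  proof -
   have p2E: "p2 \<in> E" using W(3,4) xk[OF k(2)] E(1) unfolding sat_def by blast
   have "closed_segment p2 p1 \<subseteq> S"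
   proof
    fix v assume "v \<in> closed_segment p2 p1"
    then obtain t where t: "0 \<le> t" "t \<le> 1" "v = (1 - t) *\<^sub>R p2 + t *\<^sub>R p1" by (auto simp: in_segment)
    have "v - p2 = t *\<^sub>R (p1 - p2)" by (simp add: t(3) algebra_simps)
    then have vp: "nm (v - p2) \<le> nm (p1 - p2)"
     using t fw.n_nonneg(4)[of "p1 - p2"] by (simp add: seminorm_scale[OF fw.snmax] mult_left_le_one_le)
    then have "nm v \<le> 2 * nm p2 + nm p1" by (rule tri)
    also have "\<dots> \<le> 2 * (nm x * Y) + 3 * (C * Y)" using nxY nx bd by linarith
    finally have "nm v \<le> (2 * nm x + 3 * C) * Y" by (simp add: algebra_simps)
    moreover have "nm (p2 - v) \<le> C / ?X" using vp cl seminorm_commute[OF fw.snmax, of p2 v] by linarith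
    ultimately show "v \<in> S" unfolding S_def using p2E by blast
   qed
   then have "path_component S p2 p1"
   proof (rule path_component_of_subset)
    show "path_component (closed_segment p2 p1) p2 p1"
     using convex_imp_path_connected[OF convex_closed_segment[of p2 p1]]
     unfolding path_connected_component by blast
   qed
   note mid = this
   have l1: "path_component S (x + k1) z1" "path_component S z1 p1"
    using legs[OF k(1) bd(1) W(1) bd(3) W(2) bd(5)] by auto
   have l2: "path_component S (x + k2) z2" "path_component S z2 p2"
    using legs[OF k(2) bd(2) W(3) bd(4) W(4) bd(6)] by auto
   have "path_component S (x + k2) p1"
    by (rule path_component_trans[OF path_component_trans[OF l2] mid])
   moreover have "path_component S p1 (x + k1)"
    by (rule path_component_sym[OF path_component_trans[OF l1]])
   ultimately show ?thesis by (rule path_component_trans)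
  qed
  then obtain g where g: "path g" "path_image g \<subseteq> S" "pathstart g = x + k2" "pathfinish g = x + k1"
   unfolding path_component_def by blast
  define c where "c = (\<lambda>s. g (frac s) + of_int \<lfloor>s\<rfloor> *\<^sub>R k)"
  have cc: "continuous_on UNIV c" unfolding c_def
   by (rule continuous_quasi_periodic) (use g in \<open>auto simp: k_def\<close>)
  have gS: "g (frac s) \<in> S" for s
   using g(2) frac_ge_0[of s] frac_lt_1[of s] unfolding path_image_def by (auto simp: less_imp_le)
  have nk: "nm k \<le> 2 * C * Y" unfolding k_def using seminorm_diff[OF fw.snmax, of k1 k2] bd by linarith
  have kL: "k \<in> L" unfolding k_def by (rule L_diff[OF k])
  have "nm (c s - s *\<^sub>R k) \<le> C' * Y" for s
  proof -
   have eq: "c s - s *\<^sub>R k = g (frac s) - frac s *\<^sub>R k" by (simp add: c_def frac_def scaleR_diff_left)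
   have "nm (g (frac s) - frac s *\<^sub>R k) \<le> nm (g (frac s)) + nm (frac s *\<^sub>R k)"
    by (rule seminorm_diff[OF fw.snmax])
   moreover have "nm (frac s *\<^sub>R k) \<le> nm k"
    using frac_ge_0[of s] frac_lt_1[of s] fw.n_nonneg(4)[of k]
    by (simp add: seminorm_scale[OF fw.snmax] mult_left_le_one_le less_imp_le)
   moreover have "nm (g (frac s)) \<le> (2 * nm x + 3 * C) * Y" using gS[of s] by (simp add: S_def)
   ultimately have "nm (c s - s *\<^sub>R k) \<le> (2 * nm x + 3 * C) * Y + 2 * C * Y" unfolding eq using nk by linarith
   then show ?thesis by (simp add: C'_def algebra_simps)
  qed
  moreover have "\<exists>w\<in>E. nm (w - c s) \<le> C' / ?X" for s
  proof -
   obtain w where w: "w \<in> E" "nm (w - g (frac s)) \<le> C / ?X" using gS[of s] unfolding S_def by blast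
   have "w + of_int \<lfloor>s\<rfloor> *\<^sub>R k \<in> E" using w(1) E(2) L_of_int[OF kL] by (simp add: inv_L_def)
   moreover have "nm (w + of_int \<lfloor>s\<rfloor> *\<^sub>R k - c s) \<le> C' / ?X"
   proof -
    have "C / ?X \<le> C' / ?X" using C'(2) X1 by (intro divide_right_mono) auto
    then show ?thesis using w(2) by (simp add: c_def)
   qed
   ultimately show ?thesis by blast
  qed
  moreover have "nm k \<le> C' * Y"
  proof -
   have "2 * C * Y \<le> C' * Y" using C' C(1) Y1 by (intro mult_right_mono) auto
   then show ?thesis using nk by linarith
  qed
  moreover have "cL * cmod (ell u0) \<le> cmod (ell k) * (C' * Y) ^ QL"
  proof -
   have "(4 * C * Y) ^ QL \<le> (C' * Y) ^ QL" using C' C(1) Y1 by (intro power_mono mult_right_mono) auto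
   then show ?thesis using low mult_left_mono[of "(4 * C * Y) ^ QL" "(C' * Y) ^ QL" "cmod (ell k)"]
    unfolding k_def by simp
  qed
  ultimately show ?thesis using kL cc unfolding Y_def by blast
 qed
 then show ?thesis using that C'(1) by blast
qed

text \<open>By \<open>crossing\<close>, a stable leaf of the curve near \<open>E\<close> meets an
  unstable leaf of the quasi-line in the complement. Tracing these two legs from a point of
  \<open>E\<close> ends within \<open>82 * D * (th ^ 2) ^ n\<close> of \<open>d t\<close>,
  eventually less than the width of the tube. The Liouville bound keeps the lengths polynomial in
  the scale although the direction \<open>k\<close> changes with \<open>n\<close>.\<close>

lemma clash:
 assumes E: "sat E" and cd: "continuous_on UNIV d" and d: "\<And>t. nm (d t - t *\<^sub>R k') \<le> M2"
  and \<delta>: "0 < \<delta>" "\<forall>t v. nm (v - d t) < \<delta> \<longrightarrow> v \<notin> E" and k': "ell k' \<noteq> 0"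
  and C: "1 \<le> C" and c0: "0 < c0"
 shows "\<forall>\<^sub>F n in sequentially. \<not> (\<exists>c k. continuous_on UNIV c \<and>
   (\<forall>s. nm (c s - s *\<^sub>R k) \<le> C * (rho ^ n) ^ N2) \<and> (\<forall>s. \<exists>w\<in>E. nm (w - c s) \<le> C / rho ^ n) \<and>
   nm k \<le> C * (rho ^ n) ^ N2 \<and> cL * cmod (ell u0) \<le> cmod (ell k) * (C * (rho ^ n) ^ N2) ^ QL \<and>
   c0 * (cmod (ell k) * cmod (ell k')) \<le> \<bar>Im (ell k * cnj (ell k'))\<bar>)"
proof -
 \<comment> \<open>Constants, each in front of a power of the scale: \<open>C4\<close> for the
   numerator in \<open>crossing\<close>, \<open>C5\<close> for the parameter range \<open>T\<close>,
   \<open>C6\<close> for the leaf length, \<open>C7\<close> for both the initial gap and the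
   contracted lengths.\<close>
 define ee where "ee = e / (rho - 1)"
 define C4 where "C4 = C + M2 + 2 + 4 * ee"
 define cl where "cl = cL * cmod (ell u0)"
 define C5 where "C5 = C4 * C ^ QL / (c0 * cl) + C4 / (c0 * cmod (ell k'))"
 define C6 where "C6 = 1 + 2 * e / (1 - lam) + C5 * (C + nm k') + C + M2"
 define C7 where "C7 = C + C6"
 have ee0: "0 \<le> ee" unfolding ee_def using fw.e0 rho by simp
 have M20: "0 \<le> M2" using d[of 0] fw.n_nonneg(4) order_trans by blast
 have C40: "0 \<le> C4" unfolding C4_def using C M20 ee0 by linarith
 have cl0: "0 < cl" unfolding cl_def using cL u0(2) by simp
 have C50: "0 \<le> C4 * C ^ QL / (c0 * cl)" "0 \<le> C4 / (c0 * cmod (ell k'))"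
  using C40 C c0 cl0 by simp_all
 have el: "0 \<le> 2 * e / (1 - lam)" using fw.e0 fw.lam by simp
 have C5k: "0 \<le> C5 * (C + nm k')" unfolding C5_def using C50 C fw.n_nonneg(4)[of k'] by simp
 have C60: "0 \<le> C6" unfolding C6_def using el C5k C M20 by linarith
 have "\<forall>\<^sub>F n in sequentially. C6 \<le> rho ^ n \<and> 82 * C7 * (th ^ 2) ^ n / rho ^ n < \<delta>"
  by (intro eventually_conj eventually_rho eventually_th \<delta>(1))
 then show ?thesis
 proof (rule eventually_mono, intro notI, elim conjE exE)
  fix n c k
  let ?X = "rho ^ n"
  define Y where "Y = ?X ^ N2"
  assume n: "C6 \<le> ?X" "82 * C7 * (th ^ 2) ^ n / ?X < \<delta>" and cc: "continuous_on UNIV c"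
   and cb: "\<forall>s. nm (c s - s *\<^sub>R k) \<le> C * ?X ^ N2" and ne: "\<forall>s. \<exists>w\<in>E. nm (w - c s) \<le> C / ?X"
   and nk: "nm k \<le> C * ?X ^ N2" and low: "cL * cmod (ell u0) \<le> cmod (ell k) * (C * ?X ^ N2) ^ QL"
   and ang: "c0 * (cmod (ell k) * cmod (ell k')) \<le> \<bar>Im (ell k * cnj (ell k'))\<bar>"
  have X1: "1 \<le> ?X" by (rule rho_ge_1)
  have Y1: "1 \<le> Y" unfolding Y_def using X1 by (rule one_le_power)
  have low': "cl \<le> cmod (ell k) * (C ^ QL * Y ^ QL)"
   using low unfolding cl_def Y_def[symmetric] by (simp add: power_mult_distrib)
  then have k0: "ell k \<noteq> 0" using cl0 by auto
  have XY: "?X \<le> Y" unfolding Y_def using X1 N2 power_increasing[of 1 N2 ?X] by simp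
  have num: "C * Y + M2 + 2 * (1 + 2 * e * real n) \<le> C4 * Y"
  proof -
   have "4 * e * real n \<le> 4 * e * (?X / (rho - 1))"
    using n_le_rho fw.e0 by (intro mult_left_mono) auto
   also have "\<dots> = 4 * ee * ?X" by (simp add: ee_def)
   also have "\<dots> \<le> 4 * ee * Y" using XY ee0 by (intro mult_left_mono) auto
   finally have "4 * e * real n \<le> 4 * ee * Y" .
   moreover have "M2 * 1 \<le> M2 * Y" using Y1 M20 by (intro mult_left_mono) auto
   ultimately have "C * Y + M2 + 2 + 4 * e * real n \<le> C * Y + M2 * Y + 2 * Y + 4 * ee * Y" using Y1 by linarith
   then show ?thesis by (simp add: C4_def algebra_simps)
  qed
  define T where "T = C5 * (Y * Y ^ QL)"
  have YQ: "1 \<le> Y ^ QL" using Y1 by (rule one_le_power)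
  have T1: "(C * Y + M2 + 2 * (1 + 2 * e * real n)) / (c0 * cmod (ell k)) \<le> T"
  proof -
   have ck: "0 < c0 * cmod (ell k)" using c0 k0 by simp
   have "(C * Y + M2 + 2 * (1 + 2 * e * real n)) / (c0 * cmod (ell k)) \<le> C4 * Y / (c0 * cmod (ell k))"
    using num ck by (intro divide_right_mono) auto
   also have "\<dots> \<le> C4 * C ^ QL / (c0 * cl) * (Y * Y ^ QL)"
   proof -
    have "C4 * Y * cl \<le> C4 * Y * (cmod (ell k) * (C ^ QL * Y ^ QL))"
     using low' C40 Y1 by (intro mult_left_mono) auto
    then have "C4 * Y \<le> C4 * Y * (cmod (ell k) * (C ^ QL * Y ^ QL)) / cl" using cl0 by (simp add: pos_le_divide_eq)
    then have "C4 * Y / (c0 * cmod (ell k)) \<le> C4 * Y * (cmod (ell k) * (C ^ QL * Y ^ QL)) / cl / (c0 * cmod (ell k))"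
     using ck by (intro divide_right_mono) auto
    also have "\<dots> = C4 * C ^ QL / (c0 * cl) * (Y * Y ^ QL)" using k0 c0 cl0 by (simp add: field_simps)
    finally show ?thesis .
   qed
   also have "\<dots> \<le> T" unfolding T_def C5_def using C50(2) Y1 YQ by (intro mult_right_mono) auto
   finally show ?thesis .
  qed
  have T2: "(C * Y + M2 + 2 * (1 + 2 * e * real n)) / (c0 * cmod (ell k')) \<le> T"
  proof -
   have ck: "0 < c0 * cmod (ell k')" using c0 k' by simp
   have "(C * Y + M2 + 2 * (1 + 2 * e * real n)) / (c0 * cmod (ell k')) \<le> C4 * Y / (c0 * cmod (ell k'))"
    using num ck by (intro divide_right_mono) auto
   also have "\<dots> = C4 / (c0 * cmod (ell k')) * (Y * 1)" by simp
   also have "\<dots> \<le> C4 / (c0 * cmod (ell k')) * (Y * Y ^ QL)"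
    using C50(2) Y1 YQ by (intro mult_left_mono) auto
   also have "\<dots> \<le> T" unfolding T_def C5_def using C50(1) Y1 YQ by (intro mult_right_mono) auto
   finally show ?thesis .
  qed
  let ?j = "2 * N2 + N2 * QL"
  have XJ: "?X ^ ?j = Y * Y * Y ^ QL"
   by (simp add: Y_def power_add power_mult mult_2)
  have T0: "0 \<le> T" unfolding T_def C5_def using C50 Y1 by simp
  have XJ1: "1 \<le> ?X ^ ?j" using X1 by (rule one_le_power)
  \<comment> \<open>\<open>T\<close> has order \<open>Y * Y ^ QL\<close>, since \<open>ell k\<close>
    may be as small as a multiple of \<open>1 / Y ^ QL\<close>, and it is multiplied by the size of
    \<open>k\<close>, of order \<open>Y\<close>. This gives the exponent in
    \<open>rate\<close>.\<close>
  define Lb where "Lb = C6 * ?X ^ ?j"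
  have Lb: "1 + 2 * e / (1 - lam) + T * (nm k + nm k') + C * Y + M2 \<le> Lb"
  proof -
   have "nm k' \<le> nm k' * Y" using mult_left_mono[OF Y1 fw.n_nonneg(4)[of k']] by simp
   then have "nm k + nm k' \<le> (C + nm k') * Y"
    using nk unfolding Y_def[symmetric] by (simp add: distrib_right)
   then have "T * (nm k + nm k') \<le> T * ((C + nm k') * Y)" using T0 by (intro mult_left_mono) auto
   also have "\<dots> = C5 * (C + nm k') * ?X ^ ?j" unfolding T_def XJ by simp
   finally have a: "T * (nm k + nm k') \<le> C5 * (C + nm k') * ?X ^ ?j" .
   have YJ: "Y \<le> ?X ^ ?j" unfolding Y_def using X1 by (intro power_increasing) auto
   have b: "C * Y \<le> C * ?X ^ ?j" using YJ C by (intro mult_left_mono) auto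
   have c: "M2 \<le> M2 * ?X ^ ?j" using mult_left_mono[OF XJ1 M20] by simp
   have f: "1 + 2 * e / (1 - lam) \<le> (1 + 2 * e / (1 - lam)) * ?X ^ ?j"
    using mult_left_mono[OF XJ1, of "1 + 2 * e / (1 - lam)"] el by simp
   have "Lb = (1 + 2 * e / (1 - lam)) * ?X ^ ?j + C5 * (C + nm k') * ?X ^ ?j + C * ?X ^ ?j + M2 * ?X ^ ?j"
    unfolding Lb_def C6_def by (simp only: distrib_right)
   then show ?thesis using a b c f by linarith
  qed
  have Ln: "(lam + e) ^ n * Lb \<le> C6 / ?X"
   unfolding Lb_def by (rule lam_pow_C[OF order_refl C60 order_refl])
  also have "\<dots> \<le> 1" using n(1) X1 by simp
  finally have Ln1: "(lam + e) ^ n * Lb \<le> 1" .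
  obtain s t q where q: "q \<in> Ws (c s)" "q \<in> Wu (d t)" "ns (q - c s) \<le> Lb" "nu (q - d t) \<le> Lb"
   using crossing[OF cc cd cb[rule_format, folded Y_def] d ang c0 k0 k' T1 T2 Lb Ln1] by blast
  obtain w where w: "w \<in> E" "nm (w - c s) \<le> C / ?X" using ne by blast
  define D where "D = C7 / ?X"
  have D1: "C / ?X \<le> D" "C6 / ?X \<le> D" unfolding D_def C7_def using C C60 X1 by (auto intro!: divide_right_mono)
  have sm: "(lam + e) ^ n * r \<le> D" if "r \<le> Lb" for r
  proof -
   have "(lam + e) ^ n * r \<le> (lam + e) ^ n * Lb" using that lam_e by (intro mult_left_mono) auto
   then show ?thesis using Ln D1(2) by linarith
  qed
  have nud: "nu (d t - q) \<le> Lb" using q(4) seminorm_commute[OF fw.snu, of q "d t"] by simp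
  have wD: "nm (w - c s) \<le> D" using w(2) D1(1) by linarith
  obtain w'' where "w'' \<in> E" "nm (w'' - d t) \<le> 82 * D * (th ^ 2) ^ n"
   using double_displacement[OF q(1) bw.s.W_sym[OF q(2)] wD w(1) E sm[OF q(3)] sm[OF nud]] by blast
  moreover have "82 * (C7 / r) * T = 82 * C7 * T / r" for r T by simp
  ultimately have "nm (w'' - d t) < \<delta>" "w'' \<in> E" using n(2) unfolding D_def by (simp_all only: le_less_trans)
  then show False using \<delta>(2) by blast
 qed
qed

text \<open>The direction supplied by \<open>chain\<close> varies with \<open>n\<close> and might
  become parallel to any one fixed direction. Two directions in the complement that differ by the
  fixed angle of \<open>zeta\<close> rule this out, and invariance under \<open>F\<close> supplies
  the second.\<close>

theorem su_minimal:
 assumes E: "closed E" "sat E" "inv_L E" "E \<noteq> {}" and FE: "\<And>x. F x \<in> E \<longleftrightarrow> x \<in> E"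
 shows "E = UNIV"
proof (rule ccontr)
 assume "E \<noteq> UNIV"
 then obtain y where y: "y \<in> - E" by blast
 have V: "open (- E)" "sat (- E)" "inv_L (- E)"
 proof -
  show "inv_L (- E)" unfolding inv_L_def
  proof (intro ballI ComplI)
   fix x k assume "x \<in> - E" "k \<in> L" "x + k \<in> E"
   then have "x + k + - k \<in> E" using E(3) L_minus unfolding inv_L_def by blast
   then show False using \<open>x \<in> - E\<close> by simp
  qed
 qed (use E sat_Compl in auto)
 obtain k where k: "k \<in> L" "ell k \<noteq> 0" "path_component (- E) y (y + k)" using V_line[OF V y] by blast
 have Ak: "ell (A k) \<noteq> 0" "A k \<in> L" using k zeta L_A by (auto simp: ell_A)
 have "path_component (- E) (F y) (F y + A k)"
 proof -
  obtain g where g: "path g" "path_image g \<subseteq> - E" "pathstart g = y" "pathfinish g = y + k"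
   using k(3) unfolding path_component_def by blast
  have "path (F \<circ> g)" by (rule path_continuous_image[OF g(1) fw.s.contg])
  moreover have "path_image (F \<circ> g) \<subseteq> - E" using g(2) FE by (auto simp: path_image_compose)
  moreover have "pathstart (F \<circ> g) = F y" "pathfinish (F \<circ> g) = F y + A k"
   using g(3,4) F_per[OF k(1)] by (simp_all add: pathstart_compose pathfinish_compose)
  ultimately show ?thesis unfolding path_component_def by blast
 qed
 note pc2 = this
 obtain d1 M1 \<delta>1 where d1: "continuous_on UNIV d1" "\<And>t. nm (d1 t - t *\<^sub>R k) \<le> M1" "0 < \<delta>1"
  "\<And>t v. nm (v - d1 t) < \<delta>1 \<Longrightarrow> v \<in> - E"
  using V_quasi_line[OF V(1,3) k(1,3)] by blast
 obtain d2 M2 \<delta>2 where d2: "continuous_on UNIV d2" "\<And>t. nm (d2 t - t *\<^sub>R A k) \<le> M2" "0 < \<delta>2"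
  "\<And>t v. nm (v - d2 t) < \<delta>2 \<Longrightarrow> v \<in> - E"
  using V_quasi_line[OF V(1,3) Ak(2) pc2] by blast
 obtain x where x: "x \<in> E" using E(4) by blast
 obtain C where C: "1 \<le> C" "\<And>n. C \<le> rho ^ n \<Longrightarrow> \<exists>c k. k \<in> L \<and> continuous_on UNIV c \<and>
   (\<forall>s. nm (c s - s *\<^sub>R k) \<le> C * (rho ^ n) ^ N2) \<and> (\<forall>s. \<exists>w\<in>E. nm (w - c s) \<le> C / rho ^ n) \<and>
   nm k \<le> C * (rho ^ n) ^ N2 \<and> cL * cmod (ell u0) \<le> cmod (ell k) * (C * (rho ^ n) ^ N2) ^ QL"
  using chain[OF E(2,3) x] by blast
 \<comment> \<open>If both angles were below this bound, the area identity below would give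
   \<open>\<bar>Im zeta\<bar> < 2 * c0\<close>.\<close>
 define c0 where "c0 = \<bar>Im zeta\<bar> / 2"
 have c0: "0 < c0" unfolding c0_def using zeta by simp
 have z1: "cmod zeta = 1" by (rule cmod_zeta[OF k(2)])
 have d1': "\<forall>t v. nm (v - d1 t) < \<delta>1 \<longrightarrow> v \<notin> E" using d1(4) by blast
 have d2': "\<forall>t v. nm (v - d2 t) < \<delta>2 \<longrightarrow> v \<notin> E" using d2(4) by blast
 have "\<forall>\<^sub>F n in sequentially. False"
  using clash[OF E(2) d1(1,2,3) d1' k(2) C(1) c0] clash[OF E(2) d2(1,2,3) d2' Ak(1) C(1) c0]
   eventually_rho[of C]
 proof eventually_elim
  case (elim n)
  from C(2)[OF elim(3)] obtain c kk where c: "continuous_on UNIV c"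
   "\<forall>s. nm (c s - s *\<^sub>R kk) \<le> C * (rho ^ n) ^ N2" "\<forall>s. \<exists>w\<in>E. nm (w - c s) \<le> C / rho ^ n"
   "nm kk \<le> C * (rho ^ n) ^ N2" "cL * cmod (ell u0) \<le> cmod (ell kk) * (C * (rho ^ n) ^ N2) ^ QL" by blast
  have n1: "\<bar>Im (ell kk * cnj (ell k))\<bar> < c0 * (cmod (ell kk) * cmod (ell k))"
   using elim(1) c by (meson not_le)
  have n2: "\<bar>Im (ell kk * cnj (ell (A k)))\<bar> < c0 * (cmod (ell kk) * cmod (ell (A k)))"
   using elim(2) c by (meson not_le)
  define a where "a = ell kk * cnj (ell k)"
  have na: "cmod a = cmod (ell kk) * cmod (ell k)" by (simp add: a_def norm_mult)
  have 1: "\<bar>Im a\<bar> < c0 * cmod a" using n1 unfolding na unfolding a_def .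
  have 2: "\<bar>Im (a * cnj zeta)\<bar> < c0 * cmod a"
   using n2 z1 unfolding na by (simp add: a_def ell_A norm_mult mult.assoc mult.commute mult.left_commute)
  \<comment> \<open>The area spanned by \<open>a\<close> and \<open>a * cnj zeta\<close>, written as
    a determinant whose factors \<open>Im a\<close> and \<open>Im (a * cnj zeta)\<close> are both
    small.\<close>
  have "cmod a * cmod a * \<bar>Im zeta\<bar> = \<bar>Im a * Re (a * cnj zeta) - Re a * Im (a * cnj zeta)\<bar>"
  proof -
   have "Im a * Re (a * cnj zeta) - Re a * Im (a * cnj zeta) = (Re a ^ 2 + Im a ^ 2) * Im zeta"
    by (simp add: algebra_simps power2_eq_square)
   then have "Im a * Re (a * cnj zeta) - Re a * Im (a * cnj zeta) = cmod a ^ 2 * Im zeta"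
    unfolding cmod_power2 .
   then show ?thesis by (simp only: abs_mult abs_norm_cancel power2_eq_square)
  qed
  also have "\<dots> \<le> \<bar>Im a\<bar> * \<bar>Re (a * cnj zeta)\<bar> + \<bar>Re a\<bar> * \<bar>Im (a * cnj zeta)\<bar>"
   by (metis abs_mult abs_triangle_ineq4)
  also have "\<dots> \<le> \<bar>Im a\<bar> * cmod a + cmod a * \<bar>Im (a * cnj zeta)\<bar>"
   using abs_Re_le_cmod[of "a * cnj zeta"] abs_Re_le_cmod[of a] z1
   by (intro add_mono mult_mono) (auto simp: norm_mult)
  finally have *: "cmod a * cmod a * \<bar>Im zeta\<bar> \<le> cmod a * (\<bar>Im a\<bar> + \<bar>Im (a * cnj zeta)\<bar>)"
   by (simp add: algebra_simps)
  have a0: "0 < cmod a"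
  proof (rule ccontr)
   assume "\<not> 0 < cmod a"
   then show False using 1 by simp
  qed
  have "cmod a * \<bar>Im zeta\<bar> \<le> \<bar>Im a\<bar> + \<bar>Im (a * cnj zeta)\<bar>"
   using * a0 by (simp add: mult.assoc)
  also have "\<dots> < c0 * cmod a + c0 * cmod a" using 1 2 by linarith
  also have "\<dots> = cmod a * \<bar>Im zeta\<bar>" by (simp add: c0_def)
  finally show False by simp
 qed
 then show False by simp
qed

end

section \<open>Generalized eigenspaces and growth rates\<close>

lemma norm_vector_smult: "norm (c *s v) = cmod c * norm (v :: complex ^ 'n)"
 by (simp add: norm_vec_def norm_mult L2_set_right_distrib)

definition nil_part :: "complex ^ 'n ^ 'n \<Rightarrow> complex \<Rightarrow> complex ^ 'n \<Rightarrow> complex ^ 'n::finite" where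
 "nil_part B mu w = B *v w - mu *s w"

lemma gen_eigenspace_iff: "v \<in> generalized_eigenspace B mu \<longleftrightarrow> (\<exists>k. (nil_part B mu ^^ k) v = 0)"
 unfolding generalized_eigenspace_def nil_part_def[abs_def] by simp

lemma nil_part_add: "nil_part B mu (v + w) = nil_part B mu v + nil_part B mu w"
 by (simp add: nil_part_def matrix_vector_right_distrib vector_add_ldistrib)

lemma nil_part_scale: "nil_part B mu (c *s v) = c *s nil_part B mu v"
 by (simp add: nil_part_def matrix_vector_mult_scaleR vec.scale vector_ssub_ldistrib vector_smult_assoc mult.commute)

lemma nil_part_0: "nil_part B mu 0 = 0"
 by (simp add: nil_part_def)

lemma nil_part_pow_add: "(nil_part B mu ^^ k) (v + w) = (nil_part B mu ^^ k) v + (nil_part B mu ^^ k) w"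
 by (induction k) (simp_all add: nil_part_add)

lemma nil_part_pow_scale: "(nil_part B mu ^^ k) (c *s v) = c *s (nil_part B mu ^^ k) v"
 by (induction k) (simp_all add: nil_part_scale)

lemma nil_part_pow_0: "(nil_part B mu ^^ k) 0 = 0"
 by (induction k) (simp_all add: nil_part_0)

lemma subspace_gen_eigenspace: "vec.subspace (generalized_eigenspace B mu)"
 unfolding vec.subspace_def
proof (intro conjI ballI allI)
 show "0 \<in> generalized_eigenspace B mu" unfolding gen_eigenspace_iff by (intro exI[of _ 0]) simp
 fix v w assume "v \<in> generalized_eigenspace B mu" "w \<in> generalized_eigenspace B mu"
 then obtain j k where j: "(nil_part B mu ^^ j) v = 0" and k: "(nil_part B mu ^^ k) w = 0"
  unfolding gen_eigenspace_iff by blast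
 have "(nil_part B mu ^^ (k + j)) v = 0" by (simp only: funpow_add o_apply j nil_part_pow_0)
 moreover have "(nil_part B mu ^^ (j + k)) w = 0" by (simp only: funpow_add o_apply k nil_part_pow_0)
 ultimately have "(nil_part B mu ^^ (j + k)) (v + w) = 0" by (simp add: nil_part_pow_add add.commute)
 then show "v + w \<in> generalized_eigenspace B mu" unfolding gen_eigenspace_iff by blast
next
 fix v c assume "v \<in> generalized_eigenspace B mu"
 then obtain j where "(nil_part B mu ^^ j) v = 0" unfolding gen_eigenspace_iff by blast
 then have "(nil_part B mu ^^ j) (c *s v) = 0" by (simp add: nil_part_pow_scale)
 then show "c *s v \<in> generalized_eigenspace B mu" unfolding gen_eigenspace_iff by blast
qed

text \<open>On the generalized eigenspace of \<open>\<nu>\<close> the map is the non-zero scalar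
  \<open>\<nu> - mu\<close> plus a nilpotent map; the induction removes the nilpotent term, whose
  nilpotency order is smaller.\<close>

lemma nil_part_onto:
 assumes "\<nu> \<noteq> mu" "(nil_part B \<nu> ^^ k) w = 0"
 shows "\<exists>v\<in>generalized_eigenspace B \<nu>. nil_part B mu v = w"
 using assms(2)
proof (induction k arbitrary: w)
 case 0
 then show ?case using vec.subspace_0[OF subspace_gen_eigenspace] by (intro bexI[of _ 0]) (simp_all add: nil_part_0)
next
 case (Suc k)
 from Suc.prems have "(nil_part B \<nu> ^^ k) (nil_part B \<nu> w) = 0" by (simp add: funpow_swap1)
 from Suc.IH[OF this] obtain u where u: "u \<in> generalized_eigenspace B \<nu>" "nil_part B mu u = nil_part B \<nu> w" by blast
 have w: "w \<in> generalized_eigenspace B \<nu>" using Suc.prems unfolding gen_eigenspace_iff by blast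
 define v where "v = (1 / (\<nu> - mu)) *s (w - u)"
 have "v \<in> generalized_eigenspace B \<nu>" unfolding v_def
  by (intro vec.subspace_scale vec.subspace_diff subspace_gen_eigenspace w u)
 moreover have "nil_part B mu v = w"
 proof -
  have "nil_part B mu (w + (-1) *s u) = nil_part B mu w - nil_part B \<nu> w"
   unfolding nil_part_add nil_part_scale u(2) by simp
  also have "\<dots> = (\<nu> - mu) *s w" by (simp add: nil_part_def vector_sub_rdistrib)
  finally have eq: "nil_part B mu (w - u) = (\<nu> - mu) *s w" by simp
  show ?thesis unfolding v_def nil_part_scale eq vector_smult_assoc using assms(1) by simp
 qed
 ultimately show ?case by blast
qed

text \<open>Peels off the innermost factor. Modulo the generalized eigenspace of \<open>mu\<close>,
  each element of the span is the image under \<open>nil_part B mu\<close> of an element of the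
  span; correcting \<open>v\<close> by such a preimage leaves a vector killed by a power of
  \<open>nil_part B mu\<close>.\<close>

lemma nil_prod_in_span:
 assumes "foldr (\<lambda>mu. nil_part B mu) ms v = 0"
 shows "v \<in> vec.span (\<Union>mu. generalized_eigenspace B mu)"
 using assms
proof (induction ms arbitrary: v rule: rev_induct)
 case Nil
 then show ?case using vec.span_zero by simp
next
 case (snoc mu ms)
 let ?S = "vec.span (\<Union>mu. generalized_eigenspace B mu)"
 let ?R = "{w. \<exists>v'\<in>?S. nil_part B mu v' - w \<in> generalized_eigenspace B mu}"
 have "vec.subspace ?R"
  unfolding vec.subspace_def
 proof (intro conjI ballI allI)
  show "0 \<in> ?R" using vec.span_zero vec.subspace_0[OF subspace_gen_eigenspace]
   by (intro CollectI bexI[of _ 0]) (simp_all add: nil_part_0)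
  fix a b assume "a \<in> ?R" "b \<in> ?R"
  then obtain a' b' where ab: "a' \<in> ?S" "nil_part B mu a' - a \<in> generalized_eigenspace B mu"
   "b' \<in> ?S" "nil_part B mu b' - b \<in> generalized_eigenspace B mu" by blast
  have "nil_part B mu (a' + b') - (a + b) = (nil_part B mu a' - a) + (nil_part B mu b' - b)"
   by (simp add: nil_part_add)
  also have "\<dots> \<in> generalized_eigenspace B mu" by (rule vec.subspace_add[OF subspace_gen_eigenspace ab(2,4)])
  finally show "a + b \<in> ?R" using vec.span_add[OF ab(1,3)] by blast
 next
  fix a c assume "a \<in> ?R"
  then obtain a' where a: "a' \<in> ?S" "nil_part B mu a' - a \<in> generalized_eigenspace B mu" by blast
  have "nil_part B mu (c *s a') - c *s a = c *s (nil_part B mu a' - a)"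
   by (simp add: nil_part_scale vector_ssub_ldistrib)
  also have "\<dots> \<in> generalized_eigenspace B mu" by (rule vec.subspace_scale[OF subspace_gen_eigenspace a(2)])
  finally show "c *s a \<in> ?R" using vec.span_scale[OF a(1)] by blast
 qed
 moreover have "(\<Union>mu. generalized_eigenspace B mu) \<subseteq> ?R"
 proof
  fix w assume "w \<in> (\<Union>mu. generalized_eigenspace B mu)"
  then obtain \<nu> where \<nu>: "w \<in> generalized_eigenspace B \<nu>" by blast
  show "w \<in> ?R"
  proof (cases "\<nu> = mu")
   case True
   then have "0 - w \<in> generalized_eigenspace B mu"
    using vec.subspace_diff[OF subspace_gen_eigenspace vec.subspace_0[OF subspace_gen_eigenspace] \<nu>] by simp
   then show ?thesis using vec.span_zero by (intro CollectI bexI[of _ 0]) (simp_all add: nil_part_0)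
  next
   case False
   from \<nu> obtain k where "(nil_part B \<nu> ^^ k) w = 0" unfolding gen_eigenspace_iff by blast
   from nil_part_onto[OF False this] obtain v' where v': "v' \<in> generalized_eigenspace B \<nu>" "nil_part B mu v' = w" by blast
   have "v' \<in> ?S" by (rule vec.span_base) (use v'(1) in blast)
   moreover have "nil_part B mu v' - w \<in> generalized_eigenspace B mu"
    using v'(2) vec.subspace_0[OF subspace_gen_eigenspace] by simp
   ultimately show ?thesis by blast
  qed
 qed
 ultimately have "?S \<subseteq> ?R" by (simp add: vec.span_minimal)
 moreover have "nil_part B mu v \<in> ?S" using snoc by simp
 ultimately obtain v' where v': "v' \<in> ?S" "nil_part B mu v' - nil_part B mu v \<in> generalized_eigenspace B mu" by blast
 have "nil_part B mu (v' + (-1) *s v) \<in> generalized_eigenspace B mu"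
  unfolding nil_part_add nil_part_scale using v'(2) by simp
 then obtain k where "(nil_part B mu ^^ k) (nil_part B mu (v' - v)) = 0" unfolding gen_eigenspace_iff by auto
 then have "(nil_part B mu ^^ Suc k) (v' - v) = 0" by (simp add: funpow_swap1)
 then have "v' - v \<in> generalized_eigenspace B mu" unfolding gen_eigenspace_iff by blast
 then have "v' - v \<in> ?S" by (intro vec.span_base UN_I[of mu] UNIV_I)
 from vec.span_diff[OF v'(1) this] show ?case by simp
qed

definition poly_act :: "complex ^ 'n ^ 'n \<Rightarrow> complex poly \<Rightarrow> complex ^ 'n \<Rightarrow> complex ^ 'n::finite" where
 "poly_act B p v = (\<Sum>i\<le>degree p. coeff p i *s (((*v) B) ^^ i) v)"

lemma poly_act_bound:
 assumes "degree p \<le> m"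
 shows "poly_act B p v = (\<Sum>i\<le>m. coeff p i *s (((*v) B) ^^ i) v)"
 unfolding poly_act_def
 by (rule sum.mono_neutral_left) (use assms in \<open>auto simp: coeff_eq_0\<close>)

lemma poly_act_linear_factor: "poly_act B ([:-mu, 1:] * p) v = nil_part B mu (poly_act B p v)"
proof -
 let ?m = "degree p"
 let ?f = "\<lambda>i. (((*v) B) ^^ i) v"
 have m: "degree ([:-mu, 1:] * p) \<le> Suc ?m"
  using degree_mult_le[of "[:-mu, 1:]" p] by simp
 have c: "coeff ([:-mu, 1:] * p) i = (case i of 0 \<Rightarrow> 0 | Suc j \<Rightarrow> coeff p j) - mu * coeff p i" for i
  by (simp add: coeff_pCons split: nat.split)
 have "poly_act B ([:-mu, 1:] * p) v = (\<Sum>i\<le>Suc ?m. coeff ([:-mu, 1:] * p) i *s ?f i)"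
  by (rule poly_act_bound[OF m])
 also have "\<dots> = (\<Sum>i\<le>Suc ?m. (case i of 0 \<Rightarrow> 0 | Suc j \<Rightarrow> coeff p j) *s ?f i) - (\<Sum>i\<le>Suc ?m. (mu * coeff p i) *s ?f i)"
  unfolding c by (simp only: vector_sub_rdistrib sum_subtractf)
 also have "(\<Sum>i\<le>Suc ?m. (case i of 0 \<Rightarrow> 0 | Suc j \<Rightarrow> coeff p j) *s ?f i) = B *v poly_act B p v"
  unfolding poly_act_def
  by (simp add: sum.atMost_Suc_shift vec.sum vec.scale del: sum.atMost_Suc)
 also have "(\<Sum>i\<le>Suc ?m. (mu * coeff p i) *s ?f i) = mu *s poly_act B p v"
  unfolding poly_act_bound[OF le_SucI[OF order_refl], of B p]
  by (simp only: vec.scale_sum_right vector_smult_assoc)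
 finally show ?thesis by (simp add: nil_part_def)
qed

text \<open>The \<open>CARD('n) + 1\<close> iterates of \<open>v\<close> either repeat, which gives
  a difference of two monomials, or are distinct and linearly dependent, which gives the
  coefficients.\<close>

lemma poly_act_killed:
 fixes B :: "complex ^ 'n::finite ^ 'n" and v :: "complex ^ 'n"
 obtains p where "p \<noteq> 0" "poly_act B p v = 0"
proof -
 let ?f = "\<lambda>i. (((*v) B) ^^ i) v"
 show ?thesis
 proof (cases "inj_on ?f {..CARD('n)}")
  case False
  then obtain i j where ij: "i \<noteq> j" "?f i = ?f j" unfolding inj_on_def by blast
  let ?p = "monom 1 i - monom (1::complex) j"
  have "?p \<noteq> 0" using ij(1) by (metis eq_iff_diff_eq_0 monom_eq_iff' zero_neq_one)
  moreover have "poly_act B ?p v = 0"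
  proof -
   let ?m = "max i j"
   have "degree ?p \<le> ?m" by (intro degree_diff_le) (auto simp: degree_monom_eq)
   then have "poly_act B ?p v = (\<Sum>k\<le>?m. coeff ?p k *s ?f k)" by (rule poly_act_bound)
   also have "\<dots> = (\<Sum>k\<le>?m. if k = i then ?f k else 0) - (\<Sum>k\<le>?m. if k = j then ?f k else 0)"
    unfolding sum_subtractf[symmetric] by (intro sum.cong) (auto simp: vector_sub_rdistrib)
   also have "\<dots> = ?f i - ?f j" by simp
   finally show ?thesis using ij(2) by simp
  qed
  ultimately show ?thesis by (rule that)
 next
  case True
  have "vec.dependent (?f ` {..CARD('n)})"
  proof (rule ccontr)
   assume "\<not> vec.dependent (?f ` {..CARD('n)})"
   then have "card (?f ` {..CARD('n)}) \<le> CARD('n)"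
    using vec.independent_card_le_dim[of "?f ` {..CARD('n)}" UNIV] by (simp add: vec_dim_card card_cart_basis)
   then show False using card_image[OF True] by simp
  qed
  then obtain U where U: "(\<Sum>x\<in>?f ` {..CARD('n)}. U x *s x) = 0" "\<exists>x\<in>?f ` {..CARD('n)}. U x \<noteq> 0"
   using vec.dependent_finite[of "?f ` {..CARD('n)}"] by auto
  define p where "p = (\<Sum>i\<le>CARD('n). monom (U (?f i)) i)"
  have cp: "coeff p i = (if i \<le> CARD('n) then U (?f i) else 0)" for i
   unfolding p_def coeff_sum by (simp add: if_distrib cong: if_cong)
  have "p \<noteq> 0"
  proof -
   from U(2) obtain i where "i \<le> CARD('n)" "U (?f i) \<noteq> 0" by auto
   then have "coeff p i \<noteq> 0" by (simp add: cp)
   then show ?thesis by auto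
  qed
  moreover have "poly_act B p v = 0"
  proof -
   have "degree p \<le> CARD('n)" by (rule degree_le) (simp add: cp)
   then have "poly_act B p v = (\<Sum>i\<le>CARD('n). U (?f i) *s ?f i)"
    by (subst poly_act_bound) (auto simp: cp)
   also have "\<dots> = (\<Sum>x\<in>?f ` {..CARD('n)}. U x *s x)" by (simp add: sum.reindex[OF True])
   finally show ?thesis using U(1) by simp
  qed
  ultimately show ?thesis by (rule that)
 qed
qed

lemma poly_act_nil_prod: "p \<noteq> 0 \<Longrightarrow> poly_act B p v = 0 \<Longrightarrow> \<exists>ms. foldr (\<lambda>mu. nil_part B mu) ms v = 0"
proof -
 have "\<exists>ms c. c \<noteq> 0 \<and> poly_act B p v = foldr (\<lambda>mu. nil_part B mu) ms (c *s v)" if "p \<noteq> 0" for p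
  using that
 proof (induction "degree p" arbitrary: p)
  case 0
  then have "degree p = 0" by simp
  then obtain c where "p = [:c:]" by (rule degree_eq_zeroE)
  then show ?case using 0 by (intro exI[of _ "[]"] exI[of _ c]) (simp add: poly_act_def)
 next
  case (Suc n)
  then have "\<not> constant (poly p)" by (simp add: constant_degree)
  then obtain mu where "poly p mu = 0" using fundamental_theorem_of_algebra by blast
  then obtain q where q: "p = [:-mu, 1:] * q" unfolding poly_eq_0_iff_dvd by (elim dvdE)
  have q0: "q \<noteq> 0" using Suc.prems q by auto
  then have "degree q = n" using Suc.hyps(2) unfolding q by (subst (asm) degree_mult_eq) auto
  from Suc.hyps(1)[OF this[symmetric] q0] obtain ms c where
   "c \<noteq> 0" "poly_act B q v = foldr (\<lambda>mu. nil_part B mu) ms (c *s v)" by blast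
  then show ?case unfolding q poly_act_linear_factor by (intro exI[of _ "mu # ms"] exI[of _ c]) simp
 qed
 moreover have "foldr (\<lambda>mu. nil_part B mu) ms (c *s v) = c *s foldr (\<lambda>mu. nil_part B mu) ms v" for ms c
  by (induction ms) (simp_all add: nil_part_scale)
 ultimately show "p \<noteq> 0 \<Longrightarrow> poly_act B p v = 0 \<Longrightarrow> \<exists>ms. foldr (\<lambda>mu. nil_part B mu) ms v = 0"
  by (metis vector_mul_eq_0)
qed

text \<open>Vector by vector: some polynomial in \<open>B\<close> kills \<open>v\<close>, it splits
  into linear factors over the complex numbers, and \<open>nil_prod_in_span\<close> applies.\<close>

theorem span_gen_eigenspaces: "vec.span (\<Union>mu. generalized_eigenspace B mu) = UNIV"
proof -
 have "v \<in> vec.span (\<Union>mu. generalized_eigenspace B mu)" for v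
 proof -
  obtain p where "p \<noteq> 0" "poly_act B p v = 0" by (rule poly_act_killed)
  then show ?thesis using poly_act_nil_prod nil_prod_in_span by blast
 qed
 then show ?thesis by blast
qed

text \<open>A discrete Gronwall estimate; the slack \<open>r - a\<close> makes
  \<open>a * D + \<bar>C\<bar> \<le> D * r\<close> for large \<open>D\<close>.\<close>

lemma recursion_bound:
 fixes x y :: "nat \<Rightarrow> real"
 assumes "\<And>n. x (Suc n) \<le> a * x n + y n" "\<And>n. y n \<le> C * r ^ n" "0 \<le> a" "a < r"
 shows "\<exists>C'. \<forall>n. x n \<le> C' * r ^ n"
proof -
 define D where "D = max \<bar>x 0\<bar> (\<bar>C\<bar> / (r - a))"
 have D: "\<bar>x 0\<bar> \<le> D" "\<bar>C\<bar> \<le> D * (r - a)"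
  unfolding D_def using assms(4) by (auto simp: pos_divide_le_eq[symmetric])
 have "x n \<le> D * r ^ n" for n
 proof (induction n)
  case (Suc n)
  have "x (Suc n) \<le> a * (D * r ^ n) + C * r ^ n"
   using assms(1)[of n] assms(2)[of n] mult_left_mono[OF Suc assms(3)] by linarith
  also have "C * r ^ n \<le> D * (r - a) * r ^ n"
   using D(2) assms(3,4) by (intro mult_right_mono) auto
  finally show ?case by (simp add: algebra_simps)
 qed (use D in simp)
 then show ?thesis by blast
qed

lemma matrix_funpow_nil:
 fixes B :: "complex ^ 'n::finite ^ 'n"
 shows "((*v) B ^^ Suc n) w = mu *s ((*v) B ^^ n) w + ((*v) B ^^ n) (nil_part B mu w)"
proof -
 have "((*v) B ^^ n) (mu *s w + nil_part B mu w) = mu *s ((*v) B ^^ n) w + ((*v) B ^^ n) (nil_part B mu w)"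
  by (induction n) (simp_all add: matrix_vector_right_distrib vec.scale)
 moreover have "mu *s w + nil_part B mu w = B *v w" by (simp add: nil_part_def)
 ultimately show ?thesis by (simp add: funpow_swap1)
qed

text \<open>The polynomial factors from nilpotency are absorbed in the slack between
  \<open>cmod mu\<close> and \<open>r\<close>. Induction on the nilpotency order through
  \<open>recursion_bound\<close> avoids binomial expansions.\<close>

lemma gen_eigen_growth:
 fixes B :: "complex ^ 'n::finite ^ 'n"
 assumes "w \<in> generalized_eigenspace B mu" "cmod mu < r"
 shows "\<exists>C. \<forall>n. norm (((*v) B ^^ n) w) \<le> C * r ^ n"
proof -
 obtain k where "(nil_part B mu ^^ k) w = 0" using assms(1) unfolding gen_eigenspace_iff by blast
 then show ?thesis
 proof (induction k arbitrary: w)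
  case 0
  have "((*v) B ^^ n) 0 = 0" for n by (induction n) simp_all
  then show ?case using 0 by (intro exI[of _ 0]) simp
 next
  case (Suc k)
  then have "(nil_part B mu ^^ k) (nil_part B mu w) = 0" by (simp add: funpow_swap1)
  from Suc.IH[OF this] obtain C where C: "\<And>n. norm (((*v) B ^^ n) (nil_part B mu w)) \<le> C * r ^ n" by blast
  show ?case
  proof (rule recursion_bound[OF _ C _ assms(2)])
   show "norm (((*v) B ^^ Suc n) w) \<le> cmod mu * norm (((*v) B ^^ n) w) + norm (((*v) B ^^ n) (nil_part B mu w))" for n
    by (subst matrix_funpow_nil[where mu = mu])
     (use norm_triangle_ineq[of "mu *s ((*v) B ^^ n) w"] in \<open>simp add: norm_vector_smult\<close>)
  qed simp
 qed
qed

lemma gen_eigenspace_inverse: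
 fixes B Bi :: "complex ^ 'n::finite ^ 'n"
 assumes "Bi ** B = mat 1" "w \<in> generalized_eigenspace B mu"
 shows "mu = 0 \<Longrightarrow> w = 0"
  and "1 < r * cmod mu \<Longrightarrow> 0 < r \<Longrightarrow> \<exists>C. \<forall>n. norm (((*v) Bi ^^ n) w) \<le> C * r ^ n"
proof -
 obtain k where k: "(nil_part B mu ^^ k) w = 0" using assms(2) unfolding gen_eigenspace_iff by blast
 have BiB: "Bi *v (B *v v) = v" for v using assms(1) by (simp add: matrix_vector_mul_assoc)
 show "w = 0" if "mu = 0"
 proof -
  have nz: "nil_part B mu v = 0 \<Longrightarrow> v = 0" for v using BiB[of v] that by (simp add: nil_part_def)
  have "(nil_part B mu ^^ k) w = 0 \<Longrightarrow> w = 0" by (induction k) (auto dest: nz)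
  then show ?thesis using k by blast
 qed
 show "\<exists>C. \<forall>n. norm (((*v) Bi ^^ n) w) \<le> C * r ^ n" if r: "1 < r * cmod mu" "0 < r"
  using k
 proof (induction k arbitrary: w)
  case 0
  have "((*v) Bi ^^ n) 0 = 0" for n by (induction n) simp_all
  then show ?case using 0 by (intro exI[of _ 0]) simp
 next
  case (Suc k)
  then have "(nil_part B mu ^^ k) (nil_part B mu w) = 0" by (simp add: funpow_swap1)
  from Suc.IH[OF this] obtain C where C: "\<And>n. norm (((*v) Bi ^^ n) (nil_part B mu w)) \<le> C * r ^ n" by blast
  have mu0: "0 < cmod mu" using r by (metis less_numeral_extra(1) mult_zero_right norm_ge_zero order_le_less order_less_trans)
  have step: "mu *s ((*v) Bi ^^ Suc n) w = ((*v) Bi ^^ n) w - ((*v) Bi ^^ Suc n) (nil_part B mu w)" for n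
  proof -
   have h1: "((*v) Bi ^^ Suc n) (mu *s w + nil_part B mu w) = mu *s ((*v) Bi ^^ Suc n) w + ((*v) Bi ^^ Suc n) (nil_part B mu w)"
    for n by (induction n) (simp_all add: matrix_vector_right_distrib vec.scale)
   have "((*v) Bi ^^ Suc n) (mu *s w + nil_part B mu w) = ((*v) Bi ^^ n) w"
    by (simp add: nil_part_def funpow_swap1 BiB)
   then show ?thesis unfolding eq_diff_eq h1 .
  qed
  show ?case
  proof (rule recursion_bound[where a = "1 / cmod mu" and C = "C * r / cmod mu"])
   fix n
   have "cmod mu * norm (((*v) Bi ^^ Suc n) w) \<le> norm (((*v) Bi ^^ n) w) + norm (((*v) Bi ^^ Suc n) (nil_part B mu w))"
    unfolding norm_vector_smult[symmetric] step by (rule norm_triangle_ineq4)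
   then show "norm (((*v) Bi ^^ Suc n) w) \<le> 1 / cmod mu * norm (((*v) Bi ^^ n) w) + norm (((*v) Bi ^^ Suc n) (nil_part B mu w)) / cmod mu"
    using mu0 by (simp add: field_simps)
   show "norm (((*v) Bi ^^ Suc n) (nil_part B mu w)) / cmod mu \<le> C * r / cmod mu * r ^ n"
    using C[of "Suc n"] mu0 by (simp add: divide_right_mono mult.assoc)
   show "1 / cmod mu < r" using r mu0 by (simp add: field_simps)
  qed simp
 qed
qed

definition cplx_vec :: "real ^ 'n \<Rightarrow> complex ^ 'n" where
 "cplx_vec v = (\<chi> i. complex_of_real (v $ i))"

definition cnj_vec :: "complex ^ 'n \<Rightarrow> complex ^ 'n" where
 "cnj_vec w = (\<chi> i. cnj (w $ i))"

abbreviation int_act :: "int ^ 'n ^ 'n \<Rightarrow> real ^ 'n \<Rightarrow> real ^ 'n::finite" where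
 "int_act A \<equiv> (*v) (map_matrix real_of_int A)"

abbreviation cplx_mat :: "int ^ 'n ^ 'n \<Rightarrow> complex ^ 'n ^ 'n::finite" where
 "cplx_mat A \<equiv> map_matrix of_int A"

lemma cplx_vec_act: "cplx_vec (int_act A v) = cplx_mat A *v cplx_vec v"
 by (simp add: vec_eq_iff cplx_vec_def matrix_vector_mult_def map_matrix_def)

lemma cplx_vec_act_pow: "cplx_vec ((int_act A ^^ n) v) = ((*v) (cplx_mat A) ^^ n) (cplx_vec v)"
 by (induction n) (simp_all add: cplx_vec_act)

lemma norm_cplx_vec: "norm (cplx_vec v) = norm v"
 by (simp add: norm_vec_def cplx_vec_def)

lemma cplx_vec_add: "cplx_vec (v + w) = cplx_vec v + cplx_vec w"
 by (simp add: vec_eq_iff cplx_vec_def)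

lemma cplx_vec_scale: "cplx_vec (c *\<^sub>R v) = of_real c *s cplx_vec v"
 by (simp add: vec_eq_iff cplx_vec_def)

lemma spectral_subspace_iff: "v \<in> spectral_subspace A S \<longleftrightarrow>
  cplx_vec v \<in> vec.span (\<Union>mu\<in>S. generalized_eigenspace (cplx_mat A) mu)"
 by (simp add: spectral_subspace_def cplx_vec_def)

lemma subspace_spectral:
 fixes A :: "int ^ 'n ^ 'n::finite"
 shows "subspace (spectral_subspace A S)"
proof (rule subspaceI)
 have "cplx_vec (0 :: real ^ 'n) = 0" by (simp add: vec_eq_iff cplx_vec_def)
 then show "0 \<in> spectral_subspace A S" unfolding spectral_subspace_iff by (simp add: vec.span_zero)
qed (simp_all add: spectral_subspace_iff cplx_vec_add cplx_vec_scale vec.span_add vec.span_scale)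

lemma nil_part_commute:
 assumes "C ** B = B ** C"
 shows "(nil_part B mu ^^ k) (C *v w) = C *v ((nil_part B mu ^^ k) w)"
proof (induction k)
 case (Suc k)
 have "nil_part B mu (C *v v) = C *v nil_part B mu v" for v
  by (simp add: nil_part_def matrix_vector_mul_assoc assms matrix_vector_mult_diff_distrib vec.scale)
 with Suc show ?case by simp
qed simp

lemma spectral_commute:
 assumes "C ** A = A ** C" "v \<in> spectral_subspace A S"
 shows "int_act C v \<in> spectral_subspace A S"
proof -
 let ?B = "cplx_mat A" and ?C = "cplx_mat C"
 have "?C ** ?B = ?B ** ?C"
 proof -
  have hom: "cplx_mat X ** cplx_mat Y = cplx_mat (X ** Y)" for X Y :: "int ^ 'a ^ 'a"
   by (simp add: vec_eq_iff matrix_matrix_mult_def map_matrix_def)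
  show ?thesis unfolding hom assms(1) ..
 qed
 note com = this
 let ?G = "\<Union>mu\<in>S. generalized_eigenspace ?B mu"
 have "vec.span ?G \<subseteq> {w. ?C *v w \<in> vec.span ?G}"
 proof (rule vec.span_minimal)
  show "?G \<subseteq> {w. ?C *v w \<in> vec.span ?G}"
  proof
   fix w assume "w \<in> ?G"
   then obtain mu where "mu \<in> S" "w \<in> generalized_eigenspace ?B mu" by blast
   then obtain k where mu: "mu \<in> S" "(nil_part ?B mu ^^ k) w = 0" unfolding gen_eigenspace_iff by blast
   have "(nil_part ?B mu ^^ k) (?C *v w) = 0" unfolding nil_part_commute[OF com] mu(2) by simp
   then have "?C *v w \<in> generalized_eigenspace ?B mu" unfolding gen_eigenspace_iff by blast
   then show "w \<in> {w. ?C *v w \<in> vec.span ?G}" using mu(1) by (intro CollectI vec.span_base) blast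
  qed
  show "vec.subspace {w. ?C *v w \<in> vec.span ?G}"
   unfolding vec.subspace_def
   by (auto simp: vec.span_zero matrix_vector_right_distrib vec.span_add vec.scale vec.span_scale)
 qed
 then show ?thesis using assms(2) unfolding spectral_subspace_iff cplx_vec_act by blast
qed

lemma cnj_vec_nil: "cnj_vec ((nil_part (cplx_mat A) mu ^^ k) w) = (nil_part (cplx_mat A) (cnj mu) ^^ k) (cnj_vec w)"
proof (induction k)
 case (Suc k)
 have "cnj_vec (nil_part (cplx_mat A) mu v) = nil_part (cplx_mat A) (cnj mu) (cnj_vec v)" for v
  by (simp add: vec_eq_iff cnj_vec_def nil_part_def matrix_vector_mult_def map_matrix_def)
 with Suc show ?case by simp
qed simp

lemma cnj_vec_spectral:
 fixes A :: "int ^ 'n ^ 'n::finite"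
 assumes "\<And>mu. mu \<in> S \<Longrightarrow> cnj mu \<in> S" "w \<in> vec.span (\<Union>mu\<in>S. generalized_eigenspace (cplx_mat A) mu)"
 shows "cnj_vec w \<in> vec.span (\<Union>mu\<in>S. generalized_eigenspace (cplx_mat A) mu)"
proof -
 let ?G = "\<Union>mu\<in>S. generalized_eigenspace (cplx_mat A) mu"
 have "vec.span ?G \<subseteq> {w. cnj_vec w \<in> vec.span ?G}"
 proof (rule vec.span_minimal)
  show "?G \<subseteq> {w. cnj_vec w \<in> vec.span ?G}"
  proof
   fix w assume "w \<in> ?G"
   then obtain mu where "mu \<in> S" "w \<in> generalized_eigenspace (cplx_mat A) mu" by blast
   then obtain k where mu: "mu \<in> S" "(nil_part (cplx_mat A) mu ^^ k) w = 0" unfolding gen_eigenspace_iff by blast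
   have "(nil_part (cplx_mat A) (cnj mu) ^^ k) (cnj_vec w) = 0"
    unfolding cnj_vec_nil[symmetric] mu(2) by (simp add: cnj_vec_def vec_eq_iff)
   then have "cnj_vec w \<in> generalized_eigenspace (cplx_mat A) (cnj mu)" unfolding gen_eigenspace_iff by blast
   then show "w \<in> {w. cnj_vec w \<in> vec.span ?G}" using assms(1)[OF mu(1)] by (intro CollectI vec.span_base) blast
  qed
  have "cnj_vec (a + b) = cnj_vec a + cnj_vec b" "cnj_vec (c *s a) = cnj c *s cnj_vec a" "cnj_vec (0 :: complex ^ 'n) = 0"
   for a b :: "complex ^ 'n" and c by (simp_all add: vec_eq_iff cnj_vec_def)
  then show "vec.subspace {w. cnj_vec w \<in> vec.span ?G}"
   unfolding vec.subspace_def by (auto simp: vec.span_zero vec.span_add vec.span_scale)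
 qed
 then show ?thesis using assms(2) by blast
qed

text \<open>A real vector is the sum of the real parts of its complex components, and these stay in
  the respective real spaces because the three sets of eigenvalues are closed under
  conjugation.\<close>

lemma spectral_sum:
 fixes A :: "int ^ 'n::finite ^ 'n"
 shows "\<exists>s\<in>stable_space A. \<exists>c\<in>center_space A. \<exists>u\<in>unstable_space A. v = s + c + u"
proof -
 define G where "G S = (\<Union>mu\<in>S. generalized_eigenspace (cplx_mat A) mu)" for S
 define re where "re w = (\<chi> i. Re (w $ i))" for w :: "complex ^ 'n"
 have re_add: "re (a + b) = re a + re b" for a b by (simp add: re_def vec_eq_iff)
 have re_in: "re w \<in> spectral_subspace A S" if "\<And>mu. mu \<in> S \<Longrightarrow> cnj mu \<in> S" "w \<in> vec.span (G S)" for w S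
 proof -
  have "cplx_vec (re w) = (1/2) *s (w + cnj_vec w)"
   by (simp add: vec_eq_iff cplx_vec_def re_def cnj_vec_def complex_eq_iff)
  also have "\<dots> \<in> vec.span (G S)"
   using that(2) cnj_vec_spectral[of S w A, OF that(1)] unfolding G_def
   by (intro vec.span_scale vec.span_add) auto
  finally show ?thesis unfolding spectral_subspace_iff G_def .
 qed
 have "G UNIV = (G {mu. cmod mu < 1} \<union> G {mu. cmod mu = 1}) \<union> G {mu. cmod mu > 1}"
  unfolding G_def UN_Un[symmetric]
  by (intro arg_cong[where f = "\<lambda>S. \<Union> (generalized_eigenspace (cplx_mat A) ` S)"]) auto
 then have "cplx_vec v \<in> vec.span ((G {mu. cmod mu < 1} \<union> G {mu. cmod mu = 1}) \<union> G {mu. cmod mu > 1})"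
  using span_gen_eigenspaces[of "cplx_mat A"] unfolding G_def by auto
 then obtain s c u where w: "s \<in> vec.span (G {mu. cmod mu < 1})" "c \<in> vec.span (G {mu. cmod mu = 1})"
  "u \<in> vec.span (G {mu. cmod mu > 1})" "cplx_vec v = s + c + u"
  unfolding vec.span_Un by blast
 have "v = re (cplx_vec v)" by (simp add: re_def cplx_vec_def vec_eq_iff)
 also have "\<dots> = re s + re c + re u" unfolding w(4) re_add ..
 finally have "v = re s + re c + re u" .
 moreover have "re s \<in> stable_space A" unfolding stable_space_def by (rule re_in[OF _ w(1)]) simp
 moreover have "re c \<in> center_space A" unfolding center_space_def by (rule re_in[OF _ w(2)]) simp
 moreover have "re u \<in> unstable_space A" unfolding unstable_space_def by (rule re_in[OF _ w(3)]) simp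
 ultimately show ?thesis by blast
qed

text \<open>Asking for some rate strictly below \<open>\<rho>\<close> makes the condition stable
  under sums: the larger of two rates is still below \<open>\<rho>\<close>.\<close>

lemma span_growth:
 fixes B :: "complex ^ 'n::finite ^ 'n"
 assumes "\<And>w. w \<in> G \<Longrightarrow> \<exists>C r. 0 < r \<and> r < \<rho> \<and> (\<forall>n. norm (((*v) B ^^ n) w) \<le> C * r ^ n)" "0 < \<rho>"
  and "w \<in> vec.span G"
 shows "\<exists>C r. 0 < r \<and> r < \<rho> \<and> (\<forall>n. norm (((*v) B ^^ n) w) \<le> C * r ^ n)"
proof -
 let ?R = "{w. \<exists>C r. 0 < r \<and> r < \<rho> \<and> (\<forall>n. norm (((*v) B ^^ n) w) \<le> C * r ^ n)}"
 have add: "((*v) B ^^ n) (a + b) = ((*v) B ^^ n) a + ((*v) B ^^ n) b"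
  and scale: "((*v) B ^^ n) (c *s a) = c *s ((*v) B ^^ n) a" for n a b c
  by (induction n) (simp_all add: matrix_vector_right_distrib vec.scale)
 have "vec.span G \<subseteq> ?R"
 proof (rule vec.span_minimal)
  show "vec.subspace ?R" unfolding vec.subspace_def
  proof (intro conjI ballI allI)
   have "((*v) B ^^ n) 0 = 0" for n by (induction n) simp_all
   then show "0 \<in> ?R" using assms(2) by (intro CollectI exI[of _ 0] exI[of _ "\<rho>/2"]) simp
   fix a b assume "a \<in> ?R" "b \<in> ?R"
   then obtain C r D s where r: "0 < r" "r < \<rho>" "\<And>n. norm (((*v) B ^^ n) a) \<le> C * r ^ n"
    and s: "0 < s" "s < \<rho>" "\<And>n. norm (((*v) B ^^ n) b) \<le> D * s ^ n" by blast
   have "norm (((*v) B ^^ n) (a + b)) \<le> (\<bar>C\<bar> + \<bar>D\<bar>) * (max r s) ^ n" for n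
   proof -
    have "norm (((*v) B ^^ n) (a + b)) \<le> C * r ^ n + D * s ^ n"
     unfolding add using norm_triangle_ineq r(3)[of n] s(3)[of n] by (smt (verit))
    also have "C * r ^ n \<le> \<bar>C\<bar> * (max r s) ^ n" using r(1) by (intro mult_mono power_mono) auto
    also have "D * s ^ n \<le> \<bar>D\<bar> * (max r s) ^ n" using s(1) by (intro mult_mono power_mono) auto
    finally show ?thesis by (simp add: distrib_right)
   qed
   then show "a + b \<in> ?R" using r s by (intro CollectI exI[of _ "\<bar>C\<bar> + \<bar>D\<bar>"] exI[of _ "max r s"]) auto
  next
   fix a c assume "a \<in> ?R"
   then obtain C r where r: "0 < r" "r < \<rho>" "\<And>n. norm (((*v) B ^^ n) a) \<le> C * r ^ n" by blast
   have "norm (((*v) B ^^ n) (c *s a)) \<le> (cmod c * C) * r ^ n" for n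
    unfolding scale norm_vector_smult using mult_left_mono[OF r(3)[of n], of "cmod c"] by simp
   then show "c *s a \<in> ?R" using r by blast
  qed
  show "G \<subseteq> ?R" using assms(1) by blast
 qed
 then show ?thesis using assms(3) by blast
qed

lemma spectral_growth:
 assumes "v \<in> spectral_subspace A S" "\<And>mu. mu \<in> S \<Longrightarrow> cmod mu < \<rho>" "0 < \<rho>"
 shows "\<exists>C r. 0 < r \<and> r < \<rho> \<and> (\<forall>n. norm ((int_act A ^^ n) v) \<le> C * r ^ n)"
proof -
 have "\<exists>C r. 0 < r \<and> r < \<rho> \<and> (\<forall>n. norm (((*v) (cplx_mat A) ^^ n) w) \<le> C * r ^ n)"
  if w: "w \<in> (\<Union>mu\<in>S. generalized_eigenspace (cplx_mat A) mu)" for w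
 proof -
  obtain mu where mu: "mu \<in> S" "w \<in> generalized_eigenspace (cplx_mat A) mu" using w by blast
  obtain r where r: "cmod mu < r" "r < \<rho>" using dense[OF assms(2)[OF mu(1)]] by blast
  have "0 < r" using r(1) norm_ge_zero[of mu] by linarith
  then show ?thesis using gen_eigen_growth[OF mu(2) r(1)] r(2) by blast
 qed
 from span_growth[OF this assms(3) assms(1)[unfolded spectral_subspace_iff]]
 show ?thesis unfolding cplx_vec_act_pow[symmetric] norm_cplx_vec .
qed

lemma spectral_growth_inverse:
 assumes "v \<in> spectral_subspace A S" "\<And>mu. mu \<in> S \<Longrightarrow> 1 < \<rho> * cmod mu" "0 < \<rho>" and inv: "Ai ** A = mat 1"
 shows "\<exists>C r. 0 < r \<and> r < \<rho> \<and> (\<forall>n. norm ((int_act Ai ^^ n) v) \<le> C * r ^ n)"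
proof -
 have inv': "cplx_mat Ai ** cplx_mat A = mat 1"
 proof -
  have "cplx_mat Ai ** cplx_mat A = cplx_mat (Ai ** A)"
   by (simp add: vec_eq_iff matrix_matrix_mult_def map_matrix_def)
  then show ?thesis unfolding inv by (simp add: vec_eq_iff mat_def map_matrix_def)
 qed
 have "\<exists>C r. 0 < r \<and> r < \<rho> \<and> (\<forall>n. norm (((*v) (cplx_mat Ai) ^^ n) w) \<le> C * r ^ n)"
  if w: "w \<in> (\<Union>mu\<in>S. generalized_eigenspace (cplx_mat A) mu)" for w
 proof -
  obtain mu where mu: "mu \<in> S" "w \<in> generalized_eigenspace (cplx_mat A) mu" using w by blast
  have m0: "0 < cmod mu" using assms(2)[OF mu(1)] by (cases "mu = 0") auto
  have "1 / cmod mu < \<rho>" using assms(2)[OF mu(1)] m0 by (simp add: field_simps)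
  then obtain r where r: "1 / cmod mu < r" "r < \<rho>" using dense by blast
  have r0: "0 < r" using r(1) m0 by (meson divide_pos_pos less_trans zero_less_one)
  have "1 < r * cmod mu" using r(1) m0 by (simp add: field_simps)
  then show ?thesis using gen_eigenspace_inverse(2)[OF inv' mu(2)] r0 r(2) by blast
 qed
 from span_growth[OF this assms(3) assms(1)[unfolded spectral_subspace_iff]]
 show ?thesis unfolding cplx_vec_act_pow[symmetric] norm_cplx_vec .
qed

lemma linear_funpow:
 fixes T :: "'a::real_vector \<Rightarrow> 'a"
 assumes "linear T"
 shows "linear (T ^^ n)"
 by (induction n) (simp_all add: id_def linear_ident linear_compose[OF _ assms, unfolded comp_def])

text \<open>Each vector comes with its own constants; those of a finite orthonormal basis serve for
  all.\<close>

lemma uniform_growth: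
 fixes T :: "'a::euclidean_space \<Rightarrow> 'a"
 assumes T: "linear T" and E: "subspace E" and \<rho>: "0 < \<rho>"
  and g: "\<And>v. v \<in> E \<Longrightarrow> \<exists>C r. 0 < r \<and> r < \<rho> \<and> (\<forall>n. norm ((T ^^ n) v) \<le> C * r ^ n)"
 obtains C r where "0 < r" "r < \<rho>" "0 < C" "\<And>v n. v \<in> E \<Longrightarrow> norm ((T ^^ n) v) \<le> C * r ^ n * norm v"
proof -
 obtain b where b: "b \<subseteq> E" "pairwise orthogonal b" "\<And>x. x \<in> b \<Longrightarrow> norm x = 1" "independent b" "span b = E"
  using orthonormal_basis_subspace[OF E] by metis
 have fb: "finite b" using b(4) independent_imp_finite by blast
 have "\<forall>x\<in>b. \<exists>C r. 0 < r \<and> r < \<rho> \<and> (\<forall>n. norm ((T ^^ n) x) \<le> C * r ^ n)" using g b(1) by blast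
 then obtain Cf rf where cr: "\<And>x. x \<in> b \<Longrightarrow> 0 < rf x \<and> rf x < \<rho> \<and> (\<forall>n. norm ((T ^^ n) x) \<le> Cf x * rf x ^ n)"
  by metis
 define r where "r = Max (insert (\<rho>/2) (rf ` b))"
 define C where "C = 1 + (\<Sum>x\<in>b. \<bar>Cf x\<bar>)"
 have "\<rho>/2 \<le> r" "\<And>x. x \<in> b \<Longrightarrow> rf x \<le> r"
  unfolding r_def using fb by (simp_all only: Max_ge finite_imageI finite_insert insertI1 insertI2 imageI)
 moreover have "r < \<rho>" unfolding r_def using fb cr \<rho> by (subst Max_less_iff) auto
 ultimately have r: "0 < r" "r < \<rho>" "\<And>x. x \<in> b \<Longrightarrow> rf x \<le> r" using \<rho> by auto
 have "norm ((T ^^ n) v) \<le> C * r ^ n * norm v" if v: "v \<in> E" for v n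
 proof -
  have "(T ^^ n) v = (\<Sum>x\<in>b. (v \<bullet> x) *\<^sub>R (T ^^ n) x)"
   using arg_cong[OF orthonormal_basis_expand[OF b(2,3) _ fb, of v], of "T ^^ n"] v
   by (simp add: b(5) linear_sum[OF linear_funpow[OF T]] linear_scale[OF linear_funpow[OF T]])
  also have "norm \<dots> \<le> (\<Sum>x\<in>b. norm v * (\<bar>Cf x\<bar> * r ^ n))"
  proof (rule sum_norm_le)
   fix x assume x: "x \<in> b"
   have "norm ((T ^^ n) x) \<le> Cf x * rf x ^ n" using cr[OF x] by blast
   also have "\<dots> \<le> \<bar>Cf x\<bar> * r ^ n" using cr[OF x] r(3)[OF x] by (intro mult_mono power_mono) auto
   finally show "norm ((v \<bullet> x) *\<^sub>R (T ^^ n) x) \<le> norm v * (\<bar>Cf x\<bar> * r ^ n)"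
    using Cauchy_Schwarz_ineq2[of v x] b(3)[OF x] by (simp add: mult_mono)
  qed
  also have "\<dots> = (\<Sum>x\<in>b. \<bar>Cf x\<bar>) * (r ^ n * norm v)"
   by (simp only: sum_distrib_right) (simp add: mult_ac)
  also have "\<dots> \<le> C * (r ^ n * norm v)" unfolding C_def using r(1) by (intro mult_right_mono) auto
  finally show ?thesis by (simp add: mult.assoc)
 qed
 moreover have "0 < C" unfolding C_def by (rule add_pos_nonneg) (simp_all add: sum_nonneg)
 ultimately show ?thesis using that r by blast
qed

section \<open>Integer vectors, Lebesgue measure on the torus and ergodicity\<close>

definition int_vecs :: "(real ^ 'n) set" where
 "int_vecs = {x. \<forall>i. x $ i \<in> \<int>}"

lemma torus_of_eq: "torus_of x = torus_of y \<longleftrightarrow> x - y \<in> int_vecs"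
 by (simp add: torus_of_eq_iff int_vecs_def)

lemma int_vecs_act: "k \<in> int_vecs \<Longrightarrow> int_act A k \<in> int_vecs"
 by (auto simp: int_vecs_def matrix_vector_mult_def map_matrix_def intro!: Ints_sum Ints_mult)

lemma int_vecs_add: "x \<in> int_vecs \<Longrightarrow> y \<in> int_vecs \<Longrightarrow> x + y \<in> int_vecs"
 and int_vecs_minus: "x \<in> int_vecs \<Longrightarrow> - x \<in> int_vecs"
 and int_vecs_zero: "0 \<in> int_vecs"
 by (auto simp: int_vecs_def)

lemma torus_of_rep: "torus_of (rep_torus p) = p"
 using Quotient3_abs_rep[OF Quotient3_torus] .

lemma toral_map_of: "toral_map A (torus_of x) = torus_of (int_act A x)"
 by (rule toral_map.abs_eq)

lemma continuous_torus_of: "continuous_on S torus_of"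
proof (rule continuous_on_subset[OF _ subset_UNIV])
 show "continuous_on UNIV torus_of"
  unfolding continuous_on_open_vimage[OF open_UNIV] by (simp add: open_torus_def)
qed

text \<open>Fractional parts give a point of the half-open cube; a small step along the diagonal
  leaves the lower faces without reaching the upper ones.\<close>

lemma open_periodic_meets_cube:
 fixes U :: "(real ^ 'n::finite) set"
 assumes U: "open U" "U \<noteq> {}" "\<And>x k. x \<in> U \<Longrightarrow> k \<in> int_vecs \<Longrightarrow> x + k \<in> U"
 shows "\<exists>x\<in>U. \<forall>i. 0 < x $ i \<and> x $ i < 1"
proof -
 obtain x0 where x0: "x0 \<in> U" using U(2) by blast
 define x where "x = (\<chi> i. frac (x0 $ i))"
 have xU: "x \<in> U"
 proof -
  have "x = x0 + (\<chi> i. - of_int \<lfloor>x0 $ i\<rfloor>)" by (simp add: x_def vec_eq_iff frac_def)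
  then show ?thesis using U(3)[OF x0, of "\<chi> i. - of_int \<lfloor>x0 $ i\<rfloor>"] by (simp add: int_vecs_def)
 qed
 obtain d where d: "0 < d" "ball x d \<subseteq> U" using U(1) xU open_contains_ball by blast
 define M where "M = Max (range (\<lambda>i. x $ i))"
 have M: "x $ i \<le> M" for i unfolding M_def by (intro Max_ge) auto
 have "M < 1" unfolding M_def by (subst Max_less_iff) (auto simp: x_def frac_lt_1)
 define c :: "real ^ 'n" where "c = (\<chi> i. 1)"
 define t where "t = min ((1 - M) / 2) (d / (2 * (1 + norm c)))"
 have nc: "0 < 1 + norm c" by (smt (verit) norm_ge_zero)
 have t: "0 < t" unfolding t_def using \<open>M < 1\<close> d(1) nc by simp
 have t2: "t \<le> (1 - M) / 2" unfolding t_def by (rule min.cobounded1)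
 have t3: "t \<le> d / (2 * (1 + norm c))" unfolding t_def by (rule min.cobounded2)
 have "norm (t *\<^sub>R c) < d"
 proof -
  have "norm (t *\<^sub>R c) \<le> t * (1 + norm c)" using t by simp
  also have "\<dots> \<le> d / (2 * (1 + norm c)) * (1 + norm c)" using t3 nc by (intro mult_right_mono) auto
  also have "\<dots> = d / 2" using nc by (simp add: field_simps)
  finally show ?thesis using d(1) by simp
 qed
 then have "x + t *\<^sub>R c \<in> U" using d(2) by (auto simp: dist_norm)
 moreover have "0 < (x + t *\<^sub>R c) $ i \<and> (x + t *\<^sub>R c) $ i < 1" for i
 proof -
  have "0 \<le> x $ i" by (simp add: x_def)
  moreover have "t \<le> 1 / 2 - M / 2" using t2 by (simp add: diff_divide_distrib)
  ultimately have "0 < x $ i + t" "x $ i + t < 1" using t M[of i] \<open>M < 1\<close> by linarith+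
  then show ?thesis by (simp add: c_def)
 qed
 ultimately show ?thesis by blast
qed

text \<open>Serves to refute ergodicity by two disjoint non-empty open sets, one of them
  invariant.\<close>

lemma torus_measure_open_pos:
 fixes U :: "'n::finite torus set"
 assumes "open U" "U \<noteq> {}"
 shows "emeasure torus_measure U \<noteq> 0"
proof
 assume 0: "emeasure torus_measure U = 0"
 let ?cube = "{x :: real ^ 'n. \<forall>i. 0 \<le> x $ i \<and> x $ i < 1}"
 let ?int = "{x :: real ^ 'n. \<forall>i. 0 < x $ i \<and> x $ i < 1}"
 let ?V = "torus_of -` U"
 have oV: "open ?V" using assms(1) by (simp add: open_torus_def)
 have meas: "?cube \<in> sets lborel" by measurable
 have "torus_of \<in> measurable (restrict_space lborel ?cube) borel"
  by (rule measurable_restrict_space1)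
   (simp add: borel_measurable_continuous_onI[OF continuous_torus_of])
 then have "emeasure torus_measure U = emeasure (restrict_space lborel ?cube) (?V \<inter> ?cube)"
  unfolding torus_measure_def using assms(1)
  by (subst emeasure_distr) (auto simp: space_restrict_space)
 also have "\<dots> = emeasure lborel (?V \<inter> ?cube)"
  using meas by (intro emeasure_restrict_space) auto
 finally have z: "emeasure lborel (?V \<inter> ?cube) = 0" using 0 by simp
 have oi: "open ?int"
 proof -
  have "?int = (\<Inter>i. {x. 0 < x $ i} \<inter> {x. x $ i < 1})" by auto
  also have "open \<dots>" by (intro open_INT open_Int open_Collect_less ballI continuous_intros) auto
  finally show ?thesis .
 qed
 have "emeasure lborel (?V \<inter> ?int) \<le> emeasure lborel (?V \<inter> ?cube)"
  using oV meas by (intro emeasure_mono) (auto intro: less_imp_le sets.Int)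
 then have "emeasure lborel (?V \<inter> ?int) = 0" using z by simp
 then have "?V \<inter> ?int \<in> null_sets lborel" using oV oi by (intro null_setsI) auto
 then have "negligible (?V \<inter> ?int)"
  by (simp add: negligible_iff_null_sets null_sets_completionI)
 moreover have "?V \<inter> ?int \<noteq> {}"
 proof -
  obtain p where "p \<in> U" using assms(2) by blast
  then have "?V \<noteq> {}" using torus_of_surj[of p] by auto
  moreover have "x + k \<in> ?V" if "x \<in> ?V" "k \<in> int_vecs" for x k
  proof -
   have "torus_of (x + k) = torus_of x" using that(2) by (simp add: torus_of_eq)
   then show ?thesis using that(1) by simp
  qed
  ultimately show ?thesis using open_periodic_meets_cube[OF oV] by blast
 qed
 ultimately show False using open_not_negligible[OF open_Int[OF oV oi]] by blast
qed

lemma map_matrix_mult: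
 "(map_matrix of_int (A ** B) :: 'a::comm_ring_1 ^ 'n ^ 'n::finite) = map_matrix of_int A ** map_matrix of_int B"
 by (simp add: vec_eq_iff matrix_matrix_mult_def map_matrix_def)

lemma map_matrix_mat: "(map_matrix of_int (mat 1) :: 'a::comm_ring_1 ^ 'n ^ 'n::finite) = mat 1"
 by (simp add: vec_eq_iff mat_def map_matrix_def)

lemma det_map_matrix: "det (map_matrix of_int A :: 'a::comm_ring_1 ^ 'n ^ 'n::finite) = of_int (det A)"
 by (simp add: det_def map_matrix_def)

lemma clear_denominators:
 fixes y :: "rat ^ 'n::finite"
 obtains d :: int and m :: "int ^ 'n" where "0 < d" "\<And>i. of_int d * y $ i = of_int (m $ i)"
proof -
 define den where "den i = snd (quotient_of (y $ i))" for i
 define d where "d = (\<Prod>i\<in>UNIV. den i)"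
 have pos: "0 < den i" for i unfolding den_def by (rule quotient_of_denom_pos')
 have "\<exists>z::int. of_int d * y $ i = of_int z" for i
 proof -
  have q: "y $ i = of_int (fst (quotient_of (y $ i))) / of_int (den i)"
   unfolding den_def by (rule quotient_of_div) simp
  have "d = den i * (\<Prod>j\<in>UNIV - {i}. den j)" unfolding d_def by (simp add: prod.remove)
  then have "of_int d * y $ i = of_int (fst (quotient_of (y $ i)) * (\<Prod>j\<in>UNIV - {i}. den j))"
   using pos[of i] by (subst q) simp
  then show ?thesis by blast
 qed
 then obtain z where "\<And>i. of_int d * y $ i = of_int (z i)" by metis
 then show ?thesis using that[of d "\<chi> i. z i"] pos by (simp add: d_def prod_pos)
qed

text \<open>
 A vector periodic under \<open>A\<close> yields an integer vector periodic under the transpose, hence a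
 non-constant invariant trigonometric polynomial.
\<close>

lemma ergodic_no_periodic:
 fixes A :: "int ^ 'n ^ 'n::finite"
 assumes erg: "ergodic torus_measure (toral_map A)" and j: "0 < j" and per: "(int_act A ^^ j) v = v"
 shows "v = 0"
proof (rule ccontr)
 assume v0: "v \<noteq> 0"
 have "\<exists>M. \<forall>x. int_act M x = (int_act A ^^ i) x" for i
 proof (induction i)
  case 0
  then show ?case by (intro exI[of _ "mat 1"]) (simp add: map_matrix_mat)
 next
  case (Suc i)
  then obtain M where "\<And>x. int_act M x = (int_act A ^^ i) x" by blast
  then show ?case
   by (intro exI[of _ "A ** M"]) (simp add: map_matrix_mult matrix_vector_mul_assoc[symmetric])
 qed
 then obtain M where M: "\<And>x. int_act M x = (int_act A ^^ j) x" by blast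
 have "int_act (M - mat 1) v = 0"
 proof -
  have "map_matrix real_of_int (M - mat 1) = map_matrix real_of_int M - mat 1"
   by (simp add: vec_eq_iff map_matrix_def mat_def)
  then show ?thesis using per by (simp add: matrix_vector_mult_diff_rdistrib M)
 qed
 \<comment> \<open>The determinant is an integer, so its vanishing passes from the reals to the
   rationals, where a kernel vector can be cleared of denominators.\<close>
 then have "det (map_matrix real_of_int (M - mat 1)) = 0"
  using v0 invertible_det_nz[of "map_matrix real_of_int (M - mat 1)"]
   matrix_left_invertible_ker[of "map_matrix real_of_int (M - mat 1)"]
  by (auto simp: invertible_def)
 then have "det (transpose (M - mat 1)) = 0" by (simp add: det_map_matrix det_transpose)
 then have "det (map_matrix rat_of_int (transpose (M - mat 1))) = 0" by (simp add: det_map_matrix)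
 then have "\<not> invertible (map_matrix rat_of_int (transpose (M - mat 1)))" by (simp add: invertible_det_nz)
 then obtain y where y: "y \<noteq> 0" "map_matrix rat_of_int (transpose (M - mat 1)) *v y = 0"
  unfolding invertible_left_inverse matrix_left_invertible_ker by blast
 obtain d m where dm: "0 < d" "\<And>i. of_int d * y $ i = of_int (m $ i)" using clear_denominators[of y] by blast
 have m0: "m \<noteq> 0"
 proof
  assume "m = 0"
  then have "y $ i = 0" for i using dm(1) dm(2)[of i] by simp
  then show False using y(1) by (simp add: vec_eq_iff)
 qed
 define w where "w = (\<chi> i. real_of_int (m $ i))"
 have mM: "(\<Sum>k\<in>UNIV. m $ k * M $ k $ i) = m $ i" for i
 proof -
  have "0 = of_int d * (\<Sum>k\<in>UNIV. rat_of_int ((M - mat 1) $ k $ i) * y $ k)"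
   using arg_cong[OF y(2), of "\<lambda>z. z $ i"]
   by (simp add: matrix_vector_mult_def map_matrix_def transpose_def)
  also have "\<dots> = (\<Sum>k\<in>UNIV. rat_of_int ((M - mat 1) $ k $ i) * of_int (m $ k))"
   unfolding dm(2)[symmetric] by (simp add: sum_distrib_left mult.left_commute)
  also have "\<dots> = of_int (\<Sum>k\<in>UNIV. (M - mat 1) $ k $ i * m $ k)" by simp
  finally have "(\<Sum>k\<in>UNIV. (M - mat 1) $ k $ i * m $ k) = 0" by (metis of_int_eq_0_iff)
  moreover have "(\<Sum>k\<in>UNIV. (M - mat 1) $ k $ i * m $ k) = (\<Sum>k\<in>UNIV. m $ k * M $ k $ i) - (\<Sum>k\<in>UNIV. if k = i then m $ k else 0)"
   unfolding sum_subtractf[symmetric] by (intro sum.cong) (auto simp: mat_def algebra_simps)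
  ultimately show ?thesis by simp
 qed
 have wM: "w \<bullet> (int_act A ^^ j) x = w \<bullet> x" for x
 proof -
  have "w \<bullet> int_act M x = (\<Sum>k\<in>UNIV. \<Sum>i\<in>UNIV. real_of_int (m $ k) * (real_of_int (M $ k $ i) * x $ i))"
   by (simp add: inner_vec_def w_def matrix_vector_mult_def map_matrix_def sum_distrib_left)
  also have "\<dots> = (\<Sum>i\<in>UNIV. \<Sum>k\<in>UNIV. real_of_int (m $ k) * (real_of_int (M $ k $ i) * x $ i))"
   by (rule sum.swap)
  also have "\<dots> = (\<Sum>i\<in>UNIV. real_of_int (\<Sum>k\<in>UNIV. m $ k * M $ k $ i) * x $ i)"
   by (simp add: sum_distrib_right mult.assoc)
  also have "\<dots> = w \<bullet> x" unfolding mM by (simp add: inner_vec_def w_def)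
  finally show ?thesis unfolding M .
 qed
 \<comment> \<open>A sum of cosines over one period; it is invariant because \<open>w\<close> is
   fixed by the transpose of the \<open>j\<close>th power of \<open>A\<close>.\<close>
 define g where "g x = (\<Sum>i<j. cos (2 * pi * (w \<bullet> (int_act A ^^ i) x)))" for x
 have g_inv: "g (int_act A x) = g x" for x
 proof -
  let ?f = "\<lambda>i. cos (2 * pi * (w \<bullet> (int_act A ^^ i) x))"
  have "g (int_act A x) = (\<Sum>i<j. ?f (Suc i))" unfolding g_def by (simp only: funpow_Suc_right o_apply)
  also have "\<dots> = (\<Sum>i<Suc j. ?f i) - ?f 0" unfolding sum.lessThan_Suc_shift by simp
  also have "\<dots> = g x" by (simp add: g_def wM)
  finally show ?thesis .
 qed
 have pow_int: "k \<in> int_vecs \<Longrightarrow> (int_act A ^^ i) k \<in> int_vecs" for k i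
  by (induction i) (simp_all add: int_vecs_act)
 have pow_add: "(int_act A ^^ i) (x + k) = (int_act A ^^ i) x + (int_act A ^^ i) k" for i x k
  by (induction i) (simp_all add: matrix_vector_right_distrib)
 have g_per: "g (x + k) = g x" if k: "k \<in> int_vecs" for x k
  unfolding g_def
 proof (rule sum.cong[OF refl])
  fix i
  have "w \<bullet> (int_act A ^^ i) k \<in> \<int>"
   using pow_int[OF k, of i] by (auto simp: inner_vec_def w_def int_vecs_def intro!: Ints_sum Ints_mult)
  then obtain z where z: "w \<bullet> (int_act A ^^ i) k = of_int z" by (elim Ints_cases)
  have "2 * pi * (w \<bullet> (int_act A ^^ i) (x + k)) = 2 * pi * (w \<bullet> (int_act A ^^ i) x) + 2 * pi * of_int z"
   unfolding pow_add inner_add_right z by (simp add: distrib_left)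
  then show "cos (2 * pi * (w \<bullet> (int_act A ^^ i) (x + k))) = cos (2 * pi * (w \<bullet> (int_act A ^^ i) x))"
   by (simp add: cos_add)
 qed
 have g_cont: "continuous_on UNIV g"
 proof -
  have "continuous_on UNIV (int_act A ^^ i)" for i
   by (induction i) (auto simp: comp_def intro!: continuous_intros
     continuous_on_compose2[OF matrix_vector_mult_linear_continuous_on[of UNIV]])
  then show ?thesis unfolding g_def by (intro continuous_intros)
 qed
 have g_rep: "g (rep_torus (torus_of x)) = g x" for x
  using g_per[of "rep_torus (torus_of x) - x" x] torus_of_eq[of "rep_torus (torus_of x)" x] by (simp add: torus_of_rep)
 \<comment> \<open>The threshold separates the value \<open>j\<close> at 0 from a value of at most
   \<open>j - 2\<close>, attained where the first cosine is -1.\<close>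
 define B where "B = {z. real j - 1 < g (rep_torus z)}"
 define B' where "B' = {z. g (rep_torus z) < real j - 1}"
 have B_iff: "torus_of x \<in> B \<longleftrightarrow> real j - 1 < g x" and B'_iff: "torus_of x \<in> B' \<longleftrightarrow> g x < real j - 1" for x
  by (simp_all add: B_def B'_def g_rep)
 have oB: "open B" "open B'" unfolding open_torus_def
 proof -
  have "torus_of -` B = {x. real j - 1 < g x}" "torus_of -` B' = {x. g x < real j - 1}"
   using B_iff B'_iff by auto
  then show "open (torus_of -` B)" "open (torus_of -` B')"
   using g_cont by (simp_all add: open_Collect_less continuous_on_const)
 qed
 have inv: "toral_map A -` B \<inter> space torus_measure = B"
 proof -
  have "p \<in> toral_map A -` B \<longleftrightarrow> p \<in> B" for p
  proof -
   obtain x where "torus_of x = p" using torus_of_surj by blast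
   then show ?thesis using B_iff[of x] B_iff[of "int_act A x"] g_inv[of x] toral_map_of[of A x] by auto
  qed
  then show ?thesis by (auto simp: torus_measure_def)
 qed
 have "B \<in> sets torus_measure" using oB(1) by (simp add: torus_measure_def)
 then have "emeasure torus_measure B = 0 \<or> emeasure torus_measure (space torus_measure - B) = 0"
  using erg inv unfolding ergodic_def by blast
 moreover have "B \<noteq> {}"
 proof -
  have "(int_act A ^^ i) 0 = 0" for i by (induction i) simp_all
  then have "g 0 = real j" by (simp add: g_def)
  then show ?thesis using B_iff[of 0] by auto
 qed
 then have "emeasure torus_measure B \<noteq> 0" by (rule torus_measure_open_pos[OF oB(1)])
 moreover have "emeasure torus_measure (space torus_measure - B) \<noteq> 0"
 proof
  assume z: "emeasure torus_measure (space torus_measure - B) = 0"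
  have "B' \<subseteq> space torus_measure - B" by (auto simp: B_def B'_def torus_measure_def)
  then have "emeasure torus_measure B' \<le> emeasure torus_measure (space torus_measure - B)"
   using oB by (intro emeasure_mono) (auto simp: torus_measure_def intro!: sets.Diff)
  then have "emeasure torus_measure B' = 0" using z by simp
  moreover have "B' \<noteq> {}"
  proof -
   obtain i where i: "m $ i \<noteq> 0" using m0 by (auto simp: vec_eq_iff)
   define x where "x = axis i (1 / (2 * real_of_int (m $ i)))"
   have "w \<bullet> x = 1 / 2" using i by (simp add: x_def inner_axis w_def)
   then have "cos (2 * pi * (w \<bullet> x)) = -1" by (simp only:) simp
   have "g x = cos (2 * pi * (w \<bullet> x)) + (\<Sum>i\<in>{..<j} - {0}. cos (2 * pi * (w \<bullet> (int_act A ^^ i) x)))"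
    unfolding g_def using j by (subst sum.remove[of _ 0]) auto
   also have "(\<Sum>i\<in>{..<j} - {0}. cos (2 * pi * (w \<bullet> (int_act A ^^ i) x))) \<le> (\<Sum>i\<in>{..<j} - {0}. 1)"
    by (rule sum_mono) simp
   also have "\<dots> = real j - 1" using j by (simp add: of_nat_diff)
   finally have "g x < real j - 1" using \<open>cos (2 * pi * (w \<bullet> x)) = -1\<close> by simp
   then show ?thesis using B'_iff[of x] by auto
  qed
  ultimately show False using torus_measure_open_pos[OF oB(2)] by blast
 qed
 ultimately show False by blast
qed

text \<open>For determinant 1, Cramer's rule gives the entries of the inverse as determinants of
  integer matrices.\<close>

lemma int_inverse:
 fixes A :: "int ^ 'n ^ 'n::finite"
 assumes "det A = 1"
 obtains Ai where "A ** Ai = mat 1" "Ai ** A = mat 1"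
proof -
 let ?R = "map_matrix real_of_int :: int ^ 'n ^ 'n \<Rightarrow> real ^ 'n ^ 'n"
 have d: "det (?R A) = 1" using assms by (simp add: det_map_matrix)
 define Ai :: "int ^ 'n ^ 'n" where
  "Ai = (\<chi> k l. det (\<chi> i j. if j = k then (if i = l then 1 else 0) else A $ i $ j))"
 have col: "?R A *v column l (?R Ai) = axis l 1" for l
 proof -
  have "column l (?R Ai) = (\<chi> k. det (\<chi> i j. if j = k then axis l 1 $ i else ?R A $ i $ j) / det (?R A))"
  proof -
   have eq: "real_of_int (det (\<chi> i j. if j = k then (if i = l then 1 else 0) else A $ i $ j))
     = det (\<chi> i j. if j = k then axis l 1 $ i else ?R A $ i $ j)" for k
    unfolding det_map_matrix[symmetric]
    by (rule arg_cong[where f = det]) (simp add: vec_eq_iff map_matrix_def axis_def)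
   have "column l (?R Ai) $ k = real_of_int (det (\<chi> i j. if j = k then (if i = l then 1 else 0) else A $ i $ j))" for k
    by (simp add: column_def Ai_def map_matrix_def)
   then show ?thesis unfolding eq vec_eq_iff d by simp
  qed
  then show ?thesis using cramer[of "?R A" "column l (?R Ai)" "axis l 1"] d by simp
 qed
 have "?R A ** ?R Ai = mat 1"
 proof -
  have "(?R A ** ?R Ai) $ i $ l = (?R A *v column l (?R Ai)) $ i" for i l
   by (simp add: matrix_matrix_mult_def matrix_vector_mult_def column_def)
  then show ?thesis unfolding col by (simp add: vec_eq_iff mat_def axis_def)
 qed
 moreover from this have "?R Ai ** ?R A = mat 1" by (simp add: matrix_left_right_inverse)
 moreover have "X = Y" if "?R X = ?R Y" for X Y using that by (simp add: vec_eq_iff map_matrix_def)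
 ultimately have "A ** Ai = mat 1" "Ai ** A = mat 1"
  by (metis map_matrix_mat map_matrix_mult)+
 then show ?thesis by (rule that)
qed

section \<open>Adapted norms and Diophantine estimates\<close>

lemma exp_growth_contra:
 fixes r x C :: real
 assumes "0 < r" "r < x" "\<And>n. x ^ n \<le> C * r ^ n"
 shows False
proof -
 have "1 < x / r" using assms by simp
 from real_arch_pow[OF this] obtain n where n: "C < (x / r) ^ n" by blast
 have "(x / r) ^ n \<le> C" using assms(3)[of n] assms(1) by (simp add: power_divide pos_divide_le_eq)
 then show False using n by simp
qed

text \<open>A Euclidean combination, as its square is a quadratic form and so, by
  \<open>quadratic_matrix_L2\<close>, can be part of a Riemannian metric.\<close>

lemma seminorm_L2_set:
 fixes S :: "nat \<Rightarrow> 'a::real_vector \<Rightarrow> 'b::real_normed_vector"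
 assumes "\<And>i. linear (S i)"
 shows "seminorm (\<lambda>v. L2_set (\<lambda>i. norm (S i v)) {..<M})"
 unfolding seminorm_def
proof (intro conjI allI)
 fix x y
 have "L2_set (\<lambda>i. norm (S i (x + y))) {..<M} \<le> L2_set (\<lambda>i. norm (S i x) + norm (S i y)) {..<M}"
  by (intro L2_set_mono) (auto simp: linear_add[OF assms] norm_triangle_ineq)
 also have "\<dots> \<le> L2_set (\<lambda>i. norm (S i x)) {..<M} + L2_set (\<lambda>i. norm (S i y)) {..<M}"
  by (rule L2_set_triangle_ineq)
 finally show "L2_set (\<lambda>i. norm (S i (x + y))) {..<M} \<le> L2_set (\<lambda>i. norm (S i x)) {..<M} + L2_set (\<lambda>i. norm (S i y)) {..<M}" .
next
 fix c x
 show "L2_set (\<lambda>i. norm (S i (c *\<^sub>R x))) {..<M} = \<bar>c\<bar> * L2_set (\<lambda>i. norm (S i x)) {..<M}"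
  by (simp add: linear_scale[OF assms] L2_set_right_distrib)
qed

text \<open>Finitely many weighted iterates make one step a contraction.\<close>

lemma lyapunov_norm:
 fixes T P :: "'a::euclidean_space \<Rightarrow> 'a"
 assumes T: "linear T" and P: "linear P" and com: "\<And>v. P (T v) = T (P v)"
  and r: "0 < r" "r < lam" and g: "\<And>v n. norm ((T ^^ n) (P v)) \<le> C * r ^ n * norm (P v)"
 obtains M S where "\<And>i. linear (S i :: 'a \<Rightarrow> 'a)"
  "\<And>v. L2_set (\<lambda>i. norm (S i (T v))) {..<M::nat} \<le> lam * L2_set (\<lambda>i. norm (S i v)) {..<M}"
  "\<And>v. norm (P v) \<le> L2_set (\<lambda>i. norm (S i v)) {..<M}"
  "\<And>v i. P v = 0 \<Longrightarrow> S i v = 0"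
proof -
 have lam: "0 < lam" using r by linarith
 have "(\<lambda>n. C * (r / lam) ^ n) \<longlonglongrightarrow> C * 0"
  using r lam by (intro tendsto_intros LIMSEQ_power_zero) simp
 then have "(\<lambda>n. C * (r / lam) ^ n) \<longlonglongrightarrow> 0" by simp
 then have "\<forall>\<^sub>F n in sequentially. C * (r / lam) ^ n < 1" by (rule order_tendstoD) simp
 then obtain N where N: "\<And>n. N \<le> n \<Longrightarrow> C * (r / lam) ^ n < 1" unfolding eventually_sequentially by blast
 \<comment> \<open>At time \<open>M\<close> the weighted iterate is no longer than the initial one,
   so that the sum of squares does not increase when its index is shifted by one.\<close>
 define M where "M = Suc N"
 have M: "C * r ^ M \<le> lam ^ M"
 proof -
  have "C * (r / lam) ^ M < 1" by (rule N) (simp add: M_def)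
  then show ?thesis using lam by (simp add: power_divide pos_divide_less_eq)
 qed
 define S where "S i v = (1 / lam ^ i) *\<^sub>R (T ^^ i) (P v)" for i v
 note lin = linear_funpow[OF T]
 have linS: "linear (S i)" for i
 proof -
  have "linear (\<lambda>v. (T ^^ i) (P v))" using linear_compose[OF P lin, of i] by (simp add: comp_def)
  then show ?thesis unfolding S_def by (rule linear_compose_scale_right)
 qed
 have "L2_set (\<lambda>i. norm (S i (T v))) {..<M} \<le> lam * L2_set (\<lambda>i. norm (S i v)) {..<M}" for v
 proof -
  let ?f = "\<lambda>i. (norm (S i v))\<^sup>2"
  have step: "norm (S i (T v)) = lam * norm (S (Suc i) v)" for i
  proof -
   have "(T ^^ i) (P (T v)) = (T ^^ Suc i) (P v)" by (simp add: com funpow_swap1)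
   then show ?thesis using lam by (simp add: S_def)
  qed
  have last: "?f M \<le> ?f 0"
  proof -
   have "norm (S M v) = norm ((T ^^ M) (P v)) / lam ^ M" using lam by (simp add: S_def)
   also have "\<dots> \<le> (C * r ^ M * norm (P v)) / lam ^ M" using g[of M v] lam by (intro divide_right_mono) auto
   also have "\<dots> \<le> (lam ^ M * norm (P v)) / lam ^ M"
    using M lam by (intro divide_right_mono mult_right_mono) auto
   also have "\<dots> = norm (S 0 v)" using lam by (simp add: S_def)
   finally show ?thesis by (intro power_mono) auto
  qed
  have "(\<Sum>i<M. ?f (Suc i)) + ?f 0 = (\<Sum>i<M. ?f i) + ?f M"
   using sum.lessThan_Suc_shift[of ?f M] sum.lessThan_Suc[of ?f M] by simp
  then have le: "(\<Sum>i<M. ?f (Suc i)) \<le> (\<Sum>i<M. ?f i)" using last by linarith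
  have "L2_set (\<lambda>i. norm (S i (T v))) {..<M} = lam * L2_set (\<lambda>i. norm (S (Suc i) v)) {..<M}"
   unfolding step using lam by (simp add: L2_set_right_distrib)
  also have "L2_set (\<lambda>i. norm (S (Suc i) v)) {..<M} \<le> L2_set (\<lambda>i. norm (S i v)) {..<M}"
   unfolding L2_set_def by (rule real_sqrt_le_mono[OF le])
  finally show ?thesis using lam by simp
 qed
 moreover have "norm (P v) \<le> L2_set (\<lambda>i. norm (S i v)) {..<M}" for v
 proof -
  have "norm (S 0 v) \<le> L2_set (\<lambda>i. norm (S i v)) {..<M}" by (rule member_le_L2_set) (auto simp: M_def)
  then show ?thesis by (simp add: S_def)
 qed
 moreover have "S i v = 0" if "P v = 0" for i v
  using that linear_0[OF lin, of i] by (simp add: S_def)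
 ultimately show ?thesis using that[of S M] linS by blast
qed

lemma quadratic_matrix:
 fixes S :: "real ^ 'n::finite \<Rightarrow> 'b::real_inner"
 assumes "linear S"
 obtains G :: "real ^ 'n ^ 'n" where "transpose G = G" "\<And>v. v \<bullet> (G *v v) = (norm (S v))\<^sup>2"
proof -
 define G :: "real ^ 'n ^ 'n" where "G = (\<chi> i j. S (axis i 1) \<bullet> S (axis j 1))"
 have "transpose G = G" by (simp add: G_def transpose_def vec_eq_iff inner_commute)
 moreover have "v \<bullet> (G *v v) = (norm (S v))\<^sup>2" for v
 proof -
  have "v = (\<Sum>i\<in>UNIV. v $ i *\<^sub>R axis i 1)"
   by (simp add: vec_eq_iff axis_def if_distrib cong: if_cong)
  then have Sv: "S v = (\<Sum>i\<in>UNIV. v $ i *\<^sub>R S (axis i 1))"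
   using linear_sum[OF assms, of "\<lambda>i. v $ i *\<^sub>R axis i 1" UNIV] by (simp add: linear_scale[OF assms])
  have "v \<bullet> (G *v v) = (\<Sum>i\<in>UNIV. v $ i * (\<Sum>j\<in>UNIV. (S (axis i 1) \<bullet> S (axis j 1)) * v $ j))"
   by (simp add: inner_vec_def matrix_vector_mult_def G_def)
  also have "\<dots> = S v \<bullet> S v"
   unfolding Sv by (simp add: inner_sum_left inner_sum_right sum_distrib_left mult_ac inner_commute)
  finally show ?thesis by (simp add: power2_norm_eq_inner)
 qed
 ultimately show ?thesis by (rule that)
qed

lemma quadratic_matrix_add:
 fixes G H :: "real ^ 'n::finite ^ 'n"
 assumes "transpose G = G" "transpose H = H"
 shows "transpose (G + H) = G + H" "v \<bullet> ((G + H) *v v) = v \<bullet> (G *v v) + v \<bullet> (H *v v)"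
 using assms by (simp_all add: transpose_def vec_eq_iff matrix_vector_mult_add_rdistrib inner_add_right)

lemma quadratic_matrix_L2:
 fixes S :: "nat \<Rightarrow> real ^ 'n::finite \<Rightarrow> 'b::real_inner"
 assumes "\<And>i. linear (S i)"
 shows "\<exists>G :: real ^ 'n ^ 'n. transpose G = G \<and> (\<forall>v. v \<bullet> (G *v v) = (L2_set (\<lambda>i. norm (S i v)) {..<M})\<^sup>2)"
proof -
 have "\<exists>G :: real ^ 'n ^ 'n. transpose G = G \<and> (\<forall>v. v \<bullet> (G *v v) = (\<Sum>i<M. (norm (S i v))\<^sup>2))"
 proof (induction M)
  case 0
  show ?case by (intro exI[of _ 0]) (simp add: transpose_def vec_eq_iff)
 next
  case (Suc M)
  then obtain G :: "real ^ 'n ^ 'n" where G: "transpose G = G" "\<And>v. v \<bullet> (G *v v) = (\<Sum>i<M. (norm (S i v))\<^sup>2)" by blast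
  obtain H :: "real ^ 'n ^ 'n" where H: "transpose H = H" "\<And>v. v \<bullet> (H *v v) = (norm (S M v))\<^sup>2"
   using quadratic_matrix[OF assms] by blast
  show ?case using quadratic_matrix_add[OF G(1) H(1)] G(2) H(2) by (intro exI[of _ "G + H"]) simp
 qed
 then show ?thesis by (simp add: L2_set_def sum_nonneg)
qed

text \<open>The polynomial is the characteristic one; in the expansion over permutations only the
  identity reaches the full degree.\<close>

lemma eigenvalue_integer_monic:
 fixes M :: "int ^ 'n::finite ^ 'n" and v :: "real ^ 'n"
 assumes v: "v \<noteq> 0" "int_act M v = \<tau> *\<^sub>R v"
 obtains p :: "real poly" where "lead_coeff p = 1" "\<And>i. coeff p i \<in> \<int>" "poly p \<tau> = 0"
proof -
 define X :: "real poly ^ 'n ^ 'n" where "X = (\<chi> i j. if i = j then [:- of_int (M $ i $ j), 1:] else [:- of_int (M $ i $ j):])"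
 define p where "p = det X"
 let ?t = "\<lambda>\<pi>. of_int (sign \<pi>) * (\<Prod>i\<in>UNIV. X $ i $ \<pi> i)"
 have p: "p = (\<Sum>\<pi> | \<pi> permutes UNIV. ?t \<pi>)" unfolding p_def det_def ..
 have deg1: "degree (X $ i $ j) \<le> 1" for i j by (simp add: X_def)
 have id_deg: "degree (\<Prod>i\<in>UNIV. X $ i $ i) = CARD('n)" "lead_coeff (\<Prod>i\<in>UNIV. X $ i $ i) = 1"
 proof -
  have X: "X $ i $ i \<noteq> 0" "degree (X $ i $ i) = 1" "lead_coeff (X $ i $ i) = 1" for i by (simp_all add: X_def)
  show "degree (\<Prod>i\<in>UNIV. X $ i $ i) = CARD('n)" using X(1,2) by (simp add: degree_prod_eq_sum_degree)
  show "lead_coeff (\<Prod>i\<in>UNIV. X $ i $ i) = 1" unfolding lead_coeff_prod X(3) by simp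
 qed
 have other: "degree (?t \<pi>) < CARD('n)" if "\<pi> permutes UNIV" and ne: "\<pi> \<noteq> id" for \<pi>
 proof -
  obtain k where k: "\<pi> k \<noteq> k" using ne by (auto simp: fun_eq_iff)
  have "degree (\<Prod>i\<in>UNIV. X $ i $ \<pi> i) \<le> (\<Sum>i\<in>UNIV. degree (X $ i $ \<pi> i))"
   using degree_prod_sum_le[of UNIV "\<lambda>i. X $ i $ \<pi> i"] by (simp add: comp_def)
  also have "\<dots> = degree (X $ k $ \<pi> k) + (\<Sum>i\<in>UNIV - {k}. degree (X $ i $ \<pi> i))" by (simp add: sum.remove)
  also have "\<dots> \<le> 0 + (\<Sum>i\<in>UNIV - {k}. 1)" using k by (intro add_mono sum_mono deg1) (simp add: X_def)
  also have "\<dots> < CARD('n)" by (simp add: card_gt_0_iff)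
  finally have "degree (\<Prod>i\<in>UNIV. X $ i $ \<pi> i) < CARD('n)" .
  moreover have "?t \<pi> = smult (of_int (sign \<pi>)) (\<Prod>i\<in>UNIV. X $ i $ \<pi> i)"
   by (simp add: of_int_poly)
  ultimately show ?thesis by (simp only: degree_smult_le[THEN le_less_trans])
 qed
 have fin: "finite {\<pi>. \<pi> permutes (UNIV :: 'n set)}" by (rule finite_permutations) simp
 have psplit: "p = (\<Prod>i\<in>UNIV. X $ i $ i) + (\<Sum>\<pi>\<in>{\<pi>. \<pi> permutes UNIV} - {id}. ?t \<pi>)"
  unfolding p by (subst sum.remove[OF fin, of id]) (simp_all add: permutes_id)
 have "degree (\<Sum>\<pi>\<in>{\<pi>. \<pi> permutes UNIV} - {id}. ?t \<pi>) < CARD('n)"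
  by (rule degree_sum_less) (use other in auto)
 then have "lead_coeff p = 1" unfolding psplit add.commute[of "\<Prod>i\<in>UNIV. X $ i $ i"] id_deg(1)[symmetric]
  using lead_coeff_add_le id_deg(2) by fastforce
 moreover have "coeff p i \<in> \<int>" for i
 proof -
  define Z where "Z = {q :: real poly. \<forall>i. coeff q i \<in> \<int>}"
  have Zm: "a * b \<in> Z" if "a \<in> Z" "b \<in> Z" for a b
   using that unfolding Z_def by (auto simp: coeff_mult intro!: Ints_sum Ints_mult)
  have X: "X $ i $ j \<in> Z" for i j
   unfolding X_def Z_def by (auto simp: coeff_pCons split: nat.split)
  have one: "1 \<in> Z" unfolding Z_def by (auto simp: coeff_1)
  have prodZ: "(\<Prod>i\<in>I. f i) \<in> Z" if "\<And>i. f i \<in> Z" for I :: "'n set" and f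
   by (induction I rule: infinite_finite_induct) (auto simp: one Zm that)
  have "of_int z \<in> Z" for z :: int
   unfolding Z_def by (auto simp: of_int_poly coeff_pCons split: nat.split)
  then have "?t \<pi> \<in> Z" for \<pi> using X by (intro Zm prodZ)
  then have "p \<in> Z" unfolding p Z_def by (auto simp: coeff_sum intro!: Ints_sum)
  then show ?thesis by (simp add: Z_def)
 qed
 moreover have "poly p \<tau> = 0"
 proof -
  define Y :: "real ^ 'n ^ 'n" where "Y = (\<chi> i j. poly (X $ i $ j) \<tau>)"
  have "poly p \<tau> = det Y"
   unfolding p det_def Y_def by (simp add: poly_sum poly_prod)
  moreover have "Y *v v = 0"
  proof -
   have "Y = mat \<tau> - map_matrix real_of_int M"
    by (simp add: vec_eq_iff Y_def X_def mat_def map_matrix_def)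
   moreover have "mat \<tau> *v v = \<tau> *\<^sub>R v"
    by (simp add: vec_eq_iff matrix_vector_mult_def mat_def if_distrib[of "\<lambda>u. u * _"] cong: if_cong)
   ultimately show ?thesis using v(2) by (simp add: matrix_vector_mult_diff_rdistrib)
  qed
  then have "det Y = 0"
   using v(1) invertible_det_nz[of Y] unfolding invertible_left_inverse matrix_left_invertible_ker by blast
  ultimately show ?thesis by simp
 qed
 ultimately show ?thesis by (rule that)
qed

text \<open>Liouville's argument: at a rational \<open>x\<close> with denominator \<open>w1\<close>
  that is not a root, \<open>poly p x\<close> has absolute value at least
  \<open>1 / \<bar>w1\<bar> ^ degree p\<close>, while near \<tau> the factor
  \<open>x - \<tau>\<close> bounds it by a multiple of the distance.\<close>

lemma liouville_approximation:
 fixes \<tau> :: real and p :: "real poly"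
 assumes p: "p \<noteq> 0" "\<And>i. coeff p i \<in> \<int>" "poly p \<tau> = 0" and irr: "\<tau> \<notin> \<rat>"
 obtains c where "0 < c" "\<And>w0 w1 :: int. (w0, w1) \<noteq> (0, 0) \<Longrightarrow>
  c \<le> \<bar>of_int w0 + of_int w1 * \<tau>\<bar> * (1 + \<bar>of_int w0\<bar> + \<bar>of_int w1\<bar>) ^ degree p"
proof -
 obtain q where q: "p = [:-\<tau>, 1:] * q" using p(3) unfolding poly_eq_0_iff_dvd by (elim dvdE)
 have "bounded (poly q ` cball \<tau> 1)"
  by (intro compact_imp_bounded compact_continuous_image continuous_intros) simp
 then obtain b where b: "\<And>x. x \<in> cball \<tau> 1 \<Longrightarrow> \<bar>poly q x\<bar> \<le> b" unfolding bounded_iff by (auto simp del: mem_cball)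
 define Bd where "Bd = 1 + \<bar>b\<bar>"
 have Bd: "1 \<le> Bd" "\<And>x. x \<in> cball \<tau> 1 \<Longrightarrow> \<bar>poly q x\<bar> \<le> Bd" using b unfolding Bd_def by force+
 define R where "R = {x \<in> \<rat>. poly p x = 0}"
 have finR: "finite R" unfolding R_def by (rule finite_subset[OF _ poly_roots_finite[OF p(1)]]) blast
 \<comment> \<open>\<open>p\<close> is not assumed irreducible and may have rational roots;
   \<open>d\<close> is their least distance from \<tau>, capped at 1.\<close>
 define d where "d = Min (insert 1 ((\<lambda>x. \<bar>x - \<tau>\<bar>) ` R))"
 have d1: "d \<le> 1" unfolding d_def using finR by (intro Min_le) auto
 have dR: "d \<le> \<bar>x - \<tau>\<bar>" if "x \<in> R" for x unfolding d_def using finR that by (intro Min_le) auto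
 have d0: "0 < d" unfolding d_def using finR irr by (subst Min_gr_iff) (auto simp: R_def)
 define c where "c = min d (1 / Bd)"
 have c: "0 < c" "c \<le> d" "c \<le> 1 / Bd" unfolding c_def using d0 Bd(1) by auto
 let ?N = "degree p"
 have main: "c \<le> \<bar>of_int w0 + of_int w1 * \<tau>\<bar> * (1 + \<bar>of_int w0\<bar> + \<bar>of_int w1\<bar>) ^ ?N"
  if w: "(w0, w1) \<noteq> (0, 0)" for w0 w1 :: int
 proof -
  let ?H = "1 + \<bar>real_of_int w0\<bar> + \<bar>real_of_int w1\<bar>"
  have H1: "1 \<le> ?H ^ ?N" by (rule one_le_power) simp
  have c1: "c \<le> 1" using c(2) d1 by linarith
  have ge: "c \<le> y * ?H ^ ?N" if "c \<le> y" for y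
   using mult_mono[OF that H1] c(1) that by simp
  show ?thesis
  proof (cases "w1 = 0")
   case True
   then have "1 \<le> \<bar>real_of_int w0 + of_int w1 * \<tau>\<bar>" using w by simp
   then show ?thesis using c1 by (intro ge) linarith
  next
   case False
   define x where "x = - real_of_int w0 / of_int w1"
   have w1: "1 \<le> \<bar>real_of_int w1\<bar>" using False by linarith
   have eq: "\<bar>of_int w0 + of_int w1 * \<tau>\<bar> = \<bar>real_of_int w1\<bar> * \<bar>x - \<tau>\<bar>"
   proof -
    have "of_int w0 + of_int w1 * \<tau> = - (of_int w1 * (x - \<tau>))" using False by (simp add: x_def field_simps)
    then show ?thesis by (simp only: abs_minus_cancel abs_mult)
   qed
   have lo: "\<bar>x - \<tau>\<bar> \<le> \<bar>of_int w0 + of_int w1 * \<tau>\<bar>" unfolding eq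
    using mult_right_mono[OF w1, of "\<bar>x - \<tau>\<bar>"] by simp
   show ?thesis
   proof (cases "d \<le> \<bar>x - \<tau>\<bar>")
    case True
    then show ?thesis using lo c(2) by (intro ge) linarith
   next
    case close: False
    have "x \<in> \<rat>" unfolding x_def by (intro Rats_divide Rats_minus_iff[THEN iffD2] Rats_of_int)
    then have px: "poly p x \<noteq> 0" using dR[of x] close unfolding R_def by auto
    define z where "z = poly p x * of_int w1 ^ ?N"
    have "z \<in> \<int>"
    proof -
     have "z = (\<Sum>i\<le>?N. coeff p i * (- of_int w0) ^ i * of_int w1 ^ (?N - i))"
      unfolding z_def poly_altdef sum_distrib_right
     proof (rule sum.cong[OF refl])
      fix i assume "i \<in> {..?N}"
      then have "real_of_int w1 ^ ?N = of_int w1 ^ i * of_int w1 ^ (?N - i)" by (simp add: power_add[symmetric])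
      then show "coeff p i * x ^ i * of_int w1 ^ ?N = coeff p i * (- of_int w0) ^ i * of_int w1 ^ (?N - i)"
       using False by (simp add: x_def power_mult_distrib[symmetric])
     qed
     then show ?thesis using p(2) by (auto intro!: Ints_sum Ints_mult Ints_power Ints_minus)
    qed
    moreover have "z \<noteq> 0" using px False by (simp add: z_def)
    ultimately have z1: "1 \<le> \<bar>z\<bar>" by (elim Ints_cases) auto
    have "x \<in> cball \<tau> 1" using close d1 by (simp add: dist_real_def abs_minus_commute)
    then have "\<bar>poly p x\<bar> \<le> \<bar>x - \<tau>\<bar> * Bd"
     unfolding q poly_mult using Bd(2)[of x] by (simp add: abs_mult mult_left_mono)
    then have "\<bar>z\<bar> \<le> (\<bar>x - \<tau>\<bar> * Bd) * \<bar>real_of_int w1\<bar> ^ ?N"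
     unfolding z_def abs_mult power_abs by (intro mult_right_mono) auto
    also have "\<dots> \<le> (\<bar>of_int w0 + of_int w1 * \<tau>\<bar> * Bd) * ?H ^ ?N"
     using lo Bd(1) by (intro mult_mono power_mono) auto
    finally have "1 \<le> Bd * (\<bar>of_int w0 + of_int w1 * \<tau>\<bar> * ?H ^ ?N)" using z1 by (simp add: mult_ac)
    then have "1 / Bd \<le> \<bar>of_int w0 + of_int w1 * \<tau>\<bar> * ?H ^ ?N" using Bd(1) by (simp add: field_simps)
    then show ?thesis using c(3) by linarith
   qed
  qed
 qed
 show ?thesis by (rule that[OF c(1) main])
qed

text \<open>\<open>x\<close> is recovered from \<open>(T ^^ n) x\<close> by \<open>S ^^ n\<close>,
  which contracts by \<open>r ^ n\<close> on \<open>E\<close>; growth slower than the powers of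
  \<open>1 / r\<close> leaves only 0.\<close>

lemma inverse_growth_zero:
 fixes T S :: "'a::real_normed_vector \<Rightarrow> 'a"
 assumes ST: "\<And>v. S (T v) = v" and inv: "\<And>v. v \<in> E \<Longrightarrow> T v \<in> E"
  and dec: "\<And>v n. v \<in> E \<Longrightarrow> norm ((S ^^ n) v) \<le> C * r ^ n * norm v"
  and x: "x \<in> E" "\<And>n. norm ((T ^^ n) x) \<le> C' * \<rho> ^ n"
  and r: "0 < r" "0 < \<rho>" "r * \<rho> < 1" "0 < C"
 shows "x = 0"
proof -
 have "(S ^^ n) ((T ^^ n) x) = x" for n
 proof (induction n)
  case (Suc n)
  then show ?case by (simp add: funpow_swap1[of S] ST)
 qed simp
 moreover have "(T ^^ n) x \<in> E" for n by (induction n) (simp_all add: x inv)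
 ultimately have "norm x \<le> C * r ^ n * norm ((T ^^ n) x)" for n using dec[of "(T ^^ n) x" n] by simp
 also have "C * r ^ n * norm ((T ^^ n) x) \<le> C * r ^ n * (C' * \<rho> ^ n)" for n
  using x(2) r by (intro mult_left_mono) auto
 also have "C * r ^ n * (C' * \<rho> ^ n) = C * C' * (r * \<rho>) ^ n" for n by (simp add: power_mult_distrib)
 finally have le: "norm x \<le> C * C' * (r * \<rho>) ^ n" for n .
 have "(\<lambda>n. C * C' * (r * \<rho>) ^ n) \<longlonglongrightarrow> C * C' * 0"
  using r by (intro tendsto_intros LIMSEQ_power_zero) (simp add: abs_mult)
 then have "norm x \<le> C * C' * 0" using le by (intro LIMSEQ_le_const) auto
 then show ?thesis by simp
qed

lemma direct_sum_projections:
 fixes E1 E2 E3 :: "'a::real_vector set"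
 assumes sub: "subspace E1" "subspace E2" "subspace E3"
  and sum: "\<And>v. \<exists>a\<in>E1. \<exists>b\<in>E2. \<exists>c\<in>E3. v = a + b + c"
  and dir: "\<And>a b c. a \<in> E1 \<Longrightarrow> b \<in> E2 \<Longrightarrow> c \<in> E3 \<Longrightarrow> a + b + c = 0 \<Longrightarrow> a = 0 \<and> b = 0 \<and> c = 0"
 obtains P1 P2 P3 where "linear P1" "linear P2" "linear P3"
  "\<And>v. P1 v \<in> E1" "\<And>v. P2 v \<in> E2" "\<And>v. P3 v \<in> E3" "\<And>v. P1 v + P2 v + P3 v = v"
  "\<And>a b c. a \<in> E1 \<Longrightarrow> b \<in> E2 \<Longrightarrow> c \<in> E3 \<Longrightarrow> P1 (a + b + c) = a \<and> P2 (a + b + c) = b \<and> P3 (a + b + c) = c"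
proof -
 obtain P1 P2 P3 where P: "P1 v \<in> E1" "P2 v \<in> E2" "P3 v \<in> E3" "P1 v + P2 v + P3 v = v" for v
  using sum by metis
 have uniq: "P1 (a + b + c) = a \<and> P2 (a + b + c) = b \<and> P3 (a + b + c) = c"
  if abc: "a \<in> E1" "b \<in> E2" "c \<in> E3" for a b c
 proof -
  let ?v = "a + b + c"
  have "(P1 ?v - a) + (P2 ?v - b) + (P3 ?v - c) = 0" using P(4)[of ?v] by (simp add: algebra_simps)
  from dir[OF _ _ _ this] show ?thesis using abc P sub by (auto intro: subspace_diff)
 qed
 have add: "P1 (v + w) = P1 v + P1 w \<and> P2 (v + w) = P2 v + P2 w \<and> P3 (v + w) = P3 v + P3 w" for v w
 proof -
  have "(P1 v + P1 w) + (P2 v + P2 w) + (P3 v + P3 w) = (P1 v + P2 v + P3 v) + (P1 w + P2 w + P3 w)"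
   by (simp add: algebra_simps)
  then have "(P1 v + P1 w) + (P2 v + P2 w) + (P3 v + P3 w) = v + w" by (simp only: P(4))
  then show ?thesis using uniq[of "P1 v + P1 w" "P2 v + P2 w" "P3 v + P3 w"] P sub
   by (simp add: subspace_add)
 qed
 have scale: "P1 (t *\<^sub>R v) = t *\<^sub>R P1 v \<and> P2 (t *\<^sub>R v) = t *\<^sub>R P2 v \<and> P3 (t *\<^sub>R v) = t *\<^sub>R P3 v" for t v
 proof -
  have "t *\<^sub>R P1 v + t *\<^sub>R P2 v + t *\<^sub>R P3 v = t *\<^sub>R v" by (simp only: scaleR_add_right[symmetric] P(4))
  then show ?thesis using uniq[of "t *\<^sub>R P1 v" "t *\<^sub>R P2 v" "t *\<^sub>R P3 v"] P sub
   by (simp add: subspace_scale)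
 qed
 show ?thesis
  by (rule that[of P1 P2 P3]) (use P(1-3) P(4) uniq add scale in \<open>auto intro!: linearI\<close>)
qed

lemma finite_bounded_int_vecs: "finite {k :: real ^ 'n::finite. k \<in> int_vecs \<and> norm k \<le> B}"
proof (rule finite_subset)
 let ?F = "PiE UNIV (\<lambda>_. {- \<lceil>B\<rceil>..\<lceil>B\<rceil>}) :: ('n \<Rightarrow> int) set"
 show "finite ((\<lambda>f. \<chi> i. real_of_int (f i)) ` ?F)" by (intro finite_imageI finite_PiE) auto
 show "{k :: real ^ 'n. k \<in> int_vecs \<and> norm k \<le> B} \<subseteq> (\<lambda>f. \<chi> i. real_of_int (f i)) ` ?F"
 proof clarify
  fix k :: "real ^ 'n" assume k: "k \<in> int_vecs" "norm k \<le> B"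
  have "real_of_int \<lfloor>k $ i\<rfloor> = k $ i" for i using k(1) by (simp add: int_vecs_def)
  moreover have "\<bar>k $ i\<bar> \<le> B" for i using component_le_norm_cart[of k i] k(2) by linarith
  then have "- \<lceil>B\<rceil> \<le> \<lfloor>k $ i\<rfloor> \<and> \<lfloor>k $ i\<rfloor> \<le> \<lceil>B\<rceil>" for i by (smt (verit) floor_le_iff ceiling_less_iff le_floor_iff le_of_int_ceiling of_int_minus)
  ultimately show "k \<in> (\<lambda>f. \<chi> i. real_of_int (f i)) ` ?F"
   by (intro image_eqI[of _ _ "\<lambda>i. \<lfloor>k $ i\<rfloor>"]) (simp only: vec_eq_iff vec_lambda_beta, auto)
 qed
qed

lemma L2_set_seminorm_bounded:
 fixes S :: "nat \<Rightarrow> 'a::euclidean_space \<Rightarrow> 'b::real_normed_vector"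
 assumes "\<And>i. linear (S i)"
 shows "\<exists>K. \<forall>v. L2_set (\<lambda>i. norm (S i v)) {..<M} \<le> K * norm v"
proof -
 have "\<exists>b. \<forall>v. norm (S i v) \<le> b * norm v" for i using linear_bounded[OF assms] by blast
 then obtain b where b: "norm (S i v) \<le> b i * norm v" for i v by metis
 have "L2_set (\<lambda>i. norm (S i v)) {..<M} \<le> (\<Sum>i<M. b i) * norm v" for v
 proof -
  have "L2_set (\<lambda>i. norm (S i v)) {..<M} \<le> (\<Sum>i<M. norm (S i v))" by (rule L2_set_le_sum) simp
  also have "\<dots> \<le> (\<Sum>i<M. b i * norm v)" by (intro sum_mono b)
  finally show ?thesis by (simp add: sum_distrib_right)
 qed
 then show ?thesis by blast
qed

section \<open>Spectral structure of an ergodic toral automorphism\<close>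

text \<open>Within the locale, ergodicity enters only as the absence of periodic vectors.\<close>

locale toral_ergodic =
 fixes A Ai :: "int ^ 'n ^ 'n::finite"
 assumes inv: "A ** Ai = mat 1" "Ai ** A = mat 1"
  and no_per: "\<And>j v. 0 < j \<Longrightarrow> (int_act A ^^ j) v = v \<Longrightarrow> v = 0"
  and dim2: "dim (center_space A) = 2"
begin

abbreviation "Es \<equiv> stable_space A"
abbreviation "Ec \<equiv> center_space A"
abbreviation "Eu \<equiv> unstable_space A"
abbreviation "a \<equiv> int_act A"
abbreviation "b \<equiv> int_act Ai"

lemma a_b: "a (b v) = v" and b_a: "b (a v) = v"
 by (simp_all only: matrix_vector_mul_assoc map_matrix_mult[symmetric] inv map_matrix_mat matrix_vector_mul_lid)

lemma lin_a: "linear a" and lin_b: "linear b"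
 by (rule matrix_vector_mul_linear)+

lemma sub: "subspace Es" "subspace Ec" "subspace Eu"
 unfolding stable_space_def center_space_def unstable_space_def by (rule subspace_spectral)+

lemma spaces_inv:
 "v \<in> Es \<Longrightarrow> a v \<in> Es" "v \<in> Ec \<Longrightarrow> a v \<in> Ec" "v \<in> Eu \<Longrightarrow> a v \<in> Eu"
 "v \<in> Es \<Longrightarrow> b v \<in> Es" "v \<in> Ec \<Longrightarrow> b v \<in> Ec" "v \<in> Eu \<Longrightarrow> b v \<in> Eu"
 unfolding stable_space_def center_space_def unstable_space_def by (rule spectral_commute, simp add: inv, assumption)+

lemma pow_add: "(a ^^ n) (v + w) = (a ^^ n) v + (a ^^ n) w" "(b ^^ n) (v + w) = (b ^^ n) v + (b ^^ n) w"
 by (induction n) (simp_all add: matrix_vector_right_distrib)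

lemma su_growth:
 obtains r C where "0 < r" "r < 1" "0 < C" "\<And>v n. v \<in> Es \<Longrightarrow> norm ((a ^^ n) v) \<le> C * r ^ n * norm v"
  "\<And>v n. v \<in> Eu \<Longrightarrow> norm ((b ^^ n) v) \<le> C * r ^ n * norm v"
proof -
 obtain C1 r1 where 1: "0 < r1" "r1 < 1" "0 < C1" "\<And>v n. v \<in> Es \<Longrightarrow> norm ((a ^^ n) v) \<le> C1 * r1 ^ n * norm v"
 proof (rule uniform_growth[OF lin_a sub(1), of 1])
  show "\<exists>C r. 0 < r \<and> r < 1 \<and> (\<forall>n. norm ((a ^^ n) v) \<le> C * r ^ n)" if "v \<in> Es" for v
   using that unfolding stable_space_def by (rule spectral_growth) auto
 qed auto
 obtain C2 r2 where 2: "0 < r2" "r2 < 1" "0 < C2" "\<And>v n. v \<in> Eu \<Longrightarrow> norm ((b ^^ n) v) \<le> C2 * r2 ^ n * norm v"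
 proof (rule uniform_growth[OF lin_b sub(3), of 1])
  show "\<exists>C r. 0 < r \<and> r < 1 \<and> (\<forall>n. norm ((b ^^ n) v) \<le> C * r ^ n)" if "v \<in> Eu" for v
   using that unfolding unstable_space_def by (rule spectral_growth_inverse[OF _ _ _ inv(2)]) auto
 qed auto
 have le: "C1 * r1 ^ n \<le> max C1 C2 * max r1 r2 ^ n" "C2 * r2 ^ n \<le> max C1 C2 * max r1 r2 ^ n" for n
  using 1 2 by (auto intro!: mult_mono power_mono)
 show ?thesis
 proof (rule that[of "max r1 r2" "max C1 C2"])
  show "norm ((a ^^ n) v) \<le> max C1 C2 * max r1 r2 ^ n * norm v" if "v \<in> Es" for v n
   using 1(4)[OF that, of n] mult_right_mono[OF le(1)[of n], of "norm v"] by simp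
  show "norm ((b ^^ n) v) \<le> max C1 C2 * max r1 r2 ^ n * norm v" if "v \<in> Eu" for v n
   using 2(4)[OF that, of n] mult_right_mono[OF le(2)[of n], of "norm v"] by simp
 qed (use 1 2 in auto)
qed

lemma center_growth:
 assumes "v \<in> Ec" "1 < \<rho>"
 shows "\<exists>C r. 0 < r \<and> r < \<rho> \<and> (\<forall>n. norm ((a ^^ n) v) \<le> C * r ^ n)"
  "\<exists>C r. 0 < r \<and> r < \<rho> \<and> (\<forall>n. norm ((b ^^ n) v) \<le> C * r ^ n)"
proof -
 show "\<exists>C r. 0 < r \<and> r < \<rho> \<and> (\<forall>n. norm ((a ^^ n) v) \<le> C * r ^ n)"
  using assms(1) unfolding center_space_def by (rule spectral_growth) (use assms(2) in auto)
 show "\<exists>C r. 0 < r \<and> r < \<rho> \<and> (\<forall>n. norm ((b ^^ n) v) \<le> C * r ^ n)"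
  using assms(1) unfolding center_space_def by (rule spectral_growth_inverse[OF _ _ _ inv(2)]) (use assms(2) in auto)
qed

lemma growth_weaken:
 fixes f :: "nat \<Rightarrow> real"
 assumes "\<exists>C r. 0 < r \<and> r < \<rho> \<and> (\<forall>n. f n \<le> C * r ^ n)"
 shows "\<exists>C\<ge>0. \<forall>n. f n \<le> C * \<rho> ^ n"
proof -
 obtain C r where C: "0 < r" "r < \<rho>" "\<And>n. f n \<le> C * r ^ n" using assms by blast
 have "f n \<le> \<bar>C\<bar> * \<rho> ^ n" for n
 proof -
  have "C * r ^ n \<le> \<bar>C\<bar> * \<rho> ^ n" using C(1,2) by (intro mult_mono power_mono) auto
  then show ?thesis using C(3)[of n] by linarith
 qed
 then show ?thesis by (intro exI[of _ "\<bar>C\<bar>"]) simp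
qed

text \<open>Iterating the relation forwards bounds the growth of \<open>u\<close> by that of
  \<open>s\<close> and \<open>c\<close>, which is too slow for an unstable vector; iterating
  backwards then removes \<open>s\<close> in the same way.\<close>

lemma direct:
 assumes s: "s \<in> Es" and c: "c \<in> Ec" and u: "u \<in> Eu" and 0: "s + c + u = 0"
 shows "s = 0 \<and> c = 0 \<and> u = 0"
proof -
 obtain r C where r: "0 < r" "r < 1" "0 < C" "\<And>v n. v \<in> Es \<Longrightarrow> norm ((a ^^ n) v) \<le> C * r ^ n * norm v"
  "\<And>v n. v \<in> Eu \<Longrightarrow> norm ((b ^^ n) v) \<le> C * r ^ n * norm v" using that by (rule su_growth)
 \<comment> \<open>A number strictly between 1 and \<open>1 / r\<close>.\<close>
 define \<rho> where "\<rho> = 2 / (1 + r)"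
 have \<rho>: "1 < \<rho>" "r * \<rho> < 1" using r unfolding \<rho>_def by (simp_all add: divide_less_eq)
 have r1: "r ^ n \<le> \<rho> ^ n" for n using r \<rho> by (intro power_mono) auto
 obtain C1 where C1: "0 \<le> C1" "\<And>n. norm ((a ^^ n) c) \<le> C1 * \<rho> ^ n"
  using growth_weaken[OF center_growth(1)[OF c \<rho>(1)]] by blast
 obtain C2 where C2: "0 \<le> C2" "\<And>n. norm ((b ^^ n) c) \<le> C2 * \<rho> ^ n"
  using growth_weaken[OF center_growth(2)[OF c \<rho>(1)]] by blast
 have z: "(a ^^ n) (0 :: real ^ 'n) = 0" "(b ^^ n) (0 :: real ^ 'n) = 0" for n
  by (induction n) simp_all
 have u0: "u = 0"
 proof (rule inverse_growth_zero[where E = Eu and T = a and S = b and r = r and \<rho> = \<rho> and C = C])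
  show "norm ((a ^^ n) u) \<le> (C * norm s + C1) * \<rho> ^ n" for n
  proof -
   have "(a ^^ n) s + (a ^^ n) c + (a ^^ n) u = 0" by (simp only: pow_add(1)[symmetric] 0 z)
   from minus_unique[OF this] have "(a ^^ n) u = - ((a ^^ n) s + (a ^^ n) c)" by (rule sym)
   then have "norm ((a ^^ n) u) \<le> norm ((a ^^ n) s) + norm ((a ^^ n) c)"
    by (simp only: norm_minus_cancel norm_triangle_ineq)
   also have "\<dots> \<le> C * r ^ n * norm s + C1 * \<rho> ^ n" by (intro add_mono r(4) s C1)
   also have "C * r ^ n * norm s \<le> C * \<rho> ^ n * norm s" using r r1 by (intro mult_left_mono mult_right_mono) auto
   finally show ?thesis by (simp add: algebra_simps)
  qed
 qed (use r \<rho> u b_a spaces_inv in auto)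
 have s0: "s = 0"
 proof (rule inverse_growth_zero[where E = Es and T = b and S = a and r = r and \<rho> = \<rho> and C = C])
  show "norm ((b ^^ n) s) \<le> C2 * \<rho> ^ n" for n
  proof -
   have "c + s = 0" using 0 u0 by (simp add: add.commute)
   then have "(b ^^ n) c + (b ^^ n) s = 0" by (simp only: pow_add(2)[symmetric] z)
   from minus_unique[OF this] have "(b ^^ n) s = - ((b ^^ n) c)" by (rule sym)
   then show ?thesis using C2 by (simp only: norm_minus_cancel)
  qed
 qed (use r \<rho> s a_b spaces_inv in auto)
 show ?thesis using 0 s0 u0 by simp
qed

lemma center_rate:
 assumes v: "v \<in> Ec" and T: "T = a \<or> T = b" and c: "0 < c" "\<And>n. c * x ^ n \<le> norm ((T ^^ n) v)"
 shows "x \<le> 1"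
proof (rule ccontr)
 assume "\<not> x \<le> 1"
 then have "1 < x" by simp
 from center_growth[OF v this] T obtain C r where C: "0 < r" "r < x" "\<And>n. norm ((T ^^ n) v) \<le> C * r ^ n" by blast
 have "x ^ n \<le> (C / c) * r ^ n" for n using order_trans[OF c(2) C(3), of n] c(1) by (simp add: field_simps)
 from exp_growth_contra[OF C(1,2) this] show False .
qed

text \<open>By the growth rates in both directions of time, a real eigenvalue on the centre would be
  1 or -1, so the second iterate would fix the eigenvector, against \<open>no_per\<close>.\<close>

lemma center_no_eigenvector:
 assumes v: "v \<in> Ec" "v \<noteq> 0"
 shows "a v \<noteq> t *\<^sub>R v"
proof
 assume t: "a v = t *\<^sub>R v"
 have lin: "(T ^^ n) v = s ^ n *\<^sub>R v" if "T v = s *\<^sub>R v" "linear T" for T s n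
  by (induction n) (simp_all add: that linear_scale)
 have t0: "t \<noteq> 0"
 proof
  assume "t = 0"
  then have "a v = 0" using t by simp
  then show False using b_a[of v] v(2) by simp
 qed
 have bt: "b v = inverse t *\<^sub>R v"
 proof -
  have "t *\<^sub>R b v = v" by (simp only: linear_scale[OF lin_b, symmetric] t[symmetric] b_a)
  then have "inverse t *\<^sub>R (t *\<^sub>R b v) = inverse t *\<^sub>R v" by (simp only:)
  then show ?thesis using t0 by simp
 qed
 have "\<bar>t\<bar> \<le> 1" by (rule center_rate[OF v(1), of a "norm v"]) (use v(2) in \<open>simp_all add: lin[OF t lin_a] power_abs\<close>)
 moreover have "\<bar>inverse t\<bar> \<le> 1"
  by (rule center_rate[OF v(1), of b "norm v"]) (use v(2) in \<open>simp_all add: lin[OF bt lin_b] power_abs\<close>)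
 ultimately have "\<bar>t\<bar> = 1" using t0 by (simp add: abs_inverse field_simps)
 then have "t * t = 1" by (simp add: abs_if split: if_splits)
 then have "(a ^^ 2) v = v" using t by (simp add: numeral_2_eq_2 linear_scale[OF lin_a])
 then show False using no_per[of 2 v] v(2) by simp
qed

text \<open>On the plane, \<open>A\<close> satisfies a quadratic equation with trace \<tau> and
  determinant \<open>D\<close>. Without eigenvectors its discriminant is negative, and a root
  \<zeta> yields a complex coordinate. Growth slower than every exponential in both directions of
  time forces \<open>cmod \<zeta> = 1\<close>, hence \<open>D = 1\<close>.\<close>

lemma center_plane:
 obtains c0 \<tau> and \<zeta> :: complex and ell0 where "c0 \<in> Ec" "c0 \<noteq> 0" "a (a c0) = \<tau> *\<^sub>R a c0 - c0"
  "\<zeta> = Complex (\<tau> / 2) (sqrt (1 - \<tau>\<^sup>2 / 4))" "\<tau>\<^sup>2 < 4"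
  "linear ell0" "ell0 c0 = 1" "ell0 (a c0) = \<zeta>" "\<And>v. v \<in> Ec \<Longrightarrow> \<exists>x y. v = x *\<^sub>R c0 + y *\<^sub>R a c0"
  "\<And>v. v \<in> Ec \<Longrightarrow> ell0 (a v) = \<zeta> * ell0 v"
proof -
 have "\<not> Ec \<subseteq> {0}" using dim2 by (simp only: dim_eq_0[symmetric])
 then obtain c0 where c0: "c0 \<in> Ec" "c0 \<noteq> 0" by blast
 have ac0: "a c0 \<in> Ec" by (rule spaces_inv(2)[OF c0(1)])
 have ne: "a c0 \<noteq> c0" using center_no_eigenvector[OF c0, of 1] by simp
 have ind: "independent {c0, a c0}"
 proof -
  have "a c0 \<notin> span {c0}" using center_no_eigenvector[OF c0] by (auto simp: span_singleton)
  then have "independent (insert (a c0) {c0})" using c0(2) by (intro independent_insertI) (auto simp: independent_empty)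
  then show ?thesis by (simp add: insert_commute)
 qed
 have sp: "Ec \<subseteq> span {c0, a c0}"
  by (rule card_ge_dim_independent[OF _ ind]) (use c0(1) ac0 dim2 ne in auto)
 have "a (a c0) \<in> span {c0, a c0}" using sp spaces_inv(2)[OF ac0] by blast
 then obtain D' \<tau> where "a (a c0) - D' *\<^sub>R c0 - \<tau> *\<^sub>R a c0 = 0"
  by (auto simp: span_breakdown_eq)
 then have "a (a c0) = \<tau> *\<^sub>R a c0 - (- D') *\<^sub>R c0" by (simp add: algebra_simps)
 then obtain D where D: "a (a c0) = \<tau> *\<^sub>R a c0 - D *\<^sub>R c0" ..
 have disc: "\<tau>\<^sup>2 < 4 * D"
 proof (rule ccontr)
  assume "\<not> \<tau>\<^sup>2 < 4 * D"
  then have q: "(sqrt (\<tau>\<^sup>2 - 4 * D))\<^sup>2 = \<tau>\<^sup>2 - 4 * D" by simp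
  define t where "t = (\<tau> + sqrt (\<tau>\<^sup>2 - 4 * D)) / 2"
  have t: "t\<^sup>2 - \<tau> * t + D = 0" using q unfolding t_def by (simp add: power2_eq_square field_simps)
  define v where "v = a c0 - t *\<^sub>R c0"
  have v: "v \<in> Ec" "v \<noteq> 0" unfolding v_def
   using center_no_eigenvector[OF c0, of t] subspace_diff[OF sub(2) ac0 subspace_scale[OF sub(2) c0(1)]] by auto
  have Dt: "D = \<tau> * t - t * t" using t by (simp add: power2_eq_square)
  have "a v = (\<tau> - t) *\<^sub>R v"
   unfolding v_def linear_diff[OF lin_a] linear_scale[OF lin_a] D unfolding Dt by (simp add: algebra_simps)
  then show False using center_no_eigenvector[OF v] by blast
 qed
 define \<zeta> where "\<zeta> = Complex (\<tau> / 2) (sqrt (D - \<tau>\<^sup>2 / 4))"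
 have \<zeta>2: "\<zeta> * \<zeta> = of_real \<tau> * \<zeta> - of_real D"
  using disc by (simp add: complex_eq_iff \<zeta>_def) (simp add: power2_eq_square)
 have cz: "(cmod \<zeta>)\<^sup>2 = D" unfolding \<zeta>_def using disc by (simp add: cmod_power2 power_divide)
 obtain ell0 :: "real ^ 'n \<Rightarrow> complex" where ell0: "linear ell0" "ell0 c0 = 1" "ell0 (a c0) = \<zeta>"
  using linear_independent_extend[OF ind, of "\<lambda>x. if x = c0 then 1 else \<zeta>"] ne by auto
 obtain K where K: "0 < K" "\<And>v. cmod (ell0 v) \<le> K * norm v" using linear_bounded_pos[OF ell0(1)] by blast
 have xy: "\<exists>x y. v = x *\<^sub>R c0 + y *\<^sub>R a c0" if v: "v \<in> Ec" for v
 proof -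
  have "v \<in> span {c0, a c0}" using sp v by blast
  then obtain x y where "v - x *\<^sub>R c0 - y *\<^sub>R a c0 = 0" by (auto simp: span_breakdown_eq)
  then have "v = x *\<^sub>R c0 + y *\<^sub>R a c0" by (simp add: algebra_simps)
  then show ?thesis by blast
 qed
 have la: "ell0 (a v) = \<zeta> * ell0 v" if v: "v \<in> Ec" for v
 proof -
  obtain x y where v: "v = x *\<^sub>R c0 + y *\<^sub>R a c0" using xy[OF v] by blast
  show ?thesis unfolding v linear_add[OF lin_a] linear_scale[OF lin_a] D linear_add[OF ell0(1)] linear_scale[OF ell0(1)]
   linear_diff[OF ell0(1)] ell0 using arg_cong[OF \<zeta>2, of "\<lambda>z. of_real y * z"]
   by (simp add: scaleR_conv_of_real algebra_simps)
 qed
 have \<zeta>0: "\<zeta> \<noteq> 0" using disc by (auto simp: \<zeta>_def complex_eq_iff)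
 have lb: "ell0 (b v) = inverse \<zeta> * ell0 v" if v: "v \<in> Ec" for v
  using la[OF spaces_inv(5)[OF v]] \<zeta>0 by (simp add: a_b)
 have bound: "cmod z \<le> 1" if T: "T = a \<or> T = b" "\<And>v. v \<in> Ec \<Longrightarrow> T v \<in> Ec" "\<And>v. v \<in> Ec \<Longrightarrow> ell0 (T v) = z * ell0 v" for z T
 proof (rule center_rate[OF c0(1) T(1), of "1 / K"])
  fix n
  have "(T ^^ n) c0 \<in> Ec \<and> ell0 ((T ^^ n) c0) = z ^ n" by (induction n) (auto simp: c0 ell0 T)
  then show "1 / K * cmod z ^ n \<le> norm ((T ^^ n) c0)"
   using K(1) K(2)[of "(T ^^ n) c0"] by (simp add: norm_power field_simps)
 qed (use K(1) in simp)
 have "cmod \<zeta> \<le> 1" by (rule bound[OF _ spaces_inv(2) la]) simp_all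
 moreover have "cmod (inverse \<zeta>) \<le> 1" by (rule bound[OF _ spaces_inv(5) lb]) simp_all
 ultimately have "cmod \<zeta> = 1" using \<zeta>0 by (simp add: norm_inverse inverse_le_1_iff)
 then have "D = 1" using cz by simp
 then show ?thesis using D \<zeta>_def disc by (intro that[OF c0 _ _ _ ell0 xy la]) simp_all
qed

text \<open>A bounded orbit of integer vectors is finite and, the map being invertible,
  periodic.\<close>

lemma bounded_orbit_zero:
 assumes k: "k \<in> int_vecs" and T: "T = a \<and> S = b \<or> T = b \<and> S = a" and bd: "\<And>n. norm ((T ^^ n) k) \<le> B"
 shows "k = 0"
proof -
 have TS: "T (S v) = v" "S (T v) = v" for v using T a_b b_a by auto
 have "(T ^^ n) k \<in> int_vecs" for n using T by (induction n) (auto simp: k int_vecs_act)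
 then have "range (\<lambda>n. (T ^^ n) k) \<subseteq> {k. k \<in> int_vecs \<and> norm k \<le> B}" using bd by blast
 then have "finite (range (\<lambda>n. (T ^^ n) k))" using finite_bounded_int_vecs finite_subset by blast
 then have "\<not> inj (\<lambda>n. (T ^^ n) k)" using finite_imageD infinite_UNIV_nat by blast
 then obtain m n where "(T ^^ m) k = (T ^^ n) k" "m \<noteq> n" unfolding inj_def by blast
 then obtain m j where mj: "(T ^^ (m + j)) k = (T ^^ m) k" "0 < j"
  by (metis less_imp_add_positive nat_neq_iff)
 have inv: "(S ^^ i) ((T ^^ i) v) = v" for i v
 proof (induction i)
  case (Suc i)
  then show ?case by (simp add: funpow_swap1[of S] TS)
 qed simp
 have "(S ^^ m) ((T ^^ m) ((T ^^ j) k)) = (S ^^ m) ((T ^^ m) k)" using mj(1) by (simp add: funpow_add)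
 then have Tj: "(T ^^ j) k = k" by (simp only: inv)
 then have "(S ^^ j) k = k" using inv[of j k] by simp
 then show "k = 0" using T Tj no_per[OF mj(2)] by auto
qed

text \<open>Division by \<zeta>, of modulus 1, gives
  \<open>w0 * cnj \<zeta> + w1 + w2 * \<zeta>\<close>. If \<open>w0\<close> and \<open>w2\<close>
  differ, its imaginary part is at least \<open>Im \<zeta>\<close> in absolute value. Otherwise it
  is the real number \<open>w1 + w0 * \<tau>\<close>, and \<tau>, an eigenvalue of the integer
  matrix \<open>A + Ai\<close>, is an irrational algebraic integer.\<close>

lemma liouville_quadratic:
 fixes \<zeta> :: complex
 assumes \<zeta>: "\<zeta> = Complex (\<tau> / 2) (sqrt (1 - \<tau>\<^sup>2 / 4))" "\<tau>\<^sup>2 < 4"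
  and c0: "c0 \<noteq> 0" "a (a c0) = \<tau> *\<^sub>R a c0 - c0"
 obtains cL QL where "0 < cL" "\<And>w0 w1 w2 :: int. (w0, w1, w2) \<noteq> (0, 0, 0) \<Longrightarrow>
   cL \<le> cmod (of_int w0 + of_int w1 * \<zeta> + of_int w2 * \<zeta> ^ 2) * (1 + \<bar>of_int w0\<bar> + \<bar>of_int w1\<bar> + \<bar>of_int w2\<bar>) ^ QL"
proof -
 have "b c0 = \<tau> *\<^sub>R c0 - a c0"
 proof -
  have "b (\<tau> *\<^sub>R a c0 - a (a c0)) = b c0" unfolding c0(2) by simp
  then show ?thesis by (simp add: linear_diff[OF lin_b] linear_scale[OF lin_b] b_a)
 qed
 moreover have "int_act (A + Ai) c0 = a c0 + b c0"
 proof -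
  have "map_matrix real_of_int (A + Ai) = map_matrix real_of_int A + map_matrix real_of_int Ai"
   by (simp add: vec_eq_iff map_matrix_def)
  then show ?thesis by (simp add: matrix_vector_mult_add_rdistrib)
 qed
 ultimately have ev: "int_act (A + Ai) c0 = \<tau> *\<^sub>R c0" by simp
 obtain p where p: "lead_coeff p = 1" "\<And>i. coeff p i \<in> \<int>" "poly p \<tau> = 0"
  using eigenvalue_integer_monic[OF c0(1) ev] by metis
 \<comment> \<open>A rational \<tau> would be -1, 0 or 1; then \<zeta> would be a root of unity of
   order 3, 4 or 6, and \<open>c0\<close> would be periodic.\<close>
 have irr: "\<tau> \<notin> \<rat>"
 proof
  assume "\<tau> \<in> \<rat>"
  moreover have "algebraic_int \<tau>" using p by (intro algebraic_int.intros[of p]) auto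
  ultimately have "\<tau> \<in> \<int>" by (rule rational_algebraic_int_is_int[rotated])
  then obtain t :: int where t: "\<tau> = of_int t" by (elim Ints_cases)
  have "t\<^sup>2 < 4" using \<zeta>(2) unfolding t by (simp flip: of_int_power)
  then have "\<bar>t\<bar> < 2" using abs_le_square_iff[of 2 t] by simp
  then consider "t = -1" | "t = 0" | "t = 1" by linarith
  then show False
  proof cases
   case 1
   then have "(a ^^ 3) c0 = c0"
    using c0(2) t by (simp add: numeral_3_eq_3 linear_diff[OF lin_a] linear_neg[OF lin_a])
   then show False using no_per[of 3 c0] c0(1) by simp
  next
   case 2
   then have "(a ^^ 4) c0 = c0"
    using c0(2) t by (simp add: eval_nat_numeral linear_diff[OF lin_a] linear_neg[OF lin_a])
   then show False using no_per[of 4 c0] c0(1) by simp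
  next
   case 3
   then have "(a ^^ 6) c0 = c0"
    using c0(2) t by (simp add: eval_nat_numeral linear_diff[OF lin_a] linear_neg[OF lin_a])
   then show False using no_per[of 6 c0] c0(1) by simp
  qed
 qed
 have "p \<noteq> 0" using p(1) by auto
 then obtain c where c: "0 < c" "\<And>w0 w1 :: int. (w0, w1) \<noteq> (0, 0) \<Longrightarrow>
  c \<le> \<bar>of_int w0 + of_int w1 * \<tau>\<bar> * (1 + \<bar>of_int w0\<bar> + \<bar>of_int w1\<bar>) ^ degree p"
  using liouville_approximation[OF _ p(2,3) irr] by blast
 define q where "q = sqrt (1 - \<tau>\<^sup>2 / 4)"
 have q: "0 < q" "q\<^sup>2 = 1 - \<tau>\<^sup>2 / 4" using \<zeta>(2) unfolding q_def by auto
 have \<zeta>1: "\<zeta> = Complex (\<tau> / 2) q" using \<zeta>(1) by (simp add: q_def)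
 have inv: "\<zeta> * cnj \<zeta> = 1" using q(2) by (simp add: complex_eq_iff \<zeta>1 power2_eq_square)
 have cm: "cmod \<zeta> = 1" using q(2) by (simp add: cmod_def \<zeta>1 power_divide)
 show ?thesis
 proof (rule that[of "min c q"])
  show "0 < min c q" using c(1) q(1) by simp
  fix w0 w1 w2 :: int assume w: "(w0, w1, w2) \<noteq> (0, 0, 0)"
  let ?z = "of_int w0 + of_int w1 * \<zeta> + of_int w2 * \<zeta> ^ 2"
  let ?H = "1 + \<bar>real_of_int w0\<bar> + \<bar>real_of_int w1\<bar> + \<bar>real_of_int w2\<bar>"
  define y where "y = of_int w0 * cnj \<zeta> + of_int w1 + of_int w2 * \<zeta>"
  have "?z = \<zeta> * y"
   using inv unfolding y_def by (simp add: algebra_simps power2_eq_square)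
  then have zy: "cmod ?z = cmod y" by (simp add: norm_mult cm)
  have H1: "1 \<le> ?H ^ degree p" by (rule one_le_power) simp
  show "min c q \<le> cmod ?z * ?H ^ degree p"
  proof (cases "w0 = w2")
   case False
   have "Im y = of_int (w2 - w0) * q" by (simp add: y_def \<zeta>1 algebra_simps)
   then have "\<bar>Im y\<bar> = \<bar>real_of_int (w2 - w0)\<bar> * q" using q(1) by (simp add: abs_mult)
   moreover have "1 \<le> \<bar>real_of_int (w2 - w0)\<bar>" using False by linarith
   ultimately have "q \<le> cmod y" using abs_Im_le_cmod[of y] q(1) mult_right_mono[of 1 "\<bar>real_of_int (w2 - w0)\<bar>" q] by linarith
   then have "q * 1 \<le> cmod ?z * ?H ^ degree p" using H1 q(1) unfolding zy by (intro mult_mono) auto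
   then show ?thesis by simp
  next
   case True
   have yr: "y = of_real (of_int w1 + of_int w0 * \<tau>)" by (simp add: complex_eq_iff y_def \<zeta>1 True)
   have "c \<le> cmod y * (1 + \<bar>of_int w1\<bar> + \<bar>of_int w0\<bar>) ^ degree p"
    using c(2)[of w1 w0] w True unfolding yr norm_of_real by auto
   also have "\<dots> \<le> cmod y * ?H ^ degree p" by (intro mult_left_mono power_mono) auto
   finally show ?thesis unfolding zy by simp
  qed
 qed
qed

text \<open>Collects the data that depend on \<open>A\<close> alone. The stable and unstable
  seminorms come from \<open>lyapunov_norm\<close>, with \<open>lam\<close> midway between the
  contraction rate and 1; the centre one is the modulus of the complex coordinate. \<open>G\<close>
  is the matrix of the corresponding flat metric.\<close>

lemma toral_adapted:
 obtains Ps Pc Pu ns nc nu lam K and ell :: "real ^ 'n \<Rightarrow> complex" and \<zeta> cL QL u0 and G :: "real ^ 'n ^ 'n" where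
  "adapted a b Ps Pc Pu ns nc nu lam K" "linear ell" "\<And>v. nc v = cmod (ell v)" "\<And>v. ell (a v) = \<zeta> * ell v" "Im \<zeta> \<noteq> 0"
  "{v. nc v = 0 \<and> nu v = 0} = Es" "{v. ns v = 0 \<and> nu v = 0} = Ec" "{v. nc v = 0 \<and> ns v = 0} = Eu"
  "transpose G = G" "\<And>v. v \<bullet> (G *v v) = (ns v)\<^sup>2 + (nc v)\<^sup>2 + (nu v)\<^sup>2"
  "0 < cL" "\<And>w0 w1 w2 :: int. (w0, w1, w2) \<noteq> (0, 0, 0) \<Longrightarrow>
   cL \<le> cmod (of_int w0 + of_int w1 * \<zeta> + of_int w2 * \<zeta> ^ 2) * (1 + \<bar>of_int w0\<bar> + \<bar>of_int w1\<bar> + \<bar>of_int w2\<bar>) ^ QL"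
  "u0 \<in> int_vecs" "ell u0 \<noteq> 0" "Es \<noteq> {0}" "Eu \<noteq> {0}"
proof -
 obtain Ps Pc Pu where lin: "linear Ps" "linear Pc" "linear Pu"
  and P: "\<And>v. Ps v \<in> Es" "\<And>v. Pc v \<in> Ec" "\<And>v. Pu v \<in> Eu" and Psum: "\<And>v. Ps v + Pc v + Pu v = v"
  and uniq: "\<And>s c u. s \<in> Es \<Longrightarrow> c \<in> Ec \<Longrightarrow> u \<in> Eu \<Longrightarrow> Ps (s + c + u) = s \<and> Pc (s + c + u) = c \<and> Pu (s + c + u) = u"
 proof (rule direct_sum_projections[OF sub], goal_cases)
  case 1
  show ?case by (rule spectral_sum)
 next
  case 2
  show ?case by (rule direct[OF 2(2-5)])
 next
  case (3 Ps Pc Pu)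
  show ?case by (rule that[OF 3(2-9)])
 qed
 have z: "0 \<in> Es" "0 \<in> Ec" "0 \<in> Eu" using sub subspace_0 by auto
 have com: "Ps (a v) = a (Ps v) \<and> Pc (a v) = a (Pc v) \<and> Pu (a v) = a (Pu v)" for v
 proof -
  have "a (Ps v) + a (Pc v) + a (Pu v) = a v" by (simp only: linear_add[OF lin_a, symmetric] Psum)
  then show ?thesis using uniq[of "a (Ps v)" "a (Pc v)" "a (Pu v)"] P spaces_inv by simp
 qed
 have com_b: "Ps (b v) = b (Ps v)" "Pu (b v) = b (Pu v)" for v
 proof -
  have "a (Ps (b v)) = Ps v" "a (Pu (b v)) = Pu v" using com[of "b v"] by (simp_all add: a_b)
  then show "Ps (b v) = b (Ps v)" "Pu (b v) = b (Pu v)" using b_a[of "Ps (b v)"] b_a[of "Pu (b v)"] by simp_all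
 qed
 have PEs: "Ps v = v" "Pc v = 0" "Pu v = 0" if "v \<in> Es" for v using uniq[OF that z(2,3)] by auto
 have PEc: "Ps v = 0" "Pc v = v" "Pu v = 0" if "v \<in> Ec" for v using uniq[OF z(1) that z(3)] by auto
 have PEu: "Ps v = 0" "Pc v = 0" "Pu v = v" if "v \<in> Eu" for v using uniq[OF z(1,2) that] by auto
 obtain r C where r: "0 < r" "r < 1" "0 < C" "\<And>v n. v \<in> Es \<Longrightarrow> norm ((a ^^ n) v) \<le> C * r ^ n * norm v"
  "\<And>v n. v \<in> Eu \<Longrightarrow> norm ((b ^^ n) v) \<le> C * r ^ n * norm v" using that by (rule su_growth)
 define lam where "lam = (1 + r) / 2"
 have lam: "0 < lam" "lam < 1" "r < lam" using r unfolding lam_def by auto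
 obtain M S where S: "\<And>i. linear (S i :: real ^ 'n \<Rightarrow> real ^ 'n)"
  "\<And>v. L2_set (\<lambda>i. norm (S i (a v))) {..<M::nat} \<le> lam * L2_set (\<lambda>i. norm (S i v)) {..<M}"
  "\<And>v. norm (Ps v) \<le> L2_set (\<lambda>i. norm (S i v)) {..<M}" "\<And>v i. Ps v = 0 \<Longrightarrow> S i v = 0"
  using that by (rule lyapunov_norm[OF lin_a lin(1) com[THEN conjunct1] r(1) lam(3) r(4)[OF P(1)]])
 obtain M' S' where S': "\<And>i. linear (S' i :: real ^ 'n \<Rightarrow> real ^ 'n)"
  "\<And>v. L2_set (\<lambda>i. norm (S' i (b v))) {..<M'::nat} \<le> lam * L2_set (\<lambda>i. norm (S' i v)) {..<M'}"
  "\<And>v. norm (Pu v) \<le> L2_set (\<lambda>i. norm (S' i v)) {..<M'}" "\<And>v i. Pu v = 0 \<Longrightarrow> S' i v = 0"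
  using that by (rule lyapunov_norm[OF lin_b lin(3) com_b(2) r(1) lam(3) r(5)[OF P(3)]])
 obtain c0 \<tau> and \<zeta> :: complex and ell0 where c0: "c0 \<in> Ec" "c0 \<noteq> 0" "a (a c0) = \<tau> *\<^sub>R a c0 - c0"
  and \<zeta>: "\<zeta> = Complex (\<tau> / 2) (sqrt (1 - \<tau>\<^sup>2 / 4))" "\<tau>\<^sup>2 < 4"
  and ell0: "linear ell0" "ell0 c0 = 1" "ell0 (a c0) = \<zeta>"
  and Ecxy: "\<And>v. v \<in> Ec \<Longrightarrow> \<exists>x y. v = x *\<^sub>R c0 + y *\<^sub>R a c0" and la: "\<And>v. v \<in> Ec \<Longrightarrow> ell0 (a v) = \<zeta> * ell0 v"
  using that by (rule center_plane)
 define ns nc nu where "ns v = L2_set (\<lambda>i. norm (S i v)) {..<M}" and "nc v = cmod (ell0 (Pc v))"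
  and "nu v = L2_set (\<lambda>i. norm (S' i v)) {..<M'}" for v
 have lin_ell: "linear (\<lambda>v. ell0 (Pc v))" using linear_compose[OF lin(2) ell0(1)] by (simp add: comp_def)
 have \<zeta>q: "Im \<zeta> = sqrt (1 - \<tau>\<^sup>2 / 4)" "0 < Im \<zeta>" using \<zeta> by auto
 have \<zeta>1: "cmod \<zeta> = 1" using \<zeta> by (simp add: cmod_def power_divide)
 have ell_a: "ell0 (Pc (a v)) = \<zeta> * ell0 (Pc v)" for v using la[OF P(2)] com by simp
 \<comment> \<open>Bounds \<open>x *\<^sub>R c0 + y *\<^sub>R a c0\<close> by the modulus of
   \<open>x + y * \<zeta>\<close>: the imaginary part controls \<open>y\<close>, and then the whole
   controls \<open>x\<close>.\<close>
 define Kc where "Kc = (1 + cmod \<zeta> / Im \<zeta>) * norm c0 + norm (a c0) / Im \<zeta>"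
 have nPc: "norm (Pc v) \<le> Kc * nc v" for v
 proof -
  obtain x y where xy: "Pc v = x *\<^sub>R c0 + y *\<^sub>R a c0" using Ecxy[OF P(2)] by blast
  have e: "ell0 (Pc v) = of_real x + of_real y * \<zeta>" unfolding xy
   linear_add[OF ell0(1)] linear_scale[OF ell0(1)] ell0 by (simp add: scaleR_conv_of_real)
  have "\<bar>y\<bar> * Im \<zeta> \<le> nc v" using abs_Im_le_cmod[of "ell0 (Pc v)"] \<zeta>q(2) unfolding nc_def e by (simp add: abs_mult)
  then have y: "\<bar>y\<bar> \<le> nc v / Im \<zeta>" using \<zeta>q(2) by (simp add: field_simps)
  have "\<bar>x\<bar> = cmod (ell0 (Pc v) - of_real y * \<zeta>)" unfolding e by simp
  also have "\<dots> \<le> nc v + \<bar>y\<bar> * cmod \<zeta>" unfolding nc_def using norm_triangle_ineq4[of "ell0 (Pc v)" "of_real y * \<zeta>"] by (simp add: norm_mult)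
  also have "\<dots> \<le> nc v + (nc v / Im \<zeta>) * cmod \<zeta>" using y by (intro add_left_mono mult_right_mono) auto
  finally have x: "\<bar>x\<bar> \<le> (1 + cmod \<zeta> / Im \<zeta>) * nc v" by (simp add: algebra_simps)
  have "norm (Pc v) \<le> \<bar>x\<bar> * norm c0 + \<bar>y\<bar> * norm (a c0)" unfolding xy using norm_triangle_ineq[of "x *\<^sub>R c0" "y *\<^sub>R a c0"] by simp
  also have "\<dots> \<le> ((1 + cmod \<zeta> / Im \<zeta>) * nc v) * norm c0 + (nc v / Im \<zeta>) * norm (a c0)"
   using x y by (intro add_mono mult_right_mono) auto
  finally show ?thesis by (simp add: Kc_def algebra_simps)
 qed
 have Kc0: "0 \<le> Kc" using \<zeta>q unfolding Kc_def by simp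
 obtain K1 where K1: "\<And>v. ns v \<le> K1 * norm v" using L2_set_seminorm_bounded[of S M, OF S(1)] unfolding ns_def by blast
 obtain K2 where K2: "\<And>v. nu v \<le> K2 * norm v" using L2_set_seminorm_bounded[of S' M', OF S'(1)] unfolding nu_def by blast
 obtain K3 where K3: "\<And>v. nc v \<le> K3 * norm v" using linear_bounded[OF lin_ell] unfolding nc_def by blast
 define K where "K = 1 + \<bar>K1\<bar> + \<bar>K2\<bar> + \<bar>K3\<bar> + Kc"
 have K: "1 \<le> K" "Kc \<le> K" "K1 \<le> K" "K2 \<le> K" "K3 \<le> K" using Kc0 unfolding K_def by auto
 have nn: "0 \<le> ns v" "0 \<le> nc v" "0 \<le> nu v" for v by (simp_all add: ns_def nc_def nu_def L2_set_nonneg)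
 have ns0: "ns v = 0 \<longleftrightarrow> Ps v = 0" for v
  using S(3)[of v] S(4)[of v] by (auto simp: ns_def L2_set_def)
 have nu0: "nu v = 0 \<longleftrightarrow> Pu v = 0" for v
  using S'(3)[of v] S'(4)[of v] by (auto simp: nu_def L2_set_def)
 have nc0: "nc v = 0 \<longleftrightarrow> Pc v = 0" for v
  using nPc[of v] by (auto simp: nc_def linear_0[OF ell0(1)])
 have adapted: "adapted a b Ps Pc Pu ns nc nu lam K"
 proof (rule adapted.intro)
  show "seminorm ns" "seminorm nu" unfolding ns_def nu_def using S(1) S'(1) by (auto intro: seminorm_L2_set)
  show "seminorm nc" unfolding nc_def seminorm_def
   by (simp add: linear_add[OF lin_ell] linear_scale[OF lin_ell] norm_triangle_ineq)
  show "norm v \<le> K * (ns v + nc v + nu v)" for v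
  proof -
   have "norm v \<le> norm (Ps v) + norm (Pc v) + norm (Pu v)"
    using norm_triangle_ineq[of "Ps v + Pc v" "Pu v"] norm_triangle_ineq[of "Ps v" "Pc v"] by (simp add: Psum)
   also have "\<dots> \<le> 1 * ns v + Kc * nc v + 1 * nu v" using S(3)[of v] S'(3)[of v] nPc[of v] by (simp add: ns_def nu_def)
   also have "\<dots> \<le> K * ns v + K * nc v + K * nu v" using K nn by (intro add_mono mult_right_mono) auto
   finally show ?thesis by (simp add: algebra_simps)
  qed
  show "ns v \<le> K * norm v" for v using K1[of v] mult_right_mono[OF K(3), of "norm v"] by simp
  show "nc v \<le> K * norm v" for v using K3[of v] mult_right_mono[OF K(5), of "norm v"] by simp
  show "nu v \<le> K * norm v" for v using K2[of v] mult_right_mono[OF K(4), of "norm v"] by simp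
  show "nc (a v) = nc v" for v by (simp add: nc_def ell_a norm_mult \<zeta>1)
  show "nu (a v) = 0" if "nu v = 0" for v using that com[of v] by (simp add: nu0)
  show "ns (b v) = 0" if "ns v = 0" for v using that com_b(1)[of v] by (simp add: ns0)
 qed (use lin_a lin_b a_b b_a lin Psum lam K(1) S(2) S'(2) PEs[OF P(1)] PEc[OF P(2)] PEu[OF P(3)] ns0 nc0 nu0 in
   \<open>simp_all add: ns_def[symmetric] nu_def[symmetric]\<close>)
 have sets: "{v. nc v = 0 \<and> nu v = 0} = Es" "{v. ns v = 0 \<and> nu v = 0} = Ec" "{v. nc v = 0 \<and> ns v = 0} = Eu"
  unfolding ns0 nc0 nu0
 proof -
  have Pcl: "Pc v = 0 \<Longrightarrow> Pu v = 0 \<Longrightarrow> v \<in> Es" "Ps v = 0 \<Longrightarrow> Pu v = 0 \<Longrightarrow> v \<in> Ec" "Pc v = 0 \<Longrightarrow> Ps v = 0 \<Longrightarrow> v \<in> Eu" for v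
   using P[of v] Psum[of v] by simp_all
  show "{v. Pc v = 0 \<and> Pu v = 0} = Es"
   using PEs by (auto dest: Pcl(1))
  show "{v. Ps v = 0 \<and> Pu v = 0} = Ec"
   using PEc by (auto dest: Pcl(2))
  show "{v. Pc v = 0 \<and> Ps v = 0} = Eu"
   using PEu by (auto dest: Pcl(3))
 qed
 obtain G1 :: "real ^ 'n ^ 'n" where G1: "transpose G1 = G1" "\<And>v. v \<bullet> (G1 *v v) = (ns v)\<^sup>2"
  using quadratic_matrix_L2[of S M, OF S(1)] unfolding ns_def by blast
 obtain G2 :: "real ^ 'n ^ 'n" where G2: "transpose G2 = G2" "\<And>v. v \<bullet> (G2 *v v) = (nc v)\<^sup>2"
  using quadratic_matrix[OF lin_ell] unfolding nc_def by blast
 obtain G3 :: "real ^ 'n ^ 'n" where G3: "transpose G3 = G3" "\<And>v. v \<bullet> (G3 *v v) = (nu v)\<^sup>2"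
  using quadratic_matrix_L2[of S' M', OF S'(1)] unfolding nu_def by blast
 define G where "G = G1 + G2 + G3"
 have G: "transpose G = G" "v \<bullet> (G *v v) = (ns v)\<^sup>2 + (nc v)\<^sup>2 + (nu v)\<^sup>2" for v
  unfolding G_def using quadratic_matrix_add[OF quadratic_matrix_add(1)[OF G1(1) G2(1)] G3(1)] quadratic_matrix_add(2)[OF G1(1) G2(1)]
  by (simp_all add: G1 G2 G3)
 obtain cL QL where cL: "0 < cL" "\<And>w0 w1 w2 :: int. (w0, w1, w2) \<noteq> (0, 0, 0) \<Longrightarrow>
   cL \<le> cmod (of_int w0 + of_int w1 * \<zeta> + of_int w2 * \<zeta> ^ 2) * (1 + \<bar>of_int w0\<bar> + \<bar>of_int w1\<bar> + \<bar>of_int w2\<bar>) ^ QL"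
  using that by (rule liouville_quadratic[OF \<zeta> c0(2,3)])
 have ax: "axis i 1 \<in> (int_vecs :: (real ^ 'n) set)" for i by (simp add: int_vecs_def axis_def)
 \<comment> \<open>The standard basis spans, so some member of it has a non-zero centre coordinate;
   it becomes \<open>u0\<close>.\<close>
 have "\<exists>i. ell0 (Pc (axis i 1)) \<noteq> 0"
 proof (rule ccontr)
  assume "\<not> ?thesis"
  then have 0: "ell0 (Pc (axis i 1)) = 0" for i by simp
  have "c0 = (\<Sum>i\<in>UNIV. c0 $ i *\<^sub>R axis i 1)" by (simp add: vec_eq_iff axis_def if_distrib cong: if_cong)
  from arg_cong[OF this, of "\<lambda>v. ell0 (Pc v)"] have "ell0 (Pc c0) = 0"
   by (simp only: linear_sum[OF lin_ell] linear_scale[OF lin_ell] 0) simp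
  then show False using PEc(2)[OF c0(1)] ell0(2) by simp
 qed
 then obtain i where u0: "ell0 (Pc (axis i 1)) \<noteq> 0" by blast
 interpret adapted a b Ps Pc Pu ns nc nu lam K by (rule adapted)
 \<comment> \<open>If the space expanded by \<open>T\<close> were trivial, a standard basis vector
   would have a bounded orbit under \<open>T\<close>.\<close>
 have contracted: False
  if T: "T = a \<and> S = b \<or> T = b \<and> S = a" and m: "\<And>v. 0 \<le> m v" "\<And>v. m (T v) \<le> lam * m v" "\<And>v. ns v + nu v = m v" for T S m
 proof -
  let ?k = "axis i 1 :: real ^ 'n"
  have "nc ((T ^^ n) ?k) = nc ?k \<and> m ((T ^^ n) ?k) \<le> m ?k" for n
  proof (induction n)
   case (Suc n)
   have "lam * m ((T ^^ n) ?k) \<le> 1 * m ((T ^^ n) ?k)" using lam(2) m(1) by (intro mult_right_mono) auto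
   then show ?case using Suc m(2)[of "(T ^^ n) ?k"] T ncA adapted.ncA[OF swap] by auto
  qed simp
  then have "K * (ns v + nc v + nu v) \<le> K * (nc ?k + m ?k)" if "v = (T ^^ n) ?k" for v n
   using that K(1) m(3)[of v] by (intro mult_left_mono) (auto simp: add_ac)
  then have "norm ((T ^^ n) ?k) \<le> K * (nc ?k + m ?k)" for n using normK order_trans by blast
  from bounded_orbit_zero[OF ax T this] show False by (simp add: axis_eq_0_iff)
 qed
 have nontriv: "Es \<noteq> {0}" "Eu \<noteq> {0}"
 proof -
  have "ns v = 0" if "Es = {0}" for v using P(1)[of v] that by (simp add: ns0)
  then show "Es \<noteq> {0}" using contracted[of b a nu] nuAi nn(3) by force
  have "nu v = 0" if "Eu = {0}" for v using P(3)[of v] that by (simp add: nu0)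
  then show "Eu \<noteq> {0}" using contracted[of a b ns] nsA nn(1) by force
 qed
 show ?thesis
  by (rule that[OF adapted lin_ell nc_def ell_a _ sets G cL ax u0 nontriv]) (use \<zeta>q in auto)
qed

end

section \<open>Leaves on the torus and their foliation charts\<close>

lemma countable_int_vecs: "countable (int_vecs :: (real ^ 'n::finite) set)"
proof (rule countable_subset)
 show "countable (range (\<lambda>f :: 'n \<Rightarrow> int. (\<chi> i. real_of_int (f i)) :: real ^ 'n))" by simp
 show "int_vecs \<subseteq> range (\<lambda>f :: 'n \<Rightarrow> int. (\<chi> i. real_of_int (f i)) :: real ^ 'n)"
 proof
  fix k :: "real ^ 'n" assume "k \<in> int_vecs"
  then have "\<And>i. real_of_int \<lfloor>k $ i\<rfloor> = k $ i" by (simp add: int_vecs_def)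
  then have "k = (\<chi> i. real_of_int \<lfloor>k $ i\<rfloor>)" by (simp only: vec_eq_iff vec_lambda_beta) simp
  then show "k \<in> range (\<lambda>f :: 'n \<Rightarrow> int. (\<chi> i. real_of_int (f i)) :: real ^ 'n)"
   by (rule range_eqI[where x = "\<lambda>i. \<lfloor>k $ i\<rfloor>"])
 qed
qed

lemma int_vecs_norm:
 fixes k :: "real ^ 'n::finite"
 assumes k: "k \<in> int_vecs" and "norm k < 1"
 shows "k = 0"
proof -
 have "k $ i = 0" for i
 proof -
  have "\<bar>k $ i\<bar> < 1" using component_le_norm_cart[of k i] assms(2) by linarith
  moreover have "k $ i \<in> \<int>" using k by (simp add: int_vecs_def)
  ultimately show ?thesis by (elim Ints_cases) auto
 qed
 then show ?thesis by (simp add: vec_eq_iff)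
qed

lemma torus_of_shift: "k \<in> int_vecs \<Longrightarrow> torus_of (x + k) = torus_of x"
 by (simp add: torus_of_eq)

lemma open_torus_of_image:
 assumes "open S"
 shows "open (torus_of ` S)"
proof -
 have "torus_of -` torus_of ` S = (\<Union>k\<in>int_vecs. (+) k ` S)"
 proof (intro equalityI subsetI)
  fix x assume "x \<in> torus_of -` torus_of ` S"
  then obtain y where y: "y \<in> S" "torus_of x = torus_of y" by auto
  then show "x \<in> (\<Union>k\<in>int_vecs. (+) k ` S)"
   unfolding torus_of_eq by (intro UN_I[of "x - y"] image_eqI[of _ _ y]) auto
 next
  fix x assume "x \<in> (\<Union>k\<in>int_vecs. (+) k ` S)"
  then obtain k y where "k \<in> int_vecs" "y \<in> S" "x = k + y" by blast
  then show "x \<in> torus_of -` torus_of ` S" using torus_of_shift[of k y] by (auto simp: add.commute)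
 qed
 moreover have "open \<dots>" using assms by (intro open_UN ballI open_translation)
 ultimately show ?thesis by (simp add: open_torus_def)
qed

lemma product_box:
 fixes H :: "(real ^ 'n::finite) set"
 assumes "subspace H"
 shows "open (product_box H)" "convex (product_box H)" "0 \<in> product_box H" "\<And>z. z \<in> product_box H \<Longrightarrow> norm z < 2"
proof -
 let ?C = "orthogonal_comp H"
 obtain pr P2 P3 where lin: "linear pr" and pr: "\<And>z. pr z \<in> H" "\<And>z. P2 z \<in> ?C" "\<And>z. P3 z \<in> {0}" "\<And>z. pr z + P2 z + P3 z = z"
  and uniq: "\<And>a b c. a \<in> H \<Longrightarrow> b \<in> ?C \<Longrightarrow> c \<in> {0} \<Longrightarrow> pr (a + b + c) = a"
 proof (rule direct_sum_projections[OF assms subspace_orthogonal_comp[of H] subspace_single_0], goal_cases)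
  case (1 z)
  have "z \<in> H + ?C" using subspace_sum_orthogonal_comp[OF assms] by simp
  then show "\<exists>a\<in>H. \<exists>b\<in>?C. \<exists>c\<in>{0}. z = a + b + c" by (auto elim!: set_plus_elim)
 next
  case (2 a b c)
  then have "orthogonal a b" "a = - b" by (auto simp: orthogonal_comp_def eq_neg_iff_add_eq_0)
  then show ?case using 2(4) by (auto simp: orthogonal_def)
 next
  case 3
  show ?case by (rule that[OF 3(2,5-8)]) (rule 3(9)[THEN conjunct1])
 qed
 have box: "z \<in> product_box H \<longleftrightarrow> norm (pr z) < 1 \<and> norm (z - pr z) < 1" for z
 proof
  assume "z \<in> product_box H"
  then obtain v w where vw: "z = v + w" "v \<in> H" "norm v < 1" "w \<in> ?C" "norm w < 1" unfolding product_box_def by blast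
  then show "norm (pr z) < 1 \<and> norm (z - pr z) < 1" using uniq[of v w 0] by simp
 next
  assume *: "norm (pr z) < 1 \<and> norm (z - pr z) < 1"
  have "z = pr z + (z - pr z)" by simp
  moreover have "P2 z = z - pr z" using pr(3,4)[of z] by (simp add: algebra_simps)
  ultimately show "z \<in> product_box H" unfolding product_box_def using * pr(1,2)[of z] by force
 qed
 have cont: "continuous_on UNIV pr" by (rule linear_continuous_on) (simp add: linear_conv_bounded_linear[symmetric] lin)
 have eq: "product_box H = {z. norm (pr z) < 1} \<inter> {z. norm (z - pr z) < 1}" by (auto simp: box)
 show "open (product_box H)" unfolding eq
  by (intro open_Int open_Collect_less continuous_intros cont)
 have "{z. norm (pr z) < 1} = pr -` ball 0 1" "{z. norm (z - pr z) < 1} = (\<lambda>z. z - pr z) -` ball 0 1" by auto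
 then show "convex (product_box H)" unfolding eq
  using convex_linear_vimage[OF lin convex_ball, of 0 1]
   convex_linear_vimage[OF linear_compose_sub[OF linear_ident lin] convex_ball, of 0 1]
  by (simp add: convex_Int)
 show "0 \<in> product_box H" by (simp add: box linear_0[OF lin])
 show "norm z < 2" if "z \<in> product_box H" for z
  using that norm_triangle_ineq[of "pr z" "z - pr z"] by (simp add: box)
qed

lemma convex_plaque:
 assumes "subspace H"
 shows "convex (plaque H z)"
proof -
 have "plaque H z = product_box H \<inter> (+) z ` H"
  unfolding plaque_def by (auto intro: image_eqI[of _ _ "_ - z"])
 then show ?thesis
  using product_box(2)[OF assms] convex_translation[OF subspace_imp_convex[OF assms]] by (simp add: convex_Int)
qed

lemma plaque_self: "subspace H \<Longrightarrow> z \<in> product_box H \<Longrightarrow> z \<in> plaque H z"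
 by (simp add: plaque_def subspace_0)

text \<open>A connected metric space with two points is uncountable. As a leaf meets a transversal
  in countably many points, a path in the leaf cannot change plaques within a chart.\<close>

lemma path_constant_of_countable:
 fixes g :: "real \<Rightarrow> 'a::metric_space"
 assumes "continuous_on {0..1} g" "countable T" "g ` {0..1} \<subseteq> T"
 shows "g 1 = g 0"
proof (rule ccontr)
 assume "g 1 \<noteq> g 0"
 moreover have "connected (g ` {0..1})" by (rule connected_continuous_image[OF assms(1) connected_Icc])
 ultimately have "uncountable (g ` {0..1})" by (intro connected_uncountable[of _ "g 1" "g 0"]) auto
 then show False using countable_subset[OF assms(3,2)] by blast
qed

definition foliation_chart ::
  "('n::finite torus \<Rightarrow> (real ^ 'n) set) \<Rightarrow> ('n torus \<Rightarrow> 'n torus set) \<Rightarrow> 'n torus \<Rightarrow> (real ^ 'n) set \<Rightarrow>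
   (real ^ 'n \<Rightarrow> real ^ 'n) \<Rightarrow> ('n torus \<Rightarrow> real ^ 'n) \<Rightarrow> (real ^ 'n \<Rightarrow> (real ^ 'n) \<Rightarrow>\<^sub>L (real ^ 'n)) \<Rightarrow> 'n torus set \<Rightarrow> bool"
 where "foliation_chart E W p H phi psi L U \<longleftrightarrow>
  subspace H \<and> open U \<and> p \<in> U \<and> homeomorphism (product_box H) U (torus_of \<circ> phi) psi \<and>
  continuous_on (product_box H) phi \<and> continuous_on (product_box H) L \<and>
  (\<forall>z\<in>product_box H. (phi has_derivative blinfun_apply (L z)) (at z within plaque H z) \<and>
   inj_on (blinfun_apply (L z)) H \<and> L z ` H = E (torus_of (phi z)) \<and>
   path_component_set (W (torus_of (phi z)) \<inter> U) (torus_of (phi z)) = (torus_of \<circ> phi) ` plaque H z)"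

lemma tangent_foliation_iff:
 "tangent_foliation E W \<longleftrightarrow> (\<forall>p. p \<in> W p \<and> path_connected (W p) \<and> (\<forall>q\<in>W p. W q = W p)) \<and>
  (\<forall>p. \<exists>H phi psi L U. foliation_chart E W p H phi psi L U)"
 unfolding tangent_foliation_def foliation_chart_def ..

lemma foliation_chartD:
 assumes "foliation_chart E W p H phi psi L U"
 shows "subspace H" "open U" "p \<in> U" "homeomorphism (product_box H) U (torus_of \<circ> phi) psi"
  "continuous_on (product_box H) phi" "continuous_on (product_box H) L"
  "\<And>z. z \<in> product_box H \<Longrightarrow> (phi has_derivative blinfun_apply (L z)) (at z within plaque H z)"
  "\<And>z. z \<in> product_box H \<Longrightarrow> inj_on (blinfun_apply (L z)) H"
  "\<And>z. z \<in> product_box H \<Longrightarrow> L z ` H = E (torus_of (phi z))"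
  "\<And>z. z \<in> product_box H \<Longrightarrow> path_component_set (W (torus_of (phi z)) \<inter> U) (torus_of (phi z)) = (torus_of \<circ> phi) ` plaque H z"
 using assms unfolding foliation_chart_def by blast+

text \<open>\<open>per\<close> and \<open>B_int\<close> make the leaves of the lift invariant under
  integer translations, so that they descend to the torus; with \<open>B_onto\<close>,
  \<open>f\<close> maps leaves onto leaves and not merely into them.\<close>

locale torus_leaves = cone_diff B P p q lam m kap e K F DF
 for B P :: "real ^ 'n::finite \<Rightarrow> real ^ 'n" and p q lam m kap e K F DF +
 fixes f :: "'n torus \<Rightarrow> 'n torus"
 assumes f_of: "\<And>x. f (torus_of x) = torus_of (F x)" and f_deriv: "\<And>x. torus_deriv f (torus_of x) = DF x"
  and per: "\<And>x k. k \<in> int_vecs \<Longrightarrow> F (x + k) = F x + B k" and B_int: "\<And>k. k \<in> int_vecs \<Longrightarrow> B k \<in> int_vecs"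
  and B_onto: "\<And>k. k \<in> int_vecs \<Longrightarrow> \<exists>k'\<in>int_vecs. B k' = k"
begin

abbreviation H where "H \<equiv> {v. q v = 0}"

definition Wt :: "'n torus \<Rightarrow> 'n torus set" where "Wt x = torus_of ` W (rep_torus x)"

definition Et :: "'n torus \<Rightarrow> (real ^ 'n) set" where "Et x = tangent (rep_torus x)"

lemma G_shift:
 assumes "k \<in> int_vecs"
 shows "(B ^^ n) k \<in> int_vecs \<and> G n (x + k) = G n x + (B ^^ n) k"
 by (induction n) (auto simp: assms B_int per)

lemma W_shift:
 assumes k: "k \<in> int_vecs"
 shows "y + k \<in> W (x + k) \<longleftrightarrow> y \<in> W x"
 by (simp add: W_def G_shift[OF k])

lemma DF_torus: "torus_of x = torus_of y \<Longrightarrow> DF x = DF y"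
 by (simp flip: f_deriv)

lemma tangent_torus:
 assumes "torus_of x = torus_of y"
 shows "tangent x = tangent y"
proof -
 have "dG n x = dG n y \<and> torus_of (G n x) = torus_of (G n y)" for n
 proof (induction n)
  case (Suc n)
  then have "DF (G n x) = DF (G n y)" by (intro DF_torus) simp
  with Suc show ?case by (simp flip: f_of)
 qed (simp add: assms)
 then show ?thesis by (simp add: tangent_def)
qed

lemma Et_of: "Et (torus_of x) = tangent x"
 unfolding Et_def by (rule tangent_torus) (rule torus_of_rep)

lemma Wt_of: "Wt (torus_of x) = torus_of ` W x"
proof -
 have sub: "torus_of ` W x \<subseteq> torus_of ` W y" if "torus_of x = torus_of y" for x y
 proof clarify
  fix w assume "w \<in> W x"
  have k: "y - x \<in> int_vecs" using that int_vecs_minus[of "x - y"] by (simp add: torus_of_eq)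
  have "w + (y - x) \<in> W (x + (y - x))" using W_shift[OF k] \<open>w \<in> W x\<close> by (rule iffD2)
  then have "w + (y - x) \<in> W y" by simp
  then show "torus_of w \<in> torus_of ` W y" by (intro image_eqI[where x = "w + (y - x)"] torus_of_shift[OF k, symmetric])
 qed
 show ?thesis unfolding Wt_def by (intro equalityI sub) (simp_all add: torus_of_rep)
qed

lemma Wt_lift:
 assumes "torus_of y \<in> Wt (torus_of x)"
 obtains k where "k \<in> int_vecs" "y \<in> W (x + k)"
proof -
 obtain w where w: "w \<in> W x" "torus_of y = torus_of w" using assms unfolding Wt_of by blast
 have k: "y - w \<in> int_vecs" using w(2) by (simp add: torus_of_eq)
 have "w + (y - w) \<in> W (x + (y - w))" using W_shift[OF k] w(1) by blast
 then show ?thesis using k by (intro that[of "y - w"]) auto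
qed

lemma Wt_refl: "z \<in> Wt z"
 unfolding Wt_def using imageI[OF W_refl, of torus_of "rep_torus z"] by (simp add: torus_of_rep)

lemma Wt_eq:
 assumes "z \<in> Wt y"
 shows "Wt z = Wt y"
proof -
 obtain x where x: "y = torus_of x" using torus_of_surj by metis
 obtain w where w: "w \<in> W x" "z = torus_of w" using assms unfolding x Wt_of by blast
 have "W w = W x" using W_trans[OF w(1)] W_trans[OF W_sym[OF w(1)]] by (intro equalityI subsetI)
 then show ?thesis by (simp add: x w(2) Wt_of)
qed

lemma path_connected_Wt: "path_connected (Wt z)"
proof -
 have "W x = leaf_pt x ` UNIV" for x using leaf_pt leaf_pt_self by (auto simp: image_iff) metis
 then have "path_connected (W x)" for x
  using path_connected_continuous_image[OF cont_leaf_pt1 path_connected_UNIV] by simp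
 then show ?thesis unfolding Wt_def by (intro path_connected_continuous_image continuous_torus_of)
qed

lemma Wt_invariant:
 assumes "surj f"
 shows "f ` Wt z = Wt (f z)"
proof (intro equalityI subsetI)
 obtain x where x: "z = torus_of x" using torus_of_surj by metis
 show "w \<in> Wt (f z)" if "w \<in> f ` Wt z" for w
  using that W_forward unfolding x f_of Wt_of by (auto simp: f_of)
 fix w assume w: "w \<in> Wt (f z)"
 obtain w' where w': "w = f w'" using assms by (metis surjD)
 obtain y where y: "w' = torus_of y" using torus_of_surj by metis
 have "torus_of (F y) \<in> Wt (torus_of (F x))" using w by (simp add: w' y x f_of)
 then obtain k where k: "k \<in> int_vecs" "F y \<in> W (F x + k)" by (elim Wt_lift)
 obtain k' where k': "k' \<in> int_vecs" "B k' = k" using B_onto[OF k(1)] by blast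
 have "F y \<in> W (F (x + k'))" using k(2) by (simp add: per[OF k'(1)] k'(2))
 then have "w' \<in> torus_of ` W (x + k')" unfolding y by (rule imageI[OF W_backward])
 then show "w \<in> f ` Wt z" unfolding x w' Wt_of[symmetric] torus_of_shift[OF k'(1)] by blast
qed

lemma qP0: "q h = 0 \<Longrightarrow> P h = h"
 using p_zero_q_zero[of "h - P h"] pP[of h] qP[of h] seminorm_diff[OF snq, of h "P h"] q0[of "h - P h"] by simp

lemma pP0: "p v = 0 \<Longrightarrow> P v = 0"
 using p_zero_q_zero[of "P v"] qP[of v] pP[of v] seminorm_eq[OF snp, of v "P v"] by simp

text \<open>\<open>Q z\<close> selects a leaf through its point \<open>x0 + r *\<^sub>R Q z\<close>
  on a flat transversal, and the component of \<open>z\<close> in \<open>H\<close> moves along this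
  leaf.\<close>

lemma chart_exists: "\<exists>H phi psi L U. foliation_chart Et Wt z0 H phi psi L U"
proof -
 obtain x0 where x0: "z0 = torus_of x0" using torus_of_surj by metis
 have sH: "subspace H" by (rule subspace_qzero)
 define Q where "Q z = z - P z" for z
 have linQ: "linear Q" unfolding Q_def by (rule linear_compose_sub[OF linear_ident linP])
 have QH: "Q h = 0" if "h \<in> H" for h using qP0 that by (simp add: Q_def)
 have pQ: "p (r *\<^sub>R Q z) = 0" for r z using pP by (simp add: Q_def seminorm_scale[OF snp])
 have Q_diff: "Q z' = Q z \<longleftrightarrow> z' - z \<in> H" for z z'
 proof
  assume "Q z' = Q z"
  then have "z' - z = P (z' - z)" by (simp add: Q_def linear_diff[OF linP] algebra_simps)
  then show "z' - z \<in> H" using qP[of "z' - z"] by (simp only: mem_Collect_eq)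
 qed (use QH[of "z' - z"] in \<open>simp add: linear_diff[OF linQ]\<close>)
 obtain b where b: "0 < b" "\<And>z. norm (Q z) \<le> b * norm z" using linear_bounded_pos[OF linQ] by blast
 \<comment> \<open>Keeps the image of the box within 1/4 of \<open>x0\<close>, where no two points
   differ by a non-zero integer vector.\<close>
 define r where "r = 1 / (4 * (2 * b + 4 * K * K * (1 + b)) + 4)"
 have r: "0 < r" "r * (2 * b + 4 * K * K * (1 + b)) < 1 / 4"
  using b(1) K0 unfolding r_def by (simp_all add: add_pos_pos divide_less_eq)
 define phi where "phi z = leaf_pt (x0 + r *\<^sub>R Q z) (x0 + r *\<^sub>R z)" for z
 define L where "L z = r *\<^sub>R tauL (phi z)" for z
 define U where "U = (torus_of \<circ> phi) ` product_box H"
 have contQ: "continuous_on UNIV Q" using linQ by (simp add: linear_continuous_on linear_conv_bounded_linear[symmetric])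
 have contphi: "continuous_on UNIV phi"
 proof -
  have "continuous_on UNIV ((\<lambda>(x, v). leaf_pt x v) \<circ> (\<lambda>z. (x0 + r *\<^sub>R Q z, x0 + r *\<^sub>R z)))"
   by (intro continuous_on_compose continuous_intros contQ cont_leaf_pt)
  then show ?thesis by (simp add: comp_def phi_def)
 qed
 have phiW: "phi z \<in> W (x0 + r *\<^sub>R Q z)" for z unfolding phi_def by (rule leaf_pt)
 have phi0: "phi 0 = x0" unfolding phi_def using linear_0[OF linQ] leaf_pt_self[OF W_refl] by simp
 have injphi: "inj_on phi S" for S
 proof (rule inj_onI)
  fix z z' assume eq: "phi z = phi z'"
  have "p (r *\<^sub>R (z - z')) = 0"
  proof -
   have "p (phi z - (x0 + r *\<^sub>R z)) = 0" "p (phi z - (x0 + r *\<^sub>R z')) = 0"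
    using leaf_pt(2)[of "x0 + r *\<^sub>R Q z" "x0 + r *\<^sub>R z"] leaf_pt(2)[of "x0 + r *\<^sub>R Q z'" "x0 + r *\<^sub>R z'"] eq
    by (simp_all add: phi_def)
   moreover have "r *\<^sub>R (z - z') = (phi z - (x0 + r *\<^sub>R z')) - (phi z - (x0 + r *\<^sub>R z))" by (simp add: algebra_simps)
   ultimately show ?thesis using seminorm_diff[OF snp, of "phi z - (x0 + r *\<^sub>R z')" "phi z - (x0 + r *\<^sub>R z)"] p0[of "r *\<^sub>R (z - z')"] by simp
  qed
  then have "P (z - z') = 0" using r(1) by (intro pP0) (simp add: seminorm_scale[OF snp])
  moreover have "Q z = Q z'"
  proof -
   have m: "phi z \<in> W (x0 + r *\<^sub>R Q z')" using phiW[of z'] eq by simp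
   have "x0 + r *\<^sub>R Q z \<in> W (x0 + r *\<^sub>R Q z')" by (rule W_trans[OF m W_sym[OF phiW[of z]]])
   moreover have "p (r *\<^sub>R Q (z - z')) = 0" by (rule pQ)
   ultimately have "x0 + r *\<^sub>R Q z = x0 + r *\<^sub>R Q z'"
    by (intro W_unique[OF _ W_refl]) (auto simp: linear_diff[OF linQ] scaleR_diff_right)
   then show ?thesis using r(1) by simp
  qed
  then have "z - z' = P (z - z')" by (simp add: Q_def linear_diff[OF linP] algebra_simps)
  ultimately show "z = z'" by simp
 qed
 have near: "norm (phi z - x0) < 1 / 4" if "z \<in> product_box H" for z
 proof -
  have z2: "norm z \<le> 2" using product_box(4)[OF sH that] by simp
  have q2: "norm (Q z) \<le> b * 2" using b(2)[of z] mult_left_mono[OF z2, of b] b(1) by linarith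
  have "norm (z - Q z) \<le> 2 + b * 2" using norm_triangle_ineq4[of z "Q z"] z2 q2 by linarith
  then have m: "r * norm (z - Q z) \<le> r * (2 + b * 2)" using r(1) by (intro mult_left_mono) auto
  have "norm (phi z - (x0 + r *\<^sub>R Q z)) \<le> 2 * K * K * norm (r *\<^sub>R (z - Q z))"
   using norm_leaf_pt[of "x0 + r *\<^sub>R Q z" "x0 + r *\<^sub>R z"] by (simp add: phi_def algebra_simps)
  also have "\<dots> \<le> 2 * K * K * (r * (2 + b * 2))" using m r(1) K0 by (intro mult_left_mono) auto
  finally have n1: "norm (phi z - (x0 + r *\<^sub>R Q z)) \<le> 2 * K * K * (r * (2 + b * 2))" .
  have n2: "norm (r *\<^sub>R Q z) \<le> r * (b * 2)" using q2 r(1) by (simp add: mult_left_mono)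
  have eq: "(phi z - (x0 + r *\<^sub>R Q z)) + r *\<^sub>R Q z = phi z - x0" by simp
  have "norm (phi z - x0) \<le> 2 * K * K * (r * (2 + b * 2)) + r * (b * 2)"
   using norm_triangle_mono[OF n1 n2] unfolding eq .
  also have "\<dots> = r * (2 * b + 4 * K * K * (1 + b))" by (simp add: algebra_simps)
  finally show ?thesis using r(2) by linarith
 qed
 have injT: "inj_on (torus_of \<circ> phi) (product_box H)"
 proof (rule inj_onI)
  fix z z' assume z: "z \<in> product_box H" "z' \<in> product_box H" and eq: "(torus_of \<circ> phi) z = (torus_of \<circ> phi) z'"
  have "norm (phi z - phi z') \<le> norm (phi z - x0) + norm (phi z' - x0)"
   using norm_triangle_ineq4[of "phi z - x0" "phi z' - x0"] by simp
  then have "norm (phi z - phi z') < 1" using near[OF z(1)] near[OF z(2)] by linarith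
  then have "phi z - phi z' = 0" using eq by (intro int_vecs_norm) (simp_all add: torus_of_eq)
  then show "z = z'" using inj_onD[OF injphi[of UNIV]] by simp
 qed
 \<comment> \<open>By invariance of domain, continuity and injectivity suffice, without an explicit
   inverse of the chart.\<close>
 have opn: "open ((torus_of \<circ> phi) ` S)" if "open S" for S
  unfolding image_comp[symmetric]
  by (rule open_torus_of_image, rule invariance_of_domain[OF continuous_on_subset[OF contphi] that injphi]) simp
 have contT: "continuous_on (product_box H) (torus_of \<circ> phi)"
  by (intro continuous_on_compose continuous_on_subset[OF contphi] continuous_torus_of) simp
 have oU: "open U" unfolding U_def by (rule opn[OF product_box(1)[OF sH]])
 obtain psi where hom: "homeomorphism (product_box H) U (torus_of \<circ> phi) psi"
 proof (rule homeomorphism_injective_open_map[OF contT _ injT])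
  show "(torus_of \<circ> phi) ` product_box H = U" by (simp only: U_def)
  fix S assume "openin (top_of_set (product_box H)) S"
  then have "open S" "S \<subseteq> product_box H" using product_box(1)[OF sH] openin_open_eq by blast+
  then show "openin (top_of_set U) ((torus_of \<circ> phi) ` S)" using opn oU by (auto simp: U_def openin_open_eq)
 qed blast
 have comp: "path_component_set (Wt (torus_of (phi z)) \<inter> U) (torus_of (phi z)) = (torus_of \<circ> phi) ` plaque H z"
  if z: "z \<in> product_box H" for z
 proof
  have "(torus_of \<circ> phi) ` plaque H z \<subseteq> Wt (torus_of (phi z)) \<inter> U"
  proof clarify
   fix z' assume z': "z' \<in> plaque H z"
   then have "Q z' = Q z" unfolding Q_diff by (simp add: plaque_def)
   then have m: "phi z' \<in> W (x0 + r *\<^sub>R Q z)" using phiW[of z'] by simp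
   have "phi z' \<in> W (phi z)" by (rule W_trans[OF W_sym[OF phiW[of z]] m])
   then show "(torus_of \<circ> phi) z' \<in> Wt (torus_of (phi z)) \<inter> U"
    using z' by (auto simp: Wt_of U_def plaque_def)
  qed
  moreover have "path_connected ((torus_of \<circ> phi) ` plaque H z)"
   by (intro path_connected_continuous_image continuous_on_subset[OF contT] convex_imp_path_connected convex_plaque sH)
    (auto simp: plaque_def)
  ultimately show "(torus_of \<circ> phi) ` plaque H z \<subseteq> path_component_set (Wt (torus_of (phi z)) \<inter> U) (torus_of (phi z))"
   using plaque_self[OF sH z] by (intro path_component_maximal) (auto intro!: rev_image_eqI[of z])
 next
  show "path_component_set (Wt (torus_of (phi z)) \<inter> U) (torus_of (phi z)) \<subseteq> (torus_of \<circ> phi) ` plaque H z"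
  proof
   fix w assume "w \<in> path_component_set (Wt (torus_of (phi z)) \<inter> U) (torus_of (phi z))"
   then obtain g where g: "path g" "path_image g \<subseteq> Wt (torus_of (phi z)) \<inter> U" "pathstart g = torus_of (phi z)" "pathfinish g = w"
    by (auto simp: path_component_def)
   \<comment> \<open>The transversal coordinates at which integer translates of the leaf of
     \<open>phi z\<close> meet the transversal. A path inside the leaf and the chart takes only
     these countably many values.\<close>
   define T where "T = (\<lambda>k. (1 / r) *\<^sub>R (leaf_pt (phi z + k) x0 - x0)) ` int_vecs"
   have gU: "g t \<in> U" "g t \<in> Wt (torus_of (phi z))" if "t \<in> {0..1}" for t using g(2) that by (auto simp: path_image_def)
   have psi: "psi y \<in> product_box H" "torus_of (phi (psi y)) = y" if "y \<in> U" for y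
    using hom that by (auto simp: homeomorphism_def)
   have psi': "psi (torus_of (phi z)) = z" if "z \<in> product_box H" for z
    using hom that by (auto simp: homeomorphism_def)
   have "(Q \<circ> (psi \<circ> g)) 1 = (Q \<circ> (psi \<circ> g)) 0"
   proof (rule path_constant_of_countable)
    show "continuous_on {0..1} (Q \<circ> (psi \<circ> g))"
    proof (intro continuous_on_compose)
     show "continuous_on {0..1} g" using g(1) by (simp add: path_def)
     show "continuous_on (g ` {0..1}) psi"
      using gU by (intro continuous_on_subset[OF homeomorphism_cont2[OF hom]]) auto
     show "continuous_on ((psi \<circ> g) ` {0..1}) Q" by (rule continuous_on_subset[OF contQ subset_UNIV])
    qed
    show "countable T" unfolding T_def using countable_int_vecs by (rule countable_image)
    show "(Q \<circ> (psi \<circ> g)) ` {0..1} \<subseteq> T"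
    proof
     fix y assume "y \<in> (Q \<circ> (psi \<circ> g)) ` {0..1}"
     then obtain t where t: "t \<in> {0..1}" "y = Q (psi (g t))" by auto
     let ?y = "psi (g t)"
     have "torus_of (phi ?y) \<in> Wt (torus_of (phi z))" using gU[OF t(1)] psi(2) by simp
     then obtain k where k: "k \<in> int_vecs" "phi ?y \<in> W (phi z + k)" by (elim Wt_lift)
     have "x0 + r *\<^sub>R Q ?y \<in> W (phi z + k)" by (rule W_trans[OF k(2) W_sym[OF phiW[of ?y]]])
     then have "leaf_pt (phi z + k) x0 = x0 + r *\<^sub>R Q ?y" by (rule leaf_pt_eqI) (simp add: pQ)
     then have "y = (1 / r) *\<^sub>R (leaf_pt (phi z + k) x0 - x0)" using r(1) by (simp add: t(2))
     then show "y \<in> T" unfolding T_def using k(1) by blast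
    qed
   qed
   then have "Q (psi w) = Q z" using g(3,4) psi'[OF z] by (simp add: pathstart_def pathfinish_def)
   moreover have wU: "w \<in> U" using gU(1)[of 1] g(4) by (simp add: pathfinish_def)
   ultimately have "psi w \<in> plaque H z" using psi(1) unfolding Q_diff by (simp add: plaque_def)
   then show "w \<in> (torus_of \<circ> phi) ` plaque H z" using psi(2)[OF wU] by (intro rev_image_eqI[of "psi w"]) auto
  qed
 qed
 have zU: "z0 \<in> U" unfolding U_def using product_box(3)[OF sH] by (intro rev_image_eqI[of 0]) (auto simp: x0 phi0)
 have contL: "continuous_on (product_box H) L"
 proof -
  have "continuous_on (product_box H) (\<lambda>z. tauL (phi z))"
   by (rule continuous_on_compose2[OF cont_tauL[of UNIV] continuous_on_subset[OF contphi subset_UNIV] subset_UNIV])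
  then show ?thesis unfolding L_def by (intro continuous_intros)
 qed
 have main: "\<forall>z\<in>product_box H. (phi has_derivative blinfun_apply (L z)) (at z within plaque H z) \<and>
   inj_on (blinfun_apply (L z)) H \<and> L z ` H = Et (torus_of (phi z)) \<and>
   path_component_set (Wt (torus_of (phi z)) \<inter> U) (torus_of (phi z)) = (torus_of \<circ> phi) ` plaque H z"
 proof
  fix z assume z: "z \<in> product_box H"
  have Lz: "L z h = tau (phi z) (r *\<^sub>R h)" for h by (simp add: L_def tauL scaleR_blinfun.rep_eq linear_scale[OF linear_tau])
  have Lz': "blinfun_apply (L z) = (\<lambda>h. tau (phi z) (r *\<^sub>R h))" by (simp add: fun_eq_iff Lz)
  have "(phi has_derivative L z) (at z within plaque H z)"
  proof (rule has_derivative_transform)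
   show "z \<in> plaque H z" by (rule plaque_self[OF sH z])
   show "phi y = leaf_pt (x0 + r *\<^sub>R Q z) (x0 + r *\<^sub>R y)" if "y \<in> plaque H z" for y
   proof -
    have "Q y = Q z" using that unfolding Q_diff by (simp add: plaque_def)
    then show ?thesis by (simp add: phi_def)
   qed
   have "((\<lambda>y. x0 + r *\<^sub>R y) has_derivative (\<lambda>h. r *\<^sub>R h)) (at z)" by (auto intro!: derivative_eq_intros)
   from has_derivative_compose[OF this leaf_pt_deriv[of "x0 + r *\<^sub>R Q z"]]
   have "((\<lambda>y. leaf_pt (x0 + r *\<^sub>R Q z) (x0 + r *\<^sub>R y)) has_derivative (\<lambda>h. tau (phi z) (r *\<^sub>R h))) (at z)"
    by (simp add: phi_def)
   then show "((\<lambda>y. leaf_pt (x0 + r *\<^sub>R Q z) (x0 + r *\<^sub>R y)) has_derivative L z) (at z within plaque H z)"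
    unfolding Lz' by (rule has_derivative_at_withinI)
  qed
  moreover have "inj_on (L z) H"
  proof (rule inj_onI)
   fix h h' assume "h \<in> H" "h' \<in> H" "L z h = L z h'"
   then have "r *\<^sub>R h = r *\<^sub>R h'" unfolding Lz
    by (intro tau_inj[of "r *\<^sub>R h" "r *\<^sub>R h'" "phi z"]) (simp_all add: seminorm_scale[OF snq])
   then show "h = h'" using r(1) by simp
  qed
  moreover have "L z ` H = Et (torus_of (phi z))"
  proof -
   have "L z ` H = tau (phi z) ` ((*\<^sub>R) r ` H)" unfolding Lz' image_image ..
   also have "(*\<^sub>R) r ` H = H"
   proof (intro equalityI subsetI)
    fix h assume h: "h \<in> H"
    then show "h \<in> (*\<^sub>R) r ` H" using r(1)
     by (intro rev_image_eqI[of "(1 / r) *\<^sub>R h"]) (auto simp: seminorm_scale[OF snq])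
   qed (auto simp: seminorm_scale[OF snq])
   finally show ?thesis by (simp only: Et_of tangent_eq_image)
  qed
  ultimately show "(phi has_derivative blinfun_apply (L z)) (at z within plaque H z) \<and>
   inj_on (blinfun_apply (L z)) H \<and> L z ` H = Et (torus_of (phi z)) \<and>
   path_component_set (Wt (torus_of (phi z)) \<inter> U) (torus_of (phi z)) = (torus_of \<circ> phi) ` plaque H z"
   using comp[OF z] by (intro conjI)
 qed
 have "foliation_chart Et Wt z0 H phi psi L U" unfolding foliation_chart_def
  using sH oU zU hom continuous_on_subset[OF contphi subset_UNIV] contL main by (intro conjI)
 then show ?thesis by (intro exI)
qed

lemma tangent_foliation_Wt: "tangent_foliation Et Wt"
 unfolding tangent_foliation_iff
proof (rule conjI)
 show "\<forall>z. z \<in> Wt z \<and> path_connected (Wt z) \<and> (\<forall>y\<in>Wt z. Wt y = Wt z)"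
  using Wt_refl path_connected_Wt Wt_eq by blast
qed (rule allI, rule chart_exists)

end

section \<open>Uniqueness of the tangent foliation and of the splitting\<close>

lemma compact_torus: "compact (UNIV :: 'n::finite torus set)"
proof -
 have "torus_of ` cbox 0 1 = (UNIV :: 'n torus set)"
 proof (intro equalityI subsetI)
  fix z :: "'n torus"
  obtain x where x: "z = torus_of x" using torus_of_surj by metis
  have "z = torus_of (\<chi> i. frac (x $ i))" unfolding x torus_of_eq_iff by (simp add: frac_def)
  moreover have "(\<chi> i. frac (x $ i)) \<in> cbox 0 (1 :: real ^ 'n)"
   by (auto simp: mem_box_cart frac_lt_1 less_imp_le)
  ultimately show "z \<in> torus_of ` cbox 0 1" by blast
 qed simp
 then show ?thesis using compact_continuous_image[OF continuous_torus_of compact_cbox] by metis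
qed

text \<open>Compactness turns a pointwise strict inequality of rates into a uniform ratio, which
  exponential domination needs.\<close>

lemma torus_uniform_gap:
 fixes g h :: "'n::finite torus \<Rightarrow> real"
 assumes "continuous_on UNIV g" "continuous_on UNIV h" "\<And>z. 0 < g z" "\<And>z. g z < h z"
 obtains a where "1 < a" "\<And>z. a * g z \<le> h z"
proof -
 have hpos: "0 < h z" for z using assms(3,4)[of z] by linarith
 have ne: "h z \<noteq> 0" for z using hpos[of z] by simp
 have "continuous_on UNIV (\<lambda>z. g z / h z)" using assms(1,2) ne by (intro continuous_intros) auto
 then obtain z0 where z0: "\<And>z. g z / h z \<le> g z0 / h z0"
  using continuous_attains_sup[OF compact_torus] by blast
 show ?thesis
 proof (rule that[of "h z0 / g z0"])
  show "1 < h z0 / g z0" using assms(3,4)[of z0] by simp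
  show "h z0 / g z0 * g z \<le> h z" for z
   using z0[of z] assms(3)[of z0] hpos[of z0] hpos[of z] by (simp add: field_simps)
 qed
qed

lemma riemannian_norm_equiv:
 fixes M :: "'n::finite torus \<Rightarrow> real ^ 'n ^ 'n"
 assumes "riemannian_metric M"
 obtains b d where "0 < b" "0 < d" "\<And>z v. b * norm v \<le> riemannian_norm M z v" "\<And>z v. riemannian_norm M z v \<le> d * norm v"
proof -
 let ?S = "UNIV \<times> sphere 0 1 :: ('n torus \<times> (real ^ 'n)) set"
 let ?q = "\<lambda>y :: 'n torus \<times> (real ^ 'n). snd y \<bullet> (M (fst y) *v snd y)"
 have cM: "continuous_on UNIV M" and pos: "\<And>z v. v \<noteq> 0 \<Longrightarrow> v \<bullet> (M z *v v) > 0"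
  using assms by (auto simp: riemannian_metric_def)
 have cM': "continuous_on ?S (\<lambda>y. M (fst y))"
  by (rule continuous_on_compose2[OF cM]) (auto intro: continuous_intros)
 have cont: "continuous_on ?S ?q"
  unfolding inner_vec_def matrix_vector_mult_def vec_lambda_beta
  by (intro continuous_intros cM')
 have comp: "compact ?S" by (intro compact_Times compact_torus compact_sphere)
 obtain e :: "real ^ 'n" where "norm e = 1" using vector_choose_size[of 1] by auto
 then have ne: "?S \<noteq> {}" by auto
 obtain y0 where y0: "y0 \<in> ?S" "\<And>y. y \<in> ?S \<Longrightarrow> ?q y0 \<le> ?q y" using continuous_attains_inf[OF comp ne cont] by blast
 obtain y1 where y1: "y1 \<in> ?S" "\<And>y. y \<in> ?S \<Longrightarrow> ?q y \<le> ?q y1" using continuous_attains_sup[OF comp ne cont] by blast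
 have q0: "0 < ?q y0" "0 < ?q y1" using y0(1) y1(1) by (auto intro!: pos)
 have hom: "(norm v)\<^sup>2 * ?q (z, (1 / norm v) *\<^sub>R v) = v \<bullet> (M z *v v)" if "v \<noteq> 0" for z v
  using that by (simp add: matrix_vector_mult_scaleR power2_eq_square)
 have unit: "(z, (1 / norm v) *\<^sub>R v) \<in> ?S" if "v \<noteq> 0" for z and v :: "real ^ 'n" using that by simp
 have bd: "sqrt (?q y0) * norm v \<le> riemannian_norm M z v \<and> riemannian_norm M z v \<le> sqrt (?q y1) * norm v" for z v
 proof (cases "v = 0")
  case False
  have "(norm v)\<^sup>2 * ?q y0 \<le> (norm v)\<^sup>2 * ?q (z, (1 / norm v) *\<^sub>R v)" "(norm v)\<^sup>2 * ?q (z, (1 / norm v) *\<^sub>R v) \<le> (norm v)\<^sup>2 * ?q y1"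
   by (intro mult_left_mono y0(2) y1(2) unit False zero_le_power2)+
  then have "(norm v)\<^sup>2 * ?q y0 \<le> v \<bullet> (M z *v v)" "v \<bullet> (M z *v v) \<le> (norm v)\<^sup>2 * ?q y1" unfolding hom[OF False] .
  from this[THEN real_sqrt_le_mono] show ?thesis by (simp add: riemannian_norm_def real_sqrt_mult mult.commute)
 qed (simp add: riemannian_norm_def)
 show ?thesis by (rule that[of "sqrt (?q y0)" "sqrt (?q y1)", OF _ _ bd[THEN conjunct1] bd[THEN conjunct2]]) (use q0 in auto)
qed

text \<open>\<open>sn\<close>, \<open>cn\<close>, \<open>un\<close> are the sizes of the components
  of an iterated vector and \<open>wn\<close> is its own size; \<open>g\<close> and \<open>h\<close>
  are the products of the upper stable and centre rates, and \<open>a\<close> is the uniform gap. A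
  non-zero unstable component, or else a non-zero centre component, eventually outweighs the
  others.\<close>

lemma domination:
 fixes g h sn cn un wn :: "nat \<Rightarrow> real"
 assumes w: "\<And>n. un n - cn n - sn n \<le> wn n" "\<And>n. cn n - sn n - un n \<le> wn n"
  and s: "\<And>n. sn n \<le> g n * sa" and c: "\<And>n. a ^ n * g n * ca \<le> cn n" "\<And>n. cn n \<le> h n * cb"
  and u: "\<And>n. a ^ n * h n * ua \<le> un n" "\<And>n. a ^ n * g n * ua \<le> un n"
  and pos: "1 < a" "\<And>n. 0 < g n" "\<And>n. 0 < h n" "0 \<le> cb"
  and nz: "0 < ua \<or> (0 < ca \<and> (\<forall>n. un n = 0))"
 shows "\<exists>n0. \<forall>n\<ge>n0. g n \<le> wn n"
proof -
 have big: "\<exists>n0. \<forall>n\<ge>n0. X \<le> a ^ n" for X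
 proof -
  obtain n0 where "X < a ^ n0" using real_arch_pow[OF pos(1)] by blast
  then have "X \<le> a ^ n" if "n0 \<le> n" for n using power_increasing[OF that, of a] pos(1) by linarith
  then show ?thesis by blast
 qed
 show ?thesis
 proof (cases "0 < ua")
  case True
  obtain n0 where n0: "\<And>n. n0 \<le> n \<Longrightarrow> max (2 * cb / ua) (2 * (sa + 1) / ua) \<le> a ^ n" using big by blast
  have "g n \<le> wn n" if "n0 \<le> n" for n
  proof -
   have A: "2 * cb \<le> a ^ n * ua" "2 * (sa + 1) \<le> a ^ n * ua" using n0[OF that] True by (simp_all add: pos_divide_le_eq)
   have "h n * (2 * cb) \<le> h n * (a ^ n * ua)" using A pos(3)[of n] by (intro mult_left_mono) auto
   then have 1: "2 * cn n \<le> un n" using c(2)[of n] u(1)[of n] by (simp add: mult_ac)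
   have "g n * (2 * (sa + 1)) \<le> g n * (a ^ n * ua)" using A pos(2)[of n] by (intro mult_left_mono) auto
   then have 2: "2 * (g n * sa) + 2 * g n \<le> un n" using u(2)[of n] by (simp add: algebra_simps)
   show ?thesis using 1 2 w(1)[of n] s[of n] by linarith
  qed
  then show ?thesis by blast
 next
  case False
  then have ca: "0 < ca" and un: "\<And>n. un n = 0" using nz by auto
  obtain n0 where n0: "\<And>n. n0 \<le> n \<Longrightarrow> (sa + 1) / ca \<le> a ^ n" using big by blast
  have "g n \<le> wn n" if "n0 \<le> n" for n
  proof -
   have A: "sa + 1 \<le> a ^ n * ca" using n0[OF that] ca by (simp add: pos_divide_le_eq)
   have "g n * (sa + 1) \<le> g n * (a ^ n * ca)" using A pos(2)[of n] by (intro mult_left_mono) auto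
   then have "g n * sa + g n \<le> cn n" using c(1)[of n] by (simp add: algebra_simps)
   then show ?thesis using w(2)[of n] s[of n] un[of n] by linarith
  qed
  then show ?thesis by blast
 qed
qed

context torus_leaves
begin

text \<open>The segment between two points of a plaque stays in it, and its image is a curve tangent
  to the bundle, to which \<open>tangent_curve_in_W\<close> applies.\<close>

lemma plaque_in_leaf:
 fixes phi :: "real ^ 'n \<Rightarrow> real ^ 'n" and L :: "real ^ 'n \<Rightarrow> (real ^ 'n) \<Rightarrow>\<^sub>L (real ^ 'n)"
 assumes H': "subspace H'" and cL: "continuous_on (product_box H') L"
  and der: "\<And>z. z \<in> product_box H' \<Longrightarrow> (phi has_derivative blinfun_apply (L z)) (at z within plaque H' z)"
  and im: "\<And>z. z \<in> product_box H' \<Longrightarrow> L z ` H' = Et (torus_of (phi z))"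
  and z: "z \<in> product_box H'" and z': "z' \<in> plaque H' z"
 shows "phi z' \<in> W (phi z)"
proof -
 define d where "d = z' - z"
 define l where "l t = z + t *\<^sub>R d" for t :: real
 have d: "d \<in> H'" using z' by (simp add: d_def plaque_def)
 have l01: "l 0 = z" "l 1 = z'" by (simp_all add: l_def d_def)
 have lp: "l t \<in> plaque H' z" if "t \<in> {0..1}" for t
 proof -
  have "l t = (1 - t) *\<^sub>R z + t *\<^sub>R z'" by (simp add: l_def d_def algebra_simps)
  then show ?thesis using convexD_alt[OF convex_plaque[OF H'] plaque_self[OF H' z] z', of t] that by simp
 qed
 then have lb: "l t \<in> product_box H'" if "t \<in> {0..1}" for t using that by (auto simp: plaque_def)
 have lpl: "l ` {0..1} \<subseteq> plaque H' (l t)" for t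
 proof
  fix y assume "y \<in> l ` {0..1}"
  then obtain t' where t': "t' \<in> {0..1}" "y = l t'" by blast
  have "l t' - l t = (t' - t) *\<^sub>R d" by (simp add: l_def algebra_simps)
  then show "y \<in> plaque H' (l t)" using lb[OF t'(1)] subspace_scale[OF H' d] by (simp add: plaque_def t'(2))
 qed
 have cl: "continuous_on {0..1} l" unfolding l_def by (intro continuous_intros)
 have cLl: "continuous_on {0..1} (\<lambda>t. L (l t) d)"
  by (intro continuous_intros continuous_on_compose2[OF cL cl]) (use lb in auto)
 have "bounded ((\<lambda>t. L (l t) d) ` {0..1})"
  by (intro compact_imp_bounded compact_continuous_image cLl) simp
 then obtain C where C: "\<And>t. t \<in> {0..1} \<Longrightarrow> norm (L (l t) d) \<le> C" unfolding bounded_iff by blast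
 have "(\<lambda>t. phi (l t)) 1 \<in> W ((\<lambda>t. phi (l t)) 0)"
 proof (rule tangent_curve_in_W[where gamma' = "\<lambda>t. L (l t) d" and C = C])
  fix t :: real assume t: "t \<in> {0..1}"
  show "((\<lambda>t. phi (l t)) has_vector_derivative L (l t) d) (at t within {0..1})"
  proof -
   have 1: "(l has_derivative (\<lambda>h. h *\<^sub>R d)) (at t within {0..1})"
    unfolding l_def by (auto intro!: derivative_eq_intros)
   have 2: "(phi has_derivative L (l t)) (at (l t) within l ` {0..1})"
    by (rule has_derivative_subset[OF der[OF lb[OF t]] lpl])
   have "((\<lambda>t. phi (l t)) has_derivative (\<lambda>h. L (l t) (h *\<^sub>R d))) (at t within {0..1})"
    by (rule has_derivative_in_compose[OF 1 2])
   then show ?thesis by (simp add: has_vector_derivative_def blinfun.scaleR_right)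
  qed
  show "L (l t) d \<in> tangent (phi (l t))" using im[OF lb[OF t]] d unfolding Et_of by blast
 qed (rule C)
 then show ?thesis by (simp add: l01)
qed

text \<open>Along a path in a leaf of \<open>W'\<close> the leaf \<open>Wt\<close> is locally
  constant: a short piece of the path stays in one path component of leaf and chart, hence in one
  plaque.\<close>

lemma foliation_subset_Wt:
 assumes fol: "tangent_foliation Et W'"
 shows "W' z \<subseteq> Wt z"
proof
 have W': "\<And>z. z \<in> W' z" "\<And>z. path_connected (W' z)" "\<And>z y. y \<in> W' z \<Longrightarrow> W' y = W' z"
  using fol unfolding tangent_foliation_def by blast+
 fix y assume y: "y \<in> W' z"
 obtain g where g: "path g" "path_image g \<subseteq> W' z" "pathstart g = z" "pathfinish g = y"
  using W'(2)[of z] W'(1)[of z] y unfolding path_connected_def by blast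
 have cg: "continuous_on {0..1} g" using g(1) by (simp add: path_def)
 have gW: "g t \<in> W' z" if "t \<in> {0..1}" for t using g(2) that by (auto simp: path_image_def)
 have "Wt (g 0) = Wt (g 1)"
 proof (rule connected_equivalence_relation[of "{0..1::real}" 0 1 "\<lambda>t t'. Wt (g t) = Wt (g t')"])
  fix t0 :: real assume t0: "t0 \<in> {0..1}"
  obtain H' phi psi L U where "foliation_chart Et W' (g t0) H' phi psi L U" using fol unfolding tangent_foliation_iff by blast
  note ch = foliation_chartD[OF this]
  define z0 where "z0 = psi (g t0)"
  have z0: "z0 \<in> product_box H'" "torus_of (phi z0) = g t0" using ch(3,4) by (auto simp: z0_def homeomorphism_def)
  have "openin (top_of_set {0..1}) ({0..1} \<inter> g -` U)" using continuous_openin_preimage_gen[OF cg ch(2)] .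
  then obtain e where e: "0 < e" "ball t0 e \<inter> {0..1} \<subseteq> {0..1} \<inter> g -` U"
   using t0 ch(3) unfolding openin_contains_ball by blast
  define T where "T = ball t0 e \<inter> {0..1}"
  have "g ` T \<subseteq> path_component_set (W' (g t0) \<inter> U) (g t0)"
  proof (rule path_component_maximal)
   show "g t0 \<in> g ` T" using t0 e(1) by (simp add: T_def)
   have "convex T" unfolding T_def by (intro convex_Int convex_ball) simp
   then show "path_connected (g ` T)"
    by (intro path_connected_continuous_image continuous_on_subset[OF cg] convex_imp_path_connected) (auto simp: T_def)
   show "g ` T \<subseteq> W' (g t0) \<inter> U" using e(2) gW W'(3)[OF gW[OF t0]] by (auto simp: T_def)
  qed
  also have "\<dots> = (torus_of \<circ> phi) ` plaque H' z0" using ch(10)[OF z0(1)] by (simp only: z0(2))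
  finally have sub: "g ` T \<subseteq> (torus_of \<circ> phi) ` plaque H' z0" .
  have "\<forall>t\<in>T. Wt (g t0) = Wt (g t)"
  proof
   fix t assume "t \<in> T"
   then obtain z' where z': "z' \<in> plaque H' z0" "g t = torus_of (phi z')" using sub by auto
   have "phi z' \<in> W (phi z0)" by (rule plaque_in_leaf[OF ch(1,6,7,9) z0(1) z'(1)])
   then have "g t \<in> Wt (g t0)" unfolding z'(2) z0(2)[symmetric] Wt_of by blast
   then show "Wt (g t0) = Wt (g t)" by (rule Wt_eq[symmetric])
  qed
  moreover have "openin (top_of_set {0..1}) T" unfolding T_def by (subst Int_commute) (simp add: openin_open_Int)
  moreover have "t0 \<in> T" using t0 e(1) by (simp add: T_def)
  ultimately show "\<exists>T. openin (top_of_set {0..1}) T \<and> t0 \<in> T \<and> (\<forall>t\<in>T. Wt (g t0) = Wt (g t))" by blast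
 qed auto
 then have "Wt y = Wt z" using g(3,4) by (simp add: pathstart_def pathfinish_def)
 then show "y \<in> Wt z" using Wt_refl[of y] by simp
qed

text \<open>The plaques of \<open>W'\<close> have to be open in the leaves of \<open>Wt\<close>. A
  plaque projects continuously and injectively to \<open>H\<close>, whose dimension is not larger,
  so invariance of domain makes the image open; thus \<open>W'\<close> is locally constant along a
  leaf of \<open>Wt\<close>.\<close>

lemma Wt_subset_foliation:
 assumes fol: "tangent_foliation Et W'"
 shows "Wt z \<subseteq> W' z"
proof
 have W': "\<And>z. z \<in> W' z" "\<And>z y. y \<in> W' z \<Longrightarrow> W' y = W' z"
  using fol unfolding tangent_foliation_def by blast+
 fix y assume "y \<in> Wt z"
 moreover obtain x where x: "z = torus_of x" using torus_of_surj by metis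
 ultimately obtain w where w: "w \<in> W x" "y = torus_of w" unfolding x Wt_of by blast
 define j where "j = leaf_pt x"
 have jW: "j v \<in> W (j v')" for v v' unfolding j_def by (rule W_trans[OF W_sym[OF leaf_pt(1)] leaf_pt(1)])
 have "W' (torus_of (j x)) = W' (torus_of (j w))"
 proof (rule connected_equivalence_relation[of UNIV x w "\<lambda>v v'. W' (torus_of (j v)) = W' (torus_of (j v'))"])
  fix v0
  obtain H' phi psi L U where "foliation_chart Et W' (torus_of (j v0)) H' phi psi L U" using fol unfolding tangent_foliation_iff by blast
  note ch = foliation_chartD[OF this]
  define z0 where "z0 = psi (torus_of (j v0))"
  have z0: "z0 \<in> product_box H'" "torus_of (phi z0) = torus_of (j v0)" using ch(3,4) by (auto simp: z0_def homeomorphism_def)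
  define k where "k = phi z0 - j v0"
  have k: "k \<in> int_vecs" using z0(2) by (simp add: k_def torus_of_eq)
  define S where "S = {h \<in> H'. z0 + h \<in> product_box H'}"
  define c where "c h = P (phi (z0 + h) - phi z0)" for h
  have pl: "z0 + h \<in> plaque H' z0" if "h \<in> S" for h using that by (simp add: S_def plaque_def)
  have leaf: "phi (z0 + h) \<in> W (phi z0)" if "h \<in> S" for h
   by (rule plaque_in_leaf[OF ch(1,6,7,9) z0(1) pl[OF that]])
  have "dim H' = dim (tangent (phi z0))"
   using dim_image_eq[of "L z0" H'] ch(8)[OF z0(1)] ch(9)[OF z0(1)]
   by (simp add: span_eq_iff[THEN iffD2, OF ch(1)] Et_of bounded_linear.linear[OF blinfun.bounded_linear_right])
  then have dims: "dim H \<le> dim H'" by (simp only: dim_tangent)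
  have p_of_P: "p v = 0" if "P v = 0" for v using pP[of v] that by simp
  have "openin (top_of_set H) (c ` S)"
  proof (rule invariance_of_domain_subspaces[OF _ ch(1) subspace_qzero dims])
   have S: "S = H' \<inter> (\<lambda>h. z0 + h) -` product_box H'" by (auto simp: S_def)
   show "openin (top_of_set H') S" unfolding S
    by (intro openin_open_Int open_vimage product_box(1)[OF ch(1)] continuous_intros)
   show "continuous_on S c" unfolding c_def
    by (intro continuous_on_compose2[OF linear_continuous_on[of P UNIV]] continuous_intros continuous_on_compose2[OF ch(5)])
     (use linP in \<open>auto simp: S_def linear_conv_bounded_linear\<close>)
   show "c \<in> S \<rightarrow> H" using qP by (simp add: c_def)
   show "inj_on c S"
   proof (rule inj_onI)
    fix h h' assume h: "h \<in> S" "h' \<in> S" "c h = c h'"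
    have "P (phi (z0 + h) - phi (z0 + h')) = 0" using h(3) by (simp add: c_def linear_diff[OF linP])
    then have "phi (z0 + h) = phi (z0 + h')" by (intro W_unique[OF leaf[OF h(1)] leaf[OF h(2)]] p_of_P)
    moreover have "inj_on (torus_of \<circ> phi) (product_box H')" using ch(4) unfolding homeomorphism_def by (metis inj_on_def)
    ultimately show "h = h'" using inj_onD[of "torus_of \<circ> phi" "product_box H'" "z0 + h" "z0 + h'"] h(1,2) by (simp add: S_def)
   qed
  qed
  then obtain T where T: "open T" "c ` S = H \<inter> T" unfolding openin_open by blast
  define V where "V = (\<lambda>v. P (v - v0)) -` T"
  have "open V" unfolding V_def
   by (intro open_vimage T(1) continuous_on_compose2[OF linear_continuous_on[of P UNIV]] continuous_intros)
    (use linP in \<open>auto simp: linear_conv_bounded_linear\<close>)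
  moreover have "v0 \<in> V"
  proof -
   have "0 \<in> S" using z0(1) subspace_0[OF ch(1)] by (simp add: S_def)
   then have "c 0 \<in> T" using T(2) by blast
   then show ?thesis by (simp add: V_def c_def linear_0[OF linP])
  qed
  moreover have "\<forall>v\<in>V. W' (torus_of (j v0)) = W' (torus_of (j v))"
  proof
   fix v assume "v \<in> V"
   then have "P (v - v0) \<in> c ` S" unfolding T(2) using qP by (simp add: V_def)
   then obtain h where h: "h \<in> S" "P (phi (z0 + h) - phi z0) = P (v - v0)" unfolding c_def by force
   have m: "j v + k \<in> W (phi z0)" using W_shift[OF k, of "j v" "j v0"] jW by (simp add: k_def)
   have "phi (z0 + h) = j v + k"
   proof (rule W_unique[OF leaf[OF h(1)] m])
    have "P ((phi (z0 + h) - phi z0) - (v - v0)) = 0" using h(2) by (simp add: linear_diff[OF linP])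
    then have 1: "p ((phi (z0 + h) - phi z0) - (v - v0)) = 0" by (rule p_of_P)
    have 2: "p ((j v - j v0) - (v - v0)) = 0" unfolding j_def by (rule p_leaf_pt_diff)
    have "phi (z0 + h) - (j v + k) = ((phi (z0 + h) - phi z0) - (v - v0)) - ((j v - j v0) - (v - v0))" by (simp add: k_def)
    then have "p (phi (z0 + h) - (j v + k)) \<le> 0" using seminorm_diff[OF snp] 1 2 by (metis add.right_neutral)
    then show "p (phi (z0 + h) - (j v + k)) = 0" using p0[of "phi (z0 + h) - (j v + k)"] by linarith
   qed
   then have "torus_of (j v) = (torus_of \<circ> phi) (z0 + h)" by (simp add: torus_of_shift[OF k])
   also have "\<dots> \<in> path_component_set (W' (torus_of (phi z0)) \<inter> U) (torus_of (phi z0))"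
    unfolding ch(10)[OF z0(1)] by (rule imageI[OF pl[OF h(1)]])
   also have "\<dots> \<subseteq> W' (torus_of (phi z0)) \<inter> U" by (rule path_component_subset)
   finally have "torus_of (j v) \<in> W' (torus_of (j v0))" by (simp add: z0(2))
   then show "W' (torus_of (j v0)) = W' (torus_of (j v))" by (rule W'(2)[symmetric])
  qed
  ultimately show "\<exists>T. openin (top_of_set UNIV) T \<and> v0 \<in> T \<and> (\<forall>v\<in>T. W' (torus_of (j v0)) = W' (torus_of (j v)))"
   by (intro exI[of _ V] conjI) simp_all
 qed auto
 then have "W' z = W' y" using leaf_pt_self[OF w(1)] leaf_pt_self[OF W_refl] by (simp add: j_def x w(2))
 then show "y \<in> W' z" using W'(1)[of y] by simp
qed

lemma uniquely_integrable_Et: "uniquely_integrable_to Et Wt"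
 unfolding uniquely_integrable_to_def
 using tangent_foliation_Wt foliation_subset_Wt Wt_subset_foliation by (blast intro: ext subset_antisym)

lemma bundle_growth:
 assumes M: "riemannian_metric M" and inv: "invariant_bundle f E" and rb: "rate_bounds M f E mu \<nu>" and v: "v \<in> E (torus_of x)"
 shows "dG n x v \<in> E (torus_of (G n x)) \<and>
  (\<Prod>i<n. mu (torus_of (G i x))) * riemannian_norm M (torus_of x) v \<le> riemannian_norm M (torus_of (G n x)) (dG n x v) \<and>
  riemannian_norm M (torus_of (G n x)) (dG n x v) \<le> (\<Prod>i<n. \<nu> (torus_of (G i x))) * riemannian_norm M (torus_of x) v"
proof (induction n)
 case (Suc n)
 let ?z = "torus_of (G n x)" and ?w = "dG n x v"
 let ?N = "riemannian_norm M ?z ?w" and ?N' = "riemannian_norm M (f ?z) (torus_deriv f ?z ?w)"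
 have z: "torus_of (G (Suc n) x) = f ?z" "dG (Suc n) x v = torus_deriv f ?z ?w" by (simp_all add: f_of f_deriv)
 have w: "?w \<in> E ?z" using Suc by blast
 have pos: "0 < mu ?z" "0 < \<nu> ?z" using rb by (auto simp: rate_bounds_def)
 have step: "mu ?z * ?N \<le> ?N' \<and> ?N' \<le> \<nu> ?z * ?N"
 proof (cases "?w = 0")
  case False
  then have "mu ?z < ?N' / ?N \<and> ?N' / ?N < \<nu> ?z" using rb w by (auto simp: rate_bounds_def)
  moreover have "0 < ?N" using M False by (simp add: riemannian_metric_def riemannian_norm_def)
  ultimately show ?thesis by (simp add: pos_less_divide_eq pos_divide_less_eq less_imp_le)
 qed (simp add: riemannian_norm_def)
 have "?N' \<le> (\<Prod>i<Suc n. \<nu> (torus_of (G i x))) * riemannian_norm M (torus_of x) v"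
  using conjunct2[OF step] mult_left_mono[OF conjunct2[OF conjunct2[OF Suc]] less_imp_le[OF pos(2)]] by (simp add: mult_ac)
 moreover have "(\<Prod>i<Suc n. mu (torus_of (G i x))) * riemannian_norm M (torus_of x) v \<le> ?N'"
  using conjunct1[OF step] mult_left_mono[OF conjunct1[OF conjunct2[OF Suc]] less_imp_le[OF pos(1)]] by (simp add: mult_ac)
 moreover have "torus_deriv f ?z ?w \<in> E (f ?z)" using inv w unfolding invariant_bundle_def by blast
 ultimately show ?case unfolding z by blast
qed (simp add: v)

text \<open>The rates of the given splitting are unrelated to \<open>lam\<close>. A tangent vector
  outside \<open>E1\<close> has a centre or unstable part, so by \<open>domination\<close> its slow
  growth bounds that of all vectors of \<open>E1\<close>, which places \<open>E1\<close> inside the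
  tangent space. Otherwise the tangent space is inside \<open>E1\<close>. Equal dimensions settle
  both cases.\<close>

lemma stable_bundle_unique:
 assumes ph: "partially_hyperbolic_splitting f E1 E2 E3" and dim1: "\<And>z. dim (E1 z) = dim H"
 shows "E1 = Et"
proof -
 obtain M mus \<nu>s muc \<nu>c muu \<nu>u where M: "riemannian_metric M"
  and rb: "rate_bounds M f E1 mus \<nu>s" "rate_bounds M f E2 muc \<nu>c" "rate_bounds M f E3 muu \<nu>u"
  and gaps: "\<And>z. \<nu>s z < min 1 (muc z)" "\<And>z. max 1 (\<nu>c z) < muu z"
  using ph unfolding partially_hyperbolic_splitting_def by blast
 have inv: "invariant_bundle f E1" "invariant_bundle f E2" "invariant_bundle f E3"
  and sum: "\<And>z. {a + b + c | a b c. a \<in> E1 z \<and> b \<in> E2 z \<and> c \<in> E3 z} = UNIV"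
  using ph unfolding partially_hyperbolic_splitting_def by blast+
 have sub: "subspace (E1 z)" for z using inv(1) by (simp add: invariant_bundle_def)
 obtain b d where bd: "0 < b" "0 < d" "\<And>z v. b * norm v \<le> riemannian_norm M z v" "\<And>z v. riemannian_norm M z v \<le> d * norm v"
  using riemannian_norm_equiv[OF M] by metis
 have rbc: "continuous_on UNIV \<nu>s" "continuous_on UNIV muc" "continuous_on UNIV \<nu>c" "continuous_on UNIV muu"
  and pos: "\<And>z. 0 < \<nu>s z" "\<And>z. 0 < \<nu>c z" "\<And>z. 0 < muc z" "\<And>z. 0 < muu z"
  using rb by (auto simp: rate_bounds_def)
 obtain a1 where a1: "1 < a1" "\<And>z. a1 * \<nu>s z \<le> muc z"
  by (rule torus_uniform_gap[OF rbc(1,2) pos(1)]) (use gaps in auto)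
 obtain a2 where a2: "1 < a2" "\<And>z. a2 * \<nu>c z \<le> muu z"
  by (rule torus_uniform_gap[OF rbc(3,4) pos(2)]) (use gaps in auto)
 have su: "\<nu>s z < muu z" for z using gaps[of z] by linarith
 obtain a3 where a3: "1 < a3" "\<And>z. a3 * \<nu>s z \<le> muu z"
  by (rule torus_uniform_gap[OF rbc(1,4) pos(1) su]) blast
 define a where "a = min a1 (min a2 a3)"
 have a: "1 < a" "a \<le> a1" "a \<le> a2" "a \<le> a3" using a1 a2 a3 by (auto simp: a_def)
 have gap: "a * \<nu>s z \<le> muc z" "a * \<nu>c z \<le> muu z" "a * \<nu>s z \<le> muu z" for z
  using a1(2)[of z] a2(2)[of z] a3(2)[of z] mult_right_mono[OF a(2), of "\<nu>s z"] mult_right_mono[OF a(3), of "\<nu>c z"]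
   mult_right_mono[OF a(4), of "\<nu>s z"] pos(1,2)[of z] by linarith+
 have E: "E1 (torus_of x) = tangent x" for x
 proof -
  define g h where "g n = (\<Prod>i<n. \<nu>s (torus_of (G i x)))" and "h n = (\<Prod>i<n. \<nu>c (torus_of (G i x)))" for n
  have gh: "0 < g n" "0 < h n" for n unfolding g_def h_def using pos by (auto intro: prod_pos)
  have pw: "a ^ n * (\<Prod>i<n. k (torus_of (G i x))) \<le> (\<Prod>i<n. l (torus_of (G i x)))"
   if "\<And>z. a * k z \<le> l z" "\<And>z. 0 < k z" for n k and l :: "'n torus \<Rightarrow> real"
  proof -
   have "a ^ n * (\<Prod>i<n. k (torus_of (G i x))) = (\<Prod>i<n. a * k (torus_of (G i x)))" by (simp add: prod.distrib)
   also have "\<dots> \<le> (\<Prod>i<n. l (torus_of (G i x)))" using that a(1) by (intro prod_mono) (auto intro: less_imp_le)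
   finally show ?thesis .
  qed
  let ?N0 = "riemannian_norm M (torus_of x)"
  have N0: "0 \<le> ?N0 v" "v \<noteq> 0 \<Longrightarrow> 0 < ?N0 v" for v
  proof -
   have 0: "0 \<le> b * norm v" "v \<noteq> 0 \<Longrightarrow> 0 < b * norm v" using bd(1) by auto
   show "0 \<le> ?N0 v" using bd(3)[of v "torus_of x"] 0(1) by linarith
   show "0 < ?N0 v" if "v \<noteq> 0" using bd(3)[of v "torus_of x"] 0(2)[OF that] by linarith
  qed
  have up: "norm (dG n x v) \<le> k n * (?N0 v / b)"
   if "riemannian_norm M (torus_of (G n x)) (dG n x v) \<le> k n * ?N0 v" for n v and k :: "nat \<Rightarrow> real"
   using order_trans[OF bd(3) that] bd(1) by (simp add: field_simps)
  have lo: "k n * (?N0 v / d) \<le> norm (dG n x v)"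
   if "k n * ?N0 v \<le> riemannian_norm M (torus_of (G n x)) (dG n x v)" for n v and k :: "nat \<Rightarrow> real"
   using order_trans[OF that bd(4)] bd(2) by (simp add: field_simps)
  have s_up: "norm (dG n x v) \<le> g n * (?N0 v / b)" if "v \<in> E1 (torus_of x)" for v n
   using bundle_growth[OF M inv(1) rb(1) that, of n] unfolding g_def by (intro up) blast
  have sub1: "E1 (torus_of x) \<subseteq> tangent x" if w: "w \<in> tangent x" "w \<notin> E1 (torus_of x)" for w
  proof -
   obtain s c u where scu: "w = s + c + u" "s \<in> E1 (torus_of x)" "c \<in> E2 (torus_of x)" "u \<in> E3 (torus_of x)"
    using sum[of "torus_of x"] by blast
   have nz: "c \<noteq> 0 \<or> u \<noteq> 0" using w(2) scu by auto
   have dGw: "dG n x w = dG n x s + dG n x c + dG n x u" for n by (simp add: scu(1) blinfun.add_right)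
   note Bc = bundle_growth[OF M inv(2) rb(2) scu(3)] and Bu = bundle_growth[OF M inv(3) rb(3) scu(4)]
   have u_lo: "k n * (?N0 u / d) \<le> norm (dG n x u)" if "k n \<le> (\<Prod>i<n. muu (torus_of (G i x)))" for n and k :: "nat \<Rightarrow> real"
    using Bu[of n] mult_right_mono[OF that N0(1)[of u]] by (intro lo) linarith
   have c_lo: "k n * (?N0 c / d) \<le> norm (dG n x c)" if "k n \<le> (\<Prod>i<n. muc (torus_of (G i x)))" for n and k :: "nat \<Rightarrow> real"
    using Bc[of n] mult_right_mono[OF that N0(1)[of c]] by (intro lo) linarith
   have "\<exists>n0. \<forall>n\<ge>n0. g n \<le> norm (dG n x w)"
   proof (rule domination[where sn = "\<lambda>n. norm (dG n x s)" and cn = "\<lambda>n. norm (dG n x c)" and un = "\<lambda>n. norm (dG n x u)"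
      and a = a and sa = "?N0 s / b" and ca = "?N0 c / d" and cb = "?N0 c / b" and h = h and ua = "?N0 u / d"])
    fix n
    have t: "norm (dG n x u) \<le> norm (dG n x w) + norm (dG n x c) + norm (dG n x s)"
     "norm (dG n x c) \<le> norm (dG n x w) + norm (dG n x s) + norm (dG n x u)"
     unfolding dGw using norm_triangle_ineq4[of "dG n x s + dG n x c + dG n x u" "dG n x c + dG n x s"]
      norm_triangle_ineq4[of "dG n x s + dG n x c + dG n x u" "dG n x s + dG n x u"]
      norm_triangle_ineq[of "dG n x c" "dG n x s"] norm_triangle_ineq[of "dG n x s" "dG n x u"]
     by (simp_all add: algebra_simps)
    show "norm (dG n x u) - norm (dG n x c) - norm (dG n x s) \<le> norm (dG n x w)"
     "norm (dG n x c) - norm (dG n x s) - norm (dG n x u) \<le> norm (dG n x w)" using t by linarith+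
    show "norm (dG n x s) \<le> g n * (?N0 s / b)" by (rule s_up[OF scu(2)])
    show "a ^ n * g n * (?N0 c / d) \<le> norm (dG n x c)"
     unfolding g_def by (rule c_lo[where k = "\<lambda>n. a ^ n * (\<Prod>i<n. \<nu>s (torus_of (G i x)))"]) (rule pw[OF gap(1) pos(1)])
    show "norm (dG n x c) \<le> h n * (?N0 c / b)" using Bc[of n] unfolding h_def by (intro up) blast
    show "a ^ n * h n * (?N0 u / d) \<le> norm (dG n x u)"
     unfolding h_def by (rule u_lo[where k = "\<lambda>n. a ^ n * (\<Prod>i<n. \<nu>c (torus_of (G i x)))"]) (rule pw[OF gap(2) pos(2)])
    show "a ^ n * g n * (?N0 u / d) \<le> norm (dG n x u)"
     unfolding g_def by (rule u_lo[where k = "\<lambda>n. a ^ n * (\<Prod>i<n. \<nu>s (torus_of (G i x)))"]) (rule pw[OF gap(3) pos(1)])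
   next
    show "0 < ?N0 u / d \<or> 0 < ?N0 c / d \<and> (\<forall>n. norm (dG n x u) = 0)"
     using nz N0(2)[of c] N0(2)[of u] bd(2) by (cases "u = 0") (auto simp: blinfun.zero_right)
   qed (use a(1) gh N0(1)[of c] bd(1) in auto)
   then obtain n0 where n0: "\<And>n. n0 \<le> n \<Longrightarrow> g n \<le> norm (dG n x w)" by blast
   have le: "0 < lam + e" using lam0 e0 by simp
   have dec: "g n \<le> 2 * K * p w * (lam + e) ^ n" if "n0 \<le> n" for n
   proof -
    have "norm (dG n x w) \<le> K * (p (dG n x w) + q (dG n x w))" by (rule normK)
    also have "\<dots> \<le> K * ((lam + e) ^ n * p w + (lam + e) ^ n * p w)"
     using tangent_contract[OF w(1), of n] tangent_contract_q[OF w(1), of n] K0 by (intro mult_left_mono add_mono) auto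
    finally show ?thesis using n0[OF that] by (simp add: algebra_simps)
   qed
   \<comment> \<open>The sum absorbs the finitely many times before domination sets in.\<close>
   define D where "D = 2 * K * p w + (\<Sum>i<n0. g i / (lam + e) ^ i)"
   have pos': "0 \<le> (\<Sum>i<n0. g i / (lam + e) ^ i)" using gh(1) le by (intro sum_nonneg divide_nonneg_pos less_imp_le) auto
   have gD: "g n \<le> D * (lam + e) ^ n" for n
   proof (cases "n0 \<le> n")
    case True
    have "2 * K * p w * (lam + e) ^ n \<le> D * (lam + e) ^ n" using pos' le unfolding D_def by (intro mult_right_mono) auto
    then show ?thesis using dec[OF True] by linarith
   next
    case False
    have "g n / (lam + e) ^ n \<le> (\<Sum>i<n0. g i / (lam + e) ^ i)"
     using False gh(1) le by (intro member_le_sum divide_nonneg_pos less_imp_le) auto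
    also have "\<dots> \<le> D" unfolding D_def using K0 p0[of w] by simp
    finally show ?thesis using le by (simp add: pos_divide_le_eq)
   qed
   show ?thesis
   proof
    fix v assume v: "v \<in> E1 (torus_of x)"
    show "v \<in> tangent x"
    proof (rule tangent_growth[of _ _ "K * (D * (?N0 v / b))"])
     fix n
     have "q (dG n x v) \<le> K * norm (dG n x v)" by (rule qK)
     also have "\<dots> \<le> K * (g n * (?N0 v / b))" using s_up[OF v, of n] K0 by (intro mult_left_mono) auto
     also have "\<dots> \<le> K * (D * (lam + e) ^ n * (?N0 v / b))"
      using gD[of n] K0 N0(1)[of v] bd(1) by (intro mult_left_mono mult_right_mono) auto
     finally show "q (dG n x v) \<le> K * (D * (?N0 v / b)) * (lam + e) ^ n" by (simp add: mult_ac)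
    qed
   qed
  qed
  have dims: "dim (E1 (torus_of x)) = dim (tangent x)" by (simp only: dim1 dim_tangent)
  show ?thesis
  proof (cases "tangent x \<subseteq> E1 (torus_of x)")
   case True
   then show ?thesis using subspace_dim_equal[OF subspace_tangent sub True] dims by simp
  next
   case False
   then have "E1 (torus_of x) \<subseteq> tangent x" using sub1 by blast
   then show ?thesis using subspace_dim_equal[OF sub subspace_tangent] dims by simp
  qed
 qed
 show ?thesis
 proof
  fix z
  show "E1 z = Et z" using E[of "rep_torus z"] by (simp add: Et_def torus_of_rep)
 qed
qed

end

section \<open>Lifts, derivatives and the neighbourhood of the automorphism\<close>

lemma int_valued_constant:
 fixes d :: "real ^ 'n::finite \<Rightarrow> real ^ 'n"
 assumes "continuous_on UNIV d" "\<And>x. d x \<in> int_vecs"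
 shows "d x = d 0"
proof (rule connected_equivalence_relation[of UNIV x 0 "\<lambda>x y. d x = d y"])
 fix y
 have "d y = d z" if "z \<in> d -` ball (d y) 1" for z
  using int_vecs_norm[OF int_vecs_add[OF assms(2)[of y] int_vecs_minus[OF assms(2)[of z]]]] that by (simp add: dist_norm)
 moreover have "open (d -` ball (d y) 1)" by (rule open_vimage[OF open_ball assms(1)])
 ultimately show "\<exists>T. openin (top_of_set UNIV) T \<and> y \<in> T \<and> (\<forall>z\<in>T. d y = d z)"
  by (intro exI[of _ "d -` ball (d y) 1"] conjI ballI) simp_all
qed auto

lemma lift_diff:
 assumes "is_lift f F" "is_lift f F'"
 shows "F' 0 - F 0 \<in> int_vecs" "F' x = F x + (F' 0 - F 0)"
proof -
 have c: "continuous_on UNIV F" "continuous_on UNIV F'" and "\<And>x. torus_of (F' x) = torus_of (F x)"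
  using assms by (auto simp: is_lift_def)
 then have i: "F' x - F x \<in> int_vecs" for x by (simp add: torus_of_eq)
 have "continuous_on UNIV (\<lambda>x. F' x - F x)" using c by (intro continuous_intros)
 from int_valued_constant[OF this i, of x] show "F' x = F x + (F' 0 - F 0)" by (simp add: algebra_simps)
 show "F' 0 - F 0 \<in> int_vecs" by (rule i)
qed

lemma is_lift_add:
 assumes "is_lift f F" "k \<in> int_vecs" "l \<in> int_vecs"
 shows "is_lift f (\<lambda>x. F (x + k) + l)"
proof -
 have "continuous_on UNIV F" using assms by (simp add: is_lift_def)
 then have "continuous_on UNIV (\<lambda>x. F (x + k))" by (rule continuous_on_compose2) (auto intro!: continuous_intros)
 then have "continuous_on UNIV (\<lambda>x. F (x + k) + l)" by (intro continuous_intros)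
 then show ?thesis using assms by (simp add: is_lift_def torus_of_shift)
qed

lemma lift_continuous:
 assumes "is_lift f F"
 shows "continuous_on UNIV f"
proof -
 have "open (f -` U)" if "open U" for U
 proof -
  have "torus_of -` f -` U = F -` torus_of -` U" using assms by (auto simp: is_lift_def)
  moreover have "open \<dots>" by (rule open_vimage) (use that assms in \<open>auto simp: is_lift_def open_torus_def\<close>)
  ultimately show ?thesis by (simp add: open_torus_def)
 qed
 then show ?thesis by (simp add: continuous_on_open_vimage)
qed

text \<open>The definition provides one lift and one base point; any other choice differs by integer
  translations, which do not affect the derivative.\<close>

lemma has_torus_derivative_lift:
 assumes F: "is_lift f F" and D: "has_torus_derivative f D (torus_of x)"
 shows "(F has_derivative blinfun_apply D) (at x)"
proof -
 obtain F' x' where F': "is_lift f F'" "torus_of x' = torus_of x" "(F' has_derivative blinfun_apply D) (at x')"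
  using D by (auto simp: has_torus_derivative_def)
 define k where "k = x' - x"
 have k: "k \<in> int_vecs" using F'(2) by (simp add: k_def torus_of_eq)
 have sh: "is_lift f (\<lambda>y. F' (y + k))" using is_lift_add[OF F'(1) k int_vecs_zero] by simp
 define c where "c = F 0 - F' (0 + k)"
 have eq: "F = (\<lambda>y. F' (y + k) + c)" unfolding c_def by (rule ext) (rule lift_diff(2)[OF sh F])
 have 1: "((\<lambda>y. y + k) has_derivative (\<lambda>h. h)) (at x)" by (auto intro!: derivative_eq_intros)
 have "x' = x + k" by (simp add: k_def)
 then have "(F' has_derivative blinfun_apply D) (at (x + k))" using F'(3) by simp
 from has_derivative_compose[OF 1 this] show ?thesis unfolding eq by (rule has_derivative_add_const)
qed

lemma torus_deriv_eq:
 assumes "has_torus_derivative f D z"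
 shows "torus_deriv f z = D"
 unfolding torus_deriv_def
proof (rule the_equality[where P = "\<lambda>D. has_torus_derivative f D z", OF assms])
 fix D' assume D': "has_torus_derivative f D' z"
 obtain F x where F: "is_lift f F" "torus_of x = z" using assms by (auto simp: has_torus_derivative_def)
 have "blinfun_apply D' = blinfun_apply D"
  using has_torus_derivative_lift[OF F(1), of _ x] D' assms F(2) by (intro has_derivative_unique[of F _ x]) auto
 then show "D' = D" by (simp add: blinfun_apply_inject)
qed

lemma C1_map_deriv:
 assumes "C1_map f"
 shows "continuous_on UNIV (torus_deriv f)" "has_torus_derivative f (torus_deriv f z) z"
  "\<exists>F. is_lift f F"
proof -
 obtain D where D: "continuous_on UNIV D" "\<And>z. has_torus_derivative f (D z) z" using assms by (auto simp: C1_map_def)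
 have "torus_deriv f = D" using torus_deriv_eq[OF D(2)] by (rule ext)
 then show "continuous_on UNIV (torus_deriv f)" "has_torus_derivative f (torus_deriv f z) z" using D by simp_all
 show "\<exists>F. is_lift f F" using D(2)[of undefined] by (auto simp: has_torus_derivative_def)
qed

definition actL :: "int ^ 'n ^ 'n::finite \<Rightarrow> (real ^ 'n) \<Rightarrow>\<^sub>L (real ^ 'n)" where
 "actL A = Blinfun (int_act A)"

lemma actL: "blinfun_apply (actL A) = int_act A"
 unfolding actL_def by (rule bounded_linear_Blinfun_apply) (rule matrix_vector_mul_bounded_linear)

lemma toral_map_lift: "is_lift (toral_map A) (int_act A)"
 by (simp add: is_lift_def toral_map_of matrix_vector_mul_bounded_linear linear_continuous_on)

lemma toral_map_deriv: "has_torus_derivative (toral_map A) (actL A) z"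
proof -
 obtain x where "torus_of x = z" using torus_of_surj by metis
 then show ?thesis unfolding has_torus_derivative_def
  by (intro exI[of _ "int_act A"] exI[of _ x])
   (simp add: toral_map_lift actL bounded_linear_imp_has_derivative matrix_vector_mul_bounded_linear)
qed

lemma C1_map_toral: "C1_map (toral_map A)"
 unfolding C1_map_def by (intro exI[of _ "\<lambda>_. actL A"]) (simp add: toral_map_deriv)

lemma toral_map_inverse:
 assumes "A ** Ai = mat 1"
 shows "toral_map A (toral_map Ai z) = z"
proof -
 obtain x where x: "z = torus_of x" using torus_of_surj by metis
 have "int_act A (int_act Ai x) = x"
  by (simp only: matrix_vector_mul_assoc map_matrix_mult[symmetric] assms map_matrix_mat matrix_vector_mul_lid)
 then show ?thesis by (simp add: x toral_map_of)
qed

text \<open>Closeness is asked for with some \<open>e < e0\<close>, which leaves room for the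
  triangle inequality in the proof of openness.\<close>

lemma C1_neighbourhood:
 assumes inv: "A ** Ai = mat 1" "Ai ** A = mat 1" and mp: "measure_preserving torus_measure (toral_map A)" and e0: "0 < e0"
 defines "U \<equiv> {f \<in> C1_vol. \<exists>e<e0. C1_near e (toral_map A) f}"
 shows "openin C1_vol_topology U" "toral_map A \<in> U"
proof -
 have "inv (toral_map A) = toral_map Ai" using toral_map_inverse[OF inv(1)] toral_map_inverse[OF inv(2)] by (intro inv_equality)
 moreover have "bij (toral_map A)"
  using toral_map_inverse[OF inv(1)] toral_map_inverse[OF inv(2)] by (intro o_bij[of "toral_map Ai"]) (auto simp: fun_eq_iff)
 ultimately have "toral_map A \<in> C1_vol" using mp by (simp add: C1_vol_def C1_map_toral)
 then show "toral_map A \<in> U" unfolding U_def C1_near_def using e0 by (auto intro!: exI[of _ "e0 / 2"])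
 show "openin C1_vol_topology U" unfolding openin_C1_vol_topology
 proof (intro conjI ballI)
  fix f assume "f \<in> U"
  then obtain e where e: "e < e0" "C1_near e (toral_map A) f" by (auto simp: U_def)
  have "g \<in> U" if g: "g \<in> C1_vol" "C1_near ((e0 - e) / 2) f g" for g
  proof -
   have "C1_near (e + (e0 - e) / 2) (toral_map A) g" unfolding C1_near_def
   proof
    fix z
    let ?A = "toral_map A"
    have "dist (?A z) (g z) \<le> dist (?A z) (f z) + dist (f z) (g z)" by (rule dist_triangle)
    moreover have "norm (torus_deriv ?A z - torus_deriv g z) \<le> norm (torus_deriv ?A z - torus_deriv f z) + norm (torus_deriv f z - torus_deriv g z)"
     using norm_triangle_ineq[of "torus_deriv ?A z - torus_deriv f z" "torus_deriv f z - torus_deriv g z"] by simp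
    moreover have "dist (?A z) (f z) < e" "norm (torus_deriv ?A z - torus_deriv f z) < e"
     "dist (f z) (g z) < (e0 - e) / 2" "norm (torus_deriv f z - torus_deriv g z) < (e0 - e) / 2"
     using e(2) g(2) unfolding C1_near_def by blast+
    ultimately show "dist (?A z) (g z) < e + (e0 - e) / 2 \<and> norm (torus_deriv ?A z - torus_deriv g z) < e + (e0 - e) / 2"
     by linarith
   qed
   moreover have "e + (e0 - e) / 2 < e0" using e(1) by (simp add: field_simps)
   ultimately show ?thesis using g(1) unfolding U_def by blast
  qed
  then show "\<exists>e>0. \<forall>g\<in>C1_vol. C1_near e f g \<longrightarrow> g \<in> U" using e(1) by (intro exI[of _ "(e0 - e) / 2"]) auto
 qed (auto simp: U_def)
qed

text \<open>For any lift \<open>F0\<close>, the integer vector near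
  \<open>F0 x - int_act A x\<close> is unique and locally constant, as 1/4 keeps the distances in
  question below 1. Subtracting it gives a lift near \<open>A\<close>, and the same smallness makes
  its integer increments those of \<open>A\<close>.\<close>

lemma near_lift:
 fixes A :: "int ^ 'n ^ 'n::finite"
 assumes f: "C1_map f" and near: "\<And>z. dist (toral_map A z) (f z) < e0" and e0: "e0 \<le> 1 / 4"
 obtains F where "is_lift f F" "\<And>x. norm (F x - int_act A x) < e0" "\<And>x k. k \<in> int_vecs \<Longrightarrow> F (x + k) = F x + int_act A k"
proof -
 obtain F0 where F0: "is_lift f F0" using C1_map_deriv(3)[OF f] by blast
 define d where "d x = F0 x - int_act A x" for x
 have "\<exists>k. k \<in> int_vecs \<and> norm (d x - k) < e0" for x
 proof -
  have "dist (torus_of (int_act A x)) (f (torus_of x)) < e0" using near[of "torus_of x"] by (simp add: toral_map_of)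
  then obtain y where y: "torus_of y = f (torus_of x)" "dist (int_act A x) y < e0" by (rule dist_torus_of_less)
  have "F0 x - y \<in> int_vecs" using F0 y(1) by (simp add: is_lift_def flip: torus_of_eq)
  moreover have eq: "d x - (F0 x - y) = y - int_act A x" by (simp add: d_def)
  have "norm (d x - (F0 x - y)) < e0" unfolding eq using y(2) by (simp add: dist_norm norm_minus_commute)
  ultimately show ?thesis by blast
 qed
 then obtain k where k: "\<And>x. k x \<in> int_vecs" "\<And>x. norm (d x - k x) < e0" by metis
 have "continuous_on UNIV F0" using F0 by (simp add: is_lift_def)
 then have cd: "continuous_on UNIV d" unfolding d_def
  by (rule continuous_on_diff[OF _ linear_continuous_on[OF matrix_vector_mul_bounded_linear]])
 have close: "k x = k y" if "norm (d x - d y) < 1 / 2" for x y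
 proof -
  have "norm (k x - k y) \<le> norm (d x - k x) + norm (d x - d y) + norm (d y - k y)"
   using norm_triangle_ineq4[of "d x - d y" "d x - k x"] norm_triangle_ineq[of "d x - d y - (d x - k x)" "d y - k y"] by simp
  then have "norm (k x - k y) < 1" using that k(2)[of x] k(2)[of y] e0 by linarith
  then show ?thesis using int_vecs_norm[of "k x - k y"] int_vecs_add[OF k(1)[of x] int_vecs_minus[OF k(1)[of y]]] by simp
 qed
 have "continuous_on UNIV k" unfolding continuous_on_iff
 proof (intro ballI allI impI)
  fix x :: "real ^ 'n" and e :: real assume "0 < e"
  obtain r where "0 < r" "\<And>y. dist y x < r \<Longrightarrow> dist (d y) (d x) < 1 / 2"
   using cd[unfolded continuous_on_iff, rule_format, of x "1 / 2"] by auto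
  moreover have "dist (k y) (k x) < e" if "dist (d y) (d x) < 1 / 2" for y
   using close[OF that[unfolded dist_norm]] \<open>0 < e\<close> by simp
  ultimately show "\<exists>r>0. \<forall>y\<in>UNIV. dist y x < r \<longrightarrow> dist (k y) (k x) < e" by blast
 qed
 note kc = int_valued_constant[OF this k(1)]
 define F where "F = (\<lambda>x. F0 (x + 0) + - k 0)"
 have lF: "is_lift f F" unfolding F_def by (rule is_lift_add[OF F0 int_vecs_zero int_vecs_minus[OF k(1)]])
 have nF: "norm (F x - int_act A x) < e0" for x
  using k(2)[of x] kc[of x] by (simp add: F_def d_def algebra_simps)
 have "F (x + m) = F x + int_act A m" if m: "m \<in> int_vecs" for x m
 proof -
  have sh: "is_lift f (\<lambda>x. F (x + m))" using is_lift_add[OF lF m int_vecs_zero] by simp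
  define m' where "m' = F m - F 0"
  have m': "m' \<in> int_vecs" "F (x + m) = F x + m'" for x
   using lift_diff[OF lF sh] unfolding m'_def add_0_left by blast+
  have "norm (m' - int_act A m) \<le> norm (F m - int_act A m) + norm (F 0 - int_act A 0)"
   using norm_triangle_ineq4[of "F m - int_act A m" "F 0 - int_act A 0"] by (simp add: m'_def algebra_simps)
  then have "norm (m' - int_act A m) < 1" using nF[of m] nF[of 0] e0 by linarith
  then have "m' = int_act A m"
   using int_vecs_norm[of "m' - int_act A m"] int_vecs_add[OF m'(1) int_vecs_minus[OF int_vecs_act[OF m]]] by simp
  then show ?thesis using m'(2) by simp
 qed
 then show ?thesis by (rule that[OF lF nF])
qed

text \<open>A lift of the inverse is corrected by an integer vector to become a right inverse. As a
  left inverse it can then fail only by a constant integer vector, which \<open>A\<close> maps to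
  0.\<close>

lemma inverse_lift:
 fixes f :: "'n::finite torus \<Rightarrow> 'n torus"
 assumes f: "bij f" "C1_map (inv f)" and F: "is_lift f F" and per: "\<And>x k. k \<in> int_vecs \<Longrightarrow> F (x + k) = F x + int_act A k"
  and inv: "Ai ** A = mat 1"
 obtains Fi where "is_lift (inv f) Fi" "\<And>x. F (Fi x) = x" "\<And>x. Fi (F x) = x"
proof -
 obtain F1 where F1: "is_lift (inv f) F1" using C1_map_deriv(3)[OF f(2)] by blast
 have fi: "f (inv f z) = z" "inv f (f z) = z" for z using f(1) by (simp_all add: bij_is_surj surj_f_inv_f bij_is_inj inv_f_f)
 have idl: "is_lift (\<lambda>z. z) (\<lambda>x :: real ^ 'n. x)" by (simp add: is_lift_def continuous_on_id)
 have cF: "continuous_on UNIV F" using F by (simp add: is_lift_def)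
 have "is_lift (\<lambda>z. z) (\<lambda>x. F (F1 x))"
  using F F1 fi continuous_on_compose2[OF cF, of UNIV F1] by (simp add: is_lift_def)
 note kd = lift_diff[OF idl this]
 define k where "k = F (F1 0) - 0"
 have k: "k \<in> int_vecs" "F (F1 x) = x + k" for x unfolding k_def by (rule kd)+
 define Fi where "Fi = (\<lambda>x. F1 (x + - k) + 0)"
 have lFi: "is_lift (inv f) Fi" unfolding Fi_def by (rule is_lift_add[OF F1 int_vecs_minus[OF k(1)] int_vecs_zero])
 have FFi: "F (Fi x) = x" for x using k(2)[of "x - k"] by (simp add: Fi_def)
 have cFi: "continuous_on UNIV Fi" using lFi by (simp add: is_lift_def)
 have "is_lift (\<lambda>z. z) (\<lambda>x. Fi (F x))"
  using F lFi fi continuous_on_compose2[OF cFi cF] by (simp add: is_lift_def)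
 note md = lift_diff[OF idl this]
 define m where "m = Fi (F 0) - 0"
 have m: "m \<in> int_vecs" "Fi (F x) = x + m" for x unfolding m_def by (rule md)+
 have "F x = F x + int_act A m" for x using FFi[of "F x"] m(2)[of x] per[OF m(1)] by simp
 then have "int_act A m = 0" by simp
 moreover have "int_act Ai (int_act A m) = m"
  by (simp only: matrix_vector_mul_assoc map_matrix_mult[symmetric] inv map_matrix_mat matrix_vector_mul_lid)
 ultimately have "m = 0" by simp
 then show ?thesis using that[OF lFi FFi] m(2) by simp
qed

text \<open>Passing from Euclidean norms to \<open>nmax\<close> costs the factor \<open>K\<close>
  for vectors and \<open>3 * K * K\<close> for operators.\<close>

lemma (in adapted) pert_intro:
 assumes deriv: "\<And>x. (F has_derivative blinfun_apply (DF x)) (at x)" and cont: "continuous_on UNIV DF"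
  and d0: "\<And>x. norm (F x - A x) \<le> d" and d1: "\<And>x v. norm (DF x v - A v) \<le> d * norm v"
  and de: "d * (K + 3 * K * K) \<le> e" and d: "0 \<le> d"
  and kap: "0 < kap" "kap \<le> 1/2" and gap: "lam + e < 1 - e / kap" "1 + e < 1 / lam - e / kap"
 shows "pert A Ai Ps Pc Pu ns nc nu lam K F DF e kap"
proof -
 have dK: "d * K \<le> e" "d * (3 * K * K) \<le> e"
 proof -
  have "0 \<le> d * K" "0 \<le> d * (3 * K * K)" using d K0 by simp_all
  moreover have "d * K + d * (3 * K * K) \<le> e" using de by (simp only: distrib_left)
  ultimately show "d * K \<le> e" "d * (3 * K * K) \<le> e" by linarith+
 qed
 have conv: "nmax w \<le> e * nmax v" if "norm w \<le> d * norm v" for v w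
 proof -
  have "nmax w \<le> K * norm w" by (rule nmax_le_norm)
  also have "\<dots> \<le> K * (d * (3 * K * nmax v))"
   using that norm_le_nmax[of v] d K0 by (intro mult_left_mono order_trans[OF that] mult_left_mono) auto
  also have "\<dots> = (d * (3 * K * K)) * nmax v" by simp
  also have "\<dots> \<le> e * nmax v" by (rule mult_right_mono[OF dK(2) n_nonneg(4)])
  finally show ?thesis .
 qed
 have lip: "norm (F y - F z - A (y - z)) \<le> d * norm (y - z)" for y z
 proof -
  have bA: "bounded_linear A" using linA by (simp add: linear_conv_bounded_linear)
  have "norm ((\<lambda>x. F x - A x) y - (\<lambda>x. F x - A x) z) \<le> d * norm (y - z)"
  proof (rule differentiable_bound[of UNIV _ "\<lambda>x v. DF x v - A v"])
   show "((\<lambda>x. F x - A x) has_derivative (\<lambda>v. DF x v - A v)) (at x within UNIV)" for x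
    by (intro has_derivative_diff deriv bounded_linear_imp_has_derivative bA)
   show "onorm (\<lambda>v. DF x v - A v) \<le> d" for x by (rule onorm_bound[OF d d1])
  qed auto
  then show ?thesis by (simp add: linear_diff[OF linA] algebra_simps)
 qed
 show ?thesis
 proof (intro pert.intro pert_axioms.intro)
  show "adapted A Ai Ps Pc Pu ns nc nu lam K" by (rule adapted_axioms)
  show "nmax (F y - F z - A (y - z)) \<le> e * nmax (y - z)" for y z by (rule conv[OF lip])
  show "nmax (DF x v - A v) \<le> e * nmax v" for x v by (rule conv[OF d1])
  show "nmax (F x - A x) \<le> e" for x
  proof -
   have "K * norm (F x - A x) \<le> K * d" using d0[of x] K0 by (intro mult_left_mono) auto
   then show ?thesis using nmax_le_norm[of "F x - A x"] dK(1) by (simp add: mult.commute)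
  qed
  show "0 \<le> e" using order_trans[OF mult_nonneg_nonneg[OF d less_imp_le[OF K0]] dK(1)] .
 qed (fact deriv cont kap gap)+
qed

lemma eventually_less_at_right:
 fixes f g :: "real \<Rightarrow> real"
 assumes "isCont f 0" "isCont g 0" "f 0 < g 0"
 shows "\<forall>\<^sub>F t in at_right 0. f t < g t"
proof -
 have "(\<lambda>t. g t - f t) \<midarrow>0\<rightarrow> g 0 - f 0" using assms(1,2) by (intro tendsto_diff isContD)
 then have "((\<lambda>t. g t - f t) \<longlongrightarrow> g 0 - f 0) (at_right 0)" by (simp add: filterlim_at_split)
 from order_tendstoD(1)[OF this, of 0] assms(3) have "\<forall>\<^sub>F t in at_right 0. 0 < g t - f t" by simp
 then show ?thesis by eventually_elim simp
qed

text \<open>With \<open>kap = t\<close> and \<open>e = t * t\<close> the quotient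
  \<open>e / kap\<close> is \<open>t\<close>, so that all inequalities are continuous in
  \<open>t\<close> and strict at 0. Before that, \<open>rho = 1 + t0\<close> is fixed by means of a
  rate between \<open>lam\<close> and 1.\<close>

lemma parameters:
 fixes lam :: real and M :: nat
 assumes lam: "0 < lam" "lam < 1"
 obtains kap e rho :: real where "0 < kap" "kap \<le> 1/2" "0 < e" "lam + e < 1 - e / kap" "1 + e < 1 / lam - e / kap"
  "1 < rho" "(lam + e) * rho ^ M \<le> 1" "((1 + e) / (1 - e / kap))\<^sup>2 < rho" "(1 + 2 * kap) * (lam + e) < 1"
  "(1 + 2 * kap)\<^sup>2 * (lam + e) < 1 - e" "(1 + 2 * kap)\<^sup>2 * (1 + e) < 1 / lam - e"
proof -
 define l where "l = (1 + lam) / 2"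
 have l: "lam < l" "l < 1" using lam by (auto simp: l_def)
 have "\<forall>\<^sub>F t in at_right 0. l * (1 + t) ^ M < 1"
  by (rule eventually_less_at_right) (use l in \<open>auto intro!: continuous_intros\<close>)
 moreover have "\<forall>\<^sub>F t :: real in at_right 0. 0 < t" by (simp add: eventually_at_right_less)
 ultimately have "\<forall>\<^sub>F t in at_right 0. 0 < t \<and> l * (1 + t) ^ M < 1" by eventually_elim simp
 then obtain t0 where t0: "0 < t0" "l * (1 + t0) ^ M < 1" using eventually_happens'[OF trivial_limit_at_right_real] by blast
 have il: "1 < 1 / lam" using lam by simp
 have "\<forall>\<^sub>F t in at_right 0. lam + t * t < 1 - t" "\<forall>\<^sub>F t in at_right 0. 1 + t * t < 1 / lam - t"
  "\<forall>\<^sub>F t in at_right 0. lam + t * t < l" "\<forall>\<^sub>F t in at_right 0. ((1 + t * t) / (1 - t))\<^sup>2 < 1 + t0"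
  "\<forall>\<^sub>F t in at_right 0. (1 + 2 * t) * (lam + t * t) < 1" "\<forall>\<^sub>F t in at_right 0. (1 + 2 * t)\<^sup>2 * (lam + t * t) < 1 - t * t"
  "\<forall>\<^sub>F t in at_right 0. (1 + 2 * t)\<^sup>2 * (1 + t * t) < 1 / lam - t * t" "\<forall>\<^sub>F t :: real in at_right 0. t < 1 / 2"
  by (rule eventually_less_at_right; use lam il l t0 in \<open>auto intro!: continuous_intros\<close>)+
 moreover have "\<forall>\<^sub>F t :: real in at_right 0. 0 < t" by (simp add: eventually_at_right_less)
 ultimately have "\<forall>\<^sub>F t in at_right 0. 0 < t \<and> t < 1 / 2 \<and> lam + t * t < 1 - t \<and> 1 + t * t < 1 / lam - t \<and> lam + t * t < l \<and>
  ((1 + t * t) / (1 - t))\<^sup>2 < 1 + t0 \<and> (1 + 2 * t) * (lam + t * t) < 1 \<and> (1 + 2 * t)\<^sup>2 * (lam + t * t) < 1 - t * t \<and>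
  (1 + 2 * t)\<^sup>2 * (1 + t * t) < 1 / lam - t * t" by eventually_elim simp
 then obtain t where t: "0 < t" "t < 1 / 2" "lam + t * t < 1 - t" "1 + t * t < 1 / lam - t" "lam + t * t < l"
  "((1 + t * t) / (1 - t))\<^sup>2 < 1 + t0" "(1 + 2 * t) * (lam + t * t) < 1" "(1 + 2 * t)\<^sup>2 * (lam + t * t) < 1 - t * t"
  "(1 + 2 * t)\<^sup>2 * (1 + t * t) < 1 / lam - t * t" using eventually_happens'[OF trivial_limit_at_right_real] by blast
 have tt: "t * t / t = t" using t(1) by simp
 have "(lam + t * t) * (1 + t0) ^ M \<le> l * (1 + t0) ^ M" using t(5) t0(1) by (intro mult_right_mono) auto
 then have "(lam + t * t) * (1 + t0) ^ M \<le> 1" using t0(2) by linarith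
 then show ?thesis using t t0 by (intro that[of t "t * t" "1 + t0"]; simp only: tt; simp)
qed

section \<open>Reversal of time and partial hyperbolicity of the perturbation\<close>

lemma rate_bounds_inverse:
 assumes f: "bij f" "continuous_on UNIV (inv f)" and d: "\<And>z v. torus_deriv (inv f) (f z) (torus_deriv f z v) = v"
  and inv: "invariant_bundle f E" and rb: "rate_bounds M f E mu \<nu>"
 shows "invariant_bundle (inv f) E" "rate_bounds M (inv f) E (\<lambda>z. 1 / \<nu> (inv f z)) (\<lambda>z. 1 / mu (inv f z))"
proof -
 have fi: "f (inv f z) = z" for z using f(1) by (simp add: bij_is_surj surj_f_inv_f)
 have im: "E z = torus_deriv f (inv f z) ` E (inv f z)" for z using inv fi[of z] unfolding invariant_bundle_def by metis
 have di: "torus_deriv (inv f) z (torus_deriv f (inv f z) v) = v" for z v using d[of "inv f z" v] by (simp add: fi)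
 show "invariant_bundle (inv f) E" unfolding invariant_bundle_def
 proof (intro allI conjI)
  show "subspace (E z)" for z using inv by (simp add: invariant_bundle_def)
  show "torus_deriv (inv f) z ` E z = E (inv f z)" for z by (subst im) (simp add: image_image di)
 qed
 have c: "continuous_on UNIV mu" "continuous_on UNIV \<nu>" and pos: "\<And>z. 0 < mu z" "\<And>z. 0 < \<nu> z"
  and r: "\<And>z v. v \<in> E z \<Longrightarrow> v \<noteq> 0 \<Longrightarrow> mu z < riemannian_norm M (f z) (torus_deriv f z v) / riemannian_norm M z v \<and>
   riemannian_norm M (f z) (torus_deriv f z v) / riemannian_norm M z v < \<nu> z"
  using rb unfolding rate_bounds_def by blast+
 have ci: "continuous_on UNIV (\<lambda>z. g (inv f z))" if "continuous_on UNIV g" for g :: "'a torus \<Rightarrow> real"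
  using continuous_on_compose2[OF that f(2)] by simp
 have ne: "mu z \<noteq> 0" "\<nu> z \<noteq> 0" for z using pos[of z] by auto
 show "rate_bounds M (inv f) E (\<lambda>z. 1 / \<nu> (inv f z)) (\<lambda>z. 1 / mu (inv f z))"
  unfolding rate_bounds_def
 proof (intro conjI allI ballI impI)
  show "continuous_on UNIV (\<lambda>z. 1 / \<nu> (inv f z))" "continuous_on UNIV (\<lambda>z. 1 / mu (inv f z))"
   using ne by (intro continuous_intros ci c; simp)+
  fix z v assume v: "v \<in> E z" "v \<noteq> 0"
  then obtain w where w: "w \<in> E (inv f z)" "v = torus_deriv f (inv f z) w" using im[of z] by blast
  have "w \<noteq> 0" using v(2) w(2) by (auto simp: blinfun.zero_right)
  from r[OF w(1) this] have a: "mu (inv f z) < riemannian_norm M z v / riemannian_norm M (inv f z) w"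
   "riemannian_norm M z v / riemannian_norm M (inv f z) w < \<nu> (inv f z)" by (simp_all add: fi w(2))
  have eq: "riemannian_norm M (inv f z) (torus_deriv (inv f) z v) / riemannian_norm M z v
   = 1 / (riemannian_norm M z v / riemannian_norm M (inv f z) w)" by (simp add: w(2) di)
  show "1 / \<nu> (inv f z) < riemannian_norm M (inv f z) (torus_deriv (inv f) z v) / riemannian_norm M z v"
   unfolding eq using a pos(1)[of "inv f z"] by (intro divide_strict_left_mono mult_pos_pos) auto
  show "riemannian_norm M (inv f z) (torus_deriv (inv f) z v) / riemannian_norm M z v < 1 / mu (inv f z)"
   unfolding eq using a pos(1)[of "inv f z"] by (intro divide_strict_left_mono mult_pos_pos) auto
 qed (use pos in auto)
qed

text \<open>Lets \<open>stable_bundle_unique\<close>, applied to the inverse map, identify the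
  unstable bundle.\<close>

lemma partially_hyperbolic_inverse:
 assumes f: "bij f" "continuous_on UNIV (inv f)" and d: "\<And>z v. torus_deriv (inv f) (f z) (torus_deriv f z v) = v"
  and ph: "partially_hyperbolic_splitting f E1 E2 E3"
 shows "partially_hyperbolic_splitting (inv f) E3 E2 E1"
proof -
 obtain M mus \<nu>s muc \<nu>c muu \<nu>u where M: "riemannian_metric M"
  and rb: "rate_bounds M f E1 mus \<nu>s" "rate_bounds M f E2 muc \<nu>c" "rate_bounds M f E3 muu \<nu>u"
  and gaps: "\<And>z. \<nu>s z < min 1 (muc z)" "\<And>z. max 1 (\<nu>c z) < muu z"
  using ph unfolding partially_hyperbolic_splitting_def by blast
 have inv: "invariant_bundle f E1" "invariant_bundle f E2" "invariant_bundle f E3"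
  using ph unfolding partially_hyperbolic_splitting_def by blast+
 have spl: "{a + b + c | a b c. a \<in> E1 z \<and> b \<in> E2 z \<and> c \<in> E3 z} = UNIV"
  "\<forall>a\<in>E1 z. \<forall>b\<in>E2 z. \<forall>c\<in>E3 z. a + b + c = 0 \<longrightarrow> a = 0 \<and> b = 0 \<and> c = 0" "E1 z \<noteq> {0}" "E3 z \<noteq> {0}" for z
  using ph unfolding partially_hyperbolic_splitting_def by blast+
 have pos: "0 < \<nu>s z" "0 < muc z" "0 < \<nu>c z" "0 < muu z" for z using rb by (auto simp: rate_bounds_def)
 have sum': "{c + b + a | c b a. c \<in> E3 z \<and> b \<in> E2 z \<and> a \<in> E1 z} = UNIV" for z
 proof -
  have "\<exists>c b a. v = c + b + a \<and> c \<in> E3 z \<and> b \<in> E2 z \<and> a \<in> E1 z" for v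
  proof -
   have "v \<in> {a + b + c | a b c. a \<in> E1 z \<and> b \<in> E2 z \<and> c \<in> E3 z}" unfolding spl by simp
   then obtain a b c where abc: "v = a + b + c" "a \<in> E1 z" "b \<in> E2 z" "c \<in> E3 z" by blast
   then have "v = c + b + a" by (simp add: add_ac)
   then show ?thesis using abc(2-4) by blast
  qed
  then show ?thesis by blast
 qed
 have dir': "c = 0 \<and> b = 0 \<and> a = 0" if "c \<in> E3 z" "b \<in> E2 z" "a \<in> E1 z" "c + b + a = 0" for a b c z
  using spl(2)[of z, rule_format, of a b c] that by (simp add: add_ac)
 have gaps': "1 / muu z < min 1 (1 / \<nu>c z)" "max 1 (1 / muc z) < 1 / \<nu>s z" for z
  using gaps[of z] pos[of z] by (auto simp: field_simps)
 show ?thesis unfolding partially_hyperbolic_splitting_def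
 proof (intro conjI allI ballI impI rate_bounds_inverse(1)[OF f d _ rb(1)] rate_bounds_inverse(1)[OF f d _ rb(2)] rate_bounds_inverse(1)[OF f d _ rb(3)] inv)
  show "\<exists>G mus \<nu>s muc \<nu>c muu \<nu>u. riemannian_metric G \<and> rate_bounds G (inv f) E3 mus \<nu>s \<and> rate_bounds G (inv f) E2 muc \<nu>c \<and>
   rate_bounds G (inv f) E1 muu \<nu>u \<and> (\<forall>p. \<nu>s p < min 1 (muc p) \<and> max 1 (\<nu>c p) < muu p)"
   using M rate_bounds_inverse(2)[OF f d inv(3) rb(3)] rate_bounds_inverse(2)[OF f d inv(2) rb(2)]
    rate_bounds_inverse(2)[OF f d inv(1) rb(1)] gaps' by blast
 qed (use sum' dir' spl(3,4) in auto)
qed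

text \<open>In \<open>rates\<close>, a factor \<open>1 + 2 * kap\<close> is the cost of comparing
  the norm of a vector in a cone with its leading component.\<close>

locale torus_pert =
 pert_lattice "int_act A" "int_act Ai" Ps Pc Pu ns nc nu lam K F DF Fi DFi e kap ell zeta int_vecs u0 cL rho QL N2
 for A Ai :: "int ^ 'n ^ 'n::finite" and Ps Pc Pu ns nc nu lam K F DF Fi DFi e kap ell zeta u0 cL rho QL N2 +
 fixes f :: "'n torus \<Rightarrow> 'n torus" and Gm :: "real ^ 'n ^ 'n"
 assumes lift: "is_lift f F" "is_lift (inv f) Fi" and f: "bij f" "C1_map f" "C1_map (inv f)"
  and DF: "\<And>x. DF x = torus_deriv f (torus_of x)" and DFi: "\<And>x. DFi x = torus_deriv (inv f) (torus_of x)"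
  and Gm: "transpose Gm = Gm" "\<And>v. v \<bullet> (Gm *v v) = (ns v)\<^sup>2 + (nc v)\<^sup>2 + (nu v)\<^sup>2"
  and spaces: "{v. nc v = 0 \<and> nu v = 0} = stable_space A" "{v. ns v = 0 \<and> nu v = 0} = center_space A"
   "{v. nc v = 0 \<and> ns v = 0} = unstable_space A"
  and nontriv: "stable_space A \<noteq> {0}" "unstable_space A \<noteq> {0}"
  and rates: "(1 + 2 * kap) * (lam + e) < 1" "(1 + 2 * kap)\<^sup>2 * (lam + e) < 1 - e" "(1 + 2 * kap)\<^sup>2 * (1 + e) < 1 / lam - e"
begin

lemma leaf_axioms: "torus_leaves_axioms (int_act A) F DF f" "torus_leaves_axioms (int_act Ai) Fi DFi (inv f)"
proof -
 have "f (torus_of x) = torus_of (F x)" "inv f (torus_of x) = torus_of (Fi x)" for x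
  using lift by (simp_all add: is_lift_def)
 moreover have "\<exists>k'\<in>int_vecs. int_act A k' = k" "\<exists>k'\<in>int_vecs. int_act Ai k' = k" if "k \<in> int_vecs" for k
  using L_A[OF that] L_Ai[OF that] fw.A_Ai[of k] fw.Ai_A[of k] by blast+
 ultimately show "torus_leaves_axioms (int_act A) F DF f" "torus_leaves_axioms (int_act Ai) Fi DFi (inv f)"
  using F_per Fi_per L_A L_Ai by (auto intro!: torus_leaves_axioms.intro simp: DF DFi)
qed

sublocale ts: torus_leaves "int_act A" Ps ns "\<lambda>v. max (nc v) (nu v)" lam 1 kap e "2 * K" F DF f
 by (rule torus_leaves.intro[OF fw.s.cone_diff_axioms leaf_axioms(1)])

sublocale tu: torus_leaves "int_act Ai" Pu nu "\<lambda>v. max (nc v) (ns v)" lam 1 kap e "2 * K" Fi DFi "inv f"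
 by (rule torus_leaves.intro[OF bw.s.cone_diff_axioms leaf_axioms(2)])

definition Ez :: "'n torus \<Rightarrow> (real ^ 'n) set" where "Ez z = Ec (rep_torus z)"

lemma Ez_of: "Ez (torus_of x) = Ec x"
proof -
 have "fw.cs.tangent (rep_torus (torus_of x)) = fw.cs.tangent x" "bw.cs.tangent (rep_torus (torus_of x)) = bw.cs.tangent x"
  by (rule torus_leaves.tangent_torus[OF torus_leaves.intro[OF fw.cs.cone_diff_axioms leaf_axioms(1)] torus_of_rep]
   torus_leaves.tangent_torus[OF torus_leaves.intro[OF bw.cs.cone_diff_axioms leaf_axioms(2)] torus_of_rep])+
 then show ?thesis by (simp only: Ez_def Ec_def)
qed

lemma invariant_bundleI:
 fixes E :: "'n torus \<Rightarrow> (real ^ 'n) set"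
 assumes E: "\<And>x. E (torus_of x) = E' x" and sub: "\<And>x. subspace (E' x)" and iff: "\<And>x v. DF x v \<in> E' (F x) \<longleftrightarrow> v \<in> E' x"
 shows "invariant_bundle f E"
 unfolding invariant_bundle_def
proof (intro allI conjI)
 fix z :: "'n torus"
 obtain x where x: "z = torus_of x" using torus_of_surj by metis
 show "subspace (E z)" unfolding x E by (rule sub)
 show "torus_deriv f z ` E z = E (f z)" unfolding x ts.f_of E DF[symmetric] by (rule DF_image[OF iff])
qed

text \<open>The metric is constant, so the base point \<open>undefined\<close> is
  immaterial.\<close>

abbreviation N where "N \<equiv> riemannian_norm (\<lambda>_ :: 'n torus. Gm) undefined"

lemma N_eq: "N v = sqrt ((ns v)\<^sup>2 + (nc v)\<^sup>2 + (nu v)\<^sup>2)"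
 by (simp add: riemannian_norm_def Gm)

lemma riemannian_metric_Gm: "riemannian_metric (\<lambda>_ :: 'n torus. Gm)"
 unfolding riemannian_metric_def
proof (intro conjI allI impI)
 fix v :: "real ^ 'n" assume "v \<noteq> 0"
 then have "ns v \<noteq> 0 \<or> nc v \<noteq> 0 \<or> nu v \<noteq> 0" using fw.nzero_imp_zero by blast
 then have "0 < (ns v)\<^sup>2 + (nc v)\<^sup>2 \<or> 0 < (nu v)\<^sup>2" by (auto simp: sum_power2_gt_zero_iff)
 then show "0 < v \<bullet> (Gm *v v)" unfolding Gm using zero_le_power2[of "ns v"] zero_le_power2[of "nc v"] zero_le_power2[of "nu v"] by linarith
qed (auto simp: Gm)

lemma N_bounds: "ns v \<le> N v" "nc v \<le> N v" "nu v \<le> N v" "N v \<le> ns v + nc v + nu v"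
proof -
 have "N v \<le> sqrt ((ns v + nc v + nu v)\<^sup>2)" unfolding N_eq
  using fw.n_nonneg[of v] by (intro real_sqrt_le_mono) (simp add: power2_eq_square algebra_simps)
 then show "N v \<le> ns v + nc v + nu v" using fw.n_nonneg[of v] by simp
 show "ns v \<le> N v" "nc v \<le> N v" "nu v \<le> N v" unfolding N_eq by (rule real_le_rsqrt, simp)+
qed

lemma N_pos: "v \<noteq> 0 \<Longrightarrow> 0 < N v"
 using riemannian_metric_Gm by (simp add: riemannian_metric_def riemannian_norm_def)

lemma rate_boundsI:
 fixes E :: "'n torus \<Rightarrow> (real ^ 'n) set"
 assumes E: "\<And>x. E (torus_of x) = E' x" and "0 < l" "l < l'" "h' < h" "0 < h'"
  and b: "\<And>x v. v \<in> E' x \<Longrightarrow> l' * N v \<le> N (DF x v) \<and> N (DF x v) \<le> h' * N v"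
 shows "rate_bounds (\<lambda>_. Gm) f E (\<lambda>_. l) (\<lambda>_. h)"
 unfolding rate_bounds_def
proof (intro conjI allI ballI impI)
 fix z v assume v: "v \<in> E z" "v \<noteq> 0"
 obtain x where x: "z = torus_of x" using torus_of_surj by metis
 have Nv: "0 < N v" using v(2) by (rule N_pos)
 have eq: "riemannian_norm (\<lambda>_. Gm) z' w = N w" for z' :: "'n torus" and w by (simp add: riemannian_norm_def)
 have D: "torus_deriv f z v = DF x v" by (simp only: x DF)
 have "v \<in> E' x" using v(1) by (simp only: x E)
 from b[OF this] have "l * N v < N (DF x v)" "N (DF x v) < h * N v"
  using mult_strict_right_mono[OF assms(3) Nv] mult_strict_right_mono[OF assms(4) Nv] by linarith+
 then show "l < riemannian_norm (\<lambda>_. Gm) (f z) (torus_deriv f z v) / riemannian_norm (\<lambda>_. Gm) z v"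
  "riemannian_norm (\<lambda>_. Gm) (f z) (torus_deriv f z v) / riemannian_norm (\<lambda>_. Gm) z v < h"
  unfolding eq[of "f z"] eq[of z] D using Nv by (simp_all add: pos_less_divide_eq pos_divide_less_eq)
qed (use assms in auto)

lemma N_cone:
 assumes "a \<le> kap * b" "c \<le> kap * b" "N v \<le> b + a + c"
 shows "N v \<le> (1 + 2 * kap) * b"
 using assms by (simp add: algebra_simps)

text \<open>Partial hyperbolicity also demands a lower rate on the stable and an upper rate on the
  unstable bundle; crude ones come from compactness.\<close>

lemma DF_N_bound: "\<exists>B\<ge>1. \<forall>x v. N (DF x v) \<le> B * N v \<and> N v \<le> B * N (DF x v)"
proof -
 obtain b d where bd: "0 < b" "0 < d" "\<And>z v. b * norm v \<le> riemannian_norm (\<lambda>_ :: 'n torus. Gm) z v"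
   "\<And>z v. riemannian_norm (\<lambda>_ :: 'n torus. Gm) z v \<le> d * norm v"
  using riemannian_norm_equiv[OF riemannian_metric_Gm] by metis
 have bound: "\<exists>B. \<forall>z v. norm (torus_deriv g z v) \<le> B * norm v" if "C1_map g" for g :: "'n torus \<Rightarrow> 'n torus"
 proof -
  have "bounded (range (torus_deriv g))"
   using C1_map_deriv(1)[OF that] compact_torus by (intro compact_imp_bounded compact_continuous_image)
  then obtain B where "\<And>z. norm (torus_deriv g z) \<le> B" unfolding bounded_iff by blast
  then have "norm (torus_deriv g z v) \<le> B * norm v" for z v
   using norm_blinfun[of "torus_deriv g z" v] mult_right_mono[of "norm (torus_deriv g z)" B "norm v"] by force
  then show ?thesis by blast
 qed
 obtain B1 where B1: "\<And>z v. norm (torus_deriv f z v) \<le> B1 * norm v" using bound[OF f(2)] by blast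
 obtain B2 where B2: "\<And>z v. norm (torus_deriv (inv f) z v) \<le> B2 * norm v" using bound[OF f(3)] by blast
 define B where "B = 1 + d * (\<bar>B1\<bar> + \<bar>B2\<bar>) / b"
 have conv: "N w \<le> B * N v" if "norm w \<le> C * norm v" "C \<le> \<bar>B1\<bar> + \<bar>B2\<bar>" for v w C
 proof -
  have "N w \<le> d * norm w" by (rule bd(4))
  also have "\<dots> \<le> d * ((\<bar>B1\<bar> + \<bar>B2\<bar>) * norm v)"
   using that(1) mult_right_mono[OF that(2), of "norm v"] bd(2) by (intro mult_left_mono) auto
  also have "\<dots> = d * (\<bar>B1\<bar> + \<bar>B2\<bar>) / b * (b * norm v)" using bd(1) by simp
  also have "\<dots> \<le> B * N v" using bd(3)[of v undefined] bd(1,2) unfolding B_def by (intro mult_mono) auto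
  finally show ?thesis .
 qed
 have "norm (DF x v) \<le> B1 * norm v" for x v unfolding DF by (rule B1)
 moreover have "norm v \<le> B2 * norm (DF x v)" for x v
  using B2[of "torus_of (F x)" "DF x v"] by (simp add: DFi[symmetric] DFi_DF)
 ultimately have "N (DF x v) \<le> B * N v \<and> N v \<le> B * N (DF x v)" for x v
  by (intro conjI conv[where C = B1] conv[where C = B2]) auto
 moreover have "1 \<le> B" unfolding B_def using bd by simp
 ultimately show ?thesis by blast
qed

lemma splitting: "partially_hyperbolic_splitting f ts.Et Ez tu.Et"
proof -
 \<comment> \<open>The upper stable, lower centre, upper centre and lower unstable rate for
   \<open>N\<close>; \<open>h\<close> and \<open>g\<close> below are inserted between them to make
   the bounds strict.\<close>
 define s1 c1 c2 u1 where "s1 = (1 + 2 * kap) * (lam + e)" and "c1 = (1 - e) / (1 + 2 * kap)"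
  and "c2 = (1 + 2 * kap) * (1 + e)" and "u1 = (1 / lam - e) / (1 + 2 * kap)"
 have k: "0 < 1 + 2 * kap" "1 \<le> 1 + 2 * kap" using fw.kap by auto
 have le: "0 < lam + e" using fw.lam fw.e0 by simp
 have s1: "0 < s1" "s1 < 1" "s1 < c1" and u1: "1 \<le> c2" "c2 < u1"
 proof -
  show "0 < s1" using k le by (simp add: s1_def)
  show "s1 < 1" using rates(1) by (simp add: s1_def)
  show "s1 < c1" using rates(2) k by (simp add: s1_def c1_def pos_less_divide_eq power2_eq_square mult_ac)
  show "c2 < u1" using rates(3) k by (simp add: c2_def u1_def pos_less_divide_eq power2_eq_square mult_ac)
  have "1 * 1 \<le> (1 + 2 * kap) * (1 + e)" using k fw.e0 by (intro mult_mono) auto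
  then show "1 \<le> c2" by (simp add: c2_def)
 qed
 obtain B where B: "1 \<le> B" "\<And>x v. N (DF x v) \<le> B * N v" "\<And>x v. N v \<le> B * N (DF x v)" using DF_N_bound by blast
 have dev: "fw.nmax (DF x v - int_act A v) \<le> e * fw.nmax v" for x v by (rule fw.DF_close)
 have nAv: "t (DF x v) \<le> t (int_act A v) + e * fw.nmax v \<and> t (int_act A v) \<le> t (DF x v) + e * fw.nmax v"
  if t: "seminorm t" "\<And>v. t v \<le> fw.nmax v" for t x v
  using seminorm_abs_diff[OF t(1), of "DF x v" "int_act A v"] t(2)[of "DF x v - int_act A v"] dev[of x v] by linarith
 have Es: "N (DF x v) \<le> s1 * N v" if v: "v \<in> Es x" for x v
 proof -
  have w: "DF x v \<in> Es (F x)" by (rule fw.s.tangent_forward[OF v])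
  have c: "nc (DF x v) \<le> kap * ns (DF x v)" "nu (DF x v) \<le> kap * ns (DF x v)" using fw.s.tangent_cone[OF w] by auto
  have "ns (DF x v) \<le> (lam + e) * ns v" using fw.s.tangent_contract[OF v, of 1] by simp
  also have "\<dots> \<le> (lam + e) * N v" using le N_bounds(1)[of v] by (intro mult_left_mono) auto
  finally have "(1 + 2 * kap) * ns (DF x v) \<le> (1 + 2 * kap) * ((lam + e) * N v)" using k by (intro mult_left_mono) auto
  moreover have "N (DF x v) \<le> (1 + 2 * kap) * ns (DF x v)" using N_bounds(4)[of "DF x v"] by (intro N_cone[OF c]) simp
  ultimately show ?thesis by (simp add: s1_def mult_ac)
 qed
 have Ec: "c1 * N v \<le> N (DF x v) \<and> N (DF x v) \<le> c2 * N v" if v: "v \<in> Ec x" for x v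
 proof -
  have w: "DF x v \<in> Ec (F x)" using v Ec_iff by blast
  have "kap * nc v \<le> 1 * nc v" using fw.kap fw.n_nonneg(2)[of v] by (intro mult_right_mono) auto
  then have nm: "fw.nmax v = nc v" using Ec_cone[OF v] fw.n_nonneg[of v] by (simp add: fw.nmax_def)
  have a: "nc (DF x v) \<le> (1 + e) * nc v" "(1 - e) * nc v \<le> nc (DF x v)"
   using nAv[OF fw.snc fw.n_le_nmax(2), of x v] by (simp_all add: nm fw.ncA algebra_simps)
  have "N v \<le> (1 + 2 * kap) * nc v" using N_bounds(4)[of v] by (intro N_cone[OF Ec_cone[OF v]]) simp
  then have "(1 - e) * N v \<le> (1 - e) * ((1 + 2 * kap) * nc v)"
   using rates(2) mult_pos_pos[OF zero_less_power[OF k(1), of 2] le] by (intro mult_left_mono) auto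
  also have "\<dots> \<le> (1 + 2 * kap) * N (DF x v)"
   using mult_left_mono[OF order_trans[OF a(2) N_bounds(2)], of "1 + 2 * kap"] k by (simp add: mult_ac)
  finally have lo: "c1 * N v \<le> N (DF x v)" using k by (simp add: c1_def pos_divide_le_eq mult_ac)
  have "N (DF x v) \<le> (1 + 2 * kap) * nc (DF x v)" using N_bounds(4)[of "DF x v"] by (intro N_cone[OF Ec_cone[OF w]]) simp
  also have "\<dots> \<le> (1 + 2 * kap) * ((1 + e) * N v)"
   using order_trans[OF a(1) mult_left_mono[OF N_bounds(2)[of v]]] k fw.e0 by (intro mult_left_mono) auto
  finally show ?thesis using lo by (simp add: c2_def mult_ac)
 qed
 have Eu: "u1 * N v \<le> N (DF x v)" if v: "v \<in> Eu x" for x v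
 proof -
  have c: "nc v \<le> kap * nu v" "ns v \<le> kap * nu v" using bw.s.tangent_cone[OF v] by auto
  have "kap * nu v \<le> 1 * nu v" using fw.kap fw.n_nonneg(3)[of v] by (intro mult_right_mono) auto
  then have nm: "fw.nmax v = nu v" using c by (simp add: fw.nmax_def)
  have il: "e \<le> 1 / lam" using rates(3) mult_pos_pos[OF zero_less_power[OF k(1), of 2], of "1 + e"] fw.e0 by linarith
  have "(1 / lam) * nu v \<le> nu (int_act A v)" using fw.nuA[of v] fw.lam by (simp add: field_simps)
  then have a: "(1 / lam - e) * nu v \<le> nu (DF x v)"
   using nAv[OF fw.snu fw.n_le_nmax(3), of x v] by (simp add: nm left_diff_distrib)
  have "N v \<le> (1 + 2 * kap) * nu v" using N_bounds(4)[of v] by (intro N_cone[OF c]) simp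
  then have "(1 / lam - e) * N v \<le> (1 / lam - e) * ((1 + 2 * kap) * nu v)" using il by (intro mult_left_mono) auto
  also have "\<dots> \<le> (1 + 2 * kap) * N (DF x v)"
   using mult_left_mono[OF order_trans[OF a N_bounds(3)], of "1 + 2 * kap"] k by (simp add: mult_ac)
  finally show ?thesis using k by (simp add: u1_def pos_divide_le_eq mult_ac)
 qed
 have Blo: "(1 / B) * N v \<le> N (DF x v)" for x v using B(1) B(3)[of v x] by (simp add: pos_divide_le_eq mult.commute)
 define h where "h = (s1 + min 1 c1) / 2"
 have h: "s1 < h" "h < 1" "h < c1" using s1 by (auto simp: h_def min_def)
 define g where "g = (c2 + u1) / 2"
 have g: "c2 < g" "g < u1" using u1 by (auto simp: g_def)
 have rb: "rate_bounds (\<lambda>_. Gm) f ts.Et (\<lambda>_. 1 / (2 * B)) (\<lambda>_. h)"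
  "rate_bounds (\<lambda>_. Gm) f Ez (\<lambda>_. (h + c1) / 2) (\<lambda>_. g)"
  "rate_bounds (\<lambda>_. Gm) f tu.Et (\<lambda>_. (g + u1) / 2) (\<lambda>_. 2 * B)"
 proof -
  show "rate_bounds (\<lambda>_. Gm) f ts.Et (\<lambda>_. 1 / (2 * B)) (\<lambda>_. h)"
   by (rule rate_boundsI[where E' = Es and l' = "1 / B" and h' = s1, OF ts.Et_of]) (use B(1) s1 h Es Blo in \<open>auto simp: field_simps\<close>)
  show "rate_bounds (\<lambda>_. Gm) f Ez (\<lambda>_. (h + c1) / 2) (\<lambda>_. g)"
   by (rule rate_boundsI[where E' = Ec and l' = c1 and h' = c2, OF Ez_of]) (use s1 h g u1 Ec in auto)
  show "rate_bounds (\<lambda>_. Gm) f tu.Et (\<lambda>_. (g + u1) / 2) (\<lambda>_. 2 * B)"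
   by (rule rate_boundsI[where E' = Eu and l' = u1 and h' = B, OF tu.Et_of]) (use B(1,2) g u1 Eu in auto)
 qed
 have nt: "Es x \<noteq> {0}" "Eu x \<noteq> {0}" for x
 proof -
  have "dim S \<noteq> 0" if "S \<noteq> {0}" "subspace S" for S :: "(real ^ 'n) set"
   using that subspace_0[OF that(2)] unfolding dim_eq_0 by blast
  then have "dim (stable_space A) \<noteq> 0" "dim (unstable_space A) \<noteq> 0"
   using nontriv subspace_spectral unfolding stable_space_def unstable_space_def by blast+
  then have "dim (Es x) \<noteq> 0" "dim (Eu x) \<noteq> 0" by (simp_all only: dim_Es dim_Eu spaces not_False_eq_True)
  then show "Es x \<noteq> {0}" "Eu x \<noteq> {0}" unfolding dim_eq_0 by blast+
 qed
 show ?thesis unfolding partially_hyperbolic_splitting_def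
 proof (intro conjI allI)
  show "invariant_bundle f ts.Et" "invariant_bundle f Ez" "invariant_bundle f tu.Et"
   by (rule invariant_bundleI[where E' = Es, OF ts.Et_of fw.s.subspace_tangent Es_iff]
    invariant_bundleI[where E' = Ec, OF Ez_of subspace_Ec Ec_iff]
    invariant_bundleI[where E' = Eu, OF tu.Et_of bw.s.subspace_tangent Eu_iff])+
  fix z :: "'n torus"
  obtain x where x: "z = torus_of x" using torus_of_surj by metis
  show "{a + b + c | a b c. a \<in> ts.Et z \<and> b \<in> Ez z \<and> c \<in> tu.Et z} = UNIV"
   unfolding x ts.Et_of tu.Et_of Ez_of by (rule splitting_sum)
  show "\<forall>a\<in>ts.Et z. \<forall>b\<in>Ez z. \<forall>c\<in>tu.Et z. a + b + c = 0 \<longrightarrow> a = 0 \<and> b = 0 \<and> c = 0"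
   unfolding x ts.Et_of tu.Et_of Ez_of using splitting_direct by blast
  show "ts.Et z \<noteq> {0}" "tu.Et z \<noteq> {0}" unfolding x ts.Et_of tu.Et_of by (rule nt)+
 next
  have "h < min 1 ((h + c1) / 2)" "max 1 g < (g + u1) / 2" using h g u1 by auto
  then show "\<exists>G mus \<nu>s muc \<nu>c muu \<nu>u. riemannian_metric G \<and> rate_bounds G f ts.Et mus \<nu>s \<and> rate_bounds G f Ez muc \<nu>c \<and>
   rate_bounds G f tu.Et muu \<nu>u \<and> (\<forall>p. \<nu>s p < min 1 (muc p) \<and> max 1 (\<nu>c p) < muu p)"
   using riemannian_metric_Gm rb by blast
 qed
qed

lemma H_spaces: "{v. max (nc v) (nu v) = 0} = stable_space A" "{v. max (nc v) (ns v) = 0} = unstable_space A"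
 unfolding fw.max_eq_0 bw.max_eq_0 by (rule spaces)+

lemma su_foliations_Wt: "su_foliations A f ts.Wt tu.Wt"
 unfolding su_foliations_def
proof (intro exI conjI allI)
 have surj: "surj f" "surj (inv f)" using f(1) by (simp_all add: bij_is_surj bij_imp_bij_inv)
 show "partially_hyperbolic_splitting f ts.Et Ez tu.Et" by (rule splitting)
 show "uniquely_integrable_to ts.Et ts.Wt" "uniquely_integrable_to tu.Et tu.Wt"
  by (rule ts.uniquely_integrable_Et tu.uniquely_integrable_Et)+
 show "invariant_foliation f ts.Wt" unfolding invariant_foliation_def using ts.Wt_invariant[OF surj(1)] by blast
 have "inv f ` tu.Wt (f z) = tu.Wt z" for z
  using tu.Wt_invariant[OF surj(2), of "f z"] f(1) by (simp add: bij_is_inj inv_f_f)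
 then have "f ` inv f ` tu.Wt (f z) = f ` tu.Wt z" for z by simp
 then show "invariant_foliation f tu.Wt" unfolding invariant_foliation_def
  using f(1) by (simp add: image_f_inv_f bij_is_surj)
 fix z
 show "dim (ts.Et z) = dim (stable_space A)" "dim (tu.Et z) = dim (unstable_space A)" "dim (Ez z) = dim (center_space A)"
  unfolding ts.Et_def tu.Et_def Ez_def dim_Es dim_Eu dim_Ec spaces by (rule refl)+
qed

text \<open>The bundles are determined by dimension and growth, and the foliations by unique
  integrability, so minimality need only be shown for the constructed leaves.\<close>

lemma su_foliations_unique:
 assumes "su_foliations A f W1 W2"
 shows "W1 = ts.Wt" "W2 = tu.Wt"
proof -
 obtain E1 E2 E3 where E: "partially_hyperbolic_splitting f E1 E2 E3" "\<And>z. dim (E1 z) = dim (stable_space A)"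
  "\<And>z. dim (E3 z) = dim (unstable_space A)" "uniquely_integrable_to E1 W1" "uniquely_integrable_to E3 W2"
  using assms unfolding su_foliations_def by blast
 have 1: "E1 = ts.Et" by (rule ts.stable_bundle_unique[OF E(1)]) (simp only: E(2) H_spaces)
 have d: "torus_deriv (inv f) (f z) (torus_deriv f z v) = v" for z v
 proof -
  obtain x where x: "z = torus_of x" using torus_of_surj by metis
  show ?thesis unfolding x ts.f_of using DFi_DF[of x v] by (simp add: DF DFi)
 qed
 have "partially_hyperbolic_splitting (inv f) E3 E2 E1"
  by (rule partially_hyperbolic_inverse[OF f(1) lift_continuous[OF lift(2)] d E(1)])
 then have 3: "E3 = tu.Et" by (rule tu.stable_bundle_unique) (simp only: E(3) H_spaces)
 show "W1 = ts.Wt" "W2 = tu.Wt"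
  using E(4,5) ts.uniquely_integrable_Et tu.uniquely_integrable_Et unfolding 1 3 uniquely_integrable_to_def by blast+
qed

text \<open>Two points of a leaf are joined by the image of a segment under \<open>leaf_pt\<close>,
  an \<open>su\<close>-path with one piece; so the preimage of \<open>E\<close> in the universal
  cover is saturated by leaves and \<open>su_minimal\<close> applies.\<close>

lemma minimal:
 assumes su: "su_foliations A f W1 W2" and E: "E \<noteq> {}" "closed E" "f ` E = E" "su_saturated W1 W2 E"
 shows "E = UNIV"
proof -
 let ?X = "torus_of -` E"
 note W12 = su_foliations_unique[OF su]
 have acc: "torus_of y \<in> E" if x: "torus_of x \<in> E" and j: "continuous_on UNIV j" "j x = x" "j y = y"
  and leaf: "range (\<lambda>v. torus_of (j v)) \<subseteq> W1 z \<or> range (\<lambda>v. torus_of (j v)) \<subseteq> W2 z" for x y :: "real ^ 'n" and j z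
 proof -
  define gamma where "gamma t = torus_of (j (x + t *\<^sub>R (y - x)))" for t
  have "continuous_on {0..1} (\<lambda>t. j (x + t *\<^sub>R (y - x)))"
   by (rule continuous_on_compose2[OF j(1)]) (auto intro!: continuous_intros)
  then have "path gamma" unfolding path_def gamma_def by (intro continuous_on_compose2[OF continuous_torus_of[of UNIV]]) auto
  then have "su_path W1 W2 gamma" unfolding su_path_def using leaf
   by (intro conjI exI[of _ 1] exI[of _ real] allI impI exI[of _ z]) (auto simp: gamma_def)
  moreover have "pathstart gamma = torus_of x" "pathfinish gamma = torus_of y"
   by (simp_all add: pathstart_def pathfinish_def gamma_def j)
  ultimately have "torus_of y \<in> accessibility_class W1 W2 (torus_of x)" unfolding accessibility_class_def by blast
  then show ?thesis using E(4) x unfolding su_saturated_def by blast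
 qed
 have "sat ?X" unfolding sat_def
 proof (intro ballI conjI subsetI)
  fix x y assume x: "x \<in> ?X"
  show "y \<in> ?X" if "y \<in> Ws x"
   unfolding vimage_eq
   by (rule acc[OF _ fw.s.cont_leaf_pt1 fw.s.leaf_pt_self[OF fw.s.W_refl] fw.s.leaf_pt_self[OF that], of "torus_of x"])
    (use x fw.s.leaf_pt(1) in \<open>auto simp: W12 ts.Wt_of\<close>)
  show "y \<in> ?X" if "y \<in> Wu x"
   unfolding vimage_eq
   by (rule acc[OF _ bw.s.cont_leaf_pt1 bw.s.leaf_pt_self[OF bw.s.W_refl] bw.s.leaf_pt_self[OF that], of "torus_of x"])
    (use x bw.s.leaf_pt(1) in \<open>auto simp: W12 tu.Wt_of\<close>)
 qed
 moreover have "inv_L ?X" unfolding inv_L_def by (simp add: torus_of_shift)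
 moreover have "closed ?X" using E(2) continuous_torus_of[of UNIV] by (rule closed_vimage)
 moreover have "?X \<noteq> {}" using E(1) torus_of_surj by (metis all_not_in_conv vimageI)
 moreover have "F x \<in> ?X \<longleftrightarrow> x \<in> ?X" for x
 proof -
  have "torus_of (F x) \<in> E \<longleftrightarrow> f (torus_of x) \<in> f ` E" by (simp only: ts.f_of E(3))
  also have "\<dots> \<longleftrightarrow> torus_of x \<in> E" using bij_is_inj[OF f(1)] by (rule inj_image_mem_iff)
  finally show ?thesis by simp
 qed
 ultimately have X: "?X = UNIV" using su_minimal by blast
 have "z \<in> E" for z
 proof -
  obtain x where "z = torus_of x" using torus_of_surj by metis
  then show ?thesis using X by blast
 qed
 then show ?thesis by blast
qed

end

theorem theorem2p2p2:
  fixes A :: "int ^ 'n ^ 'n::finite"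
  assumes "det A = 1"
    and "ergodic torus_measure (toral_map A)"
    and "dim (center_space A) = 2"
  shows "\<exists>U. openin C1_vol_topology U \<and> toral_map A \<in> U \<and>
    (\<forall>f\<in>U.
      (\<exists>Ws Wu. su_foliations A f Ws Wu) \<and>
      (\<forall>Ws Wu E. su_foliations A f Ws Wu \<longrightarrow>
         E \<noteq> {} \<longrightarrow> closed E \<longrightarrow> f ` E = E \<longrightarrow> su_saturated Ws Wu E \<longrightarrow> E = UNIV))"
proof -
 obtain Ai where inv: "A ** Ai = mat 1" "Ai ** A = mat 1" using int_inverse[OF assms(1)] by blast
 interpret te: toral_ergodic A Ai
  by unfold_locales (use inv ergodic_no_periodic[OF assms(2)] assms(3) in auto)
 show ?thesis
 proof (rule te.toral_adapted, goal_cases)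
  case (1 Ps Pc Pu ns nc nu lam K ell zeta cL QL u0 Gm)
  interpret ad: adapted "int_act A" "int_act Ai" Ps Pc Pu ns nc nu lam K by (rule 1(1))
  define N2 where "N2 = DIM(real ^ 'n) + 2"
  obtain kap e rho :: real where par: "0 < kap" "kap \<le> 1/2" "0 < e" "lam + e < 1 - e / kap" "1 + e < 1 / lam - e / kap"
   "1 < rho" "(lam + e) * rho ^ (2 * N2 + N2 * QL + 1) \<le> 1" "((1 + e) / (1 - e / kap))\<^sup>2 < rho" "(1 + 2 * kap) * (lam + e) < 1"
   "(1 + 2 * kap)\<^sup>2 * (lam + e) < 1 - e" "(1 + 2 * kap)\<^sup>2 * (1 + e) < 1 / lam - e"
   by (rule parameters[OF ad.lam, of "2 * N2 + N2 * QL + 1"]) blast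
  obtain b where b: "0 < b" "\<And>v. norm (int_act Ai v) \<le> b * norm v" using linear_bounded_pos[OF ad.linAi] by blast
  \<comment> \<open>\<open>F\<close> and \<open>DF\<close> are within \<open>e0\<close> of
    \<open>A\<close>, while \<open>Fi\<close> and \<open>DFi\<close> are within
    \<open>b * e0\<close> and \<open>2 * b\<^sup>2 * e0\<close> of its inverse; \<open>d\<close>
    dominates all three, and \<open>C\<close> converts \<open>d\<close> into the bound that
    \<open>pert_intro\<close> asks for.\<close>
  define C where "C = (b + 2 * b\<^sup>2 + 1) * (K + 3 * K * K)"
  have C: "0 < C" using b(1) ad.K0 by (auto simp: C_def intro!: mult_pos_pos add_pos_pos)
  define e0 where "e0 = min (1 / 4) (min (1 / (2 * b)) (e / C))"
  have "0 < e0" using b(1) par(3) C by (simp add: e0_def)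
  moreover have "e0 \<le> 1 / 4" "e0 \<le> min (1 / (2 * b)) (e / C)" unfolding e0_def by (rule min.cobounded1 min.cobounded2)+
  ultimately have e0: "0 < e0" "e0 \<le> 1 / 4" "e0 \<le> 1 / (2 * b)" "e0 \<le> e / C" unfolding min.bounded_iff by blast+
  define d where "d = (b + 2 * b\<^sup>2 + 1) * e0"
  have d: "0 \<le> d" "e0 \<le> d" "b * e0 \<le> d" "2 * b\<^sup>2 * e0 \<le> d" "d * (K + 3 * K * K) \<le> e"
  proof -
   have nn: "0 \<le> b * e0" "0 \<le> 2 * b\<^sup>2 * e0" using b(1) e0(1) by simp_all
   have "d = b * e0 + 2 * b\<^sup>2 * e0 + e0" by (simp add: d_def algebra_simps)
   then show "0 \<le> d" "e0 \<le> d" "b * e0 \<le> d" "2 * b\<^sup>2 * e0 \<le> d" using nn e0(1) by linarith+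
   have "d * (K + 3 * K * K) = C * e0" by (simp add: d_def C_def)
   then show "d * (K + 3 * K * K) \<le> e" using e0(4) C by (simp add: pos_le_divide_eq mult.commute)
  qed
  define U where "U = {f \<in> C1_vol. \<exists>e'<e0. C1_near e' (toral_map A) f}"
  have mp: "measure_preserving torus_measure (toral_map A)" using assms(2) by (simp add: ergodic_def)
  have main: "(\<exists>Ws Wu. su_foliations A f Ws Wu) \<and> (\<forall>Ws Wu E. su_foliations A f Ws Wu \<longrightarrow>
   E \<noteq> {} \<longrightarrow> closed E \<longrightarrow> f ` E = E \<longrightarrow> su_saturated Ws Wu E \<longrightarrow> E = UNIV)" if fU: "f \<in> U" for f
  proof -
   have f: "bij f" "C1_map f" "C1_map (inv f)" using fU by (auto simp: U_def C1_vol_def)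
   have near: "dist (toral_map A z) (f z) < e0" "norm (torus_deriv (toral_map A) z - torus_deriv f z) < e0" for z
    using fU by (auto simp: U_def C1_near_def intro: less_trans)
   obtain F where F: "is_lift f F" "\<And>x. norm (F x - int_act A x) < e0" "\<And>x k. k \<in> int_vecs \<Longrightarrow> F (x + k) = F x + int_act A k"
    by (rule near_lift[OF f(2) near(1) e0(2)]) blast
   obtain Fi where Fi: "is_lift (inv f) Fi" "\<And>x. F (Fi x) = x" "\<And>x. Fi (F x) = x"
   proof (rule inverse_lift[OF f(1,3) F(1,3) inv(2)])
    fix Fi assume "is_lift (inv f) Fi" "\<And>x. F (Fi x) = x" "\<And>x. Fi (F x) = x"
    then show thesis by (rule that)
   qed
   define DF where "DF x = torus_deriv f (torus_of x)" for x
   define DFi where "DFi x = torus_deriv (inv f) (torus_of x)" for x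
   have dF: "(F has_derivative blinfun_apply (DF x)) (at x)" for x
    unfolding DF_def by (rule has_torus_derivative_lift[OF F(1) C1_map_deriv(2)[OF f(2)]])
   have dFi: "(Fi has_derivative blinfun_apply (DFi x)) (at x)" for x
    unfolding DFi_def by (rule has_torus_derivative_lift[OF Fi(1) C1_map_deriv(2)[OF f(3)]])
   have cDF: "continuous_on UNIV DF" "continuous_on UNIV DFi" unfolding DF_def DFi_def
    by (rule continuous_on_compose2[OF C1_map_deriv(1)[OF f(2)] continuous_torus_of subset_UNIV]
     continuous_on_compose2[OF C1_map_deriv(1)[OF f(3)] continuous_torus_of subset_UNIV])+
   have DA: "norm (DF x v - int_act A v) \<le> e0 * norm v" for x v
   proof -
    have "norm ((actL A - DF x) v) \<le> norm (actL A - DF x) * norm v" by (rule norm_blinfun)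
    also have "\<dots> \<le> e0 * norm v"
     using near(2)[of "torus_of x"] by (intro mult_right_mono) (simp_all add: torus_deriv_eq[OF toral_map_deriv] DF_def)
    finally show ?thesis by (simp add: blinfun.diff_left actL norm_minus_commute)
   qed
   \<comment> \<open>\<open>b * e0 \<le> 1/2\<close> bounds the norm of \<open>DFi x v\<close> by
     \<open>2 * (b * norm v)\<close>, as in a Neumann series.\<close>
   have DAi: "norm (DFi x v - int_act Ai v) \<le> 2 * b\<^sup>2 * e0 * norm v" for x v
   proof -
    let ?w = "DFi x v"
    have "((\<lambda>x. F (Fi x)) has_derivative (\<lambda>v. DF (Fi x) (DFi x v))) (at x)" by (rule has_derivative_compose[OF dFi dF])
    then have "((\<lambda>x. x) has_derivative (\<lambda>v. DF (Fi x) (DFi x v))) (at x)" by (simp only: Fi(2))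
    from has_derivative_unique[OF this has_derivative_ident] have "DF (Fi x) ?w = v" by (rule fun_cong)
    then have "norm (int_act A ?w - v) \<le> e0 * norm ?w" using DA[of "Fi x" ?w] by (simp add: norm_minus_commute)
    then have "norm (int_act Ai (int_act A ?w - v)) \<le> b * (e0 * norm ?w)" using b by (intro order_trans[OF b(2)] mult_left_mono) auto
    then have w: "norm (?w - int_act Ai v) \<le> b * e0 * norm ?w" by (simp add: linear_diff[OF ad.linAi] ad.Ai_A mult.assoc)
    have "b * e0 \<le> 1 / 2" using e0(3) b(1) by (simp add: field_simps)
    then have "b * e0 * norm ?w \<le> 1 / 2 * norm ?w" by (rule mult_right_mono) simp
    then have "norm ?w \<le> 2 * (b * norm v)" using w b(2)[of v] norm_triangle_ineq2[of ?w "int_act Ai v"] by linarith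
    then have "b * e0 * norm ?w \<le> b * e0 * (2 * (b * norm v))" using b(1) e0(1) by (intro mult_left_mono) auto
    then show ?thesis using w by (simp add: power2_eq_square mult_ac)
   qed
   have Fi_close: "norm (Fi x - int_act Ai x) \<le> b * e0" for x
   proof -
    have "Fi x - int_act Ai x = int_act Ai (int_act A (Fi x) - F (Fi x))" by (simp add: linear_diff[OF ad.linAi] ad.Ai_A Fi(2))
    also have "norm \<dots> \<le> b * norm (int_act A (Fi x) - F (Fi x))" by (rule b(2))
    also have "\<dots> \<le> b * e0" using F(2)[of "Fi x"] b(1) by (intro mult_left_mono) (auto simp: norm_minus_commute)
    finally show ?thesis .
   qed
   have fw: "pert (int_act A) (int_act Ai) Ps Pc Pu ns nc nu lam K F DF e kap"
   proof (rule ad.pert_intro[OF dF cDF(1) _ _ d(5,1) par(1,2,4,5)])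
    show "norm (F x - int_act A x) \<le> d" for x using F(2)[of x] d(2) by linarith
    show "norm (DF x v - int_act A v) \<le> d * norm v" for x v
     using DA[of x v] mult_right_mono[OF d(2), of "norm v"] by simp
   qed
   have bw: "pert (int_act Ai) (int_act A) Pu Pc Ps nu nc ns lam K Fi DFi e kap"
   proof (rule adapted.pert_intro[OF ad.swap dFi cDF(2) _ _ d(5,1) par(1,2,4,5)])
    show "norm (Fi x - int_act Ai x) \<le> d" for x using Fi_close[of x] d(3) by linarith
    show "norm (DFi x v - int_act Ai v) \<le> d * norm v" for x v
     using DAi[of x v] mult_right_mono[OF d(4), of "norm v"] by simp
   qed
   have pair: "pert_pair (int_act A) (int_act Ai) Ps Pc Pu ns nc nu lam K F DF Fi DFi e kap"
    by (intro pert_pair.intro pert_pair_axioms.intro fw bw Fi)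
   have lat: "pert_lattice (int_act A) (int_act Ai) Ps Pc Pu ns nc nu lam K F DF Fi DFi e kap ell zeta int_vecs u0 cL rho QL N2"
    by (intro pert_lattice.intro pert_center.intro pert_center_axioms.intro pert_lattice_axioms.intro pair)
     (fact 1 par N2_def int_vecs_zero | erule (1) int_vecs_add F(3) | erule int_vecs_minus int_vecs_act F(3))+
   interpret tp: torus_pert A Ai Ps Pc Pu ns nc nu lam K F DF Fi DFi e kap ell zeta u0 cL rho QL N2 f Gm
    by (intro torus_pert.intro torus_pert_axioms.intro lat F(1) Fi(1) f DF_def DFi_def) (fact 1 par)+
   show ?thesis using tp.su_foliations_Wt tp.minimal by blast
  qed
  show ?case
   using C1_neighbourhood[OF inv mp e0(1)] main unfolding U_def[symmetric] by (intro exI[of _ U]) blast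
 qed
qed

end
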